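(* Let $r\in\mathbb{N}$, $0<p<1$ and $f\in L_p[-1,1]$. Let $\delta,\gamma\ge0$ and suppose that $w$ is a doubling weight from the class $\mathcal{W}^{\delta,\gamma}$ with $\gamma\le rp$. Then, for $0<\alpha<r-\delta/p$, we have $$E_n(f)_{p,w_n}=O(n^{-\alpha})\iff\omega_\varphi^r(f,n^{-1})_{p,w_n}=O(n^{-\alpha})\qquad(n\to\infty).$$
   Context: A doubling weight is a nonnegative $w\in L_1[-1,1]$, extended by $0$ outside $[-1,1]$, for which there is a constant $L$ (the doubling constant of $w$) with $\int_{2I}w\le L\int_I w$ for all intervals $I\subset[-1,1]$, where $2I$ is the interval with the same center as $I$ and twice its length. Let $\varphi(x)=\sqrt{1-x^2}$, $\rho_n(x)=n^{-1}\sqrt{1-x^2}+n^{-2}$, and $w_n(x)=\frac{1}{\rho_n(x)}\int_{x-\rho_n(x)}^{x+\rho_n(x)}w(u)\,du$. Class $\mathcal{W}^{\delta,\gamma}$ ($\delta,\gamma\ge0$): all doubling weights $w$ for which there is a constant $\Lambda>0$ such that for all $m,n\in\mathbb{N}$ with $m\le n$ and all $x\in[-1,1]$, $w_n(x)\varphi(x)^\gamma\le\Lambda n^\delta m^{\gamma-\delta}\rho_m(x)^\gamma w_m(x)$ (with $\varphi(x)^0=1$). For a weight $v$ on $[-1,1]$: $\|g\|_{p,v}=\left(\int_{-1}^1|g|^p v\right)^{1/p}$. $\Pi_n$ is the set of algebraic polynomials of degree $\le n-1$ and $E_n(f)_{p,v}=\inf_{P\in\Pi_n}\|f-P\|_{p,v}$.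 Symmetric difference: $\Delta_h^r(f,x)=\sum_{i=0}^r\binom ri(-1)^{r-i}f(x-rh/2+ih)$ if $x\pm rh/2\in[-1,1]$, and $0$ otherwise. Modulus: $\omega_\varphi^r(f,t)_{p,v}=\sup_{0<h\le t}\|\Delta_{h\varphi(\cdot)}^r(f,\cdot)\|_{p,v}$. *)

theory Defs
  imports "HOL-Analysis.Analysis" "HOL-Computational_Algebra.Polynomial"
begin

text \<open>The index sets of the paper start at 1; the functions below that depend on \<open>n :: nat\<close>
  are only meaningful for \<open>n \<ge> 1\<close>.\<close>

definition phi :: "real \<Rightarrow> real" where
  "phi x = sqrt (1 - x\<^sup>2)"

definition rho :: "nat \<Rightarrow> real \<Rightarrow> real" where
  "rho n x = sqrt (1 - x\<^sup>2) / real n + 1 / (real n)\<^sup>2"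

text \<open>The interval \<open>I\<close> is given by its centre \<open>c\<close> and half-length \<open>d\<close>, so that \<open>2I\<close> is
  \<open>[c - 2d, c + 2d]\<close>, which may stick out of \<open>[-1, 1]\<close>; the weight vanishes there.\<close>

definition doubling_weight :: "(real \<Rightarrow> real) \<Rightarrow> bool" where
  "doubling_weight w \<longleftrightarrow>
     (\<forall>x. 0 \<le> w x) \<and> (\<forall>x. x \<notin> {-1..1} \<longrightarrow> w x = 0) \<and>
     set_integrable lebesgue {-1..1} w \<and>
     (\<exists>L::real. \<forall>c d. 0 < d \<longrightarrow> {c - d..c + d} \<subseteq> {-1..1} \<longrightarrow>
        (LINT u:{c - 2 * d..c + 2 * d}|lebesgue. w u) \<le> L * (LINT u:{c - d..c + d}|lebesgue. w u))"

definition avg_weight :: "(real \<Rightarrow> real) \<Rightarrow> nat \<Rightarrow> real \<Rightarrow> real" where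
  "avg_weight w n x = (1 / rho n x) * (LINT u:{x - rho n x..x + rho n x}|lebesgue. w u)"

text \<open>The case distinction realises the convention \<open>phi x\<close> to the power 0 equals 1 also at
  \<open>x = 1\<close> and \<open>x = -1\<close>, where \<open>0 powr 0 = 0\<close>.\<close>

definition W_class :: "real \<Rightarrow> real \<Rightarrow> (real \<Rightarrow> real) set" where
  "W_class \<delta> \<gamma> = {w. doubling_weight w \<and>
     (\<exists>\<Lambda>>0. \<forall>m n x. 1 \<le> m \<longrightarrow> m \<le> n \<longrightarrow> x \<in> {-1..1} \<longrightarrow>
        avg_weight w n x * (if \<gamma> = 0 then 1 else phi x powr \<gamma>)
          \<le> \<Lambda> * real n powr \<delta> * real m powr (\<gamma> - \<delta>) * rho m x powr \<gamma> * avg_weight w m x)}"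

definition in_Lp :: "real \<Rightarrow> (real \<Rightarrow> real) \<Rightarrow> bool" where
  "in_Lp p f \<longleftrightarrow> f \<in> borel_measurable (lebesgue_on {-1..1}) \<and>
     integrable (lebesgue_on {-1..1}) (\<lambda>x. \<bar>f x\<bar> powr p)"

text \<open>The weighted (quasi-)norm takes values in \<open>[0, \<infinity>]\<close>, so that the infimum and the supremum
  below are taken in a complete lattice. It is meant for \<open>p > 0\<close> and \<open>v \<ge> 0\<close>.\<close>

definition Lp_norm :: "real \<Rightarrow> (real \<Rightarrow> real) \<Rightarrow> (real \<Rightarrow> real) \<Rightarrow> ennreal" where
  "Lp_norm p v g =
     (let J = (\<integral>\<^sup>+x\<in>{-1..1}. ennreal (\<bar>g x\<bar> powr p * v x) \<partial>lebesgue)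
      in if J = \<infinity> then \<infinity> else ennreal (enn2real J powr (1 / p)))"

definition Poly_space :: "nat \<Rightarrow> real poly set" where
  "Poly_space n = {P. degree P \<le> n - 1}"

definition best_approx :: "nat \<Rightarrow> (real \<Rightarrow> real) \<Rightarrow> real \<Rightarrow> (real \<Rightarrow> real) \<Rightarrow> ennreal" where
  "best_approx n f p v = (INF P\<in>Poly_space n. Lp_norm p v (\<lambda>x. f x - poly P x))"

definition sym_difference :: "nat \<Rightarrow> real \<Rightarrow> (real \<Rightarrow> real) \<Rightarrow> real \<Rightarrow> real" where
  "sym_difference r h f x =
     (if x - real r * h / 2 \<in> {-1..1} \<and> x + real r * h / 2 \<in> {-1..1}
      then \<Sum>i=0..r. real (r choose i) * (-1) ^ (r - i) * f (x - real r * h / 2 + real i * h)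
      else 0)"

definition omega_phi :: "nat \<Rightarrow> (real \<Rightarrow> real) \<Rightarrow> real \<Rightarrow> real \<Rightarrow> (real \<Rightarrow> real) \<Rightarrow> ennreal" where
  "omega_phi r f t p v = (SUP h\<in>{0<..t}. Lp_norm p v (\<lambda>x. sym_difference r (h * phi x) f x))"

end

theory Submission
  imports Defs
begin

text \<open>In the variable \<open>t = arccos x\<close> the weights \<open>w\<^sub>n\<close> vary slowly at the scale \<open>1/n\<close>: the ratio of two values
  is at most a power of \<open>1 + n \<bar>t - s\<bar>\<close>. Multiplying a polynomial by a fast decaying kernel of degree \<open>O(n)\<close>
  therefore yields weighted Nikolskii and Bernstein inequalities for \<open>0 < p \<le> 1\<close>, and these bound the norm
  of the \<open>r\<close>-th difference of a polynomial of degree \<open>m \<le> n\<close> with weight \<open>w\<^sub>n\<close> by a power of \<open>m/n\<close>; the class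
  \<open>W\<close> enters in comparing \<open>w\<^sub>n\<close> with \<open>w\<^sub>m\<close> there. Applied to the differences of near-best polynomials of dyadic
  degrees, this gives a geometric series, hence the inverse implication.

  For the direct implication, \<open>[-1, 1]\<close> is covered by overlapping cells around the points \<open>cos (k pi / n)\<close>. On each
  cell a Whitney inequality for \<open>p < 1\<close>, with differences averaged over the step, gives a polynomial of degree
  below \<open>r\<close>. These local polynomials are glued by replacing each jump function with a polynomial step, the
  primitive of a Jackson kernel, whose decay beats the growth of both the weight and the local polynomials.\<close>

subsection \<open>Cosine polynomials and localising kernels\<close>

text \<open>For \<open>p < 1\<close> a function in \<open>L_p\<close> need not be integrable, so it
  cannot be smoothed by averaging; averages are taken only of \<open>p\<close>-th powers of
  differences or of truncated functions. The triangle inequality survives for \<open>p\<close>-th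
  powers alone, so the argument runs with \<open>wnorm\<close>, the \<open>p\<close>-th power of the
  quasi-norm, and the rate \<alpha> becomes \<open>\<beta> = \<alpha> * p\<close>. The condition
  \<open>\<alpha> < r - \<delta> / p\<close> then reads \<open>\<beta> < r * p - \<delta>\<close>,
  which lets the last dyadic level dominate the series; \<open>\<gamma> \<le> r * p\<close> leaves a
  nonnegative power of \<open>phi\<close> beside the factor that the class absorbs. A second
  obstacle is that the weight changes with \<open>n\<close>: constants are uniform in
  \<open>n\<close>, and weights of comparable index are compared by
  \<open>avg_weight_le_coarser\<close>. The weights are slow in the angle, but norms in
  \<open>x\<close> carry the Jacobian \<open>sin t\<close>, which vanishes at the ends; it is
  exchanged for \<open>n * rho n\<close>, which does not. Finally \<open>f\<close> is only Lebesgue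
  measurable and is replaced by a Borel function, which for each step changes its differences only
  on a null set.\<close>

lemma cos_mult_poly: "\<exists>T. degree T \<le> j \<and> (\<forall>t. poly T (cos t) = cos (real j * t))"
proof (induction j rule: less_induct)
  case (less j)
  consider "j = 0" | "j = 1" | i where "j = Suc (Suc i)"
    by (metis One_nat_def not0_implies_Suc)
  then show ?case
  proof cases
    case 1
    then show ?thesis by (intro exI[of _ 1]) auto
  next
    case 2
    then show ?thesis by (intro exI[of _ "[:0, 1:]"]) auto
  next
    case 3
    obtain T where T: "degree T \<le> Suc i" "\<And>t. poly T (cos t) = cos (real (Suc i) * t)"
      using less.IH[of "Suc i"] 3 by auto
    obtain U where U: "degree U \<le> i" "\<And>t. poly U (cos t) = cos (real i * t)"
      using less.IH[of "i"] 3 by auto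
    \<comment> \<open>The three-term recurrence of the Chebyshev polynomials,
      \<open>T_j = 2 x T_(j-1) - T_(j-2)\<close>.\<close>
    have e: "poly ([:0, 2:] * T - U) (cos t) = cos (real j * t)" for t
    proof -
      have "cos (real j * t) + cos (real i * t) = 2 * cos t * cos (real (Suc i) * t)"
        using cos_plus_cos[of "real j * t" "real i * t"] 3
        by (simp add: algebra_simps add_divide_distrib)
      then show ?thesis by (simp add: T U algebra_simps)
    qed
    have "degree ([:0, 2:] * T) \<le> j"
      using degree_mult_le[of "[:0,2:]" T] T(1) 3 by simp
    then have "degree ([:0, 2:] * T - U) \<le> j"
      using U(1) 3 by (intro degree_diff_le) auto
    with e show ?thesis by blast
  qed
qed

text \<open>Even trigonometric polynomials of degree at most \<open>N\<close>. By
  \<open>cos_sum_poly\<close> and \<open>cos_sum_imp_poly\<close> these are exactly the functions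
  \<open>Q (cos t)\<close> with \<open>degree Q \<le> N\<close>; the coefficient form is needed to
  form symmetrised translates and primitives.\<close>

definition cos_sum :: "nat \<Rightarrow> (real \<Rightarrow> real) \<Rightarrow> bool" where
  "cos_sum N f \<longleftrightarrow> (\<exists>b. \<forall>t. f t = (\<Sum>j\<le>N. b j * cos (real j * t)))"

lemma cos_sum_add: "cos_sum N f \<Longrightarrow> cos_sum N g \<Longrightarrow> cos_sum N (\<lambda>t. f t + g t)"
  unfolding cos_sum_def
proof (elim exE)
  fix a b assume "\<forall>t. f t = (\<Sum>j\<le>N. a j * cos (real j * t))" "\<forall>t. g t = (\<Sum>j\<le>N. b j * cos (real j * t))"
  then show "\<exists>b. \<forall>t. f t + g t = (\<Sum>j\<le>N. b j * cos (real j * t))"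
    by (intro exI[of _ "\<lambda>j. a j + b j"]) (simp add: algebra_simps sum.distrib)
qed

lemma cos_sum_cmult: "cos_sum N f \<Longrightarrow> cos_sum N (\<lambda>t. c * f t)"
  unfolding cos_sum_def
proof (elim exE)
  fix a assume "\<forall>t. f t = (\<Sum>j\<le>N. a j * cos (real j * t))"
  then show "\<exists>b. \<forall>t. c * f t = (\<Sum>j\<le>N. b j * cos (real j * t))"
    by (intro exI[of _ "\<lambda>j. c * a j"]) (simp add: algebra_simps sum_distrib_left)
qed

lemma cos_sum_basis: "j \<le> N \<Longrightarrow> cos_sum N (\<lambda>t. cos (real j * t))"
  unfolding cos_sum_def by (intro exI[of _ "\<lambda>i. if i = j then 1 else 0"]) (simp add: if_distrib[of "\<lambda>x. x * _"] cong: if_cong)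

lemma cos_sum_sum: "(\<And>i. i \<in> I \<Longrightarrow> cos_sum N (f i)) \<Longrightarrow> cos_sum N (\<lambda>t. \<Sum>i\<in>I. f i t)"
proof (induction I rule: infinite_finite_induct)
  case (insert x F)
  then show ?case by (simp add: cos_sum_add)
qed (auto simp: cos_sum_def intro!: exI[of _ "\<lambda>_. 0"])

lemma cos_sum_times_cos:
  assumes "cos_sum N f"
  shows "cos_sum (Suc N) (\<lambda>t. cos t * f t)"
proof -
  obtain b where b: "\<And>t. f t = (\<Sum>j\<le>N. b j * cos (real j * t))"
    using assms by (auto simp: cos_sum_def)
  have "cos_sum (Suc N) (\<lambda>t. cos t * cos (real j * t))" if "j \<le> N" for j
  proof (cases j)
    case 0
    then show ?thesis using cos_sum_basis[of 1 "Suc N"] by simp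
  next
    case (Suc i)
    have eq: "cos t * cos (real j * t) = (1/2) * (cos (real (Suc j) * t) + cos (real i * t))" for t
      using cos_plus_cos[of "real (Suc j) * t" "real i * t"] Suc
      by (simp add: algebra_simps add_divide_distrib)
    show ?thesis unfolding eq using that Suc
      by (intro cos_sum_cmult cos_sum_add cos_sum_basis) auto
  qed
  then have "cos_sum (Suc N) (\<lambda>t. \<Sum>j\<le>N. b j * (cos t * cos (real j * t)))"
    by (intro cos_sum_sum cos_sum_cmult) auto
  then show ?thesis by (simp add: b sum_distrib_left algebra_simps)
qed

lemma cos_sum_poly: "degree Q \<le> N \<Longrightarrow> cos_sum N (\<lambda>t. poly Q (cos t))"
proof (induction Q arbitrary: N rule: pCons_induct)
  case 0
  then show ?case by (auto simp: cos_sum_def intro!: exI[of _ "\<lambda>_. 0"])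
next
  case (pCons a Q)
  have c: "cos_sum N (\<lambda>t. a)"
    using cos_sum_cmult[OF cos_sum_basis[of 0 N], of a] by simp
  show ?case
  proof (cases "Q = 0")
    case True
    then show ?thesis using c by simp
  next
    case False
    then obtain K where K: "N = Suc K" "degree Q \<le> K"
      using pCons.prems by (cases N) auto
    show ?thesis using cos_sum_add[OF c] cos_sum_times_cos[OF pCons.IH[OF K(2)]] K by simp
  qed
qed

lemma cos_sum_imp_poly:
  assumes "cos_sum N f"
  obtains Q where "degree Q \<le> N" "\<And>t. f t = poly Q (cos t)"
proof -
  obtain b where b: "\<And>t. f t = (\<Sum>j\<le>N. b j * cos (real j * t))"
    using assms by (auto simp: cos_sum_def)
  obtain T where T: "\<And>j. degree (T j) \<le> j" "\<And>j t. poly (T j) (cos t) = cos (real j * t)"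
    using cos_mult_poly by metis
  show ?thesis
  proof (rule that)
    show "degree (\<Sum>j\<le>N. smult (b j) (T j)) \<le> N"
      by (intro degree_sum_le) (auto intro: order_trans[OF degree_smult_le] order_trans[OF T(1)])
    show "f t = poly (\<Sum>j\<le>N. smult (b j) (T j)) (cos t)" for t
      by (simp add: b poly_sum T)
  qed
qed

section \<open>Cosine coefficients and the unweighted Nikolskii and Bernstein inequalities\<close>

lemma has_integral_cos_int:
  "((\<lambda>t. cos (of_int m * t)) has_integral (if m = 0 then pi else 0)) {0..pi}"
proof (cases "m = 0")
  case True
  then show ?thesis using has_integral_const_real[of "1::real" 0 pi] by simp
next
  case False
  have "((\<lambda>t. cos (of_int m * t)) has_integral (sin (of_int m * pi) / of_int m - sin (of_int m * 0) / of_int m)) {0..pi}"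
    using False
    by (intro fundamental_theorem_of_calculus)
       (auto intro!: derivative_eq_intros simp flip: has_real_derivative_iff_has_vector_derivative)
  moreover have "sin (of_int m * pi) = 0" using sin_npi_int[of m] by (simp add: mult.commute)
  ultimately show ?thesis using False by simp
qed

lemma has_integral_cos_cos:
  "((\<lambda>t. cos (real j * t) * cos (real k * t)) has_integral
     (if j = k then (if j = 0 then pi else pi / 2) else 0)) {0..pi}"
proof -
  have eq: "cos (real j * t) * cos (real k * t) =
      (cos (of_int (int j - int k) * t) + cos (of_int (int j + int k) * t)) / 2" for t
    by (simp add: cos_times_cos algebra_simps)
  show ?thesis unfolding eq
    using has_integral_divide[OF has_integral_add[OF has_integral_cos_int[of "int j - int k"] has_integral_cos_int[of "int j + int k"]], of 2]
    by (cases "j = k"; cases "j = 0") auto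
qed

text \<open>Orthogonality on \<open>[0, pi]\<close> isolates \<open>b k\<close> up to the factor
  \<open>pi\<close> or \<open>pi / 2\<close>; both exceed 1, so the factor can simply be
  dropped.\<close>

lemma cos_coeff_bound:
  assumes f: "\<And>t. f t = (\<Sum>j\<le>N. b j * cos (real j * t))" and "k \<le> N"
  shows "\<bar>b k\<bar> \<le> integral {0..pi} (\<lambda>t. \<bar>f t\<bar>)"
proof -
  have cont: "continuous_on {0..pi} f"
    unfolding f by (intro continuous_intros)
  have "((\<lambda>t. \<Sum>j\<le>N. b j * (cos (real j * t) * cos (real k * t))) has_integral
     (\<Sum>j\<le>N. b j * (if j = k then (if j = 0 then pi else pi / 2) else 0))) {0..pi}"
    by (intro has_integral_sum has_integral_mult_right has_integral_cos_cos) auto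
  moreover have "(\<Sum>j\<le>N. b j * (if j = k then (if j = 0 then pi else pi / 2) else 0)) = b k * (if k = 0 then pi else pi / 2)"
    using \<open>k \<le> N\<close> by (simp add: if_distrib[of "\<lambda>x. _ * x"] cong: if_cong)
  ultimately have I: "((\<lambda>t. f t * cos (real k * t)) has_integral b k * (if k = 0 then pi else pi / 2)) {0..pi}"
    by (simp add: f sum_distrib_right mult.assoc)
  have "\<bar>b k * (if k = 0 then pi else pi / 2)\<bar> \<le> integral {0..pi} (\<lambda>t. \<bar>f t\<bar>)"
    unfolding integral_unique[OF I, symmetric] real_norm_def[symmetric]
    by (rule integral_norm_bound_integral)
       (use I in \<open>auto intro!: integrable_continuous_interval continuous_intros cont simp: abs_mult mult_left_le\<close>)
  moreover have "\<bar>b k\<bar> * 1 \<le> \<bar>b k\<bar> * (if k = 0 then pi else pi / 2)"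
    using pi_gt3 by (intro mult_left_mono) auto
  ultimately show ?thesis by (auto simp: abs_mult split: if_splits)
qed

lemma cos_poly_deriv:
  "((\<lambda>t. poly Q (cos t)) has_real_derivative (- sin t * poly (pderiv Q) (cos t))) (at t)"
  by (rule derivative_eq_intros refl | simp add: poly_DERIV)+

text \<open>Sums the coefficient bounds. Crude as this is, \<open>N + 1\<close> and
  \<open>(N + 1)^2\<close> are of the right order between the \<open>L_1\<close> norm and the
  supremum: one factor is later compensated by a kernel integral of size \<open>1 / n\<close>, the
  other is the true cost of a derivative.\<close>

lemma cos_poly_sup_bound:
  assumes "degree Q \<le> N"
  shows "\<bar>poly Q (cos t)\<bar> \<le> (real N + 1) * integral {0..pi} (\<lambda>u. \<bar>poly Q (cos u)\<bar>)" (is ?A)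
    and "\<bar>sin t * poly (pderiv Q) (cos t)\<bar> \<le> (real N + 1)^2 * integral {0..pi} (\<lambda>u. \<bar>poly Q (cos u)\<bar>)" (is ?B)
proof -
  define I where "I = integral {0..pi} (\<lambda>u. \<bar>poly Q (cos u)\<bar>)"
  obtain b where b: "\<And>t. poly Q (cos t) = (\<Sum>j\<le>N. b j * cos (real j * t))"
    using cos_sum_poly[OF assms] by (auto simp: cos_sum_def)
  have bb: "\<bar>b k\<bar> \<le> I" if "k \<le> N" for k
    using cos_coeff_bound[where f = "\<lambda>t. poly Q (cos t)" and N = N and b = b and k = k, OF b that] by (simp add: I_def)
  have I0: "0 \<le> I" using bb[of 0] by linarith
  have "\<bar>poly Q (cos t)\<bar> \<le> (\<Sum>j\<le>N. \<bar>b j * cos (real j * t)\<bar>)" unfolding b by (rule sum_abs)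
  also have "\<dots> \<le> (\<Sum>j\<le>N. I * 1)"
    by (intro sum_mono) (unfold abs_mult, intro mult_mono, auto intro: bb I0)
  finally show ?A by (simp add: I_def algebra_simps)
  have "((\<lambda>t. \<Sum>j\<le>N. b j * cos (real j * t)) has_real_derivative (\<Sum>j\<le>N. b j * (- sin (real j * t) * real j))) (at t)"
    by (auto intro!: derivative_eq_intros sum.cong)
  then have "- sin t * poly (pderiv Q) (cos t) = (\<Sum>j\<le>N. b j * (- sin (real j * t) * real j))"
    using cos_poly_deriv[of Q t] unfolding b by (rule DERIV_unique[rotated])
  then have "\<bar>sin t * poly (pderiv Q) (cos t)\<bar> = \<bar>\<Sum>j\<le>N. b j * (- sin (real j * t) * real j)\<bar>"
    by (metis abs_minus_cancel minus_mult_left)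
  also have "\<dots> \<le> (\<Sum>j\<le>N. \<bar>b j * (- sin (real j * t) * real j)\<bar>)" by (rule sum_abs)
  also have "\<dots> \<le> (\<Sum>j\<le>N. I * (1 * (real N + 1)))"
    by (intro sum_mono) (unfold abs_mult, intro mult_mono, auto intro: bb I0)
  finally show ?B by (simp add: I_def algebra_simps power2_eq_square)
qed

text \<open>With \<open>S\<close> the maximum, \<open>|F| \<le> S^(1-p) |F|^p\<close> bounds the
  \<open>L_1\<close> norm by \<open>S^(1-p)\<close> times the \<open>L_p\<close> integral
  \<open>A\<close>. Inserting this into the sup bound and cancelling \<open>S^(1-p)\<close> gives
  the version for the value; feeding the result back into the \<open>L_1\<close> norm gives the one
  for the derivative.\<close>

lemma cos_poly_sup_bound_p:
  assumes "degree Q \<le> N" and p: "0 < p" "p \<le> 1"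
  shows "\<bar>poly Q (cos t)\<bar> powr p \<le> (real N + 1) * integral {0..pi} (\<lambda>u. \<bar>poly Q (cos u)\<bar> powr p)" (is ?A)
    and "\<bar>sin t * poly (pderiv Q) (cos t)\<bar> powr p \<le> (real N + 1) powr (1 + p) * integral {0..pi} (\<lambda>u. \<bar>poly Q (cos u)\<bar> powr p)" (is ?B)
proof -
  let ?F = "\<lambda>u. \<bar>poly Q (cos u)\<bar>"
  define A where "A = integral {0..pi} (\<lambda>u. ?F u powr p)"
  define I where "I = integral {0..pi} ?F"
  have cF: "continuous_on {0..pi} ?F" by (intro continuous_intros)
  have cFp: "continuous_on {0..pi} (\<lambda>u. ?F u powr p)"
    using p by (intro continuous_on_powr' continuous_intros) auto
  have "\<exists>x\<in>{0..pi}. \<forall>y\<in>{0..pi}. ?F y \<le> ?F x"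
    by (rule continuous_attains_sup) (use cF in auto)
  then obtain x where x: "x \<in> {0..pi}" "\<And>y. y \<in> {0..pi} \<Longrightarrow> ?F y \<le> ?F x" by auto
  define S where "S = ?F x"
  have A0: "0 \<le> A" unfolding A_def by (intro integral_nonneg integrable_continuous_interval cFp) auto
  have I0: "0 \<le> I" unfolding I_def by (intro integral_nonneg integrable_continuous_interval cF) auto
  have S0: "0 \<le> S" by (simp add: S_def)
  have IA: "I \<le> S powr (1 - p) * A"
  proof -
    have "I \<le> integral {0..pi} (\<lambda>u. S powr (1 - p) * (?F u powr p))"
      unfolding I_def
    proof (intro integral_le integrable_continuous_interval cF continuous_on_mult continuous_on_const cFp)
      fix u assume u: "u \<in> {0..pi}"
      have "?F u = ?F u powr (1 - p) * ?F u powr p" by (simp flip: powr_add)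
      also have "\<dots> \<le> S powr (1 - p) * ?F u powr p"
        using x(2)[OF u] p by (intro mult_right_mono powr_mono2) (auto simp: S_def)
      finally show "?F u \<le> S powr (1 - p) * ?F u powr p" .
    qed
    then show ?thesis by (simp add: A_def)
  qed
  have SI: "S \<le> (real N + 1) * I" using cos_poly_sup_bound(1)[OF assms(1), of x] by (simp add: S_def I_def)
  have SpA: "S powr p \<le> (real N + 1) * A"
  proof (cases "S = 0")
    case True then show ?thesis using A0 by simp
  next
    case False
    have "S \<le> (real N + 1) * (S powr (1 - p) * A)"
      using SI IA by (meson order_trans mult_left_mono add_nonneg_nonneg of_nat_0_le_iff zero_le_one)
    then have "S powr (1-p) * S powr p \<le> S powr (1 - p) * ((real N + 1) * A)"
      using S0 by (simp add: mult_ac flip: powr_add)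
    moreover have "0 < S powr (1-p)" using False by auto
    ultimately show ?thesis by (simp add: mult_le_cancel_left_pos)
  qed
  have Ip: "I powr p \<le> (real N + 1) powr (1 - p) * A"
  proof -
    have "I powr p \<le> (S powr (1 - p) * A) powr p" using IA I0 p by (intro powr_mono2) auto
    also have "\<dots> = (S powr p) powr (1 - p) * A powr p"
      using A0 by (simp add: powr_mult powr_powr mult.commute)
    also have "\<dots> \<le> ((real N + 1) * A) powr (1 - p) * A powr p"
      using SpA p by (intro mult_right_mono powr_mono2) auto
    also have "\<dots> = (real N + 1) powr (1 - p) * A"
      using A0 by (simp add: powr_mult mult.assoc flip: powr_add)
    finally show ?thesis .
  qed
  have "?F t powr p \<le> ((real N + 1) * I) powr p"
    using cos_poly_sup_bound(1)[OF assms(1), of t] p by (intro powr_mono2) (auto simp: I_def)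
  also have "\<dots> \<le> (real N + 1) powr p * ((real N + 1) powr (1 - p) * A)"
    using I0 Ip by (simp add: powr_mult mult_left_mono)
  also have "\<dots> = (real N + 1) * A" by (simp add: mult.assoc[symmetric] flip: powr_add)
  finally show ?A by (simp add: A_def)
  have "\<bar>sin t * poly (pderiv Q) (cos t)\<bar> powr p \<le> ((real N + 1)^2 * I) powr p"
    using cos_poly_sup_bound(2)[OF assms(1), of t] p by (intro powr_mono2) (auto simp: I_def)
  also have "\<dots> = ((real N + 1) powr (2 * p)) * I powr p"
    using I0 by (simp add: powr_mult powr_powr flip: powr_numeral)
  also have "\<dots> \<le> ((real N + 1) powr (2 * p)) * ((real N + 1) powr (1 - p) * A)"
    using Ip by (simp add: mult_left_mono)
  also have "\<dots> = (real N + 1) powr (1 + p) * A" by (simp add: mult.assoc[symmetric] add.commute flip: powr_add)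
  finally show ?B by (simp add: A_def)
qed

section \<open>The Fejer and Jackson kernels as algebraic polynomials in
  \<open>cos u\<close>\<close>

lemma abs_sin_nat_mult_le: "\<bar>sin (real n * x)\<bar> \<le> real n * \<bar>sin x\<bar>"
proof (induction n)
  case (Suc n)
  have "\<bar>sin (real (Suc n) * x)\<bar> = \<bar>sin (real n * x) * cos x + cos (real n * x) * sin x\<bar>"
    by (simp add: algebra_simps sin_add)
  also have "\<dots> \<le> \<bar>sin (real n * x)\<bar> * \<bar>cos x\<bar> + \<bar>cos (real n * x)\<bar> * \<bar>sin x\<bar>"
    by (metis abs_mult abs_triangle_ineq)
  also have "\<dots> \<le> \<bar>sin (real n * x)\<bar> * 1 + 1 * \<bar>sin x\<bar>"
    by (intro add_mono mult_mono) auto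
  finally show ?case using Suc by (simp add: algebra_simps)
qed auto

text \<open>Jordan's inequality: the concave function \<open>sin\<close> lies above its chord on
  \<open>[0, pi / 2]\<close>.\<close>

lemma sin_ge_linear:
  assumes "0 \<le> x" "x \<le> pi / 2"
  shows "2 * x / pi \<le> sin x"
proof -
  have "concave_on {0..pi/2} sin"
  proof -
    have "convex_on {0..pi/2} (\<lambda>x. - sin x)"
      by (rule f''_ge0_imp_convex[where f' = "\<lambda>x. - cos x" and f'' = "\<lambda>x. sin x"])
         (auto intro!: derivative_eq_intros sin_ge_zero)
    then show ?thesis by (simp add: concave_on_def)
  qed
  then have "sin ((1 - 2*x/pi) *\<^sub>R 0 + (2*x/pi) *\<^sub>R (pi/2)) \<ge> (1 - 2*x/pi) * sin 0 + (2*x/pi) * sin (pi/2)"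
    using assms by (intro concave_onD) (auto simp: field_simps)
  then show ?thesis by simp
qed

text \<open>\<open>R (cos u)\<close> is the Fejer kernel
  \<open>(sin (n u / 2) / sin (u / 2))^2\<close>, obtained from the recurrence
  \<open>R_n = 2 R_(n-1) - R_(n-2) + 2 T_(n-1)\<close>. Its value at 1 is recorded separately,
  because the product identity is empty where \<open>cos u = 1\<close>.\<close>

lemma fejer_poly_ex:
  "\<exists>R. degree R \<le> n \<and> poly R 1 = (real n)\<^sup>2 \<and> (\<forall>u. (1 - cos u) * poly R (cos u) = 1 - cos (real n * u))"
proof (induction n rule: less_induct)
  case (less n)
  consider "n = 0" | "n = 1" | i where "n = Suc (Suc i)"
    by (metis One_nat_def not0_implies_Suc)
  then show ?case
  proof cases
    case 1
    then show ?thesis by (intro exI[of _ 0]) auto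
  next
    case 2
    then show ?thesis by (intro exI[of _ 1]) auto
  next
    case 3
    obtain R where R: "degree R \<le> Suc i" "poly R 1 = (real (Suc i))\<^sup>2" "\<And>u. (1 - cos u) * poly R (cos u) = 1 - cos (real (Suc i) * u)"
      using less.IH[of "Suc i"] 3 by auto
    obtain S where S: "degree S \<le> i" "poly S 1 = (real i)\<^sup>2" "\<And>u. (1 - cos u) * poly S (cos u) = 1 - cos (real i * u)"
      using less.IH[of i] 3 by auto
    obtain T where T: "degree T \<le> Suc i" "\<And>t. poly T (cos t) = cos (real (Suc i) * t)"
      using cos_mult_poly by blast
    have T1: "poly T 1 = 1" using T(2)[of 0] by simp
    have e: "(1 - cos u) * poly (smult 2 R - S + smult 2 T) (cos u) = 1 - cos (real n * u)" for u
    proof -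
      have "cos (real n * u) + cos (real i * u) = 2 * cos u * cos (real (Suc i) * u)"
        using cos_plus_cos[of "real n * u" "real i * u"] 3
        by (simp add: algebra_simps add_divide_distrib)
      moreover have "(1 - cos u) * poly (smult 2 R - S + smult 2 T) (cos u) =
          2 * ((1 - cos u) * poly R (cos u)) - (1 - cos u) * poly S (cos u) + 2 * (1 - cos u) * poly T (cos u)"
        by (simp add: algebra_simps)
      ultimately show ?thesis unfolding R S T by (simp add: algebra_simps)
    qed
    have "degree (smult 2 R - S + smult 2 T) \<le> n"
      using R(1) S(1) T(1) 3 by (intro degree_add_le degree_diff_le order_trans[OF degree_smult_le]) auto
    moreover have "poly (smult 2 R - S + smult 2 T) 1 = (real n)\<^sup>2"
      using 3 by (simp add: R S T1 power2_eq_square algebra_simps)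
    ultimately show ?thesis using e by blast
  qed
qed

text \<open>The Fejer kernel normalised to 1 at \<open>u = 0\<close>. The constant
  \<open>1 + pi\<close> merges the two upper bounds, 1 near the origin and
  \<open>(pi / (n |u|))^2\<close> away from it, into one decaying function. The lower bound on
  \<open>n |u| \<le> pi\<close> later guarantees the mass of the kernel.\<close>

lemma fejer_poly:
  assumes n: "1 \<le> n"
  obtains q where "degree q \<le> n" "poly q 1 = 1" "\<And>u. 0 \<le> poly q (cos u)"
    "\<And>u. \<bar>u\<bar> \<le> pi \<Longrightarrow> poly q (cos u) \<le> ((1 + pi) / (1 + real n * \<bar>u\<bar>))\<^sup>2"
    "\<And>u. real n * \<bar>u\<bar> \<le> pi \<Longrightarrow> 1 / 4 \<le> poly q (cos u)"
proof -
  obtain R where R: "degree R \<le> n" "poly R 1 = (real n)\<^sup>2" "\<And>u. (1 - cos u) * poly R (cos u) = 1 - cos (real n * u)"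
    using fejer_poly_ex by blast
  define q where "q = smult (1 / (real n)\<^sup>2) R"
  have q1: "poly q 1 = 1" using n by (simp add: q_def R)
  have one_cos: "1 - cos x = 2 * (sin (x / 2))\<^sup>2" for x :: real
    using cos_double_sin[of "x/2"] by simp
  have cos1: "cos u = 1" if "sin (u / 2) = 0" for u :: real
    using one_cos[of u] that by simp
  have q: "poly q (cos u) = (sin (real n * (u / 2)))\<^sup>2 / (real n * sin (u / 2))\<^sup>2" if "sin (u / 2) \<noteq> 0" for u
  proof -
    have "2 * (sin (u / 2))\<^sup>2 * poly R (cos u) = 2 * (sin (real n * (u / 2)))\<^sup>2"
      using R(3)[of u] unfolding one_cos by simp
    then have "poly R (cos u) = (sin (real n * (u / 2)))\<^sup>2 / (sin (u / 2))\<^sup>2"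
      using that by (simp add: nonzero_eq_divide_eq mult.commute)
    then show ?thesis by (simp add: q_def power_mult_distrib)
  qed
  have q_nonneg: "0 \<le> poly q (cos u)" for u
    by (cases "sin (u / 2) = 0") (auto simp: cos1 q1 q)
  have q_le1: "poly q (cos u) \<le> 1" for u
  proof (cases "sin (u / 2) = 0")
    case False
    have "(sin (real n * (u / 2)))\<^sup>2 \<le> (real n * sin (u / 2))\<^sup>2"
      using abs_sin_nat_mult_le[of n "u/2"] by (simp add: abs_le_square_iff[symmetric] abs_mult)
    then show ?thesis using False n by (simp add: q divide_le_eq_1)
  qed (simp add: cos1 q1)
  have lin: "\<bar>x\<bar> / pi \<le> \<bar>sin (x / 2)\<bar>" if "\<bar>x\<bar> \<le> pi" for x
  proof (cases "0 \<le> x")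
    case True then show ?thesis using sin_ge_linear[of "x/2"] that by simp
  next
    case False then show ?thesis using sin_ge_linear[of "-x/2"] that by simp
  qed
  show ?thesis
  proof (rule that[of q])
    show "degree q \<le> n" using R(1) by (auto simp: q_def)
    show "poly q (cos u) \<le> ((1 + pi) / (1 + real n * \<bar>u\<bar>))\<^sup>2" if u: "\<bar>u\<bar> \<le> pi" for u
    proof (cases "real n * \<bar>u\<bar> \<le> pi")
      case True
      then have "1 \<le> (1 + pi) / (1 + real n * \<bar>u\<bar>)" by (simp add: field_simps add_pos_nonneg)
      then have "1 \<le> ((1 + pi) / (1 + real n * \<bar>u\<bar>))\<^sup>2" by (rule one_le_power)
      then show ?thesis using q_le1[of u] by linarith
    next
      case False
      then have "0 < real n * \<bar>u\<bar>" using pi_gt_zero by linarith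
      then have u0: "u \<noteq> 0" "0 < real n * \<bar>u\<bar>" by auto
      then have s0: "sin (u/2) \<noteq> 0" using lin[OF u] zero_less_divide_iff[of "\<bar>u\<bar>" pi] pi_gt_zero by (metis abs_zero not_le zero_less_abs_iff)
      have "poly q (cos u) \<le> 1 / (real n * sin (u / 2))\<^sup>2"
        unfolding q[OF s0] by (intro divide_right_mono) (auto simp: abs_square_le_1)
      also have "\<dots> \<le> 1 / (real n * \<bar>u\<bar> / pi)\<^sup>2"
      proof (intro divide_left_mono)
        have "real n * \<bar>u\<bar> / pi \<le> \<bar>real n * sin (u/2)\<bar>" using mult_left_mono[OF lin[OF u], of "real n"]
          by (simp add: abs_mult)
        then have "(real n * \<bar>u\<bar> / pi)\<^sup>2 \<le> \<bar>real n * sin (u/2)\<bar>\<^sup>2" by (intro power_mono) auto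
        then show "(real n * \<bar>u\<bar> / pi)\<^sup>2 \<le> (real n * sin (u / 2))\<^sup>2" by simp
      qed (use u0 s0 n in auto)
      also have "\<dots> = (pi / (real n * \<bar>u\<bar>))\<^sup>2" by (simp add: power_divide)
      also have "\<dots> \<le> ((1 + pi) / (1 + real n * \<bar>u\<bar>))\<^sup>2"
        using False u0 by (intro power_mono) (auto simp: field_simps add_pos_pos)
      finally show ?thesis .
    qed
    \<comment> \<open>Jordan's inequality gives
      \<open>|sin (n u / 2)| \<ge> n |u| / pi \<ge> n |u| / 4\<close>, while
      \<open>|n sin (u / 2)| \<le> n |u| / 2\<close>; the quotient is at least 1/2 and its square at
      least 1/4.\<close>
    show "1 / 4 \<le> poly q (cos u)" if u: "real n * \<bar>u\<bar> \<le> pi" for u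
    proof (cases "u = 0")
      case True then show ?thesis by (simp add: q1)
    next
      case False
      have up: "\<bar>u\<bar> \<le> pi"
        using u mult_right_mono[of 1 "real n" "\<bar>u\<bar>"] n by simp
      then have s0: "sin (u/2) \<noteq> 0" using lin[OF up] False zero_less_divide_iff[of "\<bar>u\<bar>" pi] pi_gt_zero by (metis abs_zero not_le zero_less_abs_iff)
      have "\<bar>real n * u\<bar> / pi \<le> \<bar>sin (real n * (u / 2))\<bar>"
        using lin[of "real n * u"] u by (simp add: abs_mult)
      then have a: "real n * \<bar>u\<bar> / pi \<le> \<bar>sin (real n * (u / 2))\<bar>" by (simp add: abs_mult)
      have b: "\<bar>real n * sin (u / 2)\<bar> \<le> real n * \<bar>u\<bar> / 2"
        using mult_left_mono[OF abs_sin_x_le_abs_x[of "u/2"], of "real n"] by (simp add: abs_mult)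
      have "real n * \<bar>u\<bar> / 4 \<le> real n * \<bar>u\<bar> / pi"
        using pi_less_4 by (intro divide_left_mono) auto
      then have "\<bar>real n * sin (u / 2)\<bar> / 2 \<le> \<bar>sin (real n * (u / 2))\<bar>" using a b by linarith
      then have "(\<bar>real n * sin (u / 2)\<bar> / 2)\<^sup>2 \<le> \<bar>sin (real n * (u / 2))\<bar>\<^sup>2" by (intro power_mono) auto
      then have "(real n * sin (u / 2))\<^sup>2 / 4 \<le> (sin (real n * (u / 2)))\<^sup>2" by (simp add: power_divide)
      moreover have "0 < (real n * sin (u / 2))\<^sup>2" using s0 n by simp
      ultimately show ?thesis unfolding q[OF s0] by (simp add: pos_le_divide_eq)
    qed
  qed (use q1 q_nonneg in auto)
qed

lemma inverse_power_shift:
  fixes x y :: real assumes "0 \<le> x" "x \<le> y"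
  shows "1 / (1 + y) ^ k \<le> 1 / (1 + x) ^ k"
  using assms by (intro divide_left_mono power_mono) auto

text \<open>Powers of the Fejer kernel: \<open>M\<close> factors raise the decay to order
  \<open>2 M\<close> at the price of degree \<open>M n\<close>, so any fixed decay is available
  within degree \<open>O(n)\<close>.\<close>

lemma jackson_poly:
  assumes n: "1 \<le> n"
  obtains q where "degree q \<le> M * n" "poly q 1 = 1" "\<And>u. 0 \<le> poly q (cos u)"
    "\<And>u. \<bar>u\<bar> \<le> pi \<Longrightarrow> poly q (cos u) \<le> (1 + pi) ^ (2 * M) / (1 + real n * \<bar>u\<bar>) ^ (2 * M)"
    "\<And>u. real n * \<bar>u\<bar> \<le> pi \<Longrightarrow> (1 / 4) ^ M \<le> poly q (cos u)"
proof -
  obtain q where q: "degree q \<le> n" "poly q 1 = 1" "\<And>u. 0 \<le> poly q (cos u)"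
    "\<And>u. \<bar>u\<bar> \<le> pi \<Longrightarrow> poly q (cos u) \<le> ((1 + pi) / (1 + real n * \<bar>u\<bar>))\<^sup>2"
    "\<And>u. real n * \<bar>u\<bar> \<le> pi \<Longrightarrow> 1 / 4 \<le> poly q (cos u)"
    using fejer_poly[OF n] by blast
  show ?thesis
  proof (rule that[of "q ^ M"])
    show "degree (q ^ M) \<le> M * n"
      using degree_power_le[of q M] q(1) by (metis le_trans mult.commute mult_le_mono2)
    show "poly (q ^ M) (cos u) \<le> (1 + pi) ^ (2 * M) / (1 + real n * \<bar>u\<bar>) ^ (2 * M)" if "\<bar>u\<bar> \<le> pi" for u
      using power_mono[OF q(4)[OF that] q(3), of M] by (simp add: poly_power power_divide power_mult)
    show "(1 / 4) ^ M \<le> poly (q ^ M) (cos u)" if "real n * \<bar>u\<bar> \<le> pi" for u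
      unfolding poly_power by (rule power_mono[OF q(5)[OF that]]) auto
  qed (use q in \<open>auto simp: poly_power\<close>)
qed

text \<open>Symmetrising the translate \<open>u \<mapsto> q (cos (t - u))\<close> keeps it an algebraic polynomial in \<open>cos u\<close>.\<close>

lemma localizer_poly:
  assumes n: "1 \<le> n" and t: "t \<in> {0..pi}"
  obtains R where "degree R \<le> M * n" "1 \<le> poly R (cos t)" "\<And>u. 0 \<le> poly R (cos u)"
    "\<And>u. u \<in> {0..pi} \<Longrightarrow> poly R (cos u) \<le> 2 * (1 + pi) ^ (2 * M) / (1 + real n * \<bar>t - u\<bar>) ^ (2 * M)"
proof -
  obtain q where q: "degree q \<le> M * n" "poly q 1 = 1" "\<And>u. 0 \<le> poly q (cos u)"
    "\<And>u. \<bar>u\<bar> \<le> pi \<Longrightarrow> poly q (cos u) \<le> (1 + pi) ^ (2 * M) / (1 + real n * \<bar>u\<bar>) ^ (2 * M)"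
    by (rule jackson_poly[OF n, of M]) blast
  obtain b where b: "\<And>t. poly q (cos t) = (\<Sum>j\<le>M*n. b j * cos (real j * t))"
    using cos_sum_poly[OF q(1)] by (auto simp: cos_sum_def)
  \<comment> \<open>Each frequency contributes
    \<open>cos j(t - u) + cos j(t + u) = 2 cos jt cos ju\<close>, which is even in
    \<open>u\<close>.\<close>
  have "cos_sum (M * n) (\<lambda>u. poly q (cos (t - u)) + poly q (cos (t + u)))"
    unfolding cos_sum_def
  proof (intro exI allI)
    fix u
    show "poly q (cos (t - u)) + poly q (cos (t + u)) = (\<Sum>j\<le>M*n. (2 * b j * cos (real j * t)) * cos (real j * u))"
      unfolding b sum.distrib[symmetric]
      by (intro sum.cong refl) (simp add: right_diff_distrib distrib_left cos_diff cos_add)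
  qed
  then obtain R where R: "degree R \<le> M * n" "\<And>u. poly q (cos (t - u)) + poly q (cos (t + u)) = poly R (cos u)"
    by (rule cos_sum_imp_poly) blast
  show ?thesis
  proof (rule that[of R])
    show "degree R \<le> M * n" by fact
    show "1 \<le> poly R (cos t)" using R(2)[of t] q(2) q(3)[of "t+t"] by simp
    show "0 \<le> poly R (cos u)" for u unfolding R(2)[symmetric] using q(3) by (simp add: add_nonneg_nonneg)
    fix u assume u: "u \<in> {0..pi}"
    define D where "D = real n * \<bar>t - u\<bar>"
    have D0: "0 \<le> D" by (simp add: D_def)
    have *: "poly q (cos v) \<le> (1 + pi) ^ (2 * M) / (1 + D) ^ (2 * M)" if "\<bar>v\<bar> \<le> pi" "\<bar>t - u\<bar> \<le> \<bar>v\<bar>" for v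
    proof -
      have "D \<le> real n * \<bar>v\<bar>" using that by (simp add: D_def mult_left_mono)
      from inverse_power_shift[OF D0 this, of "2*M"]
      have "(1 + pi) ^ (2 * M) * (1 / (1 + real n * \<bar>v\<bar>) ^ (2 * M)) \<le> (1 + pi) ^ (2 * M) * (1 / (1 + D) ^ (2 * M))"
        by (intro mult_left_mono) auto
      with q(4)[OF that(1)] show ?thesis by simp
    qed
    have 1: "poly q (cos (t - u)) \<le> (1 + pi) ^ (2 * M) / (1 + D) ^ (2 * M)"
      by (rule *) (use t u in auto)
    \<comment> \<open>Beyond \<open>pi\<close> the angle is reflected to
      \<open>2 * pi - (t + u)\<close>. Either representative is still at distance at least
      \<open>|t - u|\<close> from 0, so the second translate obeys the same decay bound as the
      first.\<close>
    have 2: "poly q (cos (t + u)) \<le> (1 + pi) ^ (2 * M) / (1 + D) ^ (2 * M)"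
    proof (cases "t + u \<le> pi")
      case True
      show ?thesis by (rule *) (use t u True in auto)
    next
      case False
      have "cos (t + u) = cos (2 * pi - (t + u))" by (simp add: cos_diff)
      then show ?thesis using *[of "2 * pi - (t + u)"] t u False by auto
    qed
    show "poly R (cos u) \<le> 2 * (1 + pi) ^ (2 * M) / (1 + real n * \<bar>t - u\<bar>) ^ (2 * M)"
      unfolding R(2)[symmetric] using 1 2 by (simp add: D_def)
  qed
qed

section \<open>Integrals of the decay function and passage to nonnegative integrals\<close>

lemma integral_decay_le:
  assumes n: "1 \<le> (n::nat)" and t: "t \<in> {0..pi}"
  shows "(\<lambda>u. 1 / (1 + real n * \<bar>t - u\<bar>)\<^sup>2) integrable_on {0..pi}"
    and "integral {0..pi} (\<lambda>u. 1 / (1 + real n * \<bar>t - u\<bar>)\<^sup>2) \<le> 2 / real n"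
proof -
  have pos: "1 + real n * x \<noteq> 0" if "0 \<le> x" for x using mult_nonneg_nonneg[of "real n" x] that by linarith
  have dl: "((\<lambda>u. inverse (1 + real n * (t - u)) / real n) has_real_derivative 1 / (1 + real n * (t - u))\<^sup>2) (at u within S)"
    if "u \<le> t" for u S
  proof -
    have "((\<lambda>u. inverse (1 + real n * (t - u)) / real n) has_real_derivative
        (- (inverse (1 + real n * (t - u)) * (real n * (0 - 1)) * inverse (1 + real n * (t - u)))) / real n) (at u within S)"
      using pos[of "t - u"] that n by (auto intro!: derivative_eq_intros)
    moreover have "(- (inverse z * (real n * (0 - 1)) * inverse z)) / real n = 1 / z\<^sup>2" for z
      using n by (simp add: power2_eq_square inverse_eq_divide)
    ultimately show ?thesis by simp
  qed
  have dr: "((\<lambda>u. - inverse (1 + real n * (u - t)) / real n) has_real_derivative 1 / (1 + real n * (u - t))\<^sup>2) (at u within S)"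
    if "t \<le> u" for u S
  proof -
    have "((\<lambda>u. - inverse (1 + real n * (u - t)) / real n) has_real_derivative
        (- (- (inverse (1 + real n * (u - t)) * (real n * 1) * inverse (1 + real n * (u - t))))) / real n) (at u within S)"
      using pos[of "u - t"] that n by (auto intro!: derivative_eq_intros)
    moreover have "(- (- (inverse z * (real n * 1) * inverse z))) / real n = 1 / z\<^sup>2" for z
      using n by (simp add: power2_eq_square inverse_eq_divide)
    ultimately show ?thesis by simp
  qed
  have l: "((\<lambda>u. 1 / (1 + real n * \<bar>t - u\<bar>)\<^sup>2) has_integral
     (inverse (1 + real n * (t - t)) / real n - inverse (1 + real n * (t - 0)) / real n)) {0..t}"
    using t dl by (intro fundamental_theorem_of_calculus) (auto simp flip: has_real_derivative_iff_has_vector_derivative)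
  have r: "((\<lambda>u. 1 / (1 + real n * \<bar>t - u\<bar>)\<^sup>2) has_integral
     (- inverse (1 + real n * (pi - t)) / real n - (- inverse (1 + real n * (t - t)) / real n))) {t..pi}"
    using t dr by (intro fundamental_theorem_of_calculus) (auto simp: abs_minus_commute[of t] simp flip: has_real_derivative_iff_has_vector_derivative)
  note c = has_integral_combine[OF _ _ l r]
  show "(\<lambda>u. 1 / (1 + real n * \<bar>t - u\<bar>)\<^sup>2) integrable_on {0..pi}"
    using c t by auto
  have "integral {0..pi} (\<lambda>u. 1 / (1 + real n * \<bar>t - u\<bar>)\<^sup>2) =
    (inverse (1 + real n * (t - t)) / real n - inverse (1 + real n * (t - 0)) / real n) +
    (- inverse (1 + real n * (pi - t)) / real n - (- inverse (1 + real n * (t - t)) / real n))"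
    using c t by (intro integral_unique) auto
  also have "\<dots> \<le> 2 / real n"
  proof -
    have "0 \<le> inverse (1 + real n * (pi - t)) / real n" "0 \<le> inverse (1 + real n * (t - 0)) / real n"
      using t by auto
    then show ?thesis by simp
  qed
  finally show "integral {0..pi} (\<lambda>u. 1 / (1 + real n * \<bar>t - u\<bar>)\<^sup>2) \<le> 2 / real n" .
qed

lemma borel_measurable_poly [measurable (raw)]:
  fixes f :: "'a \<Rightarrow> real"
  shows "f \<in> borel_measurable M \<Longrightarrow> (\<lambda>x. poly Q (f x)) \<in> borel_measurable M"
  by (rule borel_measurable_continuous_on) (auto intro!: continuous_intros)

text \<open>Primitives are handled with the gauge integral, weights and Fubini with
  \<open>nn_integral\<close>, which needs no integrability proofs; this converts the former into the
  latter.\<close>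

lemma nn_integral_interval_HK:
  fixes f :: "real \<Rightarrow> real"
  assumes [measurable]: "f \<in> borel_measurable borel" and nn: "\<And>x. x \<in> {a..b} \<Longrightarrow> 0 \<le> f x"
    and I: "(f has_integral I) {a..b}"
  shows "(\<integral>\<^sup>+t\<in>{a..b}. ennreal (f t) \<partial>lborel) = ennreal I"
proof -
  have "((\<lambda>x. if x \<in> {a..b} then f x else 0) has_integral I) UNIV"
    using I unfolding has_integral_restrict_UNIV .
  moreover have "(\<lambda>x. if x \<in> {a..b} then f x else 0) = (\<lambda>x. indicator {a..b} x * f x)"
    by (auto simp: indicator_def)
  ultimately have "((\<lambda>x. indicator {a..b} x * f x) has_integral I) UNIV" by simp
  then have "(\<integral>\<^sup>+t. ennreal (indicator {a..b} t * f t) \<partial>lborel) = ennreal I"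
    by (intro nn_integral_has_integral_lborel) (auto simp: indicator_def intro: nn)
  moreover have "(\<integral>\<^sup>+t. ennreal (indicator {a..b} t * f t) \<partial>lborel) = (\<integral>\<^sup>+t\<in>{a..b}. ennreal (f t) \<partial>lborel)"
    by (intro nn_integral_cong) (auto simp: indicator_def)
  ultimately show ?thesis by simp
qed

text \<open>After division by \<open>a + b\<close> both terms lie in \<open>[0, 1]\<close>, where
  \<open>x \<le> x powr p\<close>. This is the substitute for Minkowski's inequality
  throughout.\<close>

lemma powr_add_le:
  fixes a b p :: real
  assumes "0 \<le> a" "0 \<le> b" "0 < p" "p \<le> 1"
  shows "(a + b) powr p \<le> a powr p + b powr p"
proof (cases "a + b = 0")
  case True
  then show ?thesis using assms by simp
next
  case False
  then have s: "0 < a + b" using assms by linarith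
  have *: "c / (a + b) \<le> (c / (a + b)) powr p" if "0 \<le> c" "c \<le> a + b" for c
    using powr_mono'[of p 1 "c / (a+b)"] that assms s by (simp add: divide_le_eq_1)
  have "1 = a / (a + b) + b / (a + b)" using s by (simp flip: add_divide_distrib)
  also have "\<dots> \<le> (a / (a + b)) powr p + (b / (a + b)) powr p"
    using assms by (intro add_mono *) auto
  also have "\<dots> = (a powr p + b powr p) / (a + b) powr p"
    using assms by (simp add: powr_divide add_divide_distrib)
  finally show ?thesis using s by (simp add: field_simps)
qed

text \<open>The \<open>L_p\<close> integral of \<open>Q\<close> in the angle, localised around
  \<open>t\<close> at the scale \<open>1 / n\<close>. Up to a power of \<open>n\<close> it dominates
  \<open>Q\<close> and its angular derivative at \<open>t\<close> and, unlike a supremum over a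
  neighbourhood, it can be integrated against a weight by Fubini.\<close>

definition loc_int :: "real \<Rightarrow> nat \<Rightarrow> nat \<Rightarrow> real poly \<Rightarrow> real \<Rightarrow> ennreal" where
  "loc_int p K n Q t =
     (\<integral>\<^sup>+u\<in>{0..pi}. ennreal (\<bar>poly Q (cos u)\<bar> powr p / (1 + real n * \<bar>t - u\<bar>) ^ K) \<partial>lborel)"

lemma one_plus_pos: "0 < 1 + real n * \<bar>x\<bar>"
  by (simp add: add_pos_nonneg)

lemma loc_int_measurable [measurable]: "loc_int p K n Q \<in> borel_measurable borel"
  unfolding loc_int_def by measurable

lemma cont_powr_poly_cos: "0 < p \<Longrightarrow> continuous_on S (\<lambda>u::real. \<bar>poly Q (cos u)\<bar> powr p)"
  by (intro continuous_on_powr' continuous_intros) auto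

text \<open>The unweighted inequalities are applied to \<open>Q * R\<close> with \<open>R\<close> a
  localiser at \<open>t\<close> of degree \<open>O(n)\<close>: since \<open>R \<ge> 1\<close> at
  \<open>t\<close> the value is not diminished, while the decay of \<open>R\<close> turns the global
  integral into a local one. For the derivative, \<open>Q' R = (Q R)' - Q R'\<close>.\<close>

lemma poly_pointwise_aux:
  assumes p: "0 < p" "p \<le> 1"
  obtains C where "0 < C"
   "\<And>n Q t. 1 \<le> n \<Longrightarrow> degree Q \<le> n \<Longrightarrow> t \<in> {0..pi} \<Longrightarrow>
      \<bar>poly Q (cos t)\<bar> powr p \<le> C * real n * integral {0..pi} (\<lambda>u. \<bar>poly Q (cos u)\<bar> powr p / (1 + real n * \<bar>t - u\<bar>) ^ K) \<and>
      \<bar>sin t * poly (pderiv Q) (cos t)\<bar> powr p \<le> C * real n powr (1 + p) *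
          integral {0..pi} (\<lambda>u. \<bar>poly Q (cos u)\<bar> powr p / (1 + real n * \<bar>t - u\<bar>) ^ K)"
proof -
  \<comment> \<open>\<open>2 * M * p \<ge> K\<close> makes the \<open>p\<close>-th power of the
    localiser decay with order \<open>K\<close>; the successor ensures \<open>M \<ge> 1\<close>, so
    that the localiser itself has an integral of size \<open>1 / n\<close>.\<close>
  define M where "M = Suc (nat \<lceil>real K / p\<rceil>)"
  have M1: "1 \<le> M" by (simp add: M_def)
  have "real K / p \<le> 2 * real M" using real_nat_ceiling_ge[of "real K / p"] unfolding M_def by simp
  then have MK: "real K \<le> 2 * real M * p" using p by (simp add: field_simps)
  define c where "c = 2 * (1 + pi) ^ (2 * M)"
  have c0: "0 < c" by (simp add: c_def add_pos_pos)
  define c2 where "c2 = c powr p"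
  have c20: "0 < c2" using c0 by (simp add: c2_def)
  define c3 where "c3 = (real M + 1)^2 * (c * 2)"
  have c30: "0 < c3" using c0 by (simp add: c3_def)
  define C where "C = (real M + 2) * c2 + (real M + 2) powr (1 + p) * c2 + c3 powr p * ((real M + 2) * c2)"
  have C0: "0 < C" using c20 c30 by (simp add: C_def add_pos_pos)
  show ?thesis
  proof (rule that[OF C0])
    fix n :: nat and Q :: "real poly" and t :: real
    assume n: "1 \<le> n" and Q: "degree Q \<le> n" and t: "t \<in> {0..pi}"
    define H where "H = integral {0..pi} (\<lambda>u. \<bar>poly Q (cos u)\<bar> powr p / (1 + real n * \<bar>t - u\<bar>) ^ K)"
    obtain R where R: "degree R \<le> M * n" "1 \<le> poly R (cos t)" "\<And>u. 0 \<le> poly R (cos u)"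
      "\<And>u. u \<in> {0..pi} \<Longrightarrow> poly R (cos u) \<le> c / (1 + real n * \<bar>t - u\<bar>) ^ (2 * M)"
      using localizer_poly[OF n t, of M] unfolding c_def[symmetric] by metis
    have pos: "0 < 1 + real n * \<bar>t - u\<bar>" for u by (simp add: add_pos_nonneg)
    have ge1: "1 \<le> 1 + real n * \<bar>t - u\<bar>" for u by simp
    define G where "G = Q * R"
    define N where "N = (M + 1) * n"
    have dG: "degree G \<le> N"
      unfolding G_def N_def using degree_mult_le[of Q R] Q R(1) by simp
    have N1: "real N + 1 \<le> (real M + 2) * real n" using n by (simp add: N_def algebra_simps)
    have contH: "continuous_on {0..pi} (\<lambda>u. \<bar>poly Q (cos u)\<bar> powr p / (1 + real n * \<bar>t - u\<bar>) ^ K)"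
      using p pos by (intro continuous_intros cont_powr_poly_cos) (auto simp: less_imp_neq[symmetric])
    have H0: "0 \<le> H" unfolding H_def using pos
      by (intro integral_nonneg integrable_continuous_interval contH) (auto intro!: divide_nonneg_nonneg)
    have GH: "integral {0..pi} (\<lambda>u. \<bar>poly G (cos u)\<bar> powr p) \<le> c2 * H"
      unfolding H_def integral_mult_right[symmetric]
    proof (intro integral_le integrable_continuous_interval continuous_on_mult_left contH)
      show "continuous_on {0..pi} (\<lambda>u. \<bar>poly G (cos u)\<bar> powr p)" by (rule cont_powr_poly_cos[OF p(1)])
      fix u assume u: "u \<in> {0..pi}"
      let ?D = "1 + real n * \<bar>t - u\<bar>"
      have "(c / ?D ^ (2 * M)) powr p = c2 / ?D powr (2 * real M * p)"
        using c0 pos[of u] by (simp add: powr_divide c2_def powr_powr flip: powr_realpow)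
      also have "\<dots> \<le> c2 / ?D powr (real K)"
        using ge1[of u] MK c20 pos[of u] by (intro divide_left_mono powr_mono) auto
      also have "\<dots> = c2 / ?D ^ K" using pos[of u] by (simp add: powr_realpow)
      finally have D: "(c / ?D ^ (2 * M)) powr p \<le> c2 / ?D ^ K" .
      have "\<bar>poly G (cos u)\<bar> powr p = \<bar>poly Q (cos u)\<bar> powr p * poly R (cos u) powr p"
        using R(3)[of u] by (simp add: G_def abs_mult powr_mult)
      also have "\<dots> \<le> \<bar>poly Q (cos u)\<bar> powr p * (c / ?D ^ (2 * M)) powr p"
        using R(3)[of u] R(4)[OF u] p by (intro mult_left_mono powr_mono2) auto
      also have "\<dots> \<le> \<bar>poly Q (cos u)\<bar> powr p * (c2 / ?D ^ K)"
        using D by (rule mult_left_mono) simp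
      finally show "\<bar>poly G (cos u)\<bar> powr p \<le> c2 * (\<bar>poly Q (cos u)\<bar> powr p / ?D ^ K)"
        by (simp add: mult.commute)
    qed
    have QG: "\<bar>poly Q (cos t)\<bar> \<le> \<bar>poly G (cos t)\<bar>"
      using mult_left_mono[OF R(2), of "\<bar>poly Q (cos t)\<bar>"] R(3)[of t] by (simp add: G_def abs_mult)
    have 1: "\<bar>poly Q (cos t)\<bar> powr p \<le> (real M + 2) * real n * (c2 * H)"
    proof -
      have "\<bar>poly Q (cos t)\<bar> powr p \<le> \<bar>poly G (cos t)\<bar> powr p" using QG p by (intro powr_mono2) auto
      also have "\<dots> \<le> (real N + 1) * (c2 * H)"
        using cos_poly_sup_bound_p(1)[OF dG p, of t] GH
        by (meson order_trans mult_left_mono add_nonneg_nonneg of_nat_0_le_iff zero_le_one)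
      also have "\<dots> \<le> ((real M + 2) * real n) * (c2 * H)"
        using N1 c20 H0 by (intro mult_right_mono) auto
      finally show ?thesis .
    qed
    have 2: "\<bar>sin t * poly (pderiv G) (cos t)\<bar> powr p \<le> ((real M + 2) powr (1 + p) * real n powr (1 + p)) * (c2 * H)"
    proof -
      have "\<bar>sin t * poly (pderiv G) (cos t)\<bar> powr p \<le> (real N + 1) powr (1 + p) * (c2 * H)"
        using cos_poly_sup_bound_p(2)[OF dG p, of t] GH
        by (meson order_trans mult_left_mono powr_ge_zero)
      also have "\<dots> \<le> ((real M + 2) * real n) powr (1 + p) * (c2 * H)"
        using N1 c20 H0 p by (intro mult_right_mono powr_mono2) auto
      finally show ?thesis by (simp add: powr_mult)
    qed
    \<comment> \<open>The \<open>L_1\<close> norm of \<open>R\<close> is \<open>O(1 / n)\<close>, so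
      the factor \<open>(M n + 1)^2\<close> times that norm leaves only one power of
      \<open>n\<close>.\<close>
    have 3: "\<bar>sin t * poly (pderiv R) (cos t)\<bar> \<le> c3 * real n"
    proof -
      have "integral {0..pi} (\<lambda>u. \<bar>poly R (cos u)\<bar>) \<le> integral {0..pi} (\<lambda>u. c * (1 / (1 + real n * \<bar>t - u\<bar>)\<^sup>2))"
      proof (intro integral_le)
        show "(\<lambda>u. \<bar>poly R (cos u)\<bar>) integrable_on {0..pi}"
          by (intro integrable_continuous_interval continuous_intros)
        show "(\<lambda>u. c * (1 / (1 + real n * \<bar>t - u\<bar>)\<^sup>2)) integrable_on {0..pi}"
          using integrable_on_mult_right[OF integral_decay_le(1)[OF n t], of c] by simp
        fix u assume u: "u \<in> {0..pi}"
        have "(1 + real n * \<bar>t - u\<bar>) ^ 2 \<le> (1 + real n * \<bar>t - u\<bar>) ^ (2 * M)"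
          using M1 by (intro power_increasing) auto
        then have "c / (1 + real n * \<bar>t - u\<bar>) ^ (2 * M) \<le> c / (1 + real n * \<bar>t - u\<bar>) ^ 2"
          using c0 pos[of u] by (intro divide_left_mono) auto
        then show "\<bar>poly R (cos u)\<bar> \<le> c * (1 / (1 + real n * \<bar>t - u\<bar>)\<^sup>2)"
          using R(3)[of u] R(4)[OF u] by simp
      qed
      also have "\<dots> \<le> c * (2 / real n)"
        unfolding integral_mult_right using integral_decay_le(2)[OF n t] c0 by (intro mult_left_mono) auto
      finally have I: "integral {0..pi} (\<lambda>u. \<bar>poly R (cos u)\<bar>) \<le> c * (2 / real n)" .
      have "\<bar>sin t * poly (pderiv R) (cos t)\<bar> \<le> (real (M * n) + 1)\<^sup>2 * (c * (2 / real n))"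
        using cos_poly_sup_bound(2)[OF R(1), of t] I by (meson order_trans mult_left_mono zero_le_power2)
      also have "\<dots> \<le> ((real M + 1) * real n)\<^sup>2 * (c * (2 / real n))"
        using n c0 by (intro mult_right_mono power_mono) (auto simp: algebra_simps)
      also have "\<dots> = c3 * real n" using n by (simp add: c3_def power2_eq_square)
      finally show ?thesis .
    qed
    have 4: "\<bar>sin t * poly (pderiv Q) (cos t)\<bar> \<le> \<bar>sin t * poly (pderiv G) (cos t)\<bar> + \<bar>poly Q (cos t)\<bar> * (c3 * real n)"
    proof -
      have "sin t * poly (pderiv G) (cos t) = sin t * poly (pderiv Q) (cos t) * poly R (cos t) + poly Q (cos t) * (sin t * poly (pderiv R) (cos t))"
        by (simp add: G_def pderiv_mult algebra_simps)
      then have "\<bar>sin t * poly (pderiv Q) (cos t)\<bar> * poly R (cos t) \<le> \<bar>sin t * poly (pderiv G) (cos t)\<bar> + \<bar>poly Q (cos t)\<bar> * \<bar>sin t * poly (pderiv R) (cos t)\<bar>"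
        using R(3)[of t] abs_triangle_ineq4[of "sin t * poly (pderiv G) (cos t)" "poly Q (cos t) * (sin t * poly (pderiv R) (cos t))"]
        by (simp add: abs_mult)
      moreover have "\<bar>sin t * poly (pderiv Q) (cos t)\<bar> * 1 \<le> \<bar>sin t * poly (pderiv Q) (cos t)\<bar> * poly R (cos t)"
        using R(2) by (intro mult_left_mono) auto
      moreover have "\<bar>poly Q (cos t)\<bar> * \<bar>sin t * poly (pderiv R) (cos t)\<bar> \<le> \<bar>poly Q (cos t)\<bar> * (c3 * real n)"
        using 3 by (intro mult_left_mono) auto
      ultimately show ?thesis by linarith
    qed
    have "\<bar>sin t * poly (pderiv Q) (cos t)\<bar> powr p \<le> (\<bar>sin t * poly (pderiv G) (cos t)\<bar> + \<bar>poly Q (cos t)\<bar> * (c3 * real n)) powr p"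
      using 4 p by (intro powr_mono2) auto
    also have "\<dots> \<le> \<bar>sin t * poly (pderiv G) (cos t)\<bar> powr p + (\<bar>poly Q (cos t)\<bar> * (c3 * real n)) powr p"
      using c30 p by (intro powr_add_le) auto
    also have "(\<bar>poly Q (cos t)\<bar> * (c3 * real n)) powr p = \<bar>poly Q (cos t)\<bar> powr p * (c3 powr p * real n powr p)"
      using c30 by (simp add: powr_mult)
    also have "\<dots> \<le> ((real M + 2) * real n * (c2 * H)) * (c3 powr p * real n powr p)"
      using 1 by (intro mult_right_mono) auto
    finally have "\<bar>sin t * poly (pderiv Q) (cos t)\<bar> powr p \<le>
       ((real M + 2) powr (1 + p) * real n powr (1 + p)) * (c2 * H) + ((real M + 2) * real n * (c2 * H)) * (c3 powr p * real n powr p)"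
      using 2 by linarith
    also have "\<dots> = ((real M + 2) powr (1 + p) * c2 + c3 powr p * ((real M + 2) * c2)) * (real n powr (1 + p) * H)"
      using n by (simp add: powr_add algebra_simps)
    also have "\<dots> \<le> C * (real n powr (1 + p) * H)"
      using H0 c20 by (intro mult_right_mono) (auto simp: C_def)
    finally have B: "\<bar>sin t * poly (pderiv Q) (cos t)\<bar> powr p \<le> C * real n powr (1 + p) * H" by (simp add: mult.assoc)
    have "(real M + 2) * real n * (c2 * H) = ((real M + 2) * c2) * (real n * H)" by simp
    also have "\<dots> \<le> C * (real n * H)"
      using H0 c20 c30 by (intro mult_right_mono) (auto simp: C_def)
    finally have A: "\<bar>poly Q (cos t)\<bar> powr p \<le> C * real n * H" using 1 by (simp add: mult.assoc)
    from A B show "\<bar>poly Q (cos t)\<bar> powr p \<le> C * real n * integral {0..pi} (\<lambda>u. \<bar>poly Q (cos u)\<bar> powr p / (1 + real n * \<bar>t - u\<bar>) ^ K) \<and>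
      \<bar>sin t * poly (pderiv Q) (cos t)\<bar> powr p \<le> C * real n powr (1 + p) *
          integral {0..pi} (\<lambda>u. \<bar>poly Q (cos u)\<bar> powr p / (1 + real n * \<bar>t - u\<bar>) ^ K)"
      unfolding H_def by blast
  qed
qed

lemma loc_int_eq_integral:
  assumes "0 < p"
  shows "loc_int p K n Q t = ennreal (integral {0..pi} (\<lambda>u. \<bar>poly Q (cos u)\<bar> powr p / (1 + real n * \<bar>t - u\<bar>) ^ K))"
proof -
  have pos: "1 + real n * \<bar>t - u\<bar> \<noteq> 0" for u using one_plus_pos[of n "t-u"] by simp
  have "continuous_on {0..pi} (\<lambda>u. \<bar>poly Q (cos u)\<bar> powr p / (1 + real n * \<bar>t - u\<bar>) ^ K)"
    using assms pos by (intro continuous_intros cont_powr_poly_cos) auto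
  then show ?thesis unfolding loc_int_def
    by (intro nn_integral_interval_HK integrable_integral integrable_continuous_interval) (auto intro!: divide_nonneg_nonneg)
qed

lemma poly_pointwise:
  assumes p: "0 < p" "p \<le> 1"
  obtains C where "0 < C"
   "\<And>n Q t. 1 \<le> n \<Longrightarrow> degree Q \<le> n \<Longrightarrow> t \<in> {0..pi} \<Longrightarrow>
      ennreal (\<bar>poly Q (cos t)\<bar> powr p) \<le> ennreal (C * real n) * loc_int p K n Q t"
   "\<And>n Q t. 1 \<le> n \<Longrightarrow> degree Q \<le> n \<Longrightarrow> t \<in> {0..pi} \<Longrightarrow>
      ennreal (\<bar>sin t * poly (pderiv Q) (cos t)\<bar> powr p) \<le> ennreal (C * real n powr (1 + p)) * loc_int p K n Q t"
proof -
  obtain C where C: "0 < C"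
   "\<And>n Q t. 1 \<le> n \<Longrightarrow> degree Q \<le> n \<Longrightarrow> t \<in> {0..pi} \<Longrightarrow>
      \<bar>poly Q (cos t)\<bar> powr p \<le> C * real n * integral {0..pi} (\<lambda>u. \<bar>poly Q (cos u)\<bar> powr p / (1 + real n * \<bar>t - u\<bar>) ^ K) \<and>
      \<bar>sin t * poly (pderiv Q) (cos t)\<bar> powr p \<le> C * real n powr (1 + p) *
          integral {0..pi} (\<lambda>u. \<bar>poly Q (cos u)\<bar> powr p / (1 + real n * \<bar>t - u\<bar>) ^ K)"
    using poly_pointwise_aux[OF p, of K thesis] by blast
  show ?thesis
    by (rule that[OF C(1)])
       (use C in \<open>auto simp: loc_int_eq_integral[OF p(1)] simp flip: ennreal_mult' intro!: ennreal_leI\<close>)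
qed

subsection \<open>Slowly varying weights and local Bernstein estimates\<close>

text \<open>A weight in the angle whose ratio at two points grows at most polynomially in their
  distance measured in units of \<open>1 / n\<close>. \<open>C\<close> and \<open>k\<close> are
  arguments so that uniformity in \<open>n\<close> can be expressed: the constants of the polynomial
  inequalities below depend on \<open>C\<close> and \<open>k\<close>, not on \<open>n\<close> or
  \<open>V\<close>.\<close>

definition slow :: "real \<Rightarrow> nat \<Rightarrow> nat \<Rightarrow> (real \<Rightarrow> real) \<Rightarrow> bool" where
  "slow C k n V \<longleftrightarrow> V \<in> borel_measurable borel \<and> (\<forall>t\<in>{0..pi}. 0 \<le> V t) \<and>
     (\<forall>t\<in>{0..pi}. \<forall>u\<in>{0..pi}. V t \<le> C * (1 + real n * \<bar>t - u\<bar>) ^ k * V u)"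

lemma slow_meas [measurable_dest]: "slow C k n V \<Longrightarrow> V \<in> borel_measurable borel"
  by (simp add: slow_def)

lemma slowD: "slow C k n V \<Longrightarrow> t \<in> {0..pi} \<Longrightarrow> u \<in> {0..pi} \<Longrightarrow> V t \<le> C * (1 + real n * \<bar>t - u\<bar>) ^ k * V u"
  by (simp add: slow_def)

lemma slow_nonneg: "slow C k n V \<Longrightarrow> t \<in> {0..pi} \<Longrightarrow> 0 \<le> V t"
  by (simp add: slow_def)

lemma nn_decay_le:
  assumes n: "1 \<le> (n::nat)" and t: "t \<in> {0..pi}"
  shows "(\<integral>\<^sup>+u\<in>{0..pi}. ennreal (1 / (1 + real n * \<bar>t - u\<bar>)\<^sup>2) \<partial>lborel) \<le> ennreal (2 / real n)"
proof -
  have "(\<integral>\<^sup>+u\<in>{0..pi}. ennreal (1 / (1 + real n * \<bar>t - u\<bar>)\<^sup>2) \<partial>lborel) = ennreal (integral {0..pi} (\<lambda>u. 1 / (1 + real n * \<bar>t - u\<bar>)\<^sup>2))"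
    by (intro nn_integral_interval_HK integrable_integral integral_decay_le n t) auto
  also have "\<dots> \<le> ennreal (2 / real n)" by (intro ennreal_leI integral_decay_le n t)
  finally show ?thesis .
qed

text \<open>By Fubini. Of the decay exponent \<open>k + 2\<close>, the part \<open>k\<close> moves
  the weight from \<open>t\<close> to \<open>u\<close>, and the remaining 2 leaves an integrable
  kernel of mass at most \<open>2 / n\<close>, which cancels a factor \<open>n\<close> of the
  pointwise bounds.\<close>

lemma slow_kernel:
  assumes V: "slow C k n V" and C: "0 \<le> C" and n: "1 \<le> n"
  shows "(\<integral>\<^sup>+t\<in>{0..pi}. loc_int p (k + 2) n Q t * ennreal (V t) \<partial>lborel)
    \<le> ennreal (2 * C / real n) * (\<integral>\<^sup>+u\<in>{0..pi}. ennreal (\<bar>poly Q (cos u)\<bar> powr p * V u) \<partial>lborel)"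
proof -
  note [measurable] = slow_meas[OF V]
  let ?g = "\<lambda>u. \<bar>poly Q (cos u)\<bar> powr p"
  let ?i = "indicator {0..pi} :: real \<Rightarrow> ennreal"
  have "(\<integral>\<^sup>+t\<in>{0..pi}. loc_int p (k + 2) n Q t * ennreal (V t) \<partial>lborel)
     = (\<integral>\<^sup>+t. (\<integral>\<^sup>+u. ennreal (?g u / (1 + real n * \<bar>t - u\<bar>) ^ (k+2)) * ?i u * (ennreal (V t) * ?i t) \<partial>lborel) \<partial>lborel)"
    unfolding loc_int_def by (subst nn_integral_multc) (auto simp: mult.assoc)
  also have "\<dots> = (\<integral>\<^sup>+u. (\<integral>\<^sup>+t. ennreal (?g u / (1 + real n * \<bar>t - u\<bar>) ^ (k+2)) * ?i u * (ennreal (V t) * ?i t) \<partial>lborel) \<partial>lborel)"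
    by (subst lborel_pair.Fubini') auto
  also have "\<dots> \<le> (\<integral>\<^sup>+u. ennreal (C * (?g u * V u)) * ?i u * (\<integral>\<^sup>+t. ennreal (1 / (1 + real n * \<bar>u - t\<bar>)\<^sup>2) * ?i t \<partial>lborel) \<partial>lborel)"
  proof (rule nn_integral_mono)
    fix u :: real
    have "(\<integral>\<^sup>+t. ennreal (?g u / (1 + real n * \<bar>t - u\<bar>) ^ (k+2)) * ?i u * (ennreal (V t) * ?i t) \<partial>lborel)
       \<le> (\<integral>\<^sup>+t. ennreal (C * (?g u * V u)) * ?i u * (ennreal (1 / (1 + real n * \<bar>u - t\<bar>)\<^sup>2) * ?i t) \<partial>lborel)"
    proof (rule nn_integral_mono)
      fix t :: real
      show "ennreal (?g u / (1 + real n * \<bar>t - u\<bar>) ^ (k+2)) * ?i u * (ennreal (V t) * ?i t)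
        \<le> ennreal (C * (?g u * V u)) * ?i u * (ennreal (1 / (1 + real n * \<bar>u - t\<bar>)\<^sup>2) * ?i t)"
      proof (cases "t \<in> {0..pi} \<and> u \<in> {0..pi}")
        case True
        let ?D = "1 + real n * \<bar>t - u\<bar>"
        have D: "0 < ?D" by (rule one_plus_pos)
        have "?g u / ?D ^ (k+2) * V t \<le> ?g u / ?D ^ (k+2) * (C * ?D ^ k * V u)"
          using slowD[OF V, of t u] True D by (intro mult_left_mono) auto
        also have "\<dots> = C * (?g u * V u) * (1 / ?D\<^sup>2)"
          using D by (simp add: power_add power2_eq_square)
        finally have "?g u / ?D ^ (k+2) * V t \<le> C * (?g u * V u) * (1 / (1 + real n * \<bar>u - t\<bar>)\<^sup>2)"
          by (simp add: abs_minus_commute)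
        then show ?thesis using True slow_nonneg[OF V] C D
          by (simp flip: ennreal_mult')
      qed auto
    qed
    also have "\<dots> = ennreal (C * (?g u * V u)) * ?i u * (\<integral>\<^sup>+t. ennreal (1 / (1 + real n * \<bar>u - t\<bar>)\<^sup>2) * ?i t \<partial>lborel)"
      by (subst nn_integral_cmult) auto
    finally show "(\<integral>\<^sup>+t. ennreal (?g u / (1 + real n * \<bar>t - u\<bar>) ^ (k+2)) * ?i u * (ennreal (V t) * ?i t) \<partial>lborel)
      \<le> ennreal (C * (?g u * V u)) * ?i u * (\<integral>\<^sup>+t. ennreal (1 / (1 + real n * \<bar>u - t\<bar>)\<^sup>2) * ?i t \<partial>lborel)" .
  qed
  also have "\<dots> \<le> (\<integral>\<^sup>+u. ennreal (2 * C / real n) * (ennreal (?g u * V u) * ?i u) \<partial>lborel)"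
  proof (rule nn_integral_mono)
    fix u :: real
    show "ennreal (C * (?g u * V u)) * ?i u * (\<integral>\<^sup>+t. ennreal (1 / (1 + real n * \<bar>u - t\<bar>)\<^sup>2) * ?i t \<partial>lborel)
      \<le> ennreal (2 * C / real n) * (ennreal (?g u * V u) * ?i u)"
    proof (cases "u \<in> {0..pi}")
      case True
      have "ennreal (C * (?g u * V u)) * ?i u * (\<integral>\<^sup>+t. ennreal (1 / (1 + real n * \<bar>u - t\<bar>)\<^sup>2) * ?i t \<partial>lborel)
        \<le> ennreal (C * (?g u * V u)) * ?i u * ennreal (2 / real n)"
        by (rule mult_left_mono[OF nn_decay_le[OF n True]]) simp
      also have "\<dots> = ennreal (2 * C / real n) * (ennreal (?g u * V u) * ?i u)"
        using True C slow_nonneg[OF V True] by (simp add: mult_ac flip: ennreal_mult')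
      finally show ?thesis .
    qed simp
  qed
  also have "\<dots> = ennreal (2 * C / real n) * (\<integral>\<^sup>+u\<in>{0..pi}. ennreal (?g u * V u) \<partial>lborel)"
    by (rule nn_integral_cmult) auto
  finally show ?thesis .
qed

text \<open>\<open>1 + n |t - u| \<le> (1 + c) (1 + n |s - u|)\<close>, so a move of the centre by
  \<open>c / n\<close> costs a constant factor.\<close>

lemma loc_int_shift:
  assumes "real n * \<bar>s - t\<bar> \<le> c"
  shows "loc_int p K n Q s \<le> ennreal ((1 + c) ^ K) * loc_int p K n Q t"
proof -
  have c0: "0 \<le> c" using assms mult_nonneg_nonneg[of "real n" "\<bar>s - t\<bar>"] by linarith
  have "loc_int p K n Q s \<le> (\<integral>\<^sup>+u. ennreal ((1 + c) ^ K) * (ennreal (\<bar>poly Q (cos u)\<bar> powr p / (1 + real n * \<bar>t - u\<bar>) ^ K) * indicator {0..pi} u) \<partial>lborel)"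
    unfolding loc_int_def
  proof (rule nn_integral_mono)
    fix u :: real
    have D: "0 < 1 + real n * \<bar>t - u\<bar>" "0 < 1 + real n * \<bar>s - u\<bar>" by (rule one_plus_pos)+
    have "real n * \<bar>t - u\<bar> \<le> real n * (\<bar>s - t\<bar> + \<bar>s - u\<bar>)" by (intro mult_left_mono) auto
    then have "1 + real n * \<bar>t - u\<bar> \<le> 1 + c + real n * \<bar>s - u\<bar>" using assms by (simp add: distrib_left)
    also have "\<dots> \<le> (1 + c) * (1 + real n * \<bar>s - u\<bar>)"
      using c0 by (simp add: algebra_simps)
    finally have "(1 + real n * \<bar>t - u\<bar>) ^ K \<le> ((1 + c) * (1 + real n * \<bar>s - u\<bar>)) ^ K"
      using D by (intro power_mono) auto
    then have "1 / (1 + real n * \<bar>s - u\<bar>) ^ K \<le> (1 + c) ^ K / (1 + real n * \<bar>t - u\<bar>) ^ K"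
      using D by (simp add: power_mult_distrib pos_divide_le_eq pos_le_divide_eq)
    from mult_left_mono[OF this, of "\<bar>poly Q (cos u)\<bar> powr p"]
    have "\<bar>poly Q (cos u)\<bar> powr p / (1 + real n * \<bar>s - u\<bar>) ^ K \<le> (1 + c) ^ K * (\<bar>poly Q (cos u)\<bar> powr p / (1 + real n * \<bar>t - u\<bar>) ^ K)"
      by (simp add: mult.commute)
    then show "ennreal (\<bar>poly Q (cos u)\<bar> powr p / (1 + real n * \<bar>s - u\<bar>) ^ K) * indicator {0..pi} u
      \<le> ennreal ((1 + c) ^ K) * (ennreal (\<bar>poly Q (cos u)\<bar> powr p / (1 + real n * \<bar>t - u\<bar>) ^ K) * indicator {0..pi} u)"
      using c0 by (auto simp: indicator_def intro!: ennreal_leI simp flip: ennreal_mult')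
  qed
  also have "\<dots> = ennreal ((1 + c) ^ K) * loc_int p K n Q t"
    unfolding loc_int_def by (rule nn_integral_cmult) auto
  finally show ?thesis .
qed

text \<open>The Jacobian \<open>sin t\<close> is left out on purpose: it vanishes at the ends and is
  not slow. Without it all slow weights are treated alike; it is brought back in
  \<open>deriv_local_sup\<close>.\<close>

definition wint :: "real \<Rightarrow> real poly \<Rightarrow> (real \<Rightarrow> real) \<Rightarrow> real \<Rightarrow> real \<Rightarrow> ennreal" where
  "wint p Q V a b = (\<integral>\<^sup>+t\<in>{a..b}. ennreal (\<bar>poly Q (cos t)\<bar> powr p * V t) \<partial>lborel)"

lemma wint_mono: "{a..b} \<subseteq> {c..d} \<Longrightarrow> wint p Q V a b \<le> wint p Q V c d"
  unfolding wint_def by (intro nn_integral_mono) (auto simp: indicator_def)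

text \<open>Finiteness is what permits moving a multiple of this integral to the other side in
  \<open>wint_interior\<close>.\<close>

lemma wint_finite:
  assumes V: "slow C k n V" and p: "0 < p"
  shows "wint p Q V 0 pi < \<infinity>"
proof -
  have "\<exists>x\<in>{0..pi}. \<forall>y\<in>{0..pi}. \<bar>poly Q (cos y)\<bar> \<le> \<bar>poly Q (cos x)\<bar>"
    by (rule continuous_attains_sup) (auto intro!: continuous_intros)
  then obtain x where x: "\<And>y. y \<in> {0..pi} \<Longrightarrow> \<bar>poly Q (cos y)\<bar> \<le> \<bar>poly Q (cos x)\<bar>" by blast
  define B where "B = \<bar>poly Q (cos x)\<bar> powr p * (\<bar>C\<bar> * (1 + real n * pi) ^ k * V 0)"
  have pb: "\<bar>poly Q (cos t)\<bar> powr p * V t \<le> B" if t: "t \<in> {0..pi}" for t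
  proof -
    have "V t \<le> C * (1 + real n * \<bar>t - 0\<bar>) ^ k * V 0" by (rule slowD[OF V t]) auto
    also have "\<dots> \<le> \<bar>C\<bar> * (1 + real n * pi) ^ k * V 0"
      using t slow_nonneg[OF V, of 0] by (intro mult_mono power_mono add_left_mono mult_left_mono) auto
    finally have "V t \<le> \<bar>C\<bar> * (1 + real n * pi) ^ k * V 0" .
    then show ?thesis unfolding B_def using slow_nonneg[OF V t] x[OF t] p
      by (intro mult_mono powr_mono2) auto
  qed
  have "wint p Q V 0 pi \<le> (\<integral>\<^sup>+t. ennreal B * indicator {0..pi} t \<partial>lborel)"
    unfolding wint_def by (intro nn_integral_mono) (auto simp: indicator_def intro!: ennreal_leI pb)
  also have "\<dots> < \<infinity>" by (subst nn_integral_cmult_indicator) (auto simp: ennreal_mult_less_top)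
  finally show ?thesis .
qed

text \<open>The mean value theorem bounds \<open>Q (cos t)\<close> by its translate by
  \<open>s\<close> plus \<open>|s|\<close> times a derivative at a nearby angle. In
  \<open>p\<close>-th powers the second term is controlled by the local integral with the factor
  \<open>\<delta> powr p\<close>, which can be made small.\<close>

lemma wint_shift_le:
  assumes p: "0 < p" "p \<le> 1" and V: "slow C k n V" and C: "0 < C" and n: "1 \<le> n" and \<delta>: "0 < \<delta>" "\<delta> \<le> 1"
    and K: "0 < C1"
    and deriv: "\<And>t. t \<in> {0..pi} \<Longrightarrow>
      ennreal (\<bar>sin t * poly (pderiv Q) (cos t)\<bar> powr p) \<le> ennreal (C1 * real n powr (1 + p)) * loc_int p (k + 2) n Q t"
    and s: "\<bar>s\<bar> = \<delta> / real n" and ab: "{a..b} \<subseteq> {0..pi}" "{a + s..b + s} \<subseteq> {\<delta> / real n..pi - \<delta> / real n}"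
  shows "wint p Q V a b \<le> ennreal (C * 2 ^ k) * wint p Q V (\<delta> / real n) (pi - \<delta> / real n)
           + ennreal (2 ^ (k + 3) * C * C1 * \<delta> powr p) * wint p Q V 0 pi"
proof -
  note [measurable] = slow_meas[OF V]
  have np: "0 < real n" using n by simp
  have dn: "0 < \<delta> / real n" using \<delta> np by simp
  define E where "E = C1 * \<delta> powr p * real n * 2 ^ (k + 2)"
  have E0: "0 \<le> E" using K by (simp add: E_def)
  have pt: "ennreal (\<bar>poly Q (cos t)\<bar> powr p) \<le> ennreal (\<bar>poly Q (cos (t + s))\<bar> powr p) + ennreal E * loc_int p (k + 2) n Q t"
    if t: "t \<in> {a..b}" for t
  proof -
    let ?F = "\<lambda>t. poly Q (cos t)" and ?F' = "\<lambda>t. - sin t * poly (pderiv Q) (cos t)"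
    have "t + s \<in> {a + s..b + s}" using t by simp
    then have "t + s \<in> {\<delta> / real n..pi - \<delta> / real n}" using ab(2) by blast
    then have ts: "t \<in> {0..pi}" "t + s \<in> {0..pi}" using t ab(1) dn by auto
    have "\<exists>x. x \<in> {0..pi} \<and> \<bar>x - t\<bar> \<le> \<bar>s\<bar> \<and> \<bar>?F (t + s) - ?F t\<bar> = \<bar>s\<bar> * \<bar>?F' x\<bar>"
    proof (cases "0 < s")
      case True
      obtain x where "t < x" "x < t + s" "?F (t + s) - ?F t = (t + s - t) * ?F' x"
        using MVT2[of t "t + s" ?F ?F'] True cos_poly_deriv by auto
      then show ?thesis using ts True by (intro exI[of _ x]) (auto simp: abs_mult)
    next
      case False
      then have s0: "s < 0" using s dn by auto
      obtain x where "t + s < x" "x < t" "?F t - ?F (t + s) = (t - (t + s)) * ?F' x"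
        using MVT2[of "t + s" t ?F ?F'] s0 cos_poly_deriv by auto
      then show ?thesis using ts s0
        by (intro exI[of _ x]) (auto simp: abs_mult abs_minus_commute[of "?F (t+s)"])
    qed
    then obtain x where x: "x \<in> {0..pi}" "\<bar>x - t\<bar> \<le> \<bar>s\<bar>" "\<bar>?F (t + s) - ?F t\<bar> = \<bar>s\<bar> * \<bar>?F' x\<bar>" by blast
    have "\<bar>?F t\<bar> \<le> \<bar>?F (t + s)\<bar> + \<bar>s\<bar> * \<bar>sin x * poly (pderiv Q) (cos x)\<bar>"
      using x(3) by (simp add: abs_mult)
    then have "\<bar>?F t\<bar> powr p \<le> (\<bar>?F (t + s)\<bar> + \<bar>s\<bar> * \<bar>sin x * poly (pderiv Q) (cos x)\<bar>) powr p"
      using p by (intro powr_mono2) auto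
    also have "\<dots> \<le> \<bar>?F (t + s)\<bar> powr p + (\<bar>s\<bar> * \<bar>sin x * poly (pderiv Q) (cos x)\<bar>) powr p"
      using p by (intro powr_add_le) auto
    finally have "ennreal (\<bar>?F t\<bar> powr p) \<le> ennreal (\<bar>?F (t + s)\<bar> powr p) + ennreal (\<bar>s\<bar> powr p) * ennreal (\<bar>sin x * poly (pderiv Q) (cos x)\<bar> powr p)"
      by (simp add: powr_mult flip: ennreal_mult' ennreal_plus)
    also have "\<dots> \<le> ennreal (\<bar>?F (t + s)\<bar> powr p) + ennreal (\<bar>s\<bar> powr p) * (ennreal (C1 * real n powr (1 + p)) * (ennreal (2 ^ (k + 2)) * loc_int p (k + 2) n Q t))"
    proof (intro add_left_mono mult_left_mono order_trans[OF deriv[OF x(1)]])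
      \<comment> \<open>The intermediate point is within \<open>1 / n\<close> of \<open>t\<close>,
        so recentring the local integral costs only \<open>2 ^ (k + 2)\<close>.\<close>
      have "real n * \<bar>x - t\<bar> \<le> real n * (\<delta> / real n)" using x(2) s np by (intro mult_left_mono) auto
      then have "real n * \<bar>x - t\<bar> \<le> 1" using np \<delta> by simp
      from loc_int_shift[OF this, of p "k+2" Q]
      show "loc_int p (k + 2) n Q x \<le> ennreal (2 ^ (k + 2)) * loc_int p (k + 2) n Q t" by simp
    qed auto
    also have "ennreal (\<bar>s\<bar> powr p) * (ennreal (C1 * real n powr (1 + p)) * (ennreal (2 ^ (k + 2)) * loc_int p (k + 2) n Q t))
       = ennreal (\<bar>s\<bar> powr p * (C1 * real n powr (1 + p)) * 2 ^ (k + 2)) * loc_int p (k + 2) n Q t"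
      using K by (simp add: ennreal_mult mult.assoc)
    also have "\<bar>s\<bar> powr p * (C1 * real n powr (1 + p)) * 2 ^ (k + 2) = E"
      using np \<delta> by (simp add: s E_def powr_divide powr_add)
    finally show ?thesis .
  qed
  have "wint p Q V a b \<le> (\<integral>\<^sup>+t. ennreal (C * 2 ^ k) * (ennreal (\<bar>poly Q (cos (t + s))\<bar> powr p * V (t + s)) * indicator {\<delta> / real n..pi - \<delta> / real n} (t + s))
       + ennreal E * (loc_int p (k + 2) n Q t * ennreal (V t) * indicator {0..pi} t) \<partial>lborel)"
    unfolding wint_def
  proof (rule nn_integral_mono)
    fix t
    show "ennreal (\<bar>poly Q (cos t)\<bar> powr p * V t) * indicator {a..b} t \<le>
      ennreal (C * 2 ^ k) * (ennreal (\<bar>poly Q (cos (t + s))\<bar> powr p * V (t + s)) * indicator {\<delta> / real n..pi - \<delta> / real n} (t + s))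
       + ennreal E * (loc_int p (k + 2) n Q t * ennreal (V t) * indicator {0..pi} t)"
    proof (cases "t \<in> {a..b}")
      case True
      have "t + s \<in> {a + s..b + s}" using True by simp
      then have ts: "t + s \<in> {\<delta> / real n..pi - \<delta> / real n}" using ab(2) by blast
      have t0: "t \<in> {0..pi}" using True ab(1) by blast
      have ts0: "t + s \<in> {0..pi}" using ts dn by auto
      have "V t \<le> C * (1 + real n * \<bar>t - (t + s)\<bar>) ^ k * V (t + s)" by (rule slowD[OF V t0 ts0])
      also have "\<dots> \<le> C * 2 ^ k * V (t + s)"
        using np \<delta> s C slow_nonneg[OF V ts0] by (intro mult_right_mono mult_left_mono power_mono) auto
      finally have Vt: "V t \<le> C * 2 ^ k * V (t + s)" .
      have "ennreal (\<bar>poly Q (cos t)\<bar> powr p * V t) = ennreal (\<bar>poly Q (cos t)\<bar> powr p) * ennreal (V t)"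
        using slow_nonneg[OF V t0] by (simp add: ennreal_mult)
      also have "\<dots> \<le> (ennreal (\<bar>poly Q (cos (t + s))\<bar> powr p) + ennreal E * loc_int p (k + 2) n Q t) * ennreal (V t)"
        by (rule mult_right_mono[OF pt[OF True]]) simp
      also have "\<dots> = ennreal (\<bar>poly Q (cos (t + s))\<bar> powr p) * ennreal (V t) + ennreal E * (loc_int p (k + 2) n Q t * ennreal (V t))"
        by (simp add: distrib_right mult.assoc)
      also have "\<dots> \<le> ennreal (\<bar>poly Q (cos (t + s))\<bar> powr p) * ennreal (C * 2 ^ k * V (t + s)) + ennreal E * (loc_int p (k + 2) n Q t * ennreal (V t))"
        by (intro add_right_mono mult_left_mono ennreal_leI Vt) auto
      also have "ennreal (\<bar>poly Q (cos (t + s))\<bar> powr p) * ennreal (C * 2 ^ k * V (t + s)) = ennreal (C * 2 ^ k) * ennreal (\<bar>poly Q (cos (t + s))\<bar> powr p * V (t + s))"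
        using C slow_nonneg[OF V ts0] by (simp add: mult_ac flip: ennreal_mult)
      finally show ?thesis using True t0 ts by simp
    qed simp
  qed
  also have "\<dots> = ennreal (C * 2 ^ k) * (\<integral>\<^sup>+t. ennreal (\<bar>poly Q (cos (t + s))\<bar> powr p * V (t + s)) * indicator {\<delta> / real n..pi - \<delta> / real n} (t + s) \<partial>lborel)
     + ennreal E * (\<integral>\<^sup>+t. loc_int p (k + 2) n Q t * ennreal (V t) * indicator {0..pi} t \<partial>lborel)"
    by (subst nn_integral_add, measurable, subst nn_integral_cmult, measurable, subst nn_integral_cmult, measurable)
  also have "(\<integral>\<^sup>+t. ennreal (\<bar>poly Q (cos (t + s))\<bar> powr p * V (t + s)) * indicator {\<delta> / real n..pi - \<delta> / real n} (t + s) \<partial>lborel) = wint p Q V (\<delta> / real n) (pi - \<delta> / real n)"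
    unfolding wint_def by (subst nn_integral_real_affine[where c = 1 and t = s]) (auto simp: add.commute)
  also have "ennreal E * (\<integral>\<^sup>+t. loc_int p (k + 2) n Q t * ennreal (V t) * indicator {0..pi} t \<partial>lborel)
      \<le> ennreal E * (ennreal (2 * C / real n) * wint p Q V 0 pi)"
    unfolding wint_def using C by (intro mult_left_mono slow_kernel[OF V _ n]) auto
  also have "\<dots> = ennreal (2 ^ (k + 3) * C * C1 * \<delta> powr p) * wint p Q V 0 pi"
  proof -
    have "E * (2 * C / real n) = 2 ^ (k + 3) * C * C1 * \<delta> powr p" using np by (simp add: E_def power_add)
    then show ?thesis using E0 C by (simp add: mult.assoc[symmetric] flip: ennreal_mult')
  qed
  finally show ?thesis by (simp add: add_left_mono)
qed

text \<open>Near the end points the polynomial is compared with its own translates; the error is a small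
  multiple of the left-hand side and is absorbed.\<close>

lemma wint_interior:
  assumes p: "0 < p" "p \<le> 1" and C: "0 < C"
  obtains \<delta> A where "0 < \<delta>" "\<delta> \<le> 1 / 4" "0 < A"
    "\<And>n Q V. 1 \<le> n \<Longrightarrow> degree Q \<le> n \<Longrightarrow> slow C k n V \<Longrightarrow>
       wint p Q V 0 pi \<le> ennreal A * wint p Q V (\<delta> / real n) (pi - \<delta> / real n)"
proof -
  obtain C1 where C1: "0 < C1" and
   D: "\<And>n Q t. 1 \<le> n \<Longrightarrow> degree Q \<le> n \<Longrightarrow> t \<in> {0..pi} \<Longrightarrow>
      ennreal (\<bar>sin t * poly (pderiv Q) (cos t)\<bar> powr p) \<le> ennreal (C1 * real n powr (1 + p)) * loc_int p (k + 2) n Q t"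
    by (rule poly_pointwise[OF p, where K = "k + 2"]) blast
  \<comment> \<open>With \<open>\<delta> powr p \<le> e\<close> each of the two end zones
    contributes at most a quarter of the full integral beyond an interior term, so half of it can be
    absorbed. The cap \<open>1 / 4\<close> on \<delta> keeps the shifted zones inside
    \<open>[d, pi - d]\<close>.\<close>
  define e where "e = 1 / (4 * (2 ^ (k + 3) * C * C1))"
  have e0: "0 < e" using C C1 by (simp add: e_def)
  define \<delta> where "\<delta> = min (1 / 4) (e powr (1 / p))"
  have \<delta>: "0 < \<delta>" "\<delta> \<le> 1 / 4" using e0 by (auto simp: \<delta>_def)
  have "\<delta> powr p \<le> (e powr (1 / p)) powr p" using \<delta> p by (intro powr_mono2) (auto simp: \<delta>_def)
  then have "\<delta> powr p \<le> e" using e0 p by (simp add: powr_powr)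
  then have "2 ^ (k + 3) * C * C1 * \<delta> powr p \<le> 2 ^ (k + 3) * C * C1 * e" using C C1 by (intro mult_left_mono) auto
  also have "\<dots> = 1 / 4" using C C1 by (simp add: e_def)
  finally have small: "2 ^ (k + 3) * C * C1 * \<delta> powr p \<le> 1 / 4" .
  define A where "A = 2 * (1 + 2 * (C * 2 ^ k))"
  have A0: "0 < A" using C by (simp add: A_def add_pos_pos)
  show ?thesis
  proof (rule that[OF \<delta> A0])
    fix n :: nat and Q :: "real poly" and V
    assume n: "1 \<le> n" and Q: "degree Q \<le> n" and V: "slow C k n V"
    note [measurable] = slow_meas[OF V]
    define d where "d = \<delta> / real n"
    have np: "1 \<le> real n" using n by simp
    have d: "0 < d" "d \<le> 1 / 4"
      using \<delta> np by (auto simp: d_def pos_divide_le_eq intro: order_trans[OF \<delta>(2)])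
    define X Y where "X = wint p Q V 0 pi" and "Y = wint p Q V d (pi - d)"
    have end1: "wint p Q V 0 d \<le> ennreal (C * 2 ^ k) * Y + ennreal (1 / 4) * X"
    proof -
      have "wint p Q V 0 d \<le> ennreal (C * 2 ^ k) * Y + ennreal (2 ^ (k + 3) * C * C1 * \<delta> powr p) * X"
        unfolding X_def Y_def d_def
        by (rule wint_shift_le[OF p V C n _ _ C1 D[OF n Q], where s = d])
           (use \<delta> d pi_gt3 in \<open>auto simp flip: d_def\<close>)
      also have "\<dots> \<le> ennreal (C * 2 ^ k) * Y + ennreal (1 / 4) * X"
        by (intro add_left_mono mult_right_mono ennreal_leI small) auto
      finally show ?thesis .
    qed
    have end2: "wint p Q V (pi - d) pi \<le> ennreal (C * 2 ^ k) * Y + ennreal (1 / 4) * X"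
    proof -
      have "wint p Q V (pi - d) pi \<le> ennreal (C * 2 ^ k) * Y + ennreal (2 ^ (k + 3) * C * C1 * \<delta> powr p) * X"
        unfolding X_def Y_def d_def
        by (rule wint_shift_le[OF p V C n _ _ C1 D[OF n Q], where s = "-d"])
           (use \<delta> d pi_gt3 in \<open>auto simp flip: d_def\<close>)
      also have "\<dots> \<le> ennreal (C * 2 ^ k) * Y + ennreal (1 / 4) * X"
        by (intro add_left_mono mult_right_mono ennreal_leI small) auto
      finally show ?thesis .
    qed
    have "X \<le> wint p Q V 0 d + Y + wint p Q V (pi - d) pi"
      unfolding X_def Y_def wint_def
      by (subst nn_integral_add[symmetric], simp, simp)+
         (auto intro!: nn_integral_mono simp: indicator_def)
    also have "\<dots> \<le> (ennreal (C * 2 ^ k) * Y + ennreal (1 / 4) * X) + Y + (ennreal (C * 2 ^ k) * Y + ennreal (1 / 4) * X)"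
      by (intro add_mono end1 end2) simp
    finally have XY: "X \<le> (ennreal (C * 2 ^ k) * Y + ennreal (1 / 4) * X) + Y + (ennreal (C * 2 ^ k) * Y + ennreal (1 / 4) * X)" .
    have Xf: "X < \<infinity>" unfolding X_def by (rule wint_finite[OF V p(1)])
    have "Y \<le> X" unfolding X_def Y_def using d by (intro wint_mono) auto
    with Xf obtain x y where xy: "X = ennreal x" "Y = ennreal y" "0 \<le> x" "0 \<le> y"
      by (metis ennreal_cases infinity_ennreal_def leD top.not_eq_extremum)
    have "x \<le> (C * 2 ^ k * y + 1 / 4 * x) + y + (C * 2 ^ k * y + 1 / 4 * x)"
      using XY xy C by (simp flip: ennreal_mult' ennreal_plus add: ennreal_le_iff)
    then have "x \<le> A * y" by (simp add: A_def algebra_simps)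
    then have "X \<le> ennreal A * Y" using xy A0 by (simp add: ennreal_le_iff flip: ennreal_mult')
    then show "wint p Q V 0 pi \<le> ennreal A * wint p Q V (\<delta> / real n) (pi - \<delta> / real n)"
      unfolding X_def Y_def d_def .
  qed
qed

section \<open>The function \<open>rho\<close> as a slow factor, and weighted Bernstein
  inequalities\<close>

lemma abs_sin_diff_le: "\<bar>sin t - sin u\<bar> \<le> \<bar>t - u\<bar>" for t u :: real
proof -
  have "\<bar>sin t - sin u\<bar> = 2 * \<bar>sin ((t - u) / 2)\<bar> * \<bar>cos ((t + u) / 2)\<bar>"
    by (simp add: sin_diff_sin abs_mult)
  also have "\<dots> \<le> 2 * \<bar>(t - u) / 2\<bar> * 1"
    by (intro mult_mono mult_left_mono abs_sin_x_le_abs_x abs_cos_le_one) auto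
  finally show ?thesis by simp
qed

lemma rho_cos: "t \<in> {0..pi} \<Longrightarrow> rho n (cos t) = sin t / real n + 1 / (real n)\<^sup>2"
  using sin_ge_zero[of t] by (simp add: rho_def sin_squared_eq[symmetric] power2_eq_square[symmetric])
 
lemma ennreal_mult_assoc: "0 \<le> a \<Longrightarrow> ennreal a * (ennreal b * z) = ennreal (a * b) * z"
  by (simp add: ennreal_mult' mult.assoc)

lemma rho_pos: "1 \<le> n \<Longrightarrow> 0 < rho n x" if "x \<in> {-1..1}"
proof -
  assume n: "1 \<le> n"
  have "x\<^sup>2 \<le> 1" using that by (simp add: abs_square_le_1 abs_le_iff)
  then show ?thesis using n by (auto simp: rho_def intro!: add_nonneg_pos)
qed

lemma rho_measurable [measurable]: "rho n \<in> borel_measurable borel"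
  unfolding rho_def[abs_def] by measurable

text \<open>\<open>sin\<close> is 1-Lipschitz and \<open>rho n \<ge> 1 / n^2\<close>, so
  \<open>rho\<close> changes by at most the factor \<open>1 + n |t - u|\<close>: it is slow with
  exponent 1.\<close>

lemma rho_cos_le:
  assumes t: "t \<in> {0..pi}" and u: "u \<in> {0..pi}" and n: "1 \<le> n"
  shows "rho n (cos t) \<le> (1 + real n * \<bar>t - u\<bar>) * rho n (cos u)"
proof -
  have np: "0 < real n" using n by simp
  have "sin t \<le> sin u + \<bar>t - u\<bar>" using abs_sin_diff_le[of t u] by linarith
  then have "sin t / real n + 1 / (real n)\<^sup>2 \<le> (sin u + \<bar>t - u\<bar>) / real n + 1 / (real n)\<^sup>2"
    using np by (intro add_right_mono divide_right_mono) auto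
  also have "\<dots> = (sin u / real n + 1 / (real n)\<^sup>2) + real n * \<bar>t - u\<bar> * (1 / (real n)\<^sup>2)"
    using np by (simp add: power2_eq_square add_divide_distrib)
  also have "\<dots> \<le> (sin u / real n + 1 / (real n)\<^sup>2) + real n * \<bar>t - u\<bar> * (sin u / real n + 1 / (real n)\<^sup>2)"
    using sin_ge_zero[of u] u np by (intro add_left_mono mult_left_mono) auto
  finally show ?thesis using t u by (simp add: rho_cos algebra_simps)
qed

text \<open>The constant \<open>C\<close> is kept and only the exponent grows by one, so a factor
  \<open>rho powr p\<close> can be attached once per derivative without disturbing
  \<open>C\<close>.\<close>

lemma slow_rho_powr:
  assumes V: "slow C k n V" and n: "1 \<le> n" and q: "0 \<le> q" "q \<le> 1" and C: "0 \<le> C"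
  shows "slow C (Suc k) n (\<lambda>t. rho n (cos t) powr q * V t)"
  unfolding slow_def
proof (intro conjI ballI)
  note [measurable] = slow_meas[OF V]
  show "(\<lambda>t. rho n (cos t) powr q * V t) \<in> borel_measurable borel" by measurable
  fix t assume t: "t \<in> {0..pi}"
  show "0 \<le> rho n (cos t) powr q * V t" using slow_nonneg[OF V t] by simp
  fix u assume u: "u \<in> {0..pi}"
  let ?D = "1 + real n * \<bar>t - u\<bar>"
  have D: "1 \<le> ?D" by simp
  have r: "0 < rho n (cos t)" "0 < rho n (cos u)" using n by (auto intro!: rho_pos)
  have "rho n (cos t) powr q \<le> (?D * rho n (cos u)) powr q"
    using rho_cos_le[OF t u n] q r by (intro powr_mono2) auto
  also have "\<dots> = ?D powr q * rho n (cos u) powr q" by (rule powr_mult)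
  also have "\<dots> \<le> ?D * rho n (cos u) powr q"
    using D q powr_mono[of q 1 ?D] by (intro mult_right_mono) auto
  finally have "rho n (cos t) powr q * V t \<le> (?D * rho n (cos u) powr q) * (C * ?D ^ k * V u)"
    using slowD[OF V t u] slow_nonneg[OF V t] D by (intro mult_mono) auto
  then show "rho n (cos t) powr q * V t \<le> C * ?D ^ Suc k * (rho n (cos u) powr q * V u)"
    by (simp add: mult_ac)
qed

lemma sin_interior:
  assumes t: "t \<in> {d..pi - d}" and d: "0 \<le> d"
  shows "d / 2 \<le> sin t"
proof -
  have *: "d / 2 \<le> sin x" if "d \<le> x" "x \<le> pi / 2" for x
  proof -
    have "d / 2 \<le> x / 2" using that by simp
    also have "\<dots> \<le> 2 * x / pi" using that d pi_less_4 mult_right_mono[of pi 4 x] by (simp add: field_simps)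
    also have "\<dots> \<le> sin x" using that d by (intro sin_ge_linear) auto
    finally show ?thesis .
  qed
  show ?thesis using *[of t] *[of "pi - t"] t by (cases "t \<le> pi / 2") auto
qed

text \<open>At distance \<open>\<delta> / n\<close> from the ends \<open>sin t\<close> is at least
  of order \<open>1 / n\<close>, so \<open>n * rho\<close> is at most a multiple of the Jacobian
  there.\<close>

lemma rho_interior:
  assumes n: "1 \<le> n" and \<delta>: "0 < \<delta>" and t: "t \<in> {\<delta> / real n..pi - \<delta> / real n}"
  shows "real n * rho n (cos t) \<le> (1 + 2 / \<delta>) * sin t"
proof -
  have np: "0 < real n" using n by simp
  have d: "0 < \<delta> / real n" using np \<delta> by simp
  have t0: "t \<in> {0..pi}" using t d by auto
  have "\<delta> / real n / 2 \<le> sin t" using sin_interior[OF t] d by simp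
  then have "1 / real n \<le> 2 / \<delta> * sin t" using \<delta> np by (simp add: field_simps)
  moreover have "real n * rho n (cos t) = sin t + 1 / real n"
    using np by (simp add: rho_cos[OF t0] distrib_left power2_eq_square)
  ultimately show ?thesis by (simp add: algebra_simps)
qed

text \<open>On the interior \<open>rho powr p\<close> is at most a constant times
  \<open>(sin t / n) powr p\<close>, which turns \<open>Q'\<close> into the angular derivative of
  the local bound. The factors \<open>n powr (1 + p)\<close>, \<open>n powr (- p)\<close> and the
  kernel mass \<open>1 / n\<close> cancel. The end zones are recovered from
  \<open>wint_interior\<close>, applied to \<open>Q'\<close> with the weight
  \<open>rho powr p * V\<close>.\<close>

lemma wint_pderiv:
  assumes p: "0 < p" "p \<le> 1" and C: "0 < C"
  obtains B where "0 < B"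
    "\<And>n Q V. 1 \<le> n \<Longrightarrow> degree Q \<le> n \<Longrightarrow> slow C k n V \<Longrightarrow>
       wint p (pderiv Q) (\<lambda>t. rho n (cos t) powr p * V t) 0 pi \<le> ennreal B * wint p Q V 0 pi"
proof -
  obtain C1 where C1: "0 < C1" and
   D: "\<And>n Q t. 1 \<le> n \<Longrightarrow> degree Q \<le> n \<Longrightarrow> t \<in> {0..pi} \<Longrightarrow>
      ennreal (\<bar>sin t * poly (pderiv Q) (cos t)\<bar> powr p) \<le> ennreal (C1 * real n powr (1 + p)) * loc_int p (k + 2) n Q t"
    by (rule poly_pointwise[OF p, where K = "k + 2"]) blast
  obtain \<delta> A where \<delta>: "0 < \<delta>" "\<delta> \<le> 1 / 4" "0 < A" and
    I: "\<And>n Q V. 1 \<le> n \<Longrightarrow> degree Q \<le> n \<Longrightarrow> slow C (Suc k) n V \<Longrightarrow>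
       wint p Q V 0 pi \<le> ennreal A * wint p Q V (\<delta> / real n) (pi - \<delta> / real n)"
    by (rule wint_interior[OF p C, where k = "Suc k"]) blast
  define c where "c = (1 + 2 / \<delta>) powr p"
  have c0: "0 \<le> c" by (simp add: c_def)
  define B where "B = A * (2 * c * C1 * C) + 1"
  have B0: "0 < B" using \<delta> C C1 c0 by (simp add: B_def add_nonneg_pos)
  show ?thesis
  proof (rule that[OF B0])
    fix n :: nat and Q :: "real poly" and V
    assume n: "1 \<le> n" and Q: "degree Q \<le> n" and V: "slow C k n V"
    note [measurable] = slow_meas[OF V]
    have np: "0 < real n" using n by simp
    define d where "d = \<delta> / real n"
    have d: "0 < d" using \<delta> np by (simp add: d_def)
    let ?V = "\<lambda>t. rho n (cos t) powr p * V t"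
    have dQ: "degree (pderiv Q) \<le> n" using degree_pderiv[of Q] Q by simp
    have "wint p (pderiv Q) ?V d (pi - d) \<le> (\<integral>\<^sup>+t. ennreal (c * C1 * real n) * (loc_int p (k + 2) n Q t * ennreal (V t) * indicator {0..pi} t) \<partial>lborel)"
      unfolding wint_def
    proof (rule nn_integral_mono)
      fix t :: real
      show "ennreal (\<bar>poly (pderiv Q) (cos t)\<bar> powr p * ?V t) * indicator {d..pi - d} t
        \<le> ennreal (c * C1 * real n) * (loc_int p (k + 2) n Q t * ennreal (V t) * indicator {0..pi} t)"
      proof (cases "t \<in> {d..pi - d}")
        case True
        have t0: "t \<in> {0..pi}" using True d by auto
        have s0: "0 \<le> sin t" using t0 by (auto intro: sin_ge_zero)
        have r: "0 < rho n (cos t)" using n by (auto intro!: rho_pos)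
        have "rho n (cos t) \<le> (1 + 2 / \<delta>) * sin t / real n"
          using rho_interior[OF n \<delta>(1), of t] True np by (simp add: d_def pos_le_divide_eq mult.commute)
        then have "rho n (cos t) powr p \<le> ((1 + 2 / \<delta>) * sin t / real n) powr p"
          using r p by (intro powr_mono2) auto
        also have "\<dots> = c * (sin t powr p / real n powr p)"
          using \<delta> s0 np by (simp add: c_def powr_mult powr_divide)
        finally have "\<bar>poly (pderiv Q) (cos t)\<bar> powr p * rho n (cos t) powr p \<le> \<bar>poly (pderiv Q) (cos t)\<bar> powr p * (c * (sin t powr p / real n powr p))"
          by (rule mult_left_mono) simp
        also have "\<dots> = c / real n powr p * \<bar>sin t * poly (pderiv Q) (cos t)\<bar> powr p"
          using s0 by (simp add: abs_mult powr_mult)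
        finally have "ennreal (\<bar>poly (pderiv Q) (cos t)\<bar> powr p * rho n (cos t) powr p) \<le> ennreal (c / real n powr p) * ennreal (\<bar>sin t * poly (pderiv Q) (cos t)\<bar> powr p)"
          using c0 by (simp add: ennreal_leI flip: ennreal_mult')
        also have "\<dots> \<le> ennreal (c / real n powr p) * (ennreal (C1 * real n powr (1 + p)) * loc_int p (k + 2) n Q t)"
          by (intro mult_left_mono D n Q t0) auto
        also have "\<dots> = ennreal (c / real n powr p * (C1 * real n powr (1 + p))) * loc_int p (k + 2) n Q t"
          by (rule ennreal_mult_assoc) (use c0 in auto)
        also have "c / real n powr p * (C1 * real n powr (1 + p)) = c * C1 * real n"
          using np by (simp add: powr_add)
        finally have "ennreal (\<bar>poly (pderiv Q) (cos t)\<bar> powr p * rho n (cos t) powr p) * ennreal (V t) \<le> ennreal (c * C1 * real n) * loc_int p (k + 2) n Q t * ennreal (V t)"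
          by (rule mult_right_mono) simp
        then show ?thesis using True t0 slow_nonneg[OF V t0] by (simp add: mult.assoc flip: ennreal_mult')
      qed simp
    qed
    also have "\<dots> = ennreal (c * C1 * real n) * (\<integral>\<^sup>+t\<in>{0..pi}. loc_int p (k + 2) n Q t * ennreal (V t) \<partial>lborel)"
      by (rule nn_integral_cmult) measurable
    also have "\<dots> \<le> ennreal (c * C1 * real n) * (ennreal (2 * C / real n) * wint p Q V 0 pi)"
      unfolding wint_def using C by (intro mult_left_mono slow_kernel[OF V _ n]) auto
    also have "\<dots> = ennreal (2 * c * C1 * C) * wint p Q V 0 pi"
    proof -
      have "c * C1 * real n * (2 * C / real n) = 2 * c * C1 * C" using np by simp
      then show ?thesis using c0 C C1 by (simp add: mult.assoc[symmetric] flip: ennreal_mult')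
    qed
    finally have M: "wint p (pderiv Q) ?V d (pi - d) \<le> ennreal (2 * c * C1 * C) * wint p Q V 0 pi" .
    have "wint p (pderiv Q) ?V 0 pi \<le> ennreal A * wint p (pderiv Q) ?V d (pi - d)"
      unfolding d_def by (rule I[OF n dQ slow_rho_powr[OF V n]]) (use p C in auto)
    also have "\<dots> \<le> ennreal A * (ennreal (2 * c * C1 * C) * wint p Q V 0 pi)"
      by (intro mult_left_mono M) auto
    also have "\<dots> = ennreal (A * (2 * c * C1 * C)) * wint p Q V 0 pi"
      using \<delta> by (simp add: ennreal_mult' mult.assoc)
    also have "\<dots> \<le> ennreal B * wint p Q V 0 pi"
      by (intro mult_right_mono ennreal_leI) (auto simp: B_def)
    finally show "wint p (pderiv Q) ?V 0 pi \<le> ennreal B * wint p Q V 0 pi" .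
  qed
qed

text \<open>Induction on the number of derivatives; slowness of the accumulated weight and the
  degree bound are carried in the statement because the next derivative is taken with them.\<close>

lemma wint_pderivs:
  assumes p: "0 < p" "p \<le> 1" and C: "0 < C"
  shows "\<exists>B>0. \<forall>n Q V. 1 \<le> n \<longrightarrow> degree Q \<le> n \<longrightarrow> slow C k n V \<longrightarrow>
       slow C (k + r) n (\<lambda>t. rho n (cos t) powr (real r * p) * V t) \<and> degree ((pderiv ^^ r) Q) \<le> n \<and>
       wint p ((pderiv ^^ r) Q) (\<lambda>t. rho n (cos t) powr (real r * p) * V t) 0 pi \<le> ennreal B * wint p Q V 0 pi"
proof (induction r)
  case 0
  \<comment> \<open>\<open>powr\<close> returns 0 for base 0, so exponent 0 gives 1 only because
    \<open>rho\<close> is positive.\<close>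
  have "(\<lambda>t. rho n (cos t) powr (real 0 * p) * V t) = V" if "1 \<le> n" for n V
  proof
    fix t show "rho n (cos t) powr (real 0 * p) * V t = V t"
      using rho_pos[of "cos t" n] that by (simp add: less_imp_neq[symmetric])
  qed
  then show ?case by (intro exI[of _ 1]) simp
next
  case (Suc r)
  obtain B where B: "0 < B" "\<And>n Q V. 1 \<le> n \<Longrightarrow> degree Q \<le> n \<Longrightarrow> slow C k n V \<Longrightarrow>
       slow C (k + r) n (\<lambda>t. rho n (cos t) powr (real r * p) * V t) \<and> degree ((pderiv ^^ r) Q) \<le> n \<and>
       wint p ((pderiv ^^ r) Q) (\<lambda>t. rho n (cos t) powr (real r * p) * V t) 0 pi \<le> ennreal B * wint p Q V 0 pi"
    using Suc.IH by blast
  obtain B' where B': "0 < B'"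
    "\<And>n Q V. 1 \<le> n \<Longrightarrow> degree Q \<le> n \<Longrightarrow> slow C (k + r) n V \<Longrightarrow>
       wint p (pderiv Q) (\<lambda>t. rho n (cos t) powr p * V t) 0 pi \<le> ennreal B' * wint p Q V 0 pi"
    by (rule wint_pderiv[OF p C, where k = "k + r"]) blast
  have eq: "(\<lambda>t. rho n (cos t) powr (real (Suc r) * p) * V t) = (\<lambda>t. rho n (cos t) powr p * (rho n (cos t) powr (real r * p) * V t))" for n V
    by (simp add: distrib_right powr_add mult.assoc)
  show ?case
  proof (intro exI[of _ "B' * B"] conjI allI impI)
    show "0 < B' * B" using B B' by simp
    fix n :: nat and Q :: "real poly" and V
    assume n: "1 \<le> n" and Q: "degree Q \<le> n" and V: "slow C k n V"
    note b = B(2)[OF n Q V]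
    show "slow C (k + Suc r) n (\<lambda>t. rho n (cos t) powr (real (Suc r) * p) * V t)"
      unfolding eq using slow_rho_powr[of C "k + r" n _ p] b n p C by simp
    show "degree ((pderiv ^^ Suc r) Q) \<le> n" using b degree_pderiv[of "(pderiv ^^ r) Q"] by auto
    have "wint p ((pderiv ^^ Suc r) Q) (\<lambda>t. rho n (cos t) powr (real (Suc r) * p) * V t) 0 pi
       \<le> ennreal B' * wint p ((pderiv ^^ r) Q) (\<lambda>t. rho n (cos t) powr (real r * p) * V t) 0 pi"
      unfolding eq using B'(2)[OF n] b by simp
    also have "\<dots> \<le> ennreal B' * (ennreal B * wint p Q V 0 pi)"
      using b by (intro mult_left_mono) auto
    finally show "wint p ((pderiv ^^ Suc r) Q) (\<lambda>t. rho n (cos t) powr (real (Suc r) * p) * V t) 0 pi \<le> ennreal (B' * B) * wint p Q V 0 pi"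
      using B B' by (simp add: ennreal_mult' mult.assoc)
  qed
qed

text \<open>A difference with step of order \<open>1 / n\<close> at \<open>t\<close> sees the
  \<open>r\<close>-th derivative at an unknown nearby point; \<open>H t\<close> bounds all these
  values at once and can still be integrated against the weight. Here the Jacobian enters: on the
  left \<open>sin t \<le> n * rho\<close>, on the right the integral is first restricted to the
  interior, where \<open>n * rho\<close> is at most a multiple of \<open>sin t\<close>.\<close>

lemma deriv_local_sup:
  assumes p: "0 < p" "p \<le> 1" and C: "0 < C" and c: "0 \<le> c"
  obtains B where "0 < B"
    "\<And>n Q W. 1 \<le> n \<Longrightarrow> degree Q \<le> n \<Longrightarrow> slow C k n W \<Longrightarrow>
       \<exists>H\<in>borel_measurable borel.
         (\<forall>t\<in>{0..pi}. \<forall>s\<in>{0..pi}. real n * \<bar>s - t\<bar> \<le> c \<longrightarrow> ennreal (\<bar>poly ((pderiv ^^ r) Q) (cos s)\<bar> powr p) \<le> H t) \<and>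
         (\<integral>\<^sup>+t\<in>{0..pi}. H t * ennreal (rho n (cos t) powr (real r * p) * (W t * sin t)) \<partial>lborel)
           \<le> ennreal B * (\<integral>\<^sup>+t\<in>{0..pi}. ennreal (\<bar>poly Q (cos t)\<bar> powr p * (W t * sin t)) \<partial>lborel)"
proof -
  let ?k = "Suc k"
  obtain B1 where B1: "0 < B1" "\<And>n Q V. 1 \<le> n \<Longrightarrow> degree Q \<le> n \<Longrightarrow> slow C ?k n V \<Longrightarrow>
       slow C (?k + r) n (\<lambda>t. rho n (cos t) powr (real r * p) * V t) \<and> degree ((pderiv ^^ r) Q) \<le> n \<and>
       wint p ((pderiv ^^ r) Q) (\<lambda>t. rho n (cos t) powr (real r * p) * V t) 0 pi \<le> ennreal B1 * wint p Q V 0 pi"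
    using wint_pderivs[OF p C, of ?k r] by blast
  obtain \<delta> A where \<delta>: "0 < \<delta>" "0 < A" and
    I: "\<And>n Q V. 1 \<le> n \<Longrightarrow> degree Q \<le> n \<Longrightarrow> slow C ?k n V \<Longrightarrow>
       wint p Q V 0 pi \<le> ennreal A * wint p Q V (\<delta> / real n) (pi - \<delta> / real n)"
    by (rule wint_interior[OF p C, where k = ?k]) blast
  obtain C1 where C1: "0 < C1" and
   D: "\<And>n Q t. 1 \<le> n \<Longrightarrow> degree Q \<le> n \<Longrightarrow> t \<in> {0..pi} \<Longrightarrow>
      ennreal (\<bar>poly Q (cos t)\<bar> powr p) \<le> ennreal (C1 * real n) * loc_int p (?k + r + 2) n Q t"
    by (rule poly_pointwise[OF p, where K = "?k + r + 2"]) blast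
  define e where "e = (1 + c) ^ (?k + r + 2)"
  have e0: "0 < e" using c by (simp add: e_def add_nonneg_pos)
  define B where "B = C1 * e * (2 * C) * B1 * A * (1 + 2 / \<delta>)"
  have B0: "0 < B" using C C1 B1 \<delta> e0 by (simp add: B_def add_pos_pos)
  show ?thesis
  proof (rule that[OF B0])
    fix n :: nat and Q :: "real poly" and W
    assume n: "1 \<le> n" and Q: "degree Q \<le> n" and W: "slow C k n W"
    note [measurable] = slow_meas[OF W]
    have np: "0 < real n" using n by simp
    \<comment> \<open>The slow substitute for \<open>W t * sin t\<close>, up to the factor
      \<open>n\<close>; written with \<open>powr 1\<close> to fit
      \<open>slow_rho_powr\<close>.\<close>
    define V where "V t = rho n (cos t) powr 1 * W t" for t
    have V: "slow C ?k n V" unfolding V_def by (rule slow_rho_powr[OF W n]) (use C in auto)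
    note [measurable] = slow_meas[OF V]
    let ?S = "(pderiv ^^ r) Q"
    note b = B1(2)[OF n Q V]
    define H where "H t = ennreal (C1 * real n) * (ennreal e * loc_int p (?k + r + 2) n ?S t)" for t
    have Hm: "H \<in> borel_measurable borel" unfolding H_def by measurable
    have 1: "ennreal (\<bar>poly ?S (cos s)\<bar> powr p) \<le> H t" if "t \<in> {0..pi}" "s \<in> {0..pi}" "real n * \<bar>s - t\<bar> \<le> c" for t s
    proof -
      have "ennreal (\<bar>poly ?S (cos s)\<bar> powr p) \<le> ennreal (C1 * real n) * loc_int p (?k + r + 2) n ?S s"
        using D[OF n _ that(2)] b by blast
      also have "\<dots> \<le> H t" unfolding H_def e_def by (intro mult_left_mono loc_int_shift that) auto
      finally show ?thesis .
    qed
    let ?R = "\<lambda>t. rho n (cos t) powr (real r * p) * V t"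
    have sl: "slow C (?k + r) n ?R" using b by blast
    note [measurable] = slow_meas[OF sl]
    have sinV: "sin t * W t \<le> real n * V t" if t: "t \<in> {0..pi}" for t
    proof -
      have "sin t \<le> real n * rho n (cos t)" using np by (simp add: rho_cos[OF t] distrib_left)
      moreover have "rho n (cos t) powr 1 = rho n (cos t)" using rho_pos[of "cos t" n] n by (simp add: less_imp_le)
      ultimately show ?thesis using slow_nonneg[OF W t] mult_right_mono[of "sin t" "real n * rho n (cos t)" "W t"]
        by (simp add: V_def mult.assoc)
    qed
    have "(\<integral>\<^sup>+t\<in>{0..pi}. H t * ennreal (rho n (cos t) powr (real r * p) * (W t * sin t)) \<partial>lborel)
      \<le> (\<integral>\<^sup>+t. ennreal (C1 * real n * e * real n) * (loc_int p (?k + r + 2) n ?S t * ennreal (?R t) * indicator {0..pi} t) \<partial>lborel)"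
    proof (rule nn_integral_mono)
      fix t :: real
      show "H t * ennreal (rho n (cos t) powr (real r * p) * (W t * sin t)) * indicator {0..pi} t
        \<le> ennreal (C1 * real n * e * real n) * (loc_int p (?k + r + 2) n ?S t * ennreal (?R t) * indicator {0..pi} t)"
      proof (cases "t \<in> {0..pi}")
        case True
        have "rho n (cos t) powr (real r * p) * (W t * sin t) \<le> rho n (cos t) powr (real r * p) * (real n * V t)"
          using sinV[OF True] by (intro mult_left_mono) (auto simp: mult.commute)
        then have "ennreal (rho n (cos t) powr (real r * p) * (W t * sin t)) \<le> ennreal (real n) * ennreal (?R t)"
          by (simp add: ennreal_leI mult.left_commute flip: ennreal_mult')
        then have "H t * ennreal (rho n (cos t) powr (real r * p) * (W t * sin t)) \<le> H t * (ennreal (real n) * ennreal (?R t))"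
          by (rule mult_left_mono) simp
        also have "\<dots> = ennreal (C1 * real n * e * real n) * (loc_int p (?k + r + 2) n ?S t * ennreal (?R t))"
          using C1 e0 np by (simp add: H_def ennreal_mult mult_ac)
        finally show ?thesis using True by simp
      qed simp
    qed
    also have "\<dots> = ennreal (C1 * real n * e * real n) * (\<integral>\<^sup>+t\<in>{0..pi}. loc_int p (?k + r + 2) n ?S t * ennreal (?R t) \<partial>lborel)"
      by (rule nn_integral_cmult) measurable
    also have "\<dots> \<le> ennreal (C1 * real n * e * real n) * (ennreal (2 * C / real n) * wint p ?S ?R 0 pi)"
      unfolding wint_def using C by (intro mult_left_mono slow_kernel[OF sl _ n]) auto
    also have "\<dots> \<le> ennreal (C1 * real n * e * real n) * (ennreal (2 * C / real n) * (ennreal B1 * (ennreal A * wint p Q V (\<delta> / real n) (pi - \<delta> / real n))))"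
      using b order_trans[OF _ mult_left_mono[OF I[OF n Q V]]] by (intro mult_left_mono) auto
    also have "\<dots> = ennreal (C1 * e * (2 * C) * B1 * A * real n) * wint p Q V (\<delta> / real n) (pi - \<delta> / real n)"
    proof -
      have a: "ennreal x * (ennreal y * (ennreal B1 * (ennreal A * Z))) = ennreal (x * y * B1 * A) * Z" if "0 \<le> x" "0 \<le> y" for x y Z
        using that B1(1) \<delta> by (simp add: ennreal_mult mult.assoc)
      have b: "C1 * real n * e * real n * (2 * C / real n) * B1 * A = C1 * e * (2 * C) * B1 * A * real n"
        using np by simp
      have nn: "0 \<le> C1 * real n * e * real n" "0 \<le> 2 * C / real n" using C1 e0 np C by auto
      show ?thesis by (simp only: a[OF nn] b)
    qed
    also have "ennreal (C1 * e * (2 * C) * B1 * A * real n) * wint p Q V (\<delta> / real n) (pi - \<delta> / real n)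
       \<le> ennreal (C1 * e * (2 * C) * B1 * A) * (ennreal (1 + 2 / \<delta>) * (\<integral>\<^sup>+t\<in>{0..pi}. ennreal (\<bar>poly Q (cos t)\<bar> powr p * (W t * sin t)) \<partial>lborel))"
    proof -
      have "ennreal (real n) * wint p Q V (\<delta> / real n) (pi - \<delta> / real n) = (\<integral>\<^sup>+t. ennreal (real n) * (ennreal (\<bar>poly Q (cos t)\<bar> powr p * V t) * indicator {\<delta> / real n..pi - \<delta> / real n} t) \<partial>lborel)"
        unfolding wint_def by (rule nn_integral_cmult[symmetric]) measurable
      also have "\<dots> \<le> (\<integral>\<^sup>+t. ennreal (1 + 2 / \<delta>) * (ennreal (\<bar>poly Q (cos t)\<bar> powr p * (W t * sin t)) * indicator {0..pi} t) \<partial>lborel)"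
      proof (rule nn_integral_mono)
        fix t :: real
        show "ennreal (real n) * (ennreal (\<bar>poly Q (cos t)\<bar> powr p * V t) * indicator {\<delta> / real n..pi - \<delta> / real n} t)
          \<le> ennreal (1 + 2 / \<delta>) * (ennreal (\<bar>poly Q (cos t)\<bar> powr p * (W t * sin t)) * indicator {0..pi} t)"
        proof (cases "t \<in> {\<delta> / real n..pi - \<delta> / real n}")
          case True
          have "0 < \<delta> / real n" using \<delta> np by simp
          then have t: "t \<in> {0..pi}" using True by auto
          have r1: "0 < rho n (cos t)" using rho_pos[of "cos t" n] n by simp
          have "real n * V t \<le> (1 + 2 / \<delta>) * sin t * W t"
            using mult_right_mono[OF rho_interior[OF n \<delta>(1) True] slow_nonneg[OF W t]] by (simp add: V_def abs_of_pos[OF r1] mult.assoc)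
          then have "\<bar>poly Q (cos t)\<bar> powr p * (real n * V t) \<le> \<bar>poly Q (cos t)\<bar> powr p * ((1 + 2 / \<delta>) * sin t * W t)"
            by (intro mult_left_mono) auto
          then have "real n * (\<bar>poly Q (cos t)\<bar> powr p * V t) \<le> (1 + 2 / \<delta>) * (\<bar>poly Q (cos t)\<bar> powr p * (W t * sin t))"
            by (simp only: mult_ac)
          moreover have "0 \<le> 1 + 2 / \<delta>" using \<delta> by simp
          ultimately have "ennreal (real n) * ennreal (\<bar>poly Q (cos t)\<bar> powr p * V t) \<le> ennreal (1 + 2 / \<delta>) * ennreal (\<bar>poly Q (cos t)\<bar> powr p * (W t * sin t))"
            by (simp only: ennreal_mult'[symmetric] of_nat_0_le_iff ennreal_leI)
          then show ?thesis using True t by simp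
        qed simp
      qed
      also have "\<dots> = ennreal (1 + 2 / \<delta>) * (\<integral>\<^sup>+t\<in>{0..pi}. ennreal (\<bar>poly Q (cos t)\<bar> powr p * (W t * sin t)) \<partial>lborel)"
        by (rule nn_integral_cmult) measurable
      finally have "ennreal (C1 * e * (2 * C) * B1 * A) * (ennreal (real n) * wint p Q V (\<delta> / real n) (pi - \<delta> / real n)) \<le>
        ennreal (C1 * e * (2 * C) * B1 * A) * (ennreal (1 + 2 / \<delta>) * (\<integral>\<^sup>+t\<in>{0..pi}. ennreal (\<bar>poly Q (cos t)\<bar> powr p * (W t * sin t)) \<partial>lborel))"
        by (rule mult_left_mono) simp
      then show ?thesis using C1 e0 np C B1(1) \<delta> by (simp add: ennreal_mult mult.assoc)
    qed
    also have "\<dots> = ennreal B * (\<integral>\<^sup>+t\<in>{0..pi}. ennreal (\<bar>poly Q (cos t)\<bar> powr p * (W t * sin t)) \<partial>lborel)"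
      using C1 e0 np C B1(1) \<delta> unfolding B_def by (simp add: ennreal_mult mult.assoc)
    finally show "\<exists>H\<in>borel_measurable borel.
         (\<forall>t\<in>{0..pi}. \<forall>s\<in>{0..pi}. real n * \<bar>s - t\<bar> \<le> c \<longrightarrow> ennreal (\<bar>poly ?S (cos s)\<bar> powr p) \<le> H t) \<and>
         (\<integral>\<^sup>+t\<in>{0..pi}. H t * ennreal (rho n (cos t) powr (real r * p) * (W t * sin t)) \<partial>lborel)
           \<le> ennreal B * (\<integral>\<^sup>+t\<in>{0..pi}. ennreal (\<bar>poly Q (cos t)\<bar> powr p * (W t * sin t)) \<partial>lborel)"
      using Hm 1 by (intro bexI[of _ H]) auto
  qed
qed

subsection \<open>Averages of doubling weights\<close>

definition mass :: "(real \<Rightarrow> real) \<Rightarrow> real \<Rightarrow> real \<Rightarrow> real" where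
  "mass w a b = (LINT u:{a..b}|lebesgue. w u)"

lemma doubling_integrable:
  assumes "doubling_weight w"
  shows "integrable lebesgue w"
proof -
  have "(\<lambda>x. indicat_real {-1..1} x *\<^sub>R w x) = w"
    using assms by (fastforce simp: doubling_weight_def indicator_def)
  moreover have "set_integrable lebesgue {-1..1} w" using assms by (simp add: doubling_weight_def)
  ultimately show ?thesis by (simp add: set_integrable_def)
qed

lemma doubling_set_integrable:
  assumes "doubling_weight w"
  shows "set_integrable lebesgue {a..b} w"
  unfolding set_integrable_def
  by (rule integrable_mult_indicator[OF _ doubling_integrable[OF assms]]) simp

lemma doubling_nonneg: "doubling_weight w \<Longrightarrow> 0 \<le> w x"
  by (simp add: doubling_weight_def)

lemma mass_nonneg: "doubling_weight w \<Longrightarrow> 0 \<le> mass w a b"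
  unfolding mass_def set_lebesgue_integral_def
  by (intro integral_nonneg_AE AE_I2) (auto simp: doubling_nonneg)

lemma mass_mono:
  assumes w: "doubling_weight w" and sub: "{a..b} \<inter> {-1..1} \<subseteq> {c..d}"
  shows "mass w a b \<le> mass w c d"
  unfolding mass_def set_lebesgue_integral_def
proof (rule integral_mono)
  show "integrable lebesgue (\<lambda>x. indicator {a..b} x *\<^sub>R w x)" "integrable lebesgue (\<lambda>x. indicator {c..d} x *\<^sub>R w x)"
    using doubling_set_integrable[OF w] by (auto simp: set_integrable_def)
  fix x
  show "indicator {a..b} x *\<^sub>R w x \<le> indicator {c..d} x *\<^sub>R w x"
    using sub w doubling_nonneg[OF w, of x] by (cases "x \<in> {-1..1}") (auto simp: doubling_weight_def indicator_def subset_iff)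
qed

lemma doubling_const:
  assumes w: "doubling_weight w"
  obtains L where "1 \<le> L" "\<And>a b. a < b \<Longrightarrow> {a..b} \<subseteq> {-1..1} \<Longrightarrow> mass w (a - (b - a) / 2) (b + (b - a) / 2) \<le> L * mass w a b"
proof -
  obtain L where L: "\<And>c d. 0 < d \<Longrightarrow> {c - d..c + d} \<subseteq> {-1..1} \<Longrightarrow> mass w (c - 2 * d) (c + 2 * d) \<le> L * mass w (c - d) (c + d)"
    using w by (auto simp: doubling_weight_def mass_def)
  show ?thesis
  proof (rule that[of "max 1 L"])
    fix a b :: real assume ab: "a < b" "{a..b} \<subseteq> {-1..1}"
    have e: "(a + b) / 2 - (b - a) / 2 = a" "(a + b) / 2 + (b - a) / 2 = b"
      "(a + b) / 2 - 2 * ((b - a) / 2) = a - (b - a) / 2" "(a + b) / 2 + 2 * ((b - a) / 2) = b + (b - a) / 2"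
      by (simp_all add: field_simps)
    have "mass w (a - (b - a) / 2) (b + (b - a) / 2) \<le> L * mass w a b"
      using L[of "(b - a) / 2" "(a + b) / 2"] ab unfolding e by simp
    also have "\<dots> \<le> max 1 L * mass w a b" by (intro mult_right_mono mass_nonneg[OF w]) auto
    finally show "mass w (a - (b - a) / 2) (b + (b - a) / 2) \<le> max 1 L * mass w a b" .
  qed auto
qed

text \<open>The doubling condition speaks of intervals inside \<open>[-1, 1]\<close>, whereas the
  intervals of \<open>avg_weight\<close> may stick out. The interval is cut to
  \<open>[-1, 1]\<close>, doubled, cut again and doubled again, hence the constant
  \<open>L * L\<close>.\<close>

lemma doubling_centered:
  assumes w: "doubling_weight w"
  obtains L where "1 \<le> L" "\<And>c d. c \<in> {-1..1} \<Longrightarrow> 0 < d \<Longrightarrow> mass w (c - 2 * d) (c + 2 * d) \<le> L * mass w (c - d) (c + d)"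
proof -
  obtain L where L: "1 \<le> L" "\<And>a b. a < b \<Longrightarrow> {a..b} \<subseteq> {-1..1} \<Longrightarrow> mass w (a - (b - a) / 2) (b + (b - a) / 2) \<le> L * mass w a b"
    by (rule doubling_const[OF w]) blast
  show ?thesis
  proof (rule that[of "L * L"])
    show "1 \<le> L * L" using mult_mono[of 1 L 1 L] L(1) by simp
    fix c d :: real assume c: "c \<in> {-1..1}" and d: "0 < d"
    define a b where "a = max (-1) (c - d)" and "b = min 1 (c + d)"
    define a1 b1 where "a1 = max (-1) (a - (b - a) / 2)" and "b1 = min 1 (b + (b - a) / 2)"
    have ab: "a < b" "{a..b} \<subseteq> {-1..1}" using c d by (auto simp: a_def b_def)
    have "a1 \<le> a" "b \<le> b1" using ab by (auto simp: a1_def b1_def)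
    then have "a1 < b1" using ab(1) by linarith
    moreover have "{a1..b1} \<subseteq> {-1..1}" by (auto simp: a1_def b1_def)
    ultimately have ab1: "a1 < b1" "{a1..b1} \<subseteq> {-1..1}" by auto
    \<comment> \<open>The cut interval is everything or has length at least \<open>d\<close>. In the
      second case each of the two doublings moves an end that has not reached the boundary by at
      least \<open>d / 2\<close>, together by the required \<open>d\<close>.\<close>
    have len: "a = -1 \<and> b = 1 \<or> d \<le> b - a" using c d by (auto simp: a_def b_def min_def max_def)
    have len1: "b - a \<le> b1 - a1" using \<open>a1 \<le> a\<close> \<open>b \<le> b1\<close> by simp
    have "mass w (c - 2 * d) (c + 2 * d) \<le> mass w (a1 - (b1 - a1) / 2) (b1 + (b1 - a1) / 2)"
    proof (rule mass_mono[OF w], rule subsetI)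
      fix x assume x: "x \<in> {c - 2 * d..c + 2 * d} \<inter> {-1..1}"
      from len show "x \<in> {a1 - (b1 - a1) / 2..b1 + (b1 - a1) / 2}"
      proof
        assume "a = -1 \<and> b = 1"
        then show ?thesis using x by (simp add: a1_def b1_def)
      next
        assume l: "d \<le> b - a"
        have "a1 = -1 \<or> a1 = a - (b - a) / 2" "a = -1 \<or> a = c - d"
          "b1 = 1 \<or> b1 = b + (b - a) / 2" "b = 1 \<or> b = c + d"
          by (auto simp: a1_def a_def b1_def b_def max_def min_def)
        then have "a1 - d / 2 \<le> x" "x \<le> b1 + d / 2"
          using x l d c by (auto simp: diff_divide_distrib add_divide_distrib)
        then show ?thesis using l len1 by (auto simp: diff_divide_distrib)
      qed
    qed
    also have "\<dots> \<le> L * mass w a1 b1" by (rule L(2)[OF ab1])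
    also have "\<dots> \<le> L * mass w (a - (b - a) / 2) (b + (b - a) / 2)"
      using L(1) by (intro mult_left_mono mass_mono[OF w]) (auto simp: a1_def b1_def)
    also have "\<dots> \<le> L * (L * mass w a b)" using L(1) by (intro mult_left_mono L(2)[OF ab]) auto
    also have "mass w a b \<le> mass w (c - d) (c + d)" by (intro mass_mono[OF w]) (auto simp: a_def b_def)
    finally show "mass w (c - 2 * d) (c + 2 * d) \<le> L * L * mass w (c - d) (c + d)"
      using L(1) by (simp add: mult.assoc)
  qed
qed

text \<open>If \<open>L \<le> 2 ^ s\<close> and \<open>2 ^ k\<close> is the least power of two not
  below \<open>K\<close>, then \<open>L ^ k \<le> (2 ^ k) ^ s \<le> (2 * K) ^ s\<close>. A natural
  exponent \<open>s\<close> keeps the later growth bounds within ordinary powers.\<close>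

lemma doubling_dilate:
  assumes w: "doubling_weight w"
  obtains s :: nat where "\<And>c d K. c \<in> {-1..1} \<Longrightarrow> 0 < d \<Longrightarrow> 1 \<le> K \<Longrightarrow> mass w (c - K * d) (c + K * d) \<le> (2 * K) ^ s * mass w (c - d) (c + d)"
proof -
  obtain L where L: "1 \<le> L" "\<And>c d. c \<in> {-1..1} \<Longrightarrow> 0 < d \<Longrightarrow> mass w (c - 2 * d) (c + 2 * d) \<le> L * mass w (c - d) (c + d)"
    by (rule doubling_centered[OF w]) blast
  obtain s :: nat where s: "L \<le> 2 ^ s"
    using real_arch_pow[of 2 L] by (auto intro: less_imp_le)
  have it: "mass w (c - 2 ^ k * d) (c + 2 ^ k * d) \<le> (2 ^ s) ^ k * mass w (c - d) (c + d)" if c: "c \<in> {-1..1}" and d: "0 < d" for c d k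
  proof (induction k)
    case (Suc k)
    have "mass w (c - 2 ^ Suc k * d) (c + 2 ^ Suc k * d) \<le> L * mass w (c - 2 ^ k * d) (c + 2 ^ k * d)"
      using L(2)[OF c, of "2 ^ k * d"] d by (simp add: mult.assoc)
    also have "\<dots> \<le> 2 ^ s * ((2 ^ s) ^ k * mass w (c - d) (c + d))"
      using s Suc L(1) by (intro mult_mono mass_nonneg[OF w]) auto
    finally show ?case by simp
  qed simp
  show ?thesis
  proof (rule that[of s])
    fix c d K :: real assume c: "c \<in> {-1..1}" and d: "0 < d" and K: "1 \<le> K"
    define k where "k = (LEAST k. K \<le> 2 ^ k)"
    have ex: "\<exists>k. K \<le> 2 ^ k" using real_arch_pow[of 2 K] by (auto intro: less_imp_le)
    have k1: "K \<le> 2 ^ k" unfolding k_def by (rule LeastI_ex[OF ex])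
    have k2: "2 ^ k \<le> 2 * K"
    proof (cases k)
      case 0 then show ?thesis using K by simp
    next
      case (Suc j)
      then have "\<not> K \<le> 2 ^ j" using not_less_Least[of j "\<lambda>k. K \<le> 2 ^ k"] by (simp add: k_def)
      then show ?thesis using Suc by simp
    qed
    have "K * d \<le> 2 ^ k * d" using k1 d by (intro mult_right_mono) auto
    then have "mass w (c - K * d) (c + K * d) \<le> mass w (c - 2 ^ k * d) (c + 2 ^ k * d)"
      by (intro mass_mono[OF w]) auto
    also have "\<dots> \<le> (2 ^ s) ^ k * mass w (c - d) (c + d)" by (rule it[OF c d])
    also have "(2 ^ s) ^ k = ((2::real) ^ k) ^ s" by (simp add: mult.commute flip: power_mult)
    also have "\<dots> * mass w (c - d) (c + d) \<le> (2 * K) ^ s * mass w (c - d) (c + d)"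
      using k2 by (intro mult_right_mono power_mono mass_nonneg[OF w]) auto
    finally show "mass w (c - K * d) (c + K * d) \<le> (2 * K) ^ s * mass w (c - d) (c + d)" .
  qed
qed

lemma cos_diff_le:
  assumes t: "t \<in> {0..pi}" and u: "u \<in> {0..pi}"
  shows "\<bar>cos t - cos u\<bar> \<le> \<bar>t - u\<bar> * (sin u + \<bar>t - u\<bar>)"
proof -
  have "\<bar>cos t - cos u\<bar> = 2 * \<bar>sin ((t + u) / 2)\<bar> * \<bar>sin ((u - t) / 2)\<bar>"
    by (simp add: cos_diff_cos abs_mult)
  also have "\<dots> \<le> 2 * (sin u + \<bar>t - u\<bar>) * (\<bar>t - u\<bar> / 2)"
  proof (intro mult_mono mult_left_mono)
    have "\<bar>sin ((t + u) / 2) - sin u\<bar> \<le> \<bar>(t + u) / 2 - u\<bar>" by (rule abs_sin_diff_le)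
    also have "(t + u) / 2 - u = (t - u) / 2" by (simp add: field_simps)
    also have "\<bar>(t - u) / 2\<bar> \<le> \<bar>t - u\<bar>" by simp
    finally show "\<bar>sin ((t + u) / 2)\<bar> \<le> sin u + \<bar>t - u\<bar>" using sin_ge_zero[of u] u by auto
    show "\<bar>sin ((u - t) / 2)\<bar> \<le> \<bar>t - u\<bar> / 2" using abs_sin_x_le_abs_x[of "(u-t)/2"] by (simp add: abs_minus_commute)
  qed (use sin_ge_zero[of u] u in auto)
  also have "\<dots> = \<bar>t - u\<bar> * (sin u + \<bar>t - u\<bar>)"
    using mult.commute[of "sin u + \<bar>t - u\<bar>" "\<bar>t - u\<bar>"] by simp
  finally show ?thesis .
qed

text \<open>Says that the interval of radius \<open>rho n (cos t)\<close> around
  \<open>cos t\<close> lies in the one around \<open>cos u\<close> with radius enlarged by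
  \<open>(1 + n |t - u|)^2\<close>. The second power is due to the quadratic behaviour of
  \<open>cos\<close> at the ends.\<close>

lemma cos_diff_rho_le:
  assumes t: "t \<in> {0..pi}" and u: "u \<in> {0..pi}" and n: "1 \<le> n"
  shows "\<bar>cos t - cos u\<bar> + rho n (cos t) \<le> (1 + real n * \<bar>t - u\<bar>)\<^sup>2 * rho n (cos u)"
proof -
  have np: "0 < real n" using n by simp
  define D where "D = real n * \<bar>t - u\<bar>"
  have D0: "0 \<le> D" by (simp add: D_def)
  have tu: "\<bar>t - u\<bar> = D / real n" using np by (simp add: D_def)
  have su: "0 \<le> sin u" using u by (auto intro: sin_ge_zero)
  have r: "rho n (cos u) = sin u / real n + 1 / (real n)\<^sup>2" by (rule rho_cos[OF u])
  have "\<bar>cos t - cos u\<bar> \<le> D / real n * (sin u + D / real n)" using cos_diff_le[OF t u] by (simp add: tu)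
  also have "\<dots> = D * (sin u / real n) + D * D * (1 / (real n)\<^sup>2)" by (simp add: algebra_simps power2_eq_square)
  also have "\<dots> \<le> (D + D * D) * rho n (cos u)"
  proof -
    have "D * (sin u / real n) + D * D * (1 / (real n)\<^sup>2) \<le> (D + D * D) * (sin u / real n) + (D + D * D) * (1 / (real n)\<^sup>2)"
      using D0 su np by (intro add_mono mult_right_mono) auto
    then show ?thesis by (simp add: r algebra_simps)
  qed
  finally have "\<bar>cos t - cos u\<bar> \<le> (D + D * D) * rho n (cos u)" .
  moreover have "rho n (cos t) \<le> (1 + D) * rho n (cos u)" using rho_cos_le[OF t u n] by (simp add: D_def)
  ultimately have "\<bar>cos t - cos u\<bar> + rho n (cos t) \<le> (D + D * D) * rho n (cos u) + (1 + D) * rho n (cos u)" by linarith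
  also have "\<dots> = (1 + D)\<^sup>2 * rho n (cos u)" by (simp add: power2_eq_square algebra_simps)
  finally show ?thesis by (simp add: D_def)
qed

lemma avg_weight_mass: "avg_weight w n x = mass w (x - rho n x) (x + rho n x) / rho n x"
  by (simp add: avg_weight_def mass_def)

lemma avg_weight_nonneg: "doubling_weight w \<Longrightarrow> 0 \<le> avg_weight w n x" if "x \<in> {-1..1}"
  using that abs_square_le_1[of x] by (auto simp: avg_weight_mass mass_nonneg rho_def abs_le_iff intro!: divide_nonneg_nonneg add_nonneg_nonneg)

text \<open>\<open>w\<close> is merely Lebesgue measurable. An almost everywhere equal Borel
  function gives the same averages, and for it the integral depends on \<open>x\<close> in a Borel
  measurable way.\<close>

lemma avg_weight_measurable:
  assumes w: "doubling_weight w"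
  shows "avg_weight w n \<in> borel_measurable borel"
proof -
  have "w \<in> borel_measurable (completion lborel)" using doubling_integrable[OF w] by simp
  from completion_ex_borel_measurable_real[OF this]
  obtain v where v [measurable]: "v \<in> borel_measurable lborel" and ae: "AE x in lborel. w x = v x" by blast
  have eq: "(LINT u:{a..b}|lebesgue. w u) = (LINT u|lborel. (if a \<le> u \<and> u \<le> b then v u else 0))" for a b
  proof -
    have "(LINT u:{a..b}|lebesgue. w u) = (LINT u|lebesgue. (if a \<le> u \<and> u \<le> b then v u else 0))"
      unfolding set_lebesgue_integral_def
    proof (rule integral_cong_AE)
      show "(\<lambda>x. indicator {a..b} x *\<^sub>R w x) \<in> borel_measurable lebesgue"
        using doubling_set_integrable[OF w, of a b] by (simp add: set_integrable_def borel_measurable_integrable)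
      have "(\<lambda>u. if a \<le> u \<and> u \<le> b then v u else 0) \<in> borel_measurable lborel" by measurable
      then show "(\<lambda>u. if a \<le> u \<and> u \<le> b then v u else 0) \<in> borel_measurable lebesgue" by (rule measurable_completion)
      show "AE x in lebesgue. indicator {a..b} x *\<^sub>R w x = (if a \<le> x \<and> x \<le> b then v x else 0)"
        using AE_completion[OF ae] by eventually_elim (auto simp: indicator_def)
    qed
    also have "\<dots> = (LINT u|lborel. (if a \<le> u \<and> u \<le> b then v u else 0))"
      by (rule integral_completion) measurable
    finally show ?thesis .
  qed
  show ?thesis unfolding avg_weight_def[abs_def] eq by measurable
qed

text \<open>The enlarged interval has radius \<open>D^2 * rho\<close>, so doubling costs
  \<open>D ^ (2 * s)\<close>; dividing by \<open>rho\<close> at the two points costs one more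
  \<open>D\<close>. Hence the exponent \<open>2 * s + 1\<close>, the same for all
  \<open>n\<close>.\<close>

lemma slow_avg_weight:
  assumes w: "doubling_weight w"
  obtains C k where "0 < C" "\<And>n. 1 \<le> n \<Longrightarrow> slow C k n (\<lambda>t. avg_weight w n (cos t))"
proof -
  obtain s :: nat where s: "\<And>c d K. c \<in> {-1..1} \<Longrightarrow> 0 < d \<Longrightarrow> 1 \<le> K \<Longrightarrow> mass w (c - K * d) (c + K * d) \<le> (2 * K) ^ s * mass w (c - d) (c + d)"
    by (rule doubling_dilate[OF w]) blast
  show ?thesis
  proof (rule that[of "2 ^ s" "2 * s + 1"])
    fix n :: nat assume n: "1 \<le> n"
    note [measurable] = avg_weight_measurable[OF w]
    show "slow (2 ^ s) (2 * s + 1) n (\<lambda>t. avg_weight w n (cos t))"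
      unfolding slow_def
    proof (intro conjI ballI)
      show "(\<lambda>t. avg_weight w n (cos t)) \<in> borel_measurable borel" by measurable
      show "0 \<le> avg_weight w n (cos t)" for t by (rule avg_weight_nonneg[OF _ w]) simp
      fix t u assume t: "t \<in> {0..pi}" and u: "u \<in> {0..pi}"
      define D where "D = 1 + real n * \<bar>t - u\<bar>"
      have D1: "1 \<le> D" by (simp add: D_def)
      let ?x = "cos t" and ?y = "cos u"
      have r: "0 < rho n ?x" "0 < rho n ?y" using n by (auto intro!: rho_pos)
      have D2: "1 \<le> D\<^sup>2" using D1 by (rule one_le_power)
      have "mass w (?x - rho n ?x) (?x + rho n ?x) \<le> mass w (?y - D\<^sup>2 * rho n ?y) (?y + D\<^sup>2 * rho n ?y)"
        using cos_diff_rho_le[OF t u n] by (intro mass_mono[OF w]) (auto simp: D_def)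
      also have "\<dots> \<le> (2 * D\<^sup>2) ^ s * mass w (?y - rho n ?y) (?y + rho n ?y)"
        by (rule s) (use r D2 in auto)
      finally have m: "mass w (?x - rho n ?x) (?x + rho n ?x) \<le> (2 * D\<^sup>2) ^ s * mass w (?y - rho n ?y) (?y + rho n ?y)" .
      have "rho n ?y \<le> D * rho n ?x" using rho_cos_le[OF u t n] by (simp add: D_def abs_minus_commute)
      then have "1 / rho n ?x \<le> D / rho n ?y" using r by (simp add: field_simps)
      then have "mass w (?x - rho n ?x) (?x + rho n ?x) * (1 / rho n ?x) \<le> ((2 * D\<^sup>2) ^ s * mass w (?y - rho n ?y) (?y + rho n ?y)) * (D / rho n ?y)"
        using m r D1 by (intro mult_mono mult_nonneg_nonneg mass_nonneg[OF w]) auto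
      also have "(2 * D\<^sup>2) ^ s = 2 ^ s * D ^ (2 * s)" by (simp add: power_mult_distrib power_mult)
      finally show "avg_weight w n ?x \<le> 2 ^ s * (1 + real n * \<bar>t - u\<bar>) ^ (2 * s + 1) * avg_weight w n ?y"
        by (simp add: avg_weight_mass D_def mult_ac)
    qed
  qed simp
qed

text \<open>The interval for \<open>n\<close> lies in the one for \<open>m\<close>, and
  \<open>rho m \<le> K^2 * rho n\<close>; the square comes from the term \<open>1 / n^2\<close> of
  \<open>rho\<close>.\<close>

lemma avg_weight_le_coarser:
  assumes w: "doubling_weight w" and x: "x \<in> {-1..1}" and m: "1 \<le> m" "m \<le> n" and K: "real n \<le> K * real m"
  shows "avg_weight w n x \<le> K\<^sup>2 * avg_weight w m x"
proof -
  have mp: "0 < real m" "0 < real n" using m by auto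
  have K1: "1 \<le> K" using K m mp mult_right_mono[of K 1 "real m"] by (smt (verit) of_nat_le_iff mult_cancel_right1)
  have s0: "0 \<le> sqrt (1 - x\<^sup>2)" using x abs_square_le_1[of x] by (auto simp: abs_le_iff)
  have r: "0 < rho n x" "0 < rho m x" using x m by (auto intro!: rho_pos)
  have le: "rho n x \<le> rho m x"
    unfolding rho_def using m mp s0 by (intro add_mono divide_left_mono power_mono) auto
  have "1 / real m \<le> K / real n" using K mp by (simp add: field_simps)
  then have a: "inverse (real m) \<le> K * inverse (real n)" by (simp add: field_simps)
  have "rho m x \<le> K\<^sup>2 * rho n x"
  proof -
    have "sqrt (1 - x\<^sup>2) * inverse (real m) \<le> sqrt (1 - x\<^sup>2) * (K\<^sup>2 * inverse (real n))"
      using a K1 mp self_le_power[of K 2] by (intro mult_left_mono s0 order_trans[OF a]) (auto intro!: mult_right_mono)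
    moreover have "(inverse (real m))\<^sup>2 \<le> (K * inverse (real n))\<^sup>2" using a mp by (intro power_mono) auto
    ultimately show ?thesis by (simp add: rho_def divide_inverse power_mult_distrib power_inverse algebra_simps)
  qed
  then have b: "1 / rho n x \<le> K\<^sup>2 / rho m x" using r by (simp add: field_simps)
  have "mass w (x - rho n x) (x + rho n x) * (1 / rho n x) \<le> mass w (x - rho m x) (x + rho m x) * (K\<^sup>2 / rho m x)"
    using le b r by (intro mult_mono mass_mono[OF w] mass_nonneg[OF w]) auto
  then show ?thesis by (simp add: avg_weight_mass mult.commute)
qed

subsection \<open>The weighted quasi-norm and finite differences\<close>

text \<open>The \<open>p\<close>-th power of the weighted quasi-norm: without the root it is
  subadditive for \<open>p \<le> 1\<close>. It is taken over \<open>lborel\<close>, where Fubini and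
  substitution apply; \<open>Lp_norm_le_iff\<close> returns to \<open>Lp_norm\<close>.\<close>

definition wnorm :: "real \<Rightarrow> (real \<Rightarrow> real) \<Rightarrow> (real \<Rightarrow> real) \<Rightarrow> ennreal" where
  "wnorm p v g = (\<integral>\<^sup>+x\<in>{-1..1}. ennreal (\<bar>g x\<bar> powr p * v x) \<partial>lborel)"

text \<open>The substitution is made with the increasing map \<open>- cos\<close>, after a
  reflection of the interval.\<close>

lemma nn_integral_cos_subst:
  fixes g :: "real \<Rightarrow> ennreal"
  assumes [measurable]: "g \<in> borel_measurable borel"
  shows "(\<integral>\<^sup>+x\<in>{-1..1}. g x \<partial>lborel) = (\<integral>\<^sup>+t\<in>{0..pi}. g (cos t) * ennreal (sin t) \<partial>lborel)"
proof -
  have "(\<integral>\<^sup>+x\<in>{-1..1}. g x \<partial>lborel) = (\<integral>\<^sup>+x. g (- x) * indicator {- cos 0..- cos pi} x \<partial>lborel)"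
    by (subst nn_integral_real_affine[where c = "-1" and t = 0]) (auto intro!: nn_integral_cong simp: indicator_def)
  also have "\<dots> = (\<integral>\<^sup>+t. g (- (- cos t)) * ennreal (sin t) * indicator {0..pi} t \<partial>lborel)"
    by (rule nn_integral_substitution_aux[where g = "\<lambda>t. - cos t"])
       (auto intro!: derivative_eq_intros continuous_intros sin_ge_zero)
  finally show ?thesis by simp
qed

text \<open>With the mean \<open>m\<close> and half the distance \<open>v\<close> of the angles,
  \<open>|cos t - cos s| = 2 sin m sin v\<close> and \<open>sin t \<le> 2 sin m\<close>; hence
  \<open>sin v \<le> q\<close>, and Jordan's inequality finishes. A shift of \<open>x\<close> by
  \<open>q * phi x\<close> is thus a shift of order \<open>q\<close> in the angle, where the weights
  are slow.\<close>

lemma cos_close_imp_close: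
  assumes t: "t \<in> {0..pi}" and s: "s \<in> {0..pi}" and q: "0 \<le> q" and d: "\<bar>cos t - cos s\<bar> \<le> q * sin t"
  shows "\<bar>t - s\<bar> \<le> pi * q"
proof -
  define m where "m = (t + s) / 2"
  define v where "v = \<bar>t - s\<bar> / 2"
  have m: "v \<le> m" "m \<le> pi - v" and v: "0 \<le> v" "v \<le> pi / 2" using t s by (auto simp: m_def v_def abs_if field_simps)
  have sm: "0 \<le> sin m" using m v by (intro sin_ge_zero) auto
  have sv: "0 \<le> sin v" using v pi_gt_zero by (intro sin_ge_zero) auto
  \<comment> \<open>\<open>m\<close> lies in \<open>[v, pi - v]\<close>, so its sine is at least
    that of \<open>v\<close>.\<close>
  have vm: "sin v \<le> sin m"
  proof (cases "m \<le> pi / 2")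
    case True
    then show ?thesis using m v by (intro sin_monotone_2pi_le) auto
  next
    case False
    have "sin v \<le> sin (pi - m)" using False m v by (intro sin_monotone_2pi_le) auto
    then show ?thesis by simp
  qed
  have e: "\<bar>cos t - cos s\<bar> = 2 * sin m * sin v"
  proof -
    have "\<bar>sin ((s - t) / 2)\<bar> = sin v"
    proof (cases "s \<le> t")
      case True
      then have "(s - t) / 2 = - v" by (simp add: v_def abs_if field_simps)
      then show ?thesis using sv by simp
    next
      case False
      then have "(s - t) / 2 = v" by (simp add: v_def abs_if)
      then show ?thesis using sv by simp
    qed
    then show ?thesis using sm by (simp add: cos_diff_cos abs_mult m_def[symmetric])
  qed
  have st: "sin t \<le> 2 * sin m"
  proof -
    have "t = m + v \<or> t = m - v" by (auto simp: m_def v_def abs_if field_simps)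
    then have "sin t = sin m * cos v + cos m * sin v \<or> sin t = sin m * cos v - cos m * sin v"
      by (auto simp: sin_add sin_diff)
    moreover have "sin m * cos v \<le> sin m * 1" using sm by (intro mult_left_mono) auto
    moreover have "cos m * sin v \<le> 1 * sin v" "- 1 * sin v \<le> cos m * sin v" using sv by (intro mult_right_mono; simp)+
    ultimately show ?thesis using vm by auto
  qed
  show ?thesis
  proof (cases "sin m = 0")
    case True
    then have "sin v = 0" using vm sv by simp
    then have "v = 0" using v sin_gt_zero[of v] pi_gt_zero by (cases "v = 0") auto
    then show ?thesis using q by (simp add: v_def)
  next
    case False
    have "q * sin t \<le> q * (2 * sin m)" using st q by (intro mult_left_mono) auto
    then have "2 * sin m * sin v \<le> 2 * sin m * q" using d e by (simp add: mult.left_commute mult.commute)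
    then have "sin v \<le> q" using False sm by simp
    moreover have "2 * v / pi \<le> sin v" by (rule sin_ge_linear[OF v])
    ultimately have "2 * v / pi \<le> q" by linarith
    then show ?thesis by (simp add: v_def field_simps)
  qed
qed

section \<open>Shifts proportional to \<open>phi\<close>\<close>

lemma phi_measurable [measurable]: "phi \<in> borel_measurable borel"
  unfolding phi_def[abs_def] by measurable

lemma phi_nonneg: "x \<in> {-1..1} \<Longrightarrow> 0 \<le> phi x"
  using abs_square_le_1[of x] by (auto simp: phi_def abs_le_iff)

lemma phi_squared: "x \<in> {-1..1} \<Longrightarrow> (phi x)\<^sup>2 = (1 - \<bar>x\<bar>) * (1 + \<bar>x\<bar>)"
  using abs_square_le_1[of x] by (simp add: phi_def abs_le_iff algebra_simps flip: power2_eq_square)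

lemma phi_cos: "t \<in> {0..pi} \<Longrightarrow> phi (cos t) = sin t"
  using sin_ge_zero[of t] by (simp add: phi_def sin_squared_eq[symmetric])

text \<open>Squaring, and cancelling \<open>1 - |x|\<close> from
  \<open>phi^2 = (1 - |x|) (1 + |x|)\<close>, makes the condition linear in \<open>|x|\<close>, so
  the set on which a difference is defined is an interval up to the end points.\<close>

lemma phi_region:
  assumes x: "\<bar>x\<bar> < 1" and q: "0 \<le> q"
  shows "q * phi x \<le> 1 - \<bar>x\<bar> \<longleftrightarrow> q\<^sup>2 * (1 + \<bar>x\<bar>) \<le> 1 - \<bar>x\<bar>"
proof -
  have x1: "x \<in> {-1..1}" using x by auto
  have "q * phi x \<le> 1 - \<bar>x\<bar> \<longleftrightarrow> (q * phi x)\<^sup>2 \<le> (1 - \<bar>x\<bar>)\<^sup>2"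
    using x q phi_nonneg[OF x1] by (simp add: power_mono_iff)
  also have "\<dots> \<longleftrightarrow> (1 - \<bar>x\<bar>) * (q\<^sup>2 * (1 + \<bar>x\<bar>)) \<le> (1 - \<bar>x\<bar>) * (1 - \<bar>x\<bar>)"
    by (simp only: power_mult_distrib phi_squared[OF x1] power2_eq_square[of "1 - \<bar>x\<bar>"] mult_ac)
  also have "\<dots> \<longleftrightarrow> q\<^sup>2 * (1 + \<bar>x\<bar>) \<le> 1 - \<bar>x\<bar>" using x by simp
  finally show ?thesis .
qed

text \<open>On the set where the difference is defined, \<open>x \<mapsto> x + c * phi x\<close> has derivative at least \<open>1/2\<close>.\<close>

lemma nn_integral_phi_shift:
  fixes g :: "real \<Rightarrow> ennreal"
  assumes [measurable]: "g \<in> borel_measurable borel" and q: "0 < q" and c: "\<bar>c\<bar> \<le> q"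
  shows "(\<integral>\<^sup>+x\<in>{-1..1}. (if q * phi x \<le> 1 - \<bar>x\<bar> then g (x + c * phi x) else 0) \<partial>lborel) \<le> 2 * (\<integral>\<^sup>+x\<in>{-1..1}. g x \<partial>lborel)"
proof -
  \<comment> \<open>At \<open>-1\<close> and \<open>1\<close> the function \<open>phi\<close>
    vanishes and the condition holds trivially; 0 is the only other point that survives when
    \<open>q = 1\<close>.\<close>
  have ae: "AE x::real in lborel. x \<noteq> -1 \<and> x \<noteq> 0 \<and> x \<noteq> 1"
  proof -
    have "{-1, 0, 1::real} \<in> null_sets lborel" by (simp add: finite_imp_null_set_lborel)
    from AE_not_in[OF this] show ?thesis by eventually_elim auto
  qed
  show ?thesis
  proof (cases "q < 1")
    case False
    have "AE x in lborel. (if q * phi x \<le> 1 - \<bar>x\<bar> then g (x + c * phi x) else 0) * indicator {-1..1} x = 0"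
      using ae
    proof eventually_elim
      case (elim x)
      have "\<not> q * phi x \<le> 1 - \<bar>x\<bar>" if "\<bar>x\<bar> < 1"
      proof -
        have "1 * (1 + \<bar>x\<bar>) \<le> q\<^sup>2 * (1 + \<bar>x\<bar>)" using False one_le_power[of q 2] by (intro mult_right_mono) auto
        then show ?thesis unfolding phi_region[OF that less_imp_le[OF q]] using elim by auto
      qed
      then show ?case using elim by (cases "\<bar>x\<bar> < 1") (auto simp: indicator_def abs_if split: if_splits)
    qed
    then have "(\<integral>\<^sup>+x\<in>{-1..1}. (if q * phi x \<le> 1 - \<bar>x\<bar> then g (x + c * phi x) else 0) \<partial>lborel) = (\<integral>\<^sup>+x. 0 \<partial>(lborel::real measure))"
      by (intro nn_integral_cong_AE)
    then show ?thesis by simp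
  next
    case True
    \<comment> \<open>The condition \<open>q^2 (1 + |x|) \<le> 1 - |x|\<close>, solved for
      \<open>|x|\<close>.\<close>
    define y where "y = (1 - q\<^sup>2) / (1 + q\<^sup>2)"
    have q2: "0 < q\<^sup>2" "q\<^sup>2 < 1" using q True by (auto simp: power_less_one_iff)
    have qp: "0 < 1 + q\<^sup>2" using q2 by linarith
    then have y: "0 < y" "y < 1" using q2 by (simp_all only: y_def zero_less_divide_iff pos_divide_less_eq) auto
    have reg: "q * phi x \<le> 1 - \<bar>x\<bar> \<longleftrightarrow> \<bar>x\<bar> \<le> y" if "\<bar>x\<bar> < 1" for x
    proof -
      have "\<bar>x\<bar> \<le> y \<longleftrightarrow> \<bar>x\<bar> * (1 + q\<^sup>2) \<le> 1 - q\<^sup>2" unfolding y_def by (rule pos_le_divide_eq[OF qp])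
      then show ?thesis unfolding phi_region[OF that less_imp_le[OF q]] by (simp add: algebra_simps)
    qed
    define T where "T x = x + c * phi x" for x
    define T' where "T' x = 1 - c * x / phi x" for x
    have ph: "0 < phi x" if "x \<in> {-y..y}" for x
    proof -
      have "x\<^sup>2 < 1" using that y by (auto simp: abs_square_less_1 abs_less_iff)
      then show ?thesis by (simp add: phi_def)
    qed
    have der: "(T has_real_derivative T' x) (at x)" if x: "x \<in> {-y..y}" for x
    proof -
      have "0 < 1 - x\<^sup>2" using ph[OF x] by (simp add: phi_def)
      then show ?thesis unfolding T_def T'_def phi_def
        by (auto intro!: derivative_eq_intros simp: field_simps)
    qed
    \<comment> \<open>The condition gives \<open>|c| phi (1 + |x|) \<le> phi^2\<close>, so
      \<open>|c| (1 + |x|) \<le> phi\<close>, and \<open>2 |x| \<le> 1 + |x|\<close> yields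
      \<open>|c x| / phi \<le> 1 / 2\<close>.\<close>
    have T'12: "1 / 2 \<le> T' x" if x: "x \<in> {-y..y}" for x
    proof -
      have xa: "\<bar>x\<bar> < 1" using x y by (auto simp: abs_less_iff)
      then have x1: "x \<in> {-1..1}" by auto
      have "q * phi x \<le> 1 - \<bar>x\<bar>" using reg[OF xa] x by auto
      then have "\<bar>c\<bar> * phi x \<le> 1 - \<bar>x\<bar>" using mult_right_mono[OF c less_imp_le[OF ph[OF x]]] by linarith
      then have "\<bar>c\<bar> * phi x * (1 + \<bar>x\<bar>) \<le> (1 - \<bar>x\<bar>) * (1 + \<bar>x\<bar>)"
        by (intro mult_right_mono) auto
      also have "\<dots> = phi x * phi x" using phi_squared[OF x1] by (simp add: power2_eq_square)
      finally have "phi x * (\<bar>c\<bar> * (1 + \<bar>x\<bar>)) \<le> phi x * phi x" by (simp add: mult_ac)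
      then have c1: "\<bar>c\<bar> * (1 + \<bar>x\<bar>) \<le> phi x" using ph[OF x] by simp
      have "\<bar>c\<bar> * (2 * \<bar>x\<bar>) \<le> \<bar>c\<bar> * (1 + \<bar>x\<bar>)" using xa by (intro mult_left_mono) auto
      then have "2 * \<bar>c * x\<bar> \<le> phi x" using c1 by (simp add: abs_mult)
      then have "\<bar>c * x / phi x\<bar> \<le> 1 / 2" using ph[OF x] by (simp add: pos_divide_le_eq)
      then show ?thesis unfolding T'_def by linarith
    qed
    have cont: "continuous_on {-y..y} T'"
      unfolding T'_def phi_def using ph by (intro continuous_intros) (auto simp: phi_def less_imp_neq[symmetric])
    have Tb: "\<bar>T x\<bar> \<le> 1" if x: "x \<in> {-y..y}" for x
    proof -
      have xa: "\<bar>x\<bar> < 1" using x y by (auto simp: abs_less_iff)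
      have "q * phi x \<le> 1 - \<bar>x\<bar>" using reg[OF xa] x by auto
      moreover have "\<bar>c * phi x\<bar> \<le> q * phi x" using c ph[OF x] by (simp add: abs_mult mult_right_mono)
      ultimately show ?thesis unfolding T_def by linarith
    qed
    have "(\<integral>\<^sup>+x\<in>{-1..1}. (if q * phi x \<le> 1 - \<bar>x\<bar> then g (x + c * phi x) else 0) \<partial>lborel)
       \<le> (\<integral>\<^sup>+x. 2 * (g (T x) * ennreal (T' x) * indicator {-y..y} x) \<partial>lborel)"
    proof (rule nn_integral_mono_AE, use ae in eventually_elim)
      case (elim x)
      show ?case
      proof (cases "\<bar>x\<bar> < 1 \<and> \<bar>x\<bar> \<le> y")
        case True
        then have x: "x \<in> {-y..y}" by auto
        have "ennreal 1 \<le> ennreal (2 * T' x)" using T'12[OF x] by (intro ennreal_leI) auto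
        then have "g (T x) * 1 \<le> g (T x) * ennreal (2 * T' x)" by (intro mult_left_mono) auto
        then show ?thesis using True x T'12[OF x] by (simp add: T_def ennreal_mult mult_ac indicator_def)
      next
        case False
        then have "\<not> (\<bar>x\<bar> < 1 \<and> q * phi x \<le> 1 - \<bar>x\<bar>)" using reg by auto
        then show ?thesis using elim by (auto simp: indicator_def)
      qed
    qed
    also have "\<dots> = 2 * (\<integral>\<^sup>+x. g (T x) * ennreal (T' x) * indicator {-y..y} x \<partial>lborel)"
      unfolding T_def T'_def by (rule nn_integral_cmult) measurable
    also have "(\<integral>\<^sup>+x. g (T x) * ennreal (T' x) * indicator {-y..y} x \<partial>lborel) = (\<integral>\<^sup>+x. g x * indicator {T (-y)..T y} x \<partial>lborel)"
      by (rule nn_integral_substitution_aux[symmetric, OF _ _ der cont]) (use T'12 y in \<open>auto intro: order_trans[of 0 "1/2"]\<close>)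
    also have "\<dots> \<le> (\<integral>\<^sup>+x\<in>{-1..1}. g x \<partial>lborel)"
      using Tb[of "-y"] Tb[of y] y by (intro nn_integral_mono) (auto simp: indicator_def abs_le_iff)
    finally show ?thesis by (simp add: mult_left_mono)
  qed
qed

text \<open>Forward differences: they satisfy a recursion in \<open>r\<close> and carry no cut-off,
  which is kept apart in \<open>sym_difference_fdiff\<close>.\<close>

definition fdiff :: "nat \<Rightarrow> real \<Rightarrow> (real \<Rightarrow> real) \<Rightarrow> real \<Rightarrow> real" where
  "fdiff r h f x = (\<Sum>i\<le>r. real (r choose i) * (-1) ^ (r - i) * f (x + real i * h))"

lemma fdiff_0: "fdiff 0 h f x = f x"
  by (simp add: fdiff_def)

lemma fdiff_Suc: "fdiff (Suc r) h f x = fdiff r h f (x + h) - fdiff r h f x"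
proof -
  have a: "fdiff (Suc r) h f x = (\<Sum>i\<le>Suc r. (if i = 0 then 0 else real (r choose (i - 1)) * (-1) ^ (Suc r - i) * f (x + real i * h)))
      + (\<Sum>i\<le>Suc r. real (r choose i) * (-1) ^ (Suc r - i) * f (x + real i * h))"
    unfolding fdiff_def sum.distrib[symmetric]
  proof (rule sum.cong)
    fix i assume "i \<in> {..Suc r}"
    show "real (Suc r choose i) * (-1) ^ (Suc r - i) * f (x + real i * h) =
      (if i = 0 then 0 else real (r choose (i - 1)) * (-1) ^ (Suc r - i) * f (x + real i * h)) +
      real (r choose i) * (-1) ^ (Suc r - i) * f (x + real i * h)"
      by (cases i) (auto simp: algebra_simps)
  qed simp
  have b: "(\<Sum>i\<le>Suc r. (if i = 0 then 0 else real (r choose (i - 1)) * (-1) ^ (Suc r - i) * f (x + real i * h))) = fdiff r h f (x + h)"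
    unfolding fdiff_def by (subst sum.atMost_Suc_shift) (simp add: algebra_simps)
  have c: "(\<Sum>i\<le>Suc r. real (r choose i) * (-1) ^ (Suc r - i) * f (x + real i * h)) = - fdiff r h f x"
    by (simp add: fdiff_def Suc_diff_le sum_negf[symmetric])
  show ?thesis unfolding a b c by simp
qed

lemma fdiff_add: "fdiff r h (\<lambda>x. f x + g x) x = fdiff r h f x + fdiff r h g x"
  by (simp add: fdiff_def distrib_left sum.distrib)

lemma fdiff_sum: "fdiff r h (\<lambda>x. \<Sum>i\<in>I. f i x) x = (\<Sum>i\<in>I. fdiff r h (f i) x)"
  unfolding fdiff_def sum_distrib_left by (rule sum.swap)

lemma fdiff_Suc': "fdiff (Suc r) h f x = fdiff r h (\<lambda>y. f (y + h) - f y) x"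
  unfolding fdiff_Suc by (simp add: fdiff_def algebra_simps sum_subtractf)

text \<open>One difference is traded for one derivative by the mean value theorem: the induction
  passes to \<open>Q (y + h) - Q y\<close>, whose \<open>r\<close>-th derivative is \<open>h\<close>
  times a value of the next derivative of \<open>Q\<close>.\<close>

lemma fdiff_poly_le:
  assumes h: "0 \<le> h" and B: "\<And>y. y \<in> {a..a + real r * h} \<Longrightarrow> \<bar>poly ((pderiv ^^ r) Q) y\<bar> \<le> B"
  shows "\<bar>fdiff r h (poly Q) a\<bar> \<le> h ^ r * B"
  using B
proof (induction r arbitrary: Q B)
  case 0
  then show ?case by (simp add: fdiff_0)
next
  case (Suc r)
  define Q1 where "Q1 = pcompose Q [:h, 1:] - Q"
  have e: "(\<lambda>y. poly Q (y + h) - poly Q y) = poly Q1" by (auto simp: Q1_def poly_pcompose add.commute)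
  have d: "(pderiv ^^ r) Q1 = pcompose ((pderiv ^^ r) Q) [:h, 1:] - (pderiv ^^ r) Q"
    unfolding Q1_def by (induction r) (simp_all add: pderiv_diff pderiv_pcompose pderiv_pCons)
  have "\<bar>fdiff r h (poly Q1) a\<bar> \<le> h ^ r * (h * B)"
  proof (rule Suc.IH)
    fix y assume y: "y \<in> {a..a + real r * h}"
    let ?S = "(pderiv ^^ r) Q"
    show "\<bar>poly ((pderiv ^^ r) Q1) y\<bar> \<le> h * B"
    proof (cases "h = 0")
      case True
      then show ?thesis by (simp add: d poly_pcompose)
    next
      case False
      then have "0 < h" using h by simp
      then obtain z where z: "y < z" "z < y + h" "poly ?S (y + h) - poly ?S y = (y + h - y) * poly (pderiv ?S) z"
        using poly_MVT[of y "y + h" ?S] by auto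
      have "\<bar>poly ((pderiv ^^ Suc r) Q) z\<bar> \<le> B" using z y by (intro Suc.prems) (auto simp: algebra_simps)
      then show ?thesis using z(3) h by (simp add: d poly_pcompose add.commute[of h] abs_mult mult_left_mono)
    qed
  qed
  then show ?case by (simp add: fdiff_Suc' e mult_ac)
qed

lemma sym_difference_fdiff:
  "sym_difference r h f x = (if x - real r * h / 2 \<in> {-1..1} \<and> x + real r * h / 2 \<in> {-1..1} then fdiff r h f (x - real r * h / 2) else 0)"
  by (simp add: sym_difference_def fdiff_def atLeast0AtMost)

text \<open>Puts the cut-off into the form \<open>q * phi x \<le> 1 - |x|\<close> with
  \<open>q = r * h / 2\<close>, as required by \<open>nn_integral_phi_shift\<close>, and the nodes
  into the form \<open>x + c * phi x\<close> with \<open>|c| \<le> q\<close>.\<close>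

lemma sym_difference_phi:
  assumes x: "x \<in> {-1..1}" and h: "0 < h"
  shows "sym_difference r (h * phi x) f x =
    (if real r * h / 2 * phi x \<le> 1 - \<bar>x\<bar> then \<Sum>i\<le>r. real (r choose i) * (-1) ^ (r - i) * f (x + (real i - real r / 2) * h * phi x) else 0)"
proof -
  have e: "x - real r * (h * phi x) / 2 = x - real r * h / 2 * phi x" "x + real r * (h * phi x) / 2 = x + real r * h / 2 * phi x"
    by simp_all
  have n: "0 \<le> real r * h / 2 * phi x" using phi_nonneg[OF x] h by simp
  have c: "(x - real r * (h * phi x) / 2 \<in> {-1..1} \<and> x + real r * (h * phi x) / 2 \<in> {-1..1}) \<longleftrightarrow> real r * h / 2 * phi x \<le> 1 - \<bar>x\<bar>"
    unfolding e using n x by auto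
  have "fdiff r (h * phi x) f (x - real r * (h * phi x) / 2) = (\<Sum>i\<le>r. real (r choose i) * (-1) ^ (r - i) * f (x + (real i - real r / 2) * h * phi x))"
    unfolding fdiff_def by (intro sum.cong) (auto simp: algebra_simps)
  then show ?thesis unfolding sym_difference_fdiff c by simp
qed

section \<open>Subadditivity and boundedness of the difference operator\<close>

lemma powr_sum_le:
  fixes a :: "'i \<Rightarrow> real"
  assumes "0 < p" "p \<le> 1"
  shows "\<bar>\<Sum>i\<in>I. a i\<bar> powr p \<le> (\<Sum>i\<in>I. \<bar>a i\<bar> powr p)"
proof (induction I rule: infinite_finite_induct)
  case (insert x F)
  have "\<bar>\<Sum>i\<in>insert x F. a i\<bar> powr p \<le> (\<bar>a x\<bar> + \<bar>\<Sum>i\<in>F. a i\<bar>) powr p"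
    using insert assms by (intro powr_mono2) auto
  also have "\<dots> \<le> \<bar>a x\<bar> powr p + \<bar>\<Sum>i\<in>F. a i\<bar> powr p" using assms by (intro powr_add_le) auto
  finally show ?case using insert by simp
qed auto

lemma binomial_powr_le:
  assumes "0 < p" "p \<le> 1"
  shows "\<bar>real (r choose i) * (-1) ^ k * y\<bar> powr p \<le> 2 ^ r * \<bar>y\<bar> powr p"
proof -
  have "real (r choose i) \<le> 2 ^ r"
  proof -
    have "r choose i \<le> 2 ^ r" by (rule binomial_le_pow2)
    then show ?thesis by (metis of_nat_le_iff of_nat_numeral of_nat_power)
  qed
  moreover have "real (r choose i) powr p \<le> max 1 (real (r choose i))"
  proof (cases "1 \<le> r choose i")
    case True
    then show ?thesis using assms powr_mono[of p 1 "real (r choose i)"] by simp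
  next
    case False
    then have "r < i" using zero_less_binomial_iff[of r i] by linarith
    then show ?thesis by (simp add: binomial_eq_0)
  qed
  moreover have "1 \<le> (2::real) ^ r" by simp
  ultimately have "real (r choose i) powr p \<le> 2 ^ r" by linarith
  then show ?thesis by (simp add: abs_mult powr_mult power_abs mult_right_mono)
qed

lemma wnorm_add_le:
  assumes p: "0 < p" "p \<le> 1" and [measurable]: "g1 \<in> borel_measurable borel" "g2 \<in> borel_measurable borel" "v \<in> borel_measurable borel"
    and v: "\<And>x. x \<in> {-1..1} \<Longrightarrow> 0 \<le> v x" and g: "\<And>x. x \<in> {-1..1} \<Longrightarrow> g x = g1 x + g2 x"
  shows "wnorm p v g \<le> wnorm p v g1 + wnorm p v g2"
proof -
  have "wnorm p v g \<le> (\<integral>\<^sup>+x. ennreal (\<bar>g1 x\<bar> powr p * v x) * indicator {-1..1} x + ennreal (\<bar>g2 x\<bar> powr p * v x) * indicator {-1..1} x \<partial>lborel)"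
    unfolding wnorm_def
  proof (rule nn_integral_mono)
    fix x :: real
    show "ennreal (\<bar>g x\<bar> powr p * v x) * indicator {-1..1} x \<le> ennreal (\<bar>g1 x\<bar> powr p * v x) * indicator {-1..1} x + ennreal (\<bar>g2 x\<bar> powr p * v x) * indicator {-1..1} x"
    proof (cases "x \<in> {-1..1}")
      case True
      have "\<bar>g x\<bar> powr p \<le> (\<bar>g1 x\<bar> + \<bar>g2 x\<bar>) powr p" using p g[OF True] by (intro powr_mono2) auto
      also have "\<dots> \<le> \<bar>g1 x\<bar> powr p + \<bar>g2 x\<bar> powr p" using p by (intro powr_add_le) auto
      finally have "\<bar>g x\<bar> powr p * v x \<le> \<bar>g1 x\<bar> powr p * v x + \<bar>g2 x\<bar> powr p * v x"
        using v[OF True] by (simp add: mult_right_mono flip: distrib_right)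
      then show ?thesis using True v[OF True] by (simp add: ennreal_leI flip: ennreal_plus)
    qed simp
  qed
  also have "\<dots> = wnorm p v g1 + wnorm p v g2" unfolding wnorm_def by (rule nn_integral_add) measurable
  finally show ?thesis .
qed

lemma wnorm_sum_le:
  assumes p: "0 < p" "p \<le> 1" and [measurable]: "\<And>i. i \<in> I \<Longrightarrow> g i \<in> borel_measurable borel" "v \<in> borel_measurable borel"
    and v: "\<And>x. x \<in> {-1..1} \<Longrightarrow> 0 \<le> v x"
  shows "wnorm p v (\<lambda>x. \<Sum>i\<in>I. g i x) \<le> (\<Sum>i\<in>I. wnorm p v (g i))"
  using assms(3)
proof (induction I rule: infinite_finite_induct)
  case (insert i F)
  have "wnorm p v (\<lambda>x. \<Sum>i\<in>insert i F. g i x) \<le> wnorm p v (g i) + wnorm p v (\<lambda>x. \<Sum>i\<in>F. g i x)"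
    using insert by (intro wnorm_add_le p v borel_measurable_sum) auto
  also have "\<dots> \<le> wnorm p v (g i) + (\<Sum>i\<in>F. wnorm p v (g i))" using insert by (intro add_left_mono) auto
  finally show ?case using insert by simp
qed (auto simp: wnorm_def)

lemma wnorm_uminus: "wnorm p v (\<lambda>x. - g x) = wnorm p v g"
  by (simp add: wnorm_def)

lemma wnorm_weight_mono:
  assumes "\<And>x. x \<in> {-1..1} \<Longrightarrow> v x \<le> K * v' x" "0 \<le> K" and [measurable]: "g \<in> borel_measurable borel" "v' \<in> borel_measurable borel"
  shows "wnorm p v g \<le> ennreal K * wnorm p v' g"
proof -
  have "wnorm p v g \<le> (\<integral>\<^sup>+x. ennreal K * (ennreal (\<bar>g x\<bar> powr p * v' x) * indicator {-1..1} x) \<partial>lborel)"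
    unfolding wnorm_def
  proof (rule nn_integral_mono)
    fix x :: real
    show "ennreal (\<bar>g x\<bar> powr p * v x) * indicator {-1..1} x \<le> ennreal K * (ennreal (\<bar>g x\<bar> powr p * v' x) * indicator {-1..1} x)"
      using assms(1)[of x] assms(2) mult_left_mono[of "v x" "K * v' x" "\<bar>g x\<bar> powr p"]
      by (auto simp: indicator_def ennreal_leI mult.left_commute simp flip: ennreal_mult')
  qed
  also have "\<dots> = ennreal K * wnorm p v' g" unfolding wnorm_def by (rule nn_integral_cmult) measurable
  finally show ?thesis .
qed

lemma sym_difference_measurable [measurable]:
  assumes [measurable]: "f \<in> borel_measurable borel"
  shows "(\<lambda>x. sym_difference r (h * phi x) f x) \<in> borel_measurable borel"
  unfolding sym_difference_def atLeastAtMost_iff by measurable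

lemma slow_arccos:
  assumes V: "slow C k n (\<lambda>t. v (cos t))" and x: "x \<in> {-1..1}" and y: "y \<in> {-1..1}" and C: "0 \<le> C"
    and q: "0 \<le> q" and d: "\<bar>x - y\<bar> \<le> q * phi x"
  shows "v x \<le> C * (1 + real n * (pi * q)) ^ k * v y"
proof -
  define t s where "t = arccos x" and "s = arccos y"
  have t: "t \<in> {0..pi}" "cos t = x" and s: "s \<in> {0..pi}" "cos s = y"
    using x y by (auto simp: t_def s_def arccos_lbound arccos_ubound)
  have "\<bar>t - s\<bar> \<le> pi * q"
    by (rule cos_close_imp_close[OF t(1) s(1) q]) (use d t s phi_cos[OF t(1)] in simp)
  then have "C * (1 + real n * \<bar>t - s\<bar>) ^ k * v y \<le> C * (1 + real n * (pi * q)) ^ k * v y"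
    using C slow_nonneg[OF V s(1)] s(2) by (intro mult_right_mono mult_left_mono power_mono add_left_mono) auto
  with slowD[OF V t(1) s(1)] t s show ?thesis by simp
qed

text \<open>Each node \<open>x + c * phi x\<close> is a change of variables with Jacobian at least
  1/2, and for \<open>h \<le> 1 / n\<close> it lies within a bounded multiple of
  \<open>1 / n\<close> of \<open>x\<close> in the angle, so the weight at the node is comparable.
  The \<open>r + 1\<close> nodes are added in \<open>p\<close>-th powers.\<close>

lemma wnorm_sym_difference_le:
  assumes w: "doubling_weight w" and p: "0 < p" "p \<le> 1" and r: "1 \<le> r"
  obtains B where "0 < B" "\<And>n h g. 1 \<le> n \<Longrightarrow> 0 < h \<Longrightarrow> h \<le> 1 / real n \<Longrightarrow> g \<in> borel_measurable borel \<Longrightarrow>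
     wnorm p (avg_weight w n) (\<lambda>x. sym_difference r (h * phi x) g x) \<le> ennreal B * wnorm p (avg_weight w n) g"
proof -
  obtain C k where C: "0 < C" "\<And>n. 1 \<le> n \<Longrightarrow> slow C k n (\<lambda>t. avg_weight w n (cos t))"
    by (rule slow_avg_weight[OF w]) blast
  define E where "E = C * (1 + pi * real r) ^ k"
  have E0: "0 < E" using C by (simp add: E_def add_pos_nonneg)
  define B where "B = real (Suc r) * (2 * (2 ^ r * E))"
  have B0: "0 < B" using E0 by (simp add: B_def)
  show ?thesis
  proof (rule that[OF B0])
    fix n :: nat and h :: real and g :: "real \<Rightarrow> real"
    assume n: "1 \<le> n" and h: "0 < h" "h \<le> 1 / real n" and [measurable]: "g \<in> borel_measurable borel"
    note [measurable] = avg_weight_measurable[OF w]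
    let ?v = "avg_weight w n"
    have np: "0 < real n" using n by simp
    define q where "q = real r * h / 2"
    have q: "0 < q" using r h by (simp add: q_def)
    have nq: "real n * (pi * q) \<le> pi * real r"
    proof -
      have "real n * h \<le> 1" using h np by (simp add: field_simps)
      then have "pi * real r * (real n * h) \<le> pi * real r * 1" by (intro mult_left_mono) auto
      moreover have "0 \<le> pi * real r * (real n * h)" using h by simp
      moreover have "real n * (pi * q) = pi * real r * (real n * h) / 2" by (simp add: q_def)
      ultimately show ?thesis by linarith
    qed
    define c where "c i = (real i - real r / 2) * h" for i
    have cq: "\<bar>c i\<bar> \<le> q" if "i \<le> r" for i
    proof -
      have "\<bar>real i - real r / 2\<bar> \<le> real r / 2" using that by (intro abs_leI) auto
      then have "\<bar>real i - real r / 2\<bar> * h \<le> real r / 2 * h" using h by (intro mult_right_mono) auto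
      then show ?thesis using h by (simp add: c_def q_def abs_mult)
    qed
    define G where "G y = ennreal (\<bar>g y\<bar> powr p * ?v y)" for y
    have [measurable]: "G \<in> borel_measurable borel" unfolding G_def by measurable
    have "wnorm p ?v (\<lambda>x. sym_difference r (h * phi x) g x) \<le>
       (\<integral>\<^sup>+x. (\<Sum>i\<le>r. ennreal (2 ^ r * E) * ((if q * phi x \<le> 1 - \<bar>x\<bar> then G (x + c i * phi x) else 0) * indicator {-1..1} x)) \<partial>lborel)"
      unfolding wnorm_def
    proof (rule nn_integral_mono)
      fix x :: real
      show "ennreal (\<bar>sym_difference r (h * phi x) g x\<bar> powr p * ?v x) * indicator {-1..1} x \<le>
         (\<Sum>i\<le>r. ennreal (2 ^ r * E) * ((if q * phi x \<le> 1 - \<bar>x\<bar> then G (x + c i * phi x) else 0) * indicator {-1..1} x))"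
      proof (cases "x \<in> {-1..1} \<and> q * phi x \<le> 1 - \<bar>x\<bar>")
        case True
        then have x: "x \<in> {-1..1}" and reg: "q * phi x \<le> 1 - \<bar>x\<bar>" by auto
        have vx: "0 \<le> ?v x" by (rule avg_weight_nonneg[OF x w])
        have "\<bar>sym_difference r (h * phi x) g x\<bar> powr p = \<bar>\<Sum>i\<le>r. real (r choose i) * (-1) ^ (r - i) * g (x + c i * phi x)\<bar> powr p"
          using reg unfolding sym_difference_phi[OF x h(1)] by (simp add: q_def c_def)
        also have "\<dots> \<le> (\<Sum>i\<le>r. \<bar>real (r choose i) * (-1) ^ (r - i) * g (x + c i * phi x)\<bar> powr p)"
          by (rule powr_sum_le[OF p])
        also have "\<dots> \<le> (\<Sum>i\<le>r. 2 ^ r * \<bar>g (x + c i * phi x)\<bar> powr p)"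
          by (intro sum_mono binomial_powr_le p)
        finally have "\<bar>sym_difference r (h * phi x) g x\<bar> powr p * ?v x \<le> (\<Sum>i\<le>r. 2 ^ r * \<bar>g (x + c i * phi x)\<bar> powr p) * ?v x"
          using vx by (intro mult_right_mono) auto
        also have "\<dots> = (\<Sum>i\<le>r. 2 ^ r * \<bar>g (x + c i * phi x)\<bar> powr p * ?v x)" by (rule sum_distrib_right)
        also have "\<dots> \<le> (\<Sum>i\<le>r. 2 ^ r * \<bar>g (x + c i * phi x)\<bar> powr p * (E * ?v (x + c i * phi x)))"
        proof (intro sum_mono mult_left_mono)
          fix i assume i: "i \<in> {..r}"
          have "\<bar>c i * phi x\<bar> \<le> q * phi x" using cq[of i] i phi_nonneg[OF x] by (simp add: abs_mult mult_right_mono)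
          then have y: "x + c i * phi x \<in> {-1..1}" and d: "\<bar>x - (x + c i * phi x)\<bar> \<le> q * phi x" using reg by auto
          have "?v x \<le> C * (1 + real n * (pi * q)) ^ k * ?v (x + c i * phi x)"
            using slow_arccos[OF C(2)[OF n] x y _ _ d] C q by simp
          also have "\<dots> \<le> E * ?v (x + c i * phi x)" unfolding E_def
            using nq C q avg_weight_nonneg[OF y w] by (intro mult_right_mono mult_left_mono power_mono) auto
          finally show "?v x \<le> E * ?v (x + c i * phi x)" .
        qed simp
        finally have "ennreal (\<bar>sym_difference r (h * phi x) g x\<bar> powr p * ?v x) \<le> ennreal (\<Sum>i\<le>r. (2 ^ r * E) * (\<bar>g (x + c i * phi x)\<bar> powr p * ?v (x + c i * phi x)))"
          by (intro ennreal_leI) (simp add: mult_ac)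
        also have "\<dots> = (\<Sum>i\<le>r. ennreal ((2 ^ r * E) * (\<bar>g (x + c i * phi x)\<bar> powr p * ?v (x + c i * phi x))))"
        proof (rule sum_ennreal[symmetric])
          fix i assume i: "i \<in> {..r}"
          have "\<bar>c i * phi x\<bar> \<le> q * phi x" using cq[of i] i phi_nonneg[OF x] by (simp add: abs_mult mult_right_mono)
          then have y: "x + c i * phi x \<in> {-1..1}" using reg by auto
          show "0 \<le> (2 ^ r * E) * (\<bar>g (x + c i * phi x)\<bar> powr p * ?v (x + c i * phi x))" using E0 avg_weight_nonneg[OF y w] by simp
        qed
        finally show ?thesis using True E0 by (simp add: G_def ennreal_mult')
      next
        case False
        then show ?thesis
        proof (cases "x \<in> {-1..1}")
          case True
          then have "sym_difference r (h * phi x) g x = 0" using False unfolding sym_difference_phi[OF True h(1)] by (auto simp: q_def)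
          then show ?thesis using p by simp
        qed simp
      qed
    qed
    also have "\<dots> = (\<Sum>i\<le>r. \<integral>\<^sup>+x. ennreal (2 ^ r * E) * ((if q * phi x \<le> 1 - \<bar>x\<bar> then G (x + c i * phi x) else 0) * indicator {-1..1} x) \<partial>lborel)"
      by (rule nn_integral_sum) measurable
    also have "\<dots> = (\<Sum>i\<le>r. ennreal (2 ^ r * E) * (\<integral>\<^sup>+x\<in>{-1..1}. (if q * phi x \<le> 1 - \<bar>x\<bar> then G (x + c i * phi x) else 0) \<partial>lborel))"
      by (intro sum.cong refl nn_integral_cmult) measurable
    also have "\<dots> \<le> (\<Sum>i\<le>r. ennreal (2 ^ r * E) * (2 * (\<integral>\<^sup>+x\<in>{-1..1}. G x \<partial>lborel)))"
      by (intro sum_mono mult_left_mono nn_integral_phi_shift q cq) auto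
    also have "\<dots> = ennreal B * wnorm p ?v g"
      using E0 by (simp add: B_def wnorm_def G_def ennreal_mult ennreal_of_nat_eq_real_of_nat mult_ac flip: ennreal_numeral)
    finally show "wnorm p ?v (\<lambda>x. sym_difference r (h * phi x) g x) \<le> ennreal B * wnorm p ?v g" .
  qed
qed

lemma wnorm_cos:
  assumes [measurable]: "g \<in> borel_measurable borel" "v \<in> borel_measurable borel"
  shows "wnorm p v g = (\<integral>\<^sup>+t\<in>{0..pi}. ennreal (\<bar>g (cos t)\<bar> powr p * (v (cos t) * sin t)) \<partial>lborel)"
proof -
  have "wnorm p v g = (\<integral>\<^sup>+t\<in>{0..pi}. ennreal (\<bar>g (cos t)\<bar> powr p * v (cos t)) * ennreal (sin t) \<partial>lborel)"
    unfolding wnorm_def by (rule nn_integral_cos_subst) measurable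
  also have "\<dots> = (\<integral>\<^sup>+t\<in>{0..pi}. ennreal (\<bar>g (cos t)\<bar> powr p * (v (cos t) * sin t)) \<partial>lborel)"
    by (intro nn_integral_cong) (auto simp: indicator_def sin_ge_zero mult.assoc simp flip: ennreal_mult'')
  finally show ?thesis .
qed

text \<open>The heart of the inverse direction. The difference is at most
  \<open>(phi / n) ^ r\<close> times a nearby \<open>r\<close>-th derivative. In the
  \<open>p\<close>-th power, \<open>phi powr (r p)\<close> splits into
  \<open>phi powr (r p - \<gamma>)\<close>, at most \<open>(m rho_m) powr (r p - \<gamma>)\<close>,
  and \<open>phi powr \<gamma>\<close>, with which the class condition compares \<open>w_n\<close>
  and \<open>w_m\<close>. What remains is \<open>(m / n) powr (r p - \<delta>)\<close> times the
  left side of a Bernstein inequality of degree \<open>m\<close>.\<close>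

lemma wnorm_poly_difference:
  assumes W: "w \<in> W_class \<delta> \<gamma>" and p: "0 < p" "p \<le> 1" and r: "1 \<le> r" and g: "0 \<le> \<gamma>" "\<gamma> \<le> real r * p"
  obtains B where "0 < B" "\<And>m n h Q. 1 \<le> m \<Longrightarrow> m \<le> n \<Longrightarrow> degree Q \<le> m \<Longrightarrow> 0 < h \<Longrightarrow> h \<le> 1 / real n \<Longrightarrow>
     wnorm p (avg_weight w n) (\<lambda>x. sym_difference r (h * phi x) (poly Q) x)
       \<le> ennreal (B * (real m / real n) powr (real r * p - \<delta>)) * wnorm p (avg_weight w m) (poly Q)"
proof -
  have w: "doubling_weight w" using W by (simp add: W_class_def)
  obtain \<Lambda> where \<Lambda>: "0 < \<Lambda>" "\<And>m n x. 1 \<le> m \<Longrightarrow> m \<le> n \<Longrightarrow> x \<in> {-1..1} \<Longrightarrow>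
      avg_weight w n x * (if \<gamma> = 0 then 1 else phi x powr \<gamma>) \<le> \<Lambda> * real n powr \<delta> * real m powr (\<gamma> - \<delta>) * rho m x powr \<gamma> * avg_weight w m x"
    using W unfolding W_class_def by blast
  obtain C k where C: "0 < C" "\<And>n. 1 \<le> n \<Longrightarrow> slow C k n (\<lambda>t. avg_weight w n (cos t))"
    by (rule slow_avg_weight[OF w]) blast
  obtain B where B: "0 < B" "\<And>n Q W. 1 \<le> n \<Longrightarrow> degree Q \<le> n \<Longrightarrow> slow C k n W \<Longrightarrow>
       \<exists>H\<in>borel_measurable borel.
         (\<forall>t\<in>{0..pi}. \<forall>s\<in>{0..pi}. real n * \<bar>s - t\<bar> \<le> pi * real r \<longrightarrow> ennreal (\<bar>poly ((pderiv ^^ r) Q) (cos s)\<bar> powr p) \<le> H t) \<and>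
         (\<integral>\<^sup>+t\<in>{0..pi}. H t * ennreal (rho n (cos t) powr (real r * p) * (W t * sin t)) \<partial>lborel)
           \<le> ennreal B * (\<integral>\<^sup>+t\<in>{0..pi}. ennreal (\<bar>poly Q (cos t)\<bar> powr p * (W t * sin t)) \<partial>lborel)"
    by (rule deriv_local_sup[OF p C(1), where k = k and r = r and c = "pi * real r"]) auto
  show ?thesis
  proof (rule that[of "\<Lambda> * B"])
    show "0 < \<Lambda> * B" using \<Lambda> B by simp
    fix m n :: nat and h :: real and Q :: "real poly"
    assume m: "1 \<le> m" and mn: "m \<le> n" and Q: "degree Q \<le> m" and h: "0 < h" "h \<le> 1 / real n"
    note [measurable] = avg_weight_measurable[OF w]
    have n: "1 \<le> n" using m mn by simp
    have mp: "0 < real m" and np: "0 < real n" using m n by auto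
    let ?v = "avg_weight w n" and ?vm = "avg_weight w m" and ?S = "(pderiv ^^ r) Q"
    obtain H where H [measurable]: "H \<in> borel_measurable borel" and
      H1: "\<And>t s. t \<in> {0..pi} \<Longrightarrow> s \<in> {0..pi} \<Longrightarrow> real m * \<bar>s - t\<bar> \<le> pi * real r \<Longrightarrow> ennreal (\<bar>poly ?S (cos s)\<bar> powr p) \<le> H t" and
      H2: "(\<integral>\<^sup>+t\<in>{0..pi}. H t * ennreal (rho m (cos t) powr (real r * p) * (?vm (cos t) * sin t)) \<partial>lborel)
           \<le> ennreal B * (\<integral>\<^sup>+t\<in>{0..pi}. ennreal (\<bar>poly Q (cos t)\<bar> powr p * (?vm (cos t) * sin t)) \<partial>lborel)"
      using B(2)[OF m Q C(2)[OF m]] by blast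
    define K where "K = \<Lambda> * (real m / real n) powr (real r * p - \<delta>)"
    have K0: "0 \<le> K" using \<Lambda> by (simp add: K_def)
    define q where "q = real r * h / 2"
    have q: "0 < q" using r h by (simp add: q_def)
    have mq: "real m * (pi * q) \<le> pi * real r"
    proof -
      have "real m * h \<le> real n * h" using mn h by (intro mult_right_mono) auto
      also have "\<dots> \<le> 1" using h np by (simp add: field_simps)
      finally have "pi * real r * (real m * h) \<le> pi * real r * 1" by (intro mult_left_mono) auto
      moreover have "0 \<le> pi * real r * (real m * h)" using h by simp
      moreover have "real m * (pi * q) = pi * real r * (real m * h) / 2" by (simp add: q_def)
      ultimately show ?thesis by linarith
    qed
    have pt: "ennreal (\<bar>sym_difference r (h * phi (cos t)) (poly Q) (cos t)\<bar> powr p * (?v (cos t) * sin t))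
        \<le> ennreal K * (H t * ennreal (rho m (cos t) powr (real r * p) * (?vm (cos t) * sin t)))" if t: "t \<in> {0..pi}" for t
    \<comment> \<open>At the ends the Jacobian vanishes, and outside the admissible region the
      difference is 0; otherwise \<open>sin t\<close> is positive.\<close>
    proof (cases "t = 0 \<or> t = pi \<or> \<not> q * phi (cos t) \<le> 1 - \<bar>cos t\<bar>")
      case True
      then show ?thesis
      proof (elim disjE)
        assume "\<not> q * phi (cos t) \<le> 1 - \<bar>cos t\<bar>"
        then have "sym_difference r (h * phi (cos t)) (poly Q) (cos t) = 0"
          by (subst sym_difference_phi) (auto simp: q_def h)
        then show ?thesis using p by simp
      qed auto
    next
      case False
      then have t': "0 < t" "t < pi" using t by auto
      then have st: "0 < sin t" by (rule sin_gt_zero)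
      let ?x = "cos t"
      have x: "?x \<in> {-1..1}" by simp
      have ph: "phi ?x = sin t" by (rule phi_cos[OF t])
      have reg: "q * sin t \<le> 1 - \<bar>?x\<bar>" using False ph by simp
      define a where "a = ?x - q * sin t"
      \<comment> \<open>A point of the stencil where the \<open>r\<close>-th derivative is largest.
        Its angle is within \<open>pi * q\<close> of \<open>t\<close>, so \<open>H t\<close> bounds
        the derivative there.\<close>
      obtain y where y: "y \<in> {a..a + real r * (h * sin t)}" "\<And>z. z \<in> {a..a + real r * (h * sin t)} \<Longrightarrow> \<bar>poly ?S z\<bar> \<le> \<bar>poly ?S y\<bar>"
      proof -
        have "\<exists>y\<in>{a..a + real r * (h * sin t)}. \<forall>z\<in>{a..a + real r * (h * sin t)}. \<bar>poly ?S z\<bar> \<le> \<bar>poly ?S y\<bar>"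
          by (rule continuous_attains_sup) (use h st in \<open>auto intro!: continuous_intros\<close>)
        then show ?thesis using that by blast
      qed
      have e2: "a + real r * (h * sin t) = ?x + q * sin t" by (simp add: a_def q_def field_simps)
      have yd: "\<bar>?x - y\<bar> \<le> q * sin t" using y(1) unfolding e2 by (auto simp: a_def abs_le_iff)
      then have y1: "y \<in> {-1..1}" using reg by auto
      define s where "s = arccos y"
      have s: "s \<in> {0..pi}" "cos s = y" using y1 by (auto simp: s_def arccos_lbound arccos_ubound)
      have "\<bar>t - s\<bar> \<le> pi * q" by (rule cos_close_imp_close[OF t s(1)]) (use q yd s in auto)
      then have "real m * \<bar>s - t\<bar> \<le> real m * (pi * q)" by (simp add: abs_minus_commute mult_left_mono)
      then have Hs: "ennreal (\<bar>poly ?S y\<bar> powr p) \<le> H t" using H1[OF t s(1)] mq s(2) by simp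
      have "sym_difference r (h * phi ?x) (poly Q) ?x = fdiff r (h * sin t) (poly Q) a \<or> sym_difference r (h * phi ?x) (poly Q) ?x = 0"
        unfolding sym_difference_fdiff by (auto simp: ph a_def q_def mult.assoc)
      then have "\<bar>sym_difference r (h * phi ?x) (poly Q) ?x\<bar> \<le> (h * sin t) ^ r * \<bar>poly ?S y\<bar>"
        using fdiff_poly_le[of "h * sin t" a r Q "\<bar>poly ?S y\<bar>"] y(2) h st by auto
      then have "\<bar>sym_difference r (h * phi ?x) (poly Q) ?x\<bar> powr p \<le> ((h * sin t) ^ r * \<bar>poly ?S y\<bar>) powr p"
        using p by (intro powr_mono2) auto
      also have "\<dots> = (h * sin t) powr (real r * p) * \<bar>poly ?S y\<bar> powr p"
        using h st by (simp add: powr_mult powr_powr flip: powr_realpow)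
      also have "\<dots> \<le> (sin t / real n) powr (real r * p) * \<bar>poly ?S y\<bar> powr p"
      proof -
        have "h * sin t \<le> 1 / real n * sin t" using h st by (intro mult_right_mono) auto
        then show ?thesis using h st p by (intro mult_right_mono powr_mono2) auto
      qed
      finally have D: "\<bar>sym_difference r (h * phi ?x) (poly Q) ?x\<bar> powr p \<le> (sin t / real n) powr (real r * p) * \<bar>poly ?S y\<bar> powr p" .
      have vx: "0 \<le> ?v ?x" "0 \<le> ?vm ?x" by (auto intro!: avg_weight_nonneg[OF _ w])
      \<comment> \<open>As \<open>sin t\<close> is positive, the convention for exponent 0 agrees
        with \<open>powr\<close>.\<close>
      have W1: "?v ?x * sin t powr \<gamma> \<le> \<Lambda> * real n powr \<delta> * real m powr (\<gamma> - \<delta>) * rho m ?x powr \<gamma> * ?vm ?x"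
      proof -
        have "(if \<gamma> = 0 then 1 else phi ?x powr \<gamma>) = sin t powr \<gamma>" using st by (simp add: ph)
        with \<Lambda>(2)[OF m mn x] show ?thesis by simp
      qed
      have sm: "sin t \<le> real m * rho m ?x" using mp by (simp add: rho_cos[OF t] distrib_left)
      have "(sin t / real n) powr (real r * p) * ?v ?x = real n powr (- (real r * p)) * (sin t powr (real r * p - \<gamma>) * (?v ?x * sin t powr \<gamma>))"
        using st np by (simp add: powr_divide powr_minus field_simps powr_diff)
      also have "\<dots> \<le> real n powr (- (real r * p)) * ((real m * rho m ?x) powr (real r * p - \<gamma>) * (\<Lambda> * real n powr \<delta> * real m powr (\<gamma> - \<delta>) * rho m ?x powr \<gamma> * ?vm ?x))"
        by (rule mult_left_mono[OF mult_mono[OF powr_mono2[OF _ _ sm] W1]]) (use st g vx in auto)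
      also have "\<dots> = \<Lambda> * (real n powr (- (real r * p)) * real n powr \<delta>) * (real m powr (real r * p - \<gamma>) * real m powr (\<gamma> - \<delta>)) * (rho m ?x powr (real r * p - \<gamma>) * rho m ?x powr \<gamma>) * ?vm ?x"
        by (simp add: powr_mult mult_ac)
      also have "\<dots> = K * (rho m ?x powr (real r * p) * ?vm ?x)"
      proof -
        have "real n powr (- (real r * p)) * real n powr \<delta> = 1 / real n powr (real r * p - \<delta>)"
          using np by (simp add: powr_minus powr_diff field_simps)
        moreover have "real m powr (real r * p - \<gamma>) * real m powr (\<gamma> - \<delta>) = real m powr (real r * p - \<delta>)" by (simp flip: powr_add)
        moreover have "rho m ?x powr (real r * p - \<gamma>) * rho m ?x powr \<gamma> = rho m ?x powr (real r * p)" by (simp flip: powr_add)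
        ultimately show ?thesis using mp np by (simp add: K_def powr_divide)
      qed
      finally have W2: "(sin t / real n) powr (real r * p) * ?v ?x \<le> K * (rho m ?x powr (real r * p) * ?vm ?x)" .
      have "\<bar>sym_difference r (h * phi ?x) (poly Q) ?x\<bar> powr p * (?v ?x * sin t) \<le> ((sin t / real n) powr (real r * p) * \<bar>poly ?S y\<bar> powr p) * (?v ?x * sin t)"
        using D vx st by (intro mult_right_mono) auto
      also have "\<dots> = \<bar>poly ?S y\<bar> powr p * sin t * ((sin t / real n) powr (real r * p) * ?v ?x)" by (simp only: mult_ac)
      also have "\<dots> \<le> \<bar>poly ?S y\<bar> powr p * sin t * (K * (rho m ?x powr (real r * p) * ?vm ?x))"
        using W2 st by (intro mult_left_mono) auto
      also have "\<dots> = K * (\<bar>poly ?S y\<bar> powr p * (rho m ?x powr (real r * p) * (?vm ?x * sin t)))" by (simp only: mult_ac)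
      finally have "ennreal (\<bar>sym_difference r (h * phi ?x) (poly Q) ?x\<bar> powr p * (?v ?x * sin t)) \<le> ennreal K * (ennreal (\<bar>poly ?S y\<bar> powr p) * ennreal (rho m ?x powr (real r * p) * (?vm ?x * sin t)))"
        using K0 by (simp add: ennreal_leI flip: ennreal_mult')
      also have "\<dots> \<le> ennreal K * (H t * ennreal (rho m ?x powr (real r * p) * (?vm ?x * sin t)))"
        by (intro mult_left_mono mult_right_mono Hs) auto
      finally show ?thesis .
    qed
    have "wnorm p ?v (\<lambda>x. sym_difference r (h * phi x) (poly Q) x) = (\<integral>\<^sup>+t\<in>{0..pi}. ennreal (\<bar>sym_difference r (h * phi (cos t)) (poly Q) (cos t)\<bar> powr p * (?v (cos t) * sin t)) \<partial>lborel)"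
      by (rule wnorm_cos) measurable
    also have "\<dots> \<le> (\<integral>\<^sup>+t. ennreal K * (H t * ennreal (rho m (cos t) powr (real r * p) * (?vm (cos t) * sin t)) * indicator {0..pi} t) \<partial>lborel)"
      using pt by (intro nn_integral_mono) (auto simp: indicator_def)
    also have "\<dots> = ennreal K * (\<integral>\<^sup>+t\<in>{0..pi}. H t * ennreal (rho m (cos t) powr (real r * p) * (?vm (cos t) * sin t)) \<partial>lborel)"
      by (rule nn_integral_cmult) measurable
    also have "\<dots> \<le> ennreal K * (ennreal B * (\<integral>\<^sup>+t\<in>{0..pi}. ennreal (\<bar>poly Q (cos t)\<bar> powr p * (?vm (cos t) * sin t)) \<partial>lborel))"
      by (intro mult_left_mono H2) auto
    also have "\<dots> = ennreal K * (ennreal B * wnorm p ?vm (poly Q))"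
      by (subst wnorm_cos) auto
    also have "\<dots> = ennreal (\<Lambda> * B * (real m / real n) powr (real r * p - \<delta>)) * wnorm p ?vm (poly Q)"
      using K0 by (subst ennreal_mult_assoc) (auto simp: K_def mult_ac)
    finally show "wnorm p ?v (\<lambda>x. sym_difference r (h * phi x) (poly Q) x) \<le> ennreal (\<Lambda> * B * (real m / real n) powr (real r * p - \<delta>)) * wnorm p ?vm (poly Q)" .
  qed
qed

subsection \<open>The inverse estimate\<close>

text \<open>For positive \<kappa> the sum is dominated by its last term, up to the value of a
  geometric series with ratio \<open>2 powr (- \<kappa>)\<close>.\<close>

lemma sum_geometric_powr_le:
  fixes \<kappa> :: real
  assumes "0 < \<kappa>"
  shows "(\<Sum>i<N. ((2::real) ^ Suc i) powr \<kappa>) \<le> (2 ^ N) powr \<kappa> / (1 - 2 powr (- \<kappa>))"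
proof (induction N)
  case 0
  have "(2::real) powr (- \<kappa>) < 1" using assms by (simp add: powr_less_one)
  then show ?case by simp
next
  case (Suc N)
  define z :: real where "z = 2 powr (- \<kappa>)"
  have z: "0 < z" "z < 1" using assms by (auto simp: z_def powr_less_one)
  have e: "((2::real) ^ N) powr \<kappa> = z * (2 ^ Suc N) powr \<kappa>"
    by (simp add: z_def powr_mult powr_minus)
  have "(\<Sum>i<Suc N. ((2::real) ^ Suc i) powr \<kappa>) \<le> z * (2 ^ Suc N) powr \<kappa> / (1 - z) + (2 ^ Suc N) powr \<kappa>"
    using Suc unfolding e z_def[symmetric] by simp
  also have "\<dots> = (2 ^ Suc N) powr \<kappa> / (1 - z)" using z by (simp add: field_simps)
  finally show ?case by (simp add: z_def)
qed

text \<open>Serves the starting polynomial of the telescoping sum in \<open>inverse_rate\<close>,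
  for which a finite norm is enough.\<close>

lemma wnorm_poly_finite:
  assumes w: "doubling_weight w" and p: "0 < p" and n: "1 \<le> n"
  shows "wnorm p (avg_weight w n) (poly Q) < \<infinity>"
proof -
  note [measurable] = avg_weight_measurable[OF w]
  obtain C k where C: "0 < C" "\<And>n. 1 \<le> n \<Longrightarrow> slow C k n (\<lambda>t. avg_weight w n (cos t))"
    by (rule slow_avg_weight[OF w]) blast
  have "wnorm p (avg_weight w n) (poly Q) = (\<integral>\<^sup>+t\<in>{0..pi}. ennreal (\<bar>poly Q (cos t)\<bar> powr p * (avg_weight w n (cos t) * sin t)) \<partial>lborel)"
    by (rule wnorm_cos) measurable
  also have "\<dots> \<le> wint p Q (\<lambda>t. avg_weight w n (cos t)) 0 pi"
    unfolding wint_def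
  proof (intro nn_integral_mono mult_right_mono ennreal_leI mult_left_mono)
    fix t
    show "avg_weight w n (cos t) * sin t \<le> avg_weight w n (cos t)"
      using avg_weight_nonneg[OF _ w, of "cos t" n] by (intro mult_left_le) auto
  qed auto
  also have "\<dots> < \<infinity>" by (rule wint_finite[OF C(2)[OF n] p])
  finally show ?thesis .
qed

lemma sym_difference_add:
  "sym_difference r h (\<lambda>x. f x + g x) x = sym_difference r h f x + sym_difference r h g x"
  by (simp add: sym_difference_fdiff fdiff_add)

lemma sym_difference_sum:
  "sym_difference r h (\<lambda>x. \<Sum>i\<in>I. f i x) x = (\<Sum>i\<in>I. sym_difference r h (f i) x)"
proof (cases "x - real r * h / 2 \<in> {-1..1} \<and> x + real r * h / 2 \<in> {-1..1}")
  case True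
  then show ?thesis by (simp only: sym_difference_fdiff fdiff_sum simp_thms if_True)
next
  case False
  then show ?thesis unfolding sym_difference_fdiff by (subst if_not_P; simp only: if_not_P sum.neutral_const)
qed

text \<open>\<open>f\<close> is \<open>f - P_(2^N)\<close> plus dyadic differences plus a starting
  polynomial, with \<open>2^N \<le> n < 2^(N+1)\<close>. The difference at level \<open>i\<close>
  contributes a multiple of \<open>n powr (- \<theta>) * (2^(i+1)) powr \<kappa>\<close> with
  \<open>\<kappa> = \<theta> - \<beta> > 0\<close>, so the last level dominates and restores
  \<open>n powr (- \<beta>)\<close>.\<close>

theorem inverse_rate:
  assumes W: "w \<in> W_class \<delta> \<gamma>" and p: "0 < p" "p \<le> 1" and r: "1 \<le> r" and g: "0 \<le> \<gamma>" "\<gamma> \<le> real r * p"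
    and \<beta>: "0 < \<beta>" "\<beta> < real r * p - \<delta>" and [measurable]: "f \<in> borel_measurable borel"
    and approx: "\<And>n. n0 \<le> n \<Longrightarrow> \<exists>P. degree P \<le> n \<and> wnorm p (avg_weight w n) (\<lambda>x. f x - poly P x) \<le> ennreal (C0 * real n powr (- \<beta>))"
  obtains C n1 where "0 < C" "\<And>n h. n1 \<le> n \<Longrightarrow> 0 < h \<Longrightarrow> h \<le> 1 / real n \<Longrightarrow>
     wnorm p (avg_weight w n) (\<lambda>x. sym_difference r (h * phi x) f x) \<le> ennreal (C * real n powr (- \<beta>))"
proof -
  have w: "doubling_weight w" using W by (simp add: W_class_def)
  note [measurable] = avg_weight_measurable[OF w]
  have vnn: "0 \<le> avg_weight w n x" if "x \<in> {-1..1}" for n x by (rule avg_weight_nonneg[OF that w])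
  define C1 where "C1 = max 0 C0"
  have C1: "0 \<le> C1" by (simp add: C1_def)
  obtain P where P: "\<And>n. n0 \<le> n \<Longrightarrow> degree (P n) \<le> n"
     "\<And>n. n0 \<le> n \<Longrightarrow> wnorm p (avg_weight w n) (\<lambda>x. f x - poly (P n) x) \<le> ennreal (C1 * real n powr (- \<beta>))"
  proof -
    have "\<exists>P. degree P \<le> n \<and> wnorm p (avg_weight w n) (\<lambda>x. f x - poly P x) \<le> ennreal (C1 * real n powr (- \<beta>))" if "n0 \<le> n" for n
    proof -
      have "ennreal (C0 * real n powr (- \<beta>)) \<le> ennreal (C1 * real n powr (- \<beta>))"
        by (intro ennreal_leI mult_right_mono) (auto simp: C1_def)
      then show ?thesis using approx[OF that] by (meson order_trans)
    qed
    then show ?thesis using that by metis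
  qed
  obtain B where B: "0 < B" "\<And>n h g. 1 \<le> n \<Longrightarrow> 0 < h \<Longrightarrow> h \<le> 1 / real n \<Longrightarrow> g \<in> borel_measurable borel \<Longrightarrow>
     wnorm p (avg_weight w n) (\<lambda>x. sym_difference r (h * phi x) g x) \<le> ennreal B * wnorm p (avg_weight w n) g"
    by (rule wnorm_sym_difference_le[OF w p r]) blast
  define \<theta> where "\<theta> = real r * p - \<delta>"
  obtain B2 where B2: "0 < B2" "\<And>m n h Q. 1 \<le> m \<Longrightarrow> m \<le> n \<Longrightarrow> degree Q \<le> m \<Longrightarrow> 0 < h \<Longrightarrow> h \<le> 1 / real n \<Longrightarrow>
     wnorm p (avg_weight w n) (\<lambda>x. sym_difference r (h * phi x) (poly Q) x)
       \<le> ennreal (B2 * (real m / real n) powr \<theta>) * wnorm p (avg_weight w m) (poly Q)"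
    unfolding \<theta>_def by (rule wnorm_poly_difference[OF W p r g]) blast
  define \<kappa> where "\<kappa> = \<theta> - \<beta>"
  have \<kappa>: "0 < \<kappa>" using \<beta> by (simp add: \<kappa>_def \<theta>_def)
  define Z where "Z = 1 / (1 - 2 powr (- \<kappa>))"
  have Z: "0 < Z" using \<kappa> by (simp add: Z_def powr_less_one)
  \<comment> \<open>\<open>2 ^ i0 > i0 \<ge> n0\<close>: the telescope starts at a power of two
    where the approximation hypothesis already applies.\<close>
  define n00 where "n00 = max 1 n0"
  define i0 where "i0 = n00"
  have i0: "n0 \<le> 2 ^ i0" unfolding i0_def n00_def by (meson less_exp less_imp_le max.cobounded2 order_trans)
  define m0 where "m0 = (2::nat) ^ i0"
  have m0: "1 \<le> m0" "n0 \<le> m0" using i0 by (auto simp: m0_def)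
  define X where "X = enn2real (wnorm p (avg_weight w m0) (poly (P m0)))"
  have X: "wnorm p (avg_weight w m0) (poly (P m0)) = ennreal X" "0 \<le> X"
    using wnorm_poly_finite[OF w p(1) m0(1), of "P m0"] by (auto simp: X_def less_top)
  have coarse: "wnorm p (avg_weight w n) g \<le> ennreal 4 * wnorm p (avg_weight w m) g"
    if "1 \<le> m" "m \<le> n" "n \<le> 2 * m" "g \<in> borel_measurable borel" for m n g
  proof (rule wnorm_weight_mono)
    fix x :: real assume x: "x \<in> {-1..1}"
    have "real n \<le> 2 * real m" using that(3) by linarith
    from avg_weight_le_coarser[OF w x that(1,2) this] show "avg_weight w n x \<le> 4 * avg_weight w m x" by simp
  qed (use that in auto)
  \<comment> \<open>A dyadic difference is measured with the weight of the finer index: the coarser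
    error costs a factor 4 for the change of weight and \<open>2 powr \<beta>\<close> for the change
    of index.\<close>
  define D3 where "D3 = C1 + 4 * (C1 * 2 powr \<beta>)"
  have D3: "0 \<le> D3" using C1 by (simp add: D3_def)
  define C where "C = B * (4 * (C1 * 2 powr \<beta>)) + B2 * D3 * Z + B2 * real m0 powr \<theta> * X + 1"
  have C: "0 < C" using B B2 C1 D3 Z X by (simp add: C_def add_nonneg_pos)
  show ?thesis
  proof (rule that[OF C])
    fix n :: nat and h :: real assume nm: "m0 \<le> n" and h: "0 < h" "h \<le> 1 / real n"
    let ?v = "avg_weight w n" and ?D = "\<lambda>g x. sym_difference r (h * phi x) g x"
    have n: "1 \<le> n" using nm m0 by simp
    have np: "0 < real n" using n by simp
    obtain N where N: "2 ^ N \<le> n" "n < 2 ^ Suc N"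
      using ex_power_ivl1[of 2 n] n by auto
    have iN: "i0 \<le> N"
    proof -
      have "(2::nat) ^ i0 < 2 ^ Suc N" using nm N by (simp add: m0_def)
      then have "i0 < Suc N" by (rule power_less_imp_less_exp[rotated]) simp
      then show ?thesis by simp
    qed
    have pw: "(2::nat) ^ i0 \<le> 2 ^ i" if "i0 \<le> i" for i using that by (intro power_increasing) auto
    define Q where "Q i = P (2 ^ Suc i) - P (2 ^ i)" for i
    have N0: "n0 \<le> 2 ^ i" if "i0 \<le> i" for i using pw[OF that] i0 by linarith
    have tel: "f x = (f x - poly (P (2 ^ N)) x) + ((\<Sum>i\<in>{i0..<N}. poly (Q i) x) + poly (P m0) x)" for x
    proof -
      have "(\<Sum>i\<in>{i0..<N}. poly (Q i) x) = poly (P (2 ^ N)) x - poly (P (2 ^ i0)) x"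
        using sum_Suc_diff'[OF iN, of "\<lambda>i. poly (P (2 ^ i)) x"] by (simp add: Q_def)
      then show ?thesis by (simp add: m0_def)
    qed
    have c1: "wnorm p ?v (?D (\<lambda>x. f x - poly (P (2 ^ N)) x)) \<le> ennreal (B * (4 * (C1 * 2 powr \<beta>)) * real n powr (- \<beta>))"
    proof -
      have "wnorm p ?v (?D (\<lambda>x. f x - poly (P (2 ^ N)) x)) \<le> ennreal B * wnorm p ?v (\<lambda>x. f x - poly (P (2 ^ N)) x)"
        by (rule B(2)[OF n h]) measurable
      also have "\<dots> \<le> ennreal B * (ennreal 4 * wnorm p (avg_weight w (2 ^ N)) (\<lambda>x. f x - poly (P (2 ^ N)) x))"
        using N by (intro mult_left_mono coarse) auto
      also have "\<dots> \<le> ennreal B * (ennreal 4 * ennreal (C1 * real (2 ^ N) powr (- \<beta>)))"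
        by (intro mult_left_mono P N0 iN) auto
      also have "\<dots> = ennreal (B * (4 * (C1 * real (2 ^ N) powr (- \<beta>))))"
        using B C1 by (simp flip: ennreal_mult' ennreal_numeral)
      also have "\<dots> \<le> ennreal (B * (4 * (C1 * (2 powr \<beta> * real n powr (- \<beta>)))))"
      proof (intro ennreal_leI mult_left_mono)
        have "real n \<le> 2 * 2 ^ N" using N(2) by (metis less_imp_le of_nat_le_iff of_nat_mult of_nat_numeral of_nat_power power_Suc)
        then have "real n powr \<beta> \<le> (2 * 2 ^ N) powr \<beta>" using \<beta> by (intro powr_mono2) auto
        then show "real (2 ^ N) powr (- \<beta>) \<le> 2 powr \<beta> * real n powr (- \<beta>)"
          using np by (simp add: powr_mult powr_minus field_simps)
      qed (use B C1 in auto)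
      finally show ?thesis by (simp add: mult_ac)
    qed
    have c2: "wnorm p ?v (?D (poly (Q i))) \<le> ennreal (B2 * D3 * real n powr (- \<theta>) * (2 ^ Suc i) powr \<kappa>)" if i: "i \<in> {i0..<N}" for i
    proof -
      let ?m = "(2::nat) ^ Suc i"
      have mn: "?m \<le> n" using power_increasing[of "Suc i" N "2::nat"] i N by auto
      have "degree (P ?m) \<le> ?m" "degree (P (2 ^ i)) \<le> 2 ^ i" using i by (intro P(1) N0; simp)+
      have nb: "n0 \<le> 2 ^ i" "n0 \<le> 2 ^ Suc i" using i by (intro N0; simp)+
      with \<open>degree (P ?m) \<le> ?m\<close> \<open>degree (P (2 ^ i)) \<le> 2 ^ i\<close> have dQ: "degree (Q i) \<le> ?m" unfolding Q_def by (intro degree_diff_le) auto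
      have "wnorm p (avg_weight w ?m) (poly (Q i)) \<le> wnorm p (avg_weight w ?m) (\<lambda>x. f x - poly (P (2 ^ i)) x) + wnorm p (avg_weight w ?m) (\<lambda>x. - (f x - poly (P ?m) x))"
        by (rule wnorm_add_le[OF p]) (auto simp: Q_def vnn)
      also have "\<dots> \<le> ennreal 4 * wnorm p (avg_weight w (2 ^ i)) (\<lambda>x. f x - poly (P (2 ^ i)) x) + wnorm p (avg_weight w ?m) (\<lambda>x. f x - poly (P ?m) x)"
        unfolding wnorm_uminus by (intro add_right_mono coarse) auto
      also have "\<dots> \<le> ennreal 4 * ennreal (C1 * real (2 ^ i) powr (- \<beta>)) + ennreal (C1 * real ?m powr (- \<beta>))"
        by (intro add_mono mult_left_mono P nb) auto
      also have "\<dots> = ennreal (4 * (C1 * real (2 ^ i) powr (- \<beta>)) + C1 * real ?m powr (- \<beta>))"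
        using C1 by (subst ennreal_plus) (auto simp: ennreal_mult' simp flip: ennreal_numeral)
      also have "4 * (C1 * real (2 ^ i) powr (- \<beta>)) + C1 * real ?m powr (- \<beta>) = D3 * (2 ^ Suc i) powr (- \<beta>)"
        by (simp add: D3_def powr_mult powr_minus field_simps)
      finally have q: "wnorm p (avg_weight w ?m) (poly (Q i)) \<le> ennreal (D3 * (2 ^ Suc i) powr (- \<beta>))" .
      have "wnorm p ?v (?D (poly (Q i))) \<le> ennreal (B2 * (real ?m / real n) powr \<theta>) * wnorm p (avg_weight w ?m) (poly (Q i))"
        by (rule B2(2)[OF _ mn dQ h]) auto
      also have "\<dots> \<le> ennreal (B2 * (real ?m / real n) powr \<theta>) * ennreal (D3 * (2 ^ Suc i) powr (- \<beta>))"
        by (intro mult_left_mono q) auto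
      also have "\<dots> = ennreal (B2 * (real ?m / real n) powr \<theta> * (D3 * (2 ^ Suc i) powr (- \<beta>)))"
        using B2 by (simp add: ennreal_mult')
      also have "B2 * (real ?m / real n) powr \<theta> * (D3 * (2 ^ Suc i) powr (- \<beta>)) = B2 * D3 * real n powr (- \<theta>) * ((2 ^ Suc i) powr \<theta> * (2 ^ Suc i) powr (- \<beta>))"
        using np by (simp add: powr_divide powr_minus field_simps)
      also have "(2 ^ Suc i) powr \<theta> * (2 ^ Suc i) powr (- \<beta>) = ((2::real) ^ Suc i) powr \<kappa>"
        unfolding \<kappa>_def by (simp flip: powr_add)
      finally show ?thesis .
    qed
    have c2s: "(\<Sum>i\<in>{i0..<N}. wnorm p ?v (?D (poly (Q i)))) \<le> ennreal (B2 * D3 * Z * real n powr (- \<beta>))"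
    proof -
      have "(\<Sum>i\<in>{i0..<N}. wnorm p ?v (?D (poly (Q i)))) \<le> (\<Sum>i\<in>{i0..<N}. ennreal (B2 * D3 * real n powr (- \<theta>) * (2 ^ Suc i) powr \<kappa>))"
        by (intro sum_mono c2)
      also have "\<dots> = ennreal (\<Sum>i\<in>{i0..<N}. B2 * D3 * real n powr (- \<theta>) * (2 ^ Suc i) powr \<kappa>)"
        using B2 D3 by (intro sum_ennreal) auto
      also have "\<dots> \<le> ennreal (B2 * D3 * real n powr (- \<theta>) * (real n powr \<kappa> * Z))"
      proof (rule ennreal_leI)
        have "(\<Sum>i\<in>{i0..<N}. (2 ^ Suc i) powr \<kappa>) \<le> (\<Sum>i<N. ((2::real) ^ Suc i) powr \<kappa>)"
          by (intro sum_mono2) auto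
        also have "\<dots> \<le> (2 ^ N) powr \<kappa> * Z" using sum_geometric_powr_le[OF \<kappa>, of N] by (simp add: Z_def)
        also have "\<dots> \<le> real n powr \<kappa> * Z"
        proof (intro mult_right_mono powr_mono2)
          show "2 ^ N \<le> real n" using N(1) by (metis of_nat_le_iff of_nat_numeral of_nat_power)
        qed (use \<kappa> Z in auto)
        finally have "(B2 * D3 * real n powr (- \<theta>)) * (\<Sum>i\<in>{i0..<N}. (2 ^ Suc i) powr \<kappa>) \<le> (B2 * D3 * real n powr (- \<theta>)) * (real n powr \<kappa> * Z)"
          using B2 D3 by (intro mult_left_mono) auto
        then show "(\<Sum>i\<in>{i0..<N}. B2 * D3 * real n powr (- \<theta>) * (2 ^ Suc i) powr \<kappa>) \<le> B2 * D3 * real n powr (- \<theta>) * (real n powr \<kappa> * Z)"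
          by (simp add: sum_distrib_left)
      qed
      also have "B2 * D3 * real n powr (- \<theta>) * (real n powr \<kappa> * Z) = B2 * D3 * Z * (real n powr (- \<theta>) * real n powr \<kappa>)" by simp
      also have "real n powr (- \<theta>) * real n powr \<kappa> = real n powr (- \<beta>)" by (simp add: \<kappa>_def flip: powr_add)
      finally show ?thesis .
    qed
    have c3: "wnorm p ?v (?D (poly (P m0))) \<le> ennreal (B2 * real m0 powr \<theta> * X * real n powr (- \<beta>))"
    proof -
      have "wnorm p ?v (?D (poly (P m0))) \<le> ennreal (B2 * (real m0 / real n) powr \<theta>) * ennreal X"
        using B2(2)[OF m0(1) nm P(1)[OF m0(2)] h] X by simp
      also have "\<dots> = ennreal (B2 * (real m0 / real n) powr \<theta> * X)" using B2 by (simp add: ennreal_mult')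
      also have "\<dots> \<le> ennreal (B2 * (real m0 powr \<theta> * real n powr (- \<beta>)) * X)"
      proof (intro ennreal_leI mult_right_mono mult_left_mono)
        have "real n powr (- \<theta>) \<le> real n powr (- \<beta>)" using n \<beta> by (intro powr_mono) (auto simp: \<theta>_def)
        then have "real m0 powr \<theta> * real n powr (- \<theta>) \<le> real m0 powr \<theta> * real n powr (- \<beta>)" by (intro mult_left_mono) auto
        then show "(real m0 / real n) powr \<theta> \<le> real m0 powr \<theta> * real n powr (- \<beta>)"
          using np by (simp add: powr_divide powr_minus field_simps)
      qed (use B2 X in auto)
      finally show ?thesis by (simp add: mult_ac)
    qed
    have "wnorm p ?v (?D f) \<le> wnorm p ?v (?D (\<lambda>x. f x - poly (P (2 ^ N)) x)) + wnorm p ?v (\<lambda>x. (\<Sum>i\<in>{i0..<N}. ?D (poly (Q i)) x) + ?D (poly (P m0)) x)"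
    proof (rule wnorm_add_le[OF p])
      fix x :: real
      show "?D f x = ?D (\<lambda>x. f x - poly (P (2 ^ N)) x) x + ((\<Sum>i\<in>{i0..<N}. ?D (poly (Q i)) x) + ?D (poly (P m0)) x)"
        unfolding sym_difference_sum[symmetric] sym_difference_add[symmetric] using tel by simp
    qed (auto simp: vnn)
    also have "\<dots> \<le> wnorm p ?v (?D (\<lambda>x. f x - poly (P (2 ^ N)) x)) + (wnorm p ?v (\<lambda>x. \<Sum>i\<in>{i0..<N}. ?D (poly (Q i)) x) + wnorm p ?v (?D (poly (P m0))))"
      by (intro add_left_mono wnorm_add_le[OF p]) (auto simp: vnn)
    also have "\<dots> \<le> wnorm p ?v (?D (\<lambda>x. f x - poly (P (2 ^ N)) x)) + ((\<Sum>i\<in>{i0..<N}. wnorm p ?v (?D (poly (Q i)))) + wnorm p ?v (?D (poly (P m0))))"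
      by (intro add_left_mono add_right_mono wnorm_sum_le[OF p]) (auto simp: vnn)
    also have "\<dots> \<le> ennreal (B * (4 * (C1 * 2 powr \<beta>)) * real n powr (- \<beta>)) + (ennreal (B2 * D3 * Z * real n powr (- \<beta>)) + ennreal (B2 * real m0 powr \<theta> * X * real n powr (- \<beta>)))"
      by (intro add_mono c1 c2s c3)
    also have "\<dots> = ennreal ((B * (4 * (C1 * 2 powr \<beta>)) + (B2 * D3 * Z + B2 * real m0 powr \<theta> * X)) * real n powr (- \<beta>))"
      using B B2 C1 D3 Z X by (simp add: distrib_right flip: ennreal_plus)
    also have "\<dots> \<le> ennreal (C * real n powr (- \<beta>))"
      by (intro ennreal_leI mult_right_mono) (auto simp: C_def)
    finally show "wnorm p ?v (?D f) \<le> ennreal (C * real n powr (- \<beta>))" .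
  qed
qed

subsection \<open>Polynomials on lattices and intervals\<close>

text \<open>Newton's formula with errors. By induction the first differences are close to a
  combination of binomials; summation over \<open>k\<close> raises the lower index of every binomial
  by one and multiplies the error by at most \<open>K\<close>, which accounts for
  \<open>K ^ r\<close>.\<close>

lemma newton_lattice:
  assumes "\<And>k. k + r \<le> K \<Longrightarrow> \<bar>fdiff r h f (x0 + real k * h)\<bar> \<le> \<sigma>" and "0 \<le> \<sigma>"
  shows "\<exists>b. \<forall>k\<le>K. \<bar>f (x0 + real k * h) - (\<Sum>j<r. b j * real (k choose j))\<bar> \<le> real K ^ r * \<sigma>"
  using assms
proof (induction r arbitrary: f K)
  case 0
  then show ?case by (simp add: fdiff_0)
next
  case (Suc r)
  show ?case
  proof (cases K)
    case 0
    then show ?thesis using Suc.prems(2)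
      by (intro exI[of _ "\<lambda>_. f x0"]) (simp add: sum.lessThan_Suc_shift del: sum.lessThan_Suc)
  next
    case (Suc J)
    define f' where "f' y = f (y + h) - f y" for y
    have "\<exists>b. \<forall>k\<le>J. \<bar>f' (x0 + real k * h) - (\<Sum>j<r. b j * real (k choose j))\<bar> \<le> real J ^ r * \<sigma>"
    proof (rule Suc.IH[OF _ Suc.prems(2)])
      fix k assume "k + r \<le> J"
      then show "\<bar>fdiff r h f' (x0 + real k * h)\<bar> \<le> \<sigma>"
        using Suc.prems(1)[of k] Suc by (simp add: fdiff_Suc' f'_def[abs_def])
    qed
    then obtain b where b: "\<And>k. k \<le> J \<Longrightarrow> \<bar>f' (x0 + real k * h) - (\<Sum>j<r. b j * real (k choose j))\<bar> \<le> real J ^ r * \<sigma>" by blast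
    \<comment> \<open>Summing \<open>k choose j\<close> gives \<open>k choose (j + 1)\<close>, so
      the coefficients are shifted by one and the value at the first node becomes the constant
      term.\<close>
    define c where "c j = (case j of 0 \<Rightarrow> f x0 | Suc i \<Rightarrow> b i)" for j
    define e where "e k = f (x0 + real k * h) - (\<Sum>j<Suc r. c j * real (k choose j))" for k
    have step: "\<bar>e (Suc k) - e k\<bar> \<le> real J ^ r * \<sigma>" if "k \<le> J" for k
    proof -
      have "e (Suc k) - e k = f' (x0 + real k * h) - (\<Sum>j<r. b j * real (k choose j))"
        by (simp add: e_def f'_def sum.lessThan_Suc_shift c_def algebra_simps sum.distrib del: sum.lessThan_Suc)
      then show ?thesis using b[OF that] by simp
    qed
    have "k \<le> K \<Longrightarrow> \<bar>e k\<bar> \<le> real k * (real J ^ r * \<sigma>)" for k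
    proof (induction k)
      case 0
      then show ?case by (simp add: e_def c_def sum.lessThan_Suc_shift del: sum.lessThan_Suc)
    next
      case (Suc k)
      then have "\<bar>e (Suc k)\<bar> \<le> real k * (real J ^ r * \<sigma>) + real J ^ r * \<sigma>"
        using step[of k] \<open>K = Suc J\<close> by simp
      then show ?case by (simp add: algebra_simps)
    qed
    moreover have "real k * (real J ^ r * \<sigma>) \<le> real K ^ Suc r * \<sigma>" if "k \<le> K" for k
    proof -
      have "real k * (real J ^ r * \<sigma>) \<le> real K * (real K ^ r * \<sigma>)"
        using that Suc \<open>0 \<le> \<sigma>\<close> by (intro mult_mono mult_right_mono power_mono) auto
      then show ?thesis by simp
    qed
    ultimately show ?thesis by (intro exI[of _ c]) (force simp: e_def)
  qed
qed

lemma binomial_poly: "\<exists>B. degree B \<le> j \<and> (\<forall>k. poly B (real k) = real (k choose j))"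
proof (intro exI[of _ "smult (1 / fact j) (\<Prod>i<j. [:- real i, 1:])"] conjI allI)
  have "degree (\<Prod>i<j. [:- real i, 1:]) \<le> j"
    using degree_prod_sum_le[of "{..<j}" "\<lambda>i. [:- real i, 1:]"] by simp
  then show "degree (smult (1 / fact j) (\<Prod>i<j. [:- real i, 1:])) \<le> j" by simp
  fix k
  show "poly (smult (1 / fact j) (\<Prod>i<j. [:- real i, 1:])) (real k) = real (k choose j)"
    by (simp add: binomial_gbinomial gbinomial_prod_rev poly_prod atLeast0LessThan)
qed

lemma lattice_poly:
  assumes "\<And>k. k + r \<le> K \<Longrightarrow> \<bar>fdiff r h f (x0 + real k * h)\<bar> \<le> \<sigma>" and "0 \<le> \<sigma>" and r: "1 \<le> r" and h: "h \<noteq> 0"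
  obtains P where "degree P \<le> r - 1" "\<And>k. k \<le> K \<Longrightarrow> \<bar>f (x0 + real k * h) - poly P (x0 + real k * h)\<bar> \<le> real K ^ r * \<sigma>"
proof -
  obtain b where b: "\<And>k. k \<le> K \<Longrightarrow> \<bar>f (x0 + real k * h) - (\<Sum>j<r. b j * real (k choose j))\<bar> \<le> real K ^ r * \<sigma>"
    using newton_lattice[of r K h f x0 \<sigma>] assms by blast
  obtain B where B: "\<And>j. degree (B j) \<le> j" "\<And>j k. poly (B j) (real k) = real (k choose j)"
    using binomial_poly by metis
  define Q where "Q = (\<Sum>j<r. smult (b j) (B j))"
  have dQ: "degree Q \<le> r - 1"
    unfolding Q_def by (intro degree_sum_le) (auto intro: order_trans[OF degree_smult_le] order_trans[OF B(1)])
  show ?thesis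
  proof (rule that[of "pcompose Q [:- x0 / h, 1 / h:]"])
    show "degree (pcompose Q [:- x0 / h, 1 / h:]) \<le> r - 1"
      using dQ h by (simp add: degree_pcompose)
    show "\<bar>f (x0 + real k * h) - poly (pcompose Q [:- x0 / h, 1 / h:]) (x0 + real k * h)\<bar> \<le> real K ^ r * \<sigma>" if "k \<le> K" for k
    proof -
      have "poly [:- x0 / h, 1 / h:] (x0 + real k * h) = real k" using h by (simp add: field_simps)
      then have "poly (pcompose Q [:- x0 / h, 1 / h:]) (x0 + real k * h) = (\<Sum>j<r. b j * real (k choose j))"
        by (simp add: poly_pcompose Q_def poly_sum B)
      then show ?thesis using b[OF that] by simp
    qed
  qed
qed

section \<open>Equivalence of norms on polynomials of fixed degree\<close>

lemma poly_eq_on_interval: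
  fixes P Q :: "real poly"
  assumes "\<And>x. x \<in> {-1..1} \<Longrightarrow> poly P x = poly Q x"
  shows "P = Q"
proof (rule ccontr)
  assume "P \<noteq> Q"
  then have "finite {x. poly (P - Q) x = 0}" by (intro poly_roots_finite) auto
  moreover have "{-1..1} \<subseteq> {x. poly (P - Q) x = 0}" using assms by auto
  ultimately have "finite {-1..1::real}" by (rule rev_finite_subset)
  then show False using infinite_Icc[of "-1" "1::real"] by simp
qed

lemma poly_growth: "\<bar>x\<bar> \<ge> 1 \<Longrightarrow> degree Q \<le> d \<Longrightarrow> \<bar>poly Q x\<bar> \<le> (\<Sum>i\<le>d. \<bar>coeff Q i\<bar>) * \<bar>x\<bar> ^ d" for x :: real
proof -
  assume x: "\<bar>x\<bar> \<ge> 1" and d: "degree Q \<le> d"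
  have "poly Q x = (\<Sum>i\<le>d. coeff Q i * x ^ i)"
    unfolding poly_altdef using d by (intro sum.mono_neutral_left) (auto simp: coeff_eq_0)
  also have "\<bar>\<dots>\<bar> \<le> (\<Sum>i\<le>d. \<bar>coeff Q i\<bar> * \<bar>x\<bar> ^ d)"
    using x by (intro order_trans[OF sum_abs] sum_mono) (auto simp: abs_mult power_abs intro!: mult_left_mono power_increasing)
  finally show ?thesis by (simp add: sum_distrib_right)
qed

lemma pderiv_sum: "pderiv (\<Sum>i\<in>I. f i) = (\<Sum>i\<in>I. pderiv (f i))"
  by (induction I rule: infinite_finite_induct) (auto simp: pderiv_add)

text \<open>Equivalence of norms on a finite-dimensional space, made explicit: the Chebyshev
  coefficients are at most \<open>pi * S\<close>, and each Chebyshev polynomial has some bound for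
  its derivative on \<open>[-1, 1]\<close> and for its growth outside.\<close>

lemma poly_sup_norms:
  obtains C where "0 < C" "\<And>(Q::real poly) S. degree Q \<le> d \<Longrightarrow> (\<And>x. x \<in> {-1..1} \<Longrightarrow> \<bar>poly Q x\<bar> \<le> S) \<Longrightarrow>
     (\<forall>x\<in>{-1..1}. \<bar>poly (pderiv Q) x\<bar> \<le> C * S) \<and> (\<forall>x. 1 \<le> \<bar>x\<bar> \<longrightarrow> \<bar>poly Q x\<bar> \<le> C * S * \<bar>x\<bar> ^ d)"
proof -
  obtain T where T: "\<And>j. degree (T j) \<le> j" "\<And>j t. poly (T j) (cos t) = cos (real j * t)"
    using cos_mult_poly by metis
  have "\<exists>c. \<forall>x\<in>{-1..1}. \<bar>poly (pderiv (T j)) x\<bar> \<le> c" for j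
  proof -
    have "\<exists>x\<in>{-1..1::real}. \<forall>y\<in>{-1..1}. \<bar>poly (pderiv (T j)) y\<bar> \<le> \<bar>poly (pderiv (T j)) x\<bar>"
      by (rule continuous_attains_sup) (auto intro!: continuous_intros)
    then show ?thesis by blast
  qed
  then obtain c where c: "\<And>j x. x \<in> {-1..1} \<Longrightarrow> \<bar>poly (pderiv (T j)) x\<bar> \<le> c j" by metis
  have c0: "0 \<le> c j" for j using c[of 0 j] by (simp add: order_trans[OF abs_ge_zero])
  define s where "s j = (\<Sum>i\<le>d. \<bar>coeff (T j) i\<bar>)" for j
  have s0: "0 \<le> s j" for j by (simp add: s_def sum_nonneg)
  define C where "C = (\<Sum>j\<le>d. pi * (c j + s j)) + 1"
  have C: "0 < C" using c0 s0 by (simp add: C_def add_nonneg_pos sum_nonneg)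
  show ?thesis
  proof (rule that[OF C])
    fix Q :: "real poly" and S assume Q: "degree Q \<le> d" and S: "\<And>x::real. x \<in> {-1..1} \<Longrightarrow> \<bar>poly Q x\<bar> \<le> S"
    have S0: "0 \<le> S" using S[of 0] by simp
    obtain b where b: "\<And>t. poly Q (cos t) = (\<Sum>j\<le>d. b j * cos (real j * t))"
      using cos_sum_poly[OF Q] by (auto simp: cos_sum_def)
    have bj: "\<bar>b j\<bar> \<le> pi * S" if "j \<le> d" for j
    proof -
      have "\<bar>b j\<bar> \<le> integral {0..pi} (\<lambda>t. \<bar>poly Q (cos t)\<bar>)"
        using cos_coeff_bound[where f = "\<lambda>t. poly Q (cos t)" and N = d and b = b and k = j, OF b that] .
      also have "\<dots> \<le> integral {0..pi} (\<lambda>t. S)"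
        by (intro integral_le integrable_continuous_interval continuous_intros S) auto
      finally show ?thesis by simp
    qed
    have e: "Q = (\<Sum>j\<le>d. smult (b j) (T j))"
    proof (rule poly_eq_on_interval)
      fix x :: real assume "x \<in> {-1..1}"
      then have "x = cos (arccos x)" by simp
      then show "poly Q x = poly (\<Sum>j\<le>d. smult (b j) (T j)) x"
        by (metis (no_types, lifting) b T(2) poly_smult poly_sum sum.cong)
    qed
    have 1: "\<bar>poly (pderiv Q) x\<bar> \<le> C * S" if x: "x \<in> {-1..1}" for x
    proof -
      have "poly (pderiv Q) x = (\<Sum>j\<le>d. b j * poly (pderiv (T j)) x)"
        by (subst e) (simp add: pderiv_sum pderiv_smult poly_sum)
      also have "\<bar>\<dots>\<bar> \<le> (\<Sum>j\<le>d. pi * S * (c j + s j))"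
        using S0 by (intro order_trans[OF sum_abs] sum_mono)
          (auto simp: abs_mult intro!: mult_mono bj c x order_trans[OF c[OF x]] s0)
      also have "\<dots> = (C - 1) * S" by (simp add: C_def sum_distrib_left mult_ac)
      also have "\<dots> \<le> C * S" using S0 by (intro mult_right_mono) auto
      finally show ?thesis .
    qed
    have 2: "\<bar>poly Q x\<bar> \<le> C * S * \<bar>x\<bar> ^ d" if x: "1 \<le> \<bar>x\<bar>" for x
    proof -
      have "poly Q x = (\<Sum>j\<le>d. b j * poly (T j) x)" by (subst e) (simp add: poly_sum)
      also have "\<bar>\<dots>\<bar> \<le> (\<Sum>j\<le>d. pi * S * ((c j + s j) * \<bar>x\<bar> ^ d))"
      proof (intro order_trans[OF sum_abs] sum_mono)
        fix j assume j: "j \<in> {..d}"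
        have "\<bar>poly (T j) x\<bar> \<le> s j * \<bar>x\<bar> ^ d" unfolding s_def
          using T(1)[of j] j by (intro poly_growth[OF x]) auto
        also have "\<dots> \<le> (c j + s j) * \<bar>x\<bar> ^ d" using c0[of j] by (intro mult_right_mono) auto
        finally show "\<bar>b j * poly (T j) x\<bar> \<le> pi * S * ((c j + s j) * \<bar>x\<bar> ^ d)"
          unfolding abs_mult using bj[of j] j S0 by (intro mult_mono) auto
      qed
      also have "\<dots> = (C - 1) * S * \<bar>x\<bar> ^ d" by (simp add: C_def sum_distrib_left mult_ac)
      also have "\<dots> \<le> C * S * \<bar>x\<bar> ^ d" using S0 by (intro mult_right_mono) auto
      finally show ?thesis .
    qed
    show "(\<forall>x\<in>{-1..1}. \<bar>poly (pderiv Q) x\<bar> \<le> C * S) \<and> (\<forall>x. 1 \<le> \<bar>x\<bar> \<longrightarrow> \<bar>poly Q x\<bar> \<le> C * S * \<bar>x\<bar> ^ d)"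
      using 1 2 by blast
  qed
qed

lemma poly_markov_interval:
  fixes a b :: real
  assumes "a < b"
  obtains C where "0 < C" "\<And>(P::real poly) S x. degree P \<le> d \<Longrightarrow> (\<And>x. x \<in> {a..b} \<Longrightarrow> \<bar>poly P x\<bar> \<le> S) \<Longrightarrow> x \<in> {a..b} \<Longrightarrow> \<bar>poly (pderiv P) x\<bar> \<le> C * S"
proof -
  obtain C where C: "0 < C" "\<And>(Q::real poly) S. degree Q \<le> d \<Longrightarrow> (\<And>x. x \<in> {-1..1} \<Longrightarrow> \<bar>poly Q x\<bar> \<le> S) \<Longrightarrow>
     (\<forall>x\<in>{-1..1}. \<bar>poly (pderiv Q) x\<bar> \<le> C * S) \<and> (\<forall>x. 1 \<le> \<bar>x\<bar> \<longrightarrow> \<bar>poly Q x\<bar> \<le> C * S * \<bar>x\<bar> ^ d)"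
    by (rule poly_sup_norms[of d]) blast
  define m l where "m = (a + b) / 2" and "l = (b - a) / 2"
  have l: "0 < l" using assms by (simp add: l_def)
  have ab: "a = m - l" "b = m + l" by (auto simp: m_def l_def field_simps)
  show ?thesis
  proof (rule that[of "C / l"])
    show "0 < C / l" using C l by simp
    fix P :: "real poly" and S x assume P: "degree P \<le> d" and S: "\<And>x. x \<in> {a..b} \<Longrightarrow> \<bar>poly P x\<bar> \<le> S" and x: "x \<in> {a..b}"
    define Q where "Q = pcompose P [:m, l:]"
    have dQ: "degree Q \<le> d" using P l by (simp add: Q_def degree_pcompose)
    have Sq: "\<bar>poly Q y\<bar> \<le> S" if y: "y \<in> {-1..1}" for y
    proof -
      have "\<bar>y * l\<bar> \<le> 1 * l" unfolding abs_mult using y l by (intro mult_mono) auto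
      then have "m + y * l \<in> {a..b}" using ab by auto
      then show ?thesis using S by (simp add: Q_def poly_pcompose)
    qed
    have "(x - m) / l \<in> {-1..1}" using x l ab by (simp add: field_simps)
    then have "\<bar>poly (pderiv Q) ((x - m) / l)\<bar> \<le> C * S" using C(2)[OF dQ Sq] by blast
    moreover have "poly (pderiv Q) ((x - m) / l) = poly (pderiv P) x * l"
      using l by (simp add: Q_def pderiv_pcompose poly_pcompose pderiv_pCons)
    ultimately show "\<bar>poly (pderiv P) x\<bar> \<le> C / l * S" using l by (simp add: abs_mult field_simps)
  qed
qed

text \<open>The case of the constant weight in the interior estimate compares the supremum with the \<open>L\<^sub>p\<close> norm.\<close>

lemma poly_Lp_growth:
  assumes p: "0 < p" "p \<le> 1"
  obtains C where "0 < C" "\<And>Q x. degree Q \<le> d \<Longrightarrow>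
     ennreal (\<bar>poly Q x\<bar> powr p) \<le> ennreal (C * (1 + \<bar>x\<bar>) powr (real d * p)) * (\<integral>\<^sup>+y\<in>{-1..1}. ennreal (\<bar>poly Q y\<bar> powr p) \<partial>lborel)"
proof -
  define n where "n = max 1 d"
  have n: "1 \<le> n" "d \<le> n" by (auto simp: n_def)
  \<comment> \<open>With decay exponent 0 the local integral is the full integral in the
    angle.\<close>
  obtain C1 where C1: "0 < C1" "\<And>n Q t. 1 \<le> n \<Longrightarrow> degree Q \<le> n \<Longrightarrow> t \<in> {0..pi} \<Longrightarrow>
      ennreal (\<bar>poly Q (cos t)\<bar> powr p) \<le> ennreal (C1 * real n) * loc_int p 0 n Q t"
    by (rule poly_pointwise[OF p, where K = 0]) blast
  \<comment> \<open>The constant weight is slow with exponent 0, so the integral in the angle is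
    dominated by its interior part, where \<open>sin t\<close> is bounded below and the Jacobian can
    be inserted.\<close>
  obtain \<delta> A where \<delta>: "0 < \<delta>" "0 < A" and
    I: "\<And>n Q V. 1 \<le> n \<Longrightarrow> degree Q \<le> n \<Longrightarrow> slow 1 0 n V \<Longrightarrow>
       wint p Q V 0 pi \<le> ennreal A * wint p Q V (\<delta> / real n) (pi - \<delta> / real n)"
    by (rule wint_interior[OF p, where k = 0 and C = 1]) auto
  obtain C2 where C2: "0 < C2" "\<And>(Q::real poly) S. degree Q \<le> d \<Longrightarrow> (\<And>x. x \<in> {-1..1} \<Longrightarrow> \<bar>poly Q x\<bar> \<le> S) \<Longrightarrow>
     (\<forall>x\<in>{-1..1}. \<bar>poly (pderiv Q) x\<bar> \<le> C2 * S) \<and> (\<forall>x. 1 \<le> \<bar>x\<bar> \<longrightarrow> \<bar>poly Q x\<bar> \<le> C2 * S * \<bar>x\<bar> ^ d)"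
    by (rule poly_sup_norms[of d]) blast
  define c where "c = \<delta> / real n / 2"
  have c: "0 < c" using \<delta> n by (simp add: c_def)
  define D where "D = C1 * real n * (A * (1 / c))"
  have D: "0 < D" using C1 n \<delta> c by (simp add: D_def)
  define C where "C = D * (max 1 C2) powr p"
  have C: "0 < C" using D by (simp add: C_def)
  show ?thesis
  proof (rule that[OF C])
    fix Q :: "real poly" and x :: real assume Q: "degree Q \<le> d"
    define J where "J = (\<integral>\<^sup>+y\<in>{-1..1}. ennreal (\<bar>poly Q y\<bar> powr p) \<partial>lborel)"
    have dn: "degree Q \<le> n" using Q n by simp
    have sl: "slow 1 0 n (\<lambda>_. 1)" by (simp add: slow_def)
    have "wint p Q (\<lambda>_. 1) (\<delta> / real n) (pi - \<delta> / real n) \<le> (\<integral>\<^sup>+t. ennreal (1 / c) * (ennreal (\<bar>poly Q (cos t)\<bar> powr p) * ennreal (sin t) * indicator {0..pi} t) \<partial>lborel)"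
      unfolding wint_def
    proof (rule nn_integral_mono)
      fix t :: real
      show "ennreal (\<bar>poly Q (cos t)\<bar> powr p * 1) * indicator {\<delta> / real n..pi - \<delta> / real n} t \<le> ennreal (1 / c) * (ennreal (\<bar>poly Q (cos t)\<bar> powr p) * ennreal (sin t) * indicator {0..pi} t)"
      proof (cases "t \<in> {\<delta> / real n..pi - \<delta> / real n}")
        case True
        have "0 < \<delta> / real n" using \<delta> n by simp
        then have t: "t \<in> {0..pi}" using True by auto
        have "c \<le> sin t" unfolding c_def using True \<open>0 < \<delta> / real n\<close> by (intro sin_interior) auto
        then have "1 \<le> 1 / c * sin t" using c by (simp add: field_simps)
        then have "\<bar>poly Q (cos t)\<bar> powr p * 1 \<le> \<bar>poly Q (cos t)\<bar> powr p * (1 / c * sin t)" by (intro mult_left_mono) auto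
        then have "\<bar>poly Q (cos t)\<bar> powr p \<le> 1 / c * (\<bar>poly Q (cos t)\<bar> powr p * sin t)" by (simp add: mult_ac)
        then show ?thesis using True t c by (simp add: ennreal_leI flip: ennreal_mult')
      qed simp
    qed
    also have "\<dots> = ennreal (1 / c) * J"
      unfolding J_def by (subst nn_integral_cos_subst, measurable) (rule nn_integral_cmult, measurable)
    finally have w: "wint p Q (\<lambda>_. 1) (\<delta> / real n) (pi - \<delta> / real n) \<le> ennreal (1 / c) * J" .
    have sup: "ennreal (\<bar>poly Q y\<bar> powr p) \<le> ennreal D * J" if y: "y \<in> {-1..1}" for y
    proof -
      have t: "arccos y \<in> {0..pi}" "cos (arccos y) = y" using y by (auto simp: arccos_lbound arccos_ubound)
      have "ennreal (\<bar>poly Q y\<bar> powr p) \<le> ennreal (C1 * real n) * loc_int p 0 n Q (arccos y)"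
        using C1(2)[OF n(1) dn t(1)] t(2) by simp
      also have "loc_int p 0 n Q (arccos y) = wint p Q (\<lambda>_. 1) 0 pi" by (simp add: loc_int_def wint_def)
      also have "ennreal (C1 * real n) * wint p Q (\<lambda>_. 1) 0 pi \<le> ennreal (C1 * real n) * (ennreal A * (ennreal (1 / c) * J))"
        by (intro mult_left_mono order_trans[OF I[OF n(1) dn sl]] w) auto
      also have "\<dots> = ennreal D * J"
        unfolding D_def using C1 n \<delta> by (simp only: ennreal_mult_assoc mult_nonneg_nonneg less_imp_le of_nat_0_le_iff)
      finally show ?thesis .
    qed
    obtain z where z: "z \<in> {-1..1}" "\<And>y. y \<in> {-1..1} \<Longrightarrow> \<bar>poly Q y\<bar> \<le> \<bar>poly Q z\<bar>"
    proof -
      have "\<exists>x\<in>{-1..1::real}. \<forall>y\<in>{-1..1}. \<bar>poly Q y\<bar> \<le> \<bar>poly Q x\<bar>"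
        by (rule continuous_attains_sup) (auto intro!: continuous_intros)
      then show ?thesis using that by blast
    qed
    have "\<bar>poly Q x\<bar> \<le> max 1 C2 * \<bar>poly Q z\<bar> * (1 + \<bar>x\<bar>) ^ d"
    proof (cases "\<bar>x\<bar> \<le> 1")
      case True
      then have "\<bar>poly Q x\<bar> \<le> 1 * \<bar>poly Q z\<bar> * 1" using z(2)[of x] by (auto simp: abs_le_iff)
      also have "\<dots> \<le> max 1 C2 * \<bar>poly Q z\<bar> * (1 + \<bar>x\<bar>) ^ d" by (intro mult_mono) auto
      finally show ?thesis .
    next
      case False
      then have "\<bar>poly Q x\<bar> \<le> C2 * \<bar>poly Q z\<bar> * \<bar>x\<bar> ^ d" using C2(2)[OF Q z(2)] by simp
      also have "\<dots> \<le> max 1 C2 * \<bar>poly Q z\<bar> * (1 + \<bar>x\<bar>) ^ d" by (intro mult_mono power_mono) auto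
      finally show ?thesis .
    qed
    then have "\<bar>poly Q x\<bar> powr p \<le> (max 1 C2 * \<bar>poly Q z\<bar> * (1 + \<bar>x\<bar>) ^ d) powr p" using p by (intro powr_mono2) auto
    also have "\<dots> = (max 1 C2) powr p * (1 + \<bar>x\<bar>) powr (real d * p) * \<bar>poly Q z\<bar> powr p"
      by (simp add: powr_mult powr_powr add_pos_nonneg flip: powr_realpow)
    finally have "ennreal (\<bar>poly Q x\<bar> powr p) \<le> ennreal ((max 1 C2) powr p * (1 + \<bar>x\<bar>) powr (real d * p)) * ennreal (\<bar>poly Q z\<bar> powr p)"
      by (simp add: ennreal_leI flip: ennreal_mult')
    also have "\<dots> \<le> ennreal ((max 1 C2) powr p * (1 + \<bar>x\<bar>) powr (real d * p)) * (ennreal D * J)"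
      by (intro mult_left_mono sup z) auto
    also have "\<dots> = ennreal (C * (1 + \<bar>x\<bar>) powr (real d * p)) * J"
      by (subst ennreal_mult_assoc) (auto simp: C_def mult_ac)
    finally show "ennreal (\<bar>poly Q x\<bar> powr p) \<le> ennreal (C * (1 + \<bar>x\<bar>) powr (real d * p)) * (\<integral>\<^sup>+y\<in>{-1..1}. ennreal (\<bar>poly Q y\<bar> powr p) \<partial>lborel)"
      by (simp add: J_def)
  qed
qed

subsection \<open>Averaged differences\<close>

definition dcell :: "real \<Rightarrow> nat \<Rightarrow> (real \<Rightarrow> real) \<Rightarrow> real \<Rightarrow> real \<Rightarrow> ennreal" where
  "dcell p r f h x = (if 0 \<le> h \<and> 0 \<le> x \<and> x + real r * h \<le> 1 then ennreal (\<bar>fdiff r h f x\<bar> powr p) else 0)"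

text \<open>An averaged modulus of smoothness on \<open>[0, 1]\<close>: the supremum over the step
  is replaced by an integral over all admissible pairs of step and left node. Such integrals can be
  added over the cells of a covering, which suprema do not allow.\<close>

definition dint :: "real \<Rightarrow> nat \<Rightarrow> (real \<Rightarrow> real) \<Rightarrow> ennreal" where
  "dint p r f = (\<integral>\<^sup>+h. (\<integral>\<^sup>+x. dcell p r f h x \<partial>lborel) \<partial>lborel)"

definition uint :: "real \<Rightarrow> (real \<Rightarrow> real) \<Rightarrow> ennreal" where
  "uint p f = (\<integral>\<^sup>+x\<in>{0..1}. ennreal (\<bar>f x\<bar> powr p) \<partial>lborel)"

lemma fdiff_measurable_pair [measurable (raw)]:
  assumes [measurable]: "f \<in> borel_measurable borel" "a \<in> borel_measurable M" "b \<in> borel_measurable M"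
  shows "(\<lambda>z. fdiff r (a z) f (b z)) \<in> borel_measurable M"
  unfolding fdiff_def by measurable

lemma dcell_measurable [measurable (raw)]:
  assumes [measurable]: "f \<in> borel_measurable borel" "a \<in> borel_measurable M" "b \<in> borel_measurable M"
  shows "(\<lambda>z. dcell p r f (a z) (b z)) \<in> borel_measurable M"
  unfolding dcell_def by measurable

text \<open>Solves the difference for a node whose binomial coefficient is 1; it is used with the
  two end nodes \<open>j = 0\<close> and \<open>j = r\<close>.\<close>

lemma fdiff_isolate:
  assumes p: "0 < p" "p \<le> 1" and j: "j \<le> r" "r choose j = 1"
    and \<Lambda>: "\<And>i. i \<le> r \<Longrightarrow> i \<noteq> j \<Longrightarrow> \<bar>e (z + real i * h)\<bar> powr p \<le> \<Lambda>"
  shows "\<bar>e (z + real j * h)\<bar> powr p \<le> \<bar>fdiff r h e z\<bar> powr p + real r * 2 ^ r * \<Lambda>"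
proof -
  let ?a = "\<lambda>i. real (r choose i) * (-1) ^ (r - i) * e (z + real i * h)"
  have "fdiff r h e z = ?a j + (\<Sum>i\<in>{..r} - {j}. ?a i)"
    unfolding fdiff_def using j by (intro sum.remove) auto
  then have "\<bar>e (z + real j * h)\<bar> = \<bar>fdiff r h e z - (\<Sum>i\<in>{..r} - {j}. ?a i)\<bar>"
    using j by (simp add: abs_mult power_abs)
  also have "\<dots> \<le> \<bar>fdiff r h e z\<bar> + \<bar>\<Sum>i\<in>{..r} - {j}. ?a i\<bar>" by (rule abs_triangle_ineq4)
  finally have "\<bar>e (z + real j * h)\<bar> powr p \<le> (\<bar>fdiff r h e z\<bar> + \<bar>\<Sum>i\<in>{..r} - {j}. ?a i\<bar>) powr p"
    using p by (intro powr_mono2) auto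
  also have "\<dots> \<le> \<bar>fdiff r h e z\<bar> powr p + \<bar>\<Sum>i\<in>{..r} - {j}. ?a i\<bar> powr p"
    using p by (intro powr_add_le) auto
  also have "\<bar>\<Sum>i\<in>{..r} - {j}. ?a i\<bar> powr p \<le> (\<Sum>i\<in>{..r} - {j}. \<bar>?a i\<bar> powr p)" by (rule powr_sum_le[OF p])
  also have "\<dots> \<le> (\<Sum>i\<in>{..r} - {j}. 2 ^ r * \<Lambda>)"
    by (intro sum_mono order_trans[OF binomial_powr_le[OF p]] mult_left_mono \<Lambda>) auto
  also have "\<dots> = real r * 2 ^ r * \<Lambda>" using j by simp
  finally show ?thesis by simp
qed

text \<open>For fixed \<open>x\<close>, the steps that send the \<open>i\<close>-th node into
  \<open>B\<close> form a set whose measure is that of \<open>B\<close> divided by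
  \<open>i\<close>.\<close>

lemma nn_integral_scaled_bad:
  fixes x s :: real
  assumes [measurable]: "B \<in> sets borel" and i: "1 \<le> i" and s: "\<bar>s\<bar> = 1" and B: "emeasure lborel B \<le> ennreal \<eta>"
  shows "(\<integral>\<^sup>+h. indicator B (x + s * real i * h) \<partial>lborel) \<le> ennreal \<eta>"
proof -
  have c: "s * real i \<noteq> 0" using i s by auto
  have "emeasure lborel B = (\<integral>\<^sup>+y. indicator B y \<partial>lborel)" by simp
  also have "\<dots> = ennreal \<bar>s * real i\<bar> * (\<integral>\<^sup>+h. indicator B (x + s * real i * h) \<partial>lborel)"
    by (rule nn_integral_real_affine[OF _ c]) measurable
  finally have e: "emeasure lborel B = ennreal (real i) * (\<integral>\<^sup>+h. indicator B (x + s * real i * h) \<partial>lborel)"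
    using s by (simp add: abs_mult)
  have "ennreal 1 \<le> ennreal (real i)" using i by (intro ennreal_leI) simp
  then have "1 * (\<integral>\<^sup>+h. indicator B (x + s * real i * h) \<partial>lborel) \<le> ennreal (real i) * (\<integral>\<^sup>+h. indicator B (x + s * real i * h) \<partial>lborel)"
    by (intro mult_right_mono) auto
  then show ?thesis using B e by simp
qed

text \<open>Makes \<open>x\<close> the left end node in the left half of \<open>[0, 1]\<close> and
  the right end node in the right half, so that for the steps in \<open>davg\<close> the stencil
  stays in \<open>[0, 1]\<close>.\<close>

definition dbase :: "nat \<Rightarrow> real \<Rightarrow> real \<Rightarrow> real" where
  "dbase r h x = (if x \<le> 1 / 2 then x else x - real r * h)"

text \<open>With \<open>\<kappa> = 1 / (8 r)\<close> the steps run over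
  \<open>[\<kappa>, 2 \<kappa>]\<close>. The upper end gives \<open>r * h \<le> 1 / 4\<close>; the
  lower end keeps all nodes other than \<open>x\<close> out of \<open>(1 - \<kappa>, 1]\<close>, a
  piece on which the function is not yet controlled when \<open>self_improvement\<close> is
  applied.\<close>

definition davg :: "real \<Rightarrow> nat \<Rightarrow> (real \<Rightarrow> real) \<Rightarrow> real \<Rightarrow> ennreal" where
  "davg p r f x = (\<integral>\<^sup>+h\<in>{1 / (8 * real r)..2 / (8 * real r)}. ennreal (\<bar>fdiff r h f (dbase r h x)\<bar> powr p) \<partial>lborel)"

text \<open>If \<open>e\<close> is bounded off a small set, then for every point \<open>x\<close> most steps \<open>h\<close> put all other nodes
  of the difference into the good set, which bounds \<open>e x\<close> by the averaged difference.\<close>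

lemma self_improvement:
  assumes p: "0 < p" "p \<le> 1" and r: "1 \<le> r" and [measurable]: "e \<in> borel_measurable borel"
    and \<Lambda>: "0 \<le> \<Lambda>"
    and bad: "emeasure lborel {x \<in> {0..1 - 1 / (8 * real r)}. \<Lambda> < \<bar>e x\<bar> powr p} \<le> ennreal (1 / (16 * (real r)\<^sup>2))"
    and x: "x \<in> {0..1}"
  shows "ennreal (\<bar>e x\<bar> powr p) \<le> ennreal (2 * (real r * 2 ^ r * \<Lambda>)) + ennreal (16 * real r) * davg p r e x"
proof -
  define \<kappa> where "\<kappa> = 1 / (8 * real r)"
  have rp: "1 \<le> real r" using r by simp
  have \<kappa>: "0 < \<kappa>" "\<kappa> \<le> 1 / 8" "real r * \<kappa> = 1 / 8" using rp by (auto simp: \<kappa>_def field_simps)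
  define B where "B = {x \<in> {0..1 - \<kappa>}. \<Lambda> < \<bar>e x\<bar> powr p}"
  have Bm [measurable]: "B \<in> sets borel" unfolding B_def by measurable
  define M where "M = real r * 2 ^ r * \<Lambda>"
  have M: "0 \<le> M" using \<Lambda> by (simp add: M_def)
  define a where "a = \<bar>e x\<bar> powr p"
  have a: "0 \<le> a" by (simp add: a_def)
  define s :: real where "s = (if x \<le> 1 / 2 then 1 else -1)"
  have s: "\<bar>s\<bar> = 1" by (simp add: s_def)
  let ?D = "\<lambda>h. ennreal (\<bar>fdiff r h e (dbase r h x)\<bar> powr p)"
  \<comment> \<open>Either a node falls into the bad set and the last sum alone is at least
    \<open>a\<close>, or all other nodes are good and the difference can be solved for
    \<open>e x\<close>.\<close>
  have pt: "ennreal a \<le> ?D h + ennreal M + (\<Sum>i\<in>{1..r}. ennreal a * indicator B (x + s * real i * h))" if h: "h \<in> {\<kappa>..2 * \<kappa>}" for h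
  proof (cases "\<exists>i\<in>{1..r}. x + s * real i * h \<in> B")
    case True
    then obtain i where i: "i \<in> {1..r}" "x + s * real i * h \<in> B" by blast
    have "ennreal a = ennreal a * indicator B (x + s * real i * h)" using i by simp
    also have "\<dots> \<le> (\<Sum>i\<in>{1..r}. ennreal a * indicator B (x + s * real i * h))"
      using i(1) by (intro member_le_sum[of i "{1..r}" "\<lambda>i. ennreal a * indicator B (x + s * real i * h)"]) auto
    finally show ?thesis by (simp add: add_increasing)
  next
    case False
    have good: "\<bar>e (x + s * real i * h)\<bar> powr p \<le> \<Lambda>" if i: "i \<in> {1..r}" for i
    proof -
      have ih: "\<kappa> \<le> real i * h" "real i * h \<le> 1 / 4"
      proof -
        have "1 * \<kappa> \<le> real i * h" using i h \<kappa> by (intro mult_mono) auto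
        then show "\<kappa> \<le> real i * h" by simp
        have "real i * h \<le> real r * (2 * \<kappa>)" using i h \<kappa> by (intro mult_mono) auto
        then show "real i * h \<le> 1 / 4" using \<kappa>(3) by simp
      qed
      have "x + s * real i * h \<in> {0..1 - \<kappa>}" using x ih \<kappa> by (auto simp: s_def)
      then show ?thesis using False i by (auto simp: B_def not_less)
    qed
    have "a \<le> \<bar>fdiff r h e (dbase r h x)\<bar> powr p + M"
    proof (cases "x \<le> 1 / 2")
      case True
      have "\<bar>e (x + real 0 * h)\<bar> powr p \<le> \<bar>fdiff r h e x\<bar> powr p + real r * 2 ^ r * \<Lambda>"
        by (rule fdiff_isolate[OF p]) (use good True in \<open>auto simp: s_def\<close>)
      then show ?thesis using True by (simp add: a_def M_def dbase_def)
    next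
      case False
      have "\<bar>e (x - real r * h + real r * h)\<bar> powr p \<le> \<bar>fdiff r h e (x - real r * h)\<bar> powr p + real r * 2 ^ r * \<Lambda>"
      proof (rule fdiff_isolate[OF p])
        fix i assume i: "i \<le> r" "i \<noteq> r"
        have eq: "x - real r * h + real i * h = x + s * real (r - i) * h" using False i by (simp add: s_def of_nat_diff algebra_simps)
        have ri: "r - i \<in> {1..r}" using i by auto
        show "\<bar>e (x - real r * h + real i * h)\<bar> powr p \<le> \<Lambda>" unfolding eq by (rule good[OF ri])
      qed auto
      then show ?thesis using False by (simp add: a_def M_def dbase_def)
    qed
    then have "ennreal a \<le> ?D h + ennreal M" using M by (simp add: ennreal_leI flip: ennreal_plus)
    then show ?thesis by (rule order_trans) simp
  qed
  let ?I = "indicator {\<kappa>..2 * \<kappa>} :: real \<Rightarrow> ennreal"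
  have "ennreal a * ennreal \<kappa> = (\<integral>\<^sup>+h. ennreal a * ?I h \<partial>lborel)"
    using \<kappa> by (subst nn_integral_cmult_indicator) auto
  also have "\<dots> \<le> (\<integral>\<^sup>+h. (?D h * ?I h + ennreal M * ?I h) + (\<Sum>i\<in>{1..r}. ennreal a * indicator B (x + s * real i * h)) \<partial>lborel)"
    by (intro nn_integral_mono) (use pt in \<open>auto simp: indicator_def add.assoc\<close>)
  also have "\<dots> = (davg p r e x + ennreal M * ennreal \<kappa>) + (\<Sum>i\<in>{1..r}. ennreal a * (\<integral>\<^sup>+h. indicator B (x + s * real i * h) \<partial>lborel))"
  proof -
    have e1: "2 / (8 * real r) = 2 * \<kappa>" by (simp add: \<kappa>_def)
    have [measurable]: "(\<lambda>h. ?D h) \<in> borel_measurable borel" unfolding dbase_def by measurable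
    have "(\<integral>\<^sup>+h. (?D h * ?I h + ennreal M * ?I h) + (\<Sum>i\<in>{1..r}. ennreal a * indicator B (x + s * real i * h)) \<partial>lborel)
      = ((\<integral>\<^sup>+h. ?D h * ?I h \<partial>lborel) + (\<integral>\<^sup>+h. ennreal M * ?I h \<partial>lborel)) + (\<integral>\<^sup>+h. (\<Sum>i\<in>{1..r}. ennreal a * indicator B (x + s * real i * h)) \<partial>lborel)"
      by (subst nn_integral_add, measurable, subst nn_integral_add, measurable)
    also have "(\<integral>\<^sup>+h. (\<Sum>i\<in>{1..r}. ennreal a * indicator B (x + s * real i * h)) \<partial>lborel) = (\<Sum>i\<in>{1..r}. ennreal a * (\<integral>\<^sup>+h. indicator B (x + s * real i * h) \<partial>lborel))"
      by (subst nn_integral_sum) (auto intro!: sum.cong nn_integral_cmult)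
    also have "(\<integral>\<^sup>+h. ennreal M * ?I h \<partial>lborel) = ennreal M * ennreal \<kappa>"
      using \<kappa> by (subst nn_integral_cmult_indicator) auto
    also have "(\<integral>\<^sup>+h. ?D h * ?I h \<partial>lborel) = davg p r e x" unfolding davg_def e1 \<kappa>_def[symmetric] ..
    finally show ?thesis .
  qed
  \<comment> \<open>The steps with a bad node have total measure at most
    \<open>r / (16 r^2) = \<kappa> / 2\<close>, half the length of the range of \<open>h\<close>, so
    half of the left-hand side can be absorbed.\<close>
  also have "\<dots> \<le> (davg p r e x + ennreal M * ennreal \<kappa>) + (\<Sum>i\<in>{1..r}. ennreal a * ennreal (1 / (16 * (real r)\<^sup>2)))"
    using bad s by (intro add_left_mono sum_mono mult_left_mono nn_integral_scaled_bad) (auto simp: B_def \<kappa>_def)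
  also have "(\<Sum>i\<in>{1..r}. ennreal a * ennreal (1 / (16 * (real r)\<^sup>2))) = ennreal (a * (\<kappa> / 2))"
  proof -
    have "real r * (a * (1 / (16 * (real r)\<^sup>2))) = a * (\<kappa> / 2)" using rp by (simp add: \<kappa>_def power2_eq_square)
    moreover have "(\<Sum>i\<in>{1..r}. ennreal a * ennreal c) = ennreal (real r * (a * c))" for c
      using a by (simp add: ennreal_of_nat_eq_real_of_nat ennreal_mult')
    ultimately show ?thesis by (simp only:)
  qed
  finally have main: "ennreal a * ennreal \<kappa> \<le> (davg p r e x + ennreal M * ennreal \<kappa>) + ennreal (a * (\<kappa> / 2))" .
  show ?thesis
  proof (cases "davg p r e x")
    case (real g)
    then have "ennreal (a * \<kappa>) \<le> ennreal (g + M * \<kappa> + a * (\<kappa> / 2))"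
      using main a M \<kappa> by (simp flip: ennreal_mult' ennreal_plus)
    then have "a * \<kappa> \<le> g + M * \<kappa> + a * (\<kappa> / 2)" using real a M \<kappa> by (subst (asm) ennreal_le_iff) auto
    then have "a * \<kappa> / 2 \<le> g + M * \<kappa>" by simp
    then have "a * \<kappa> / 2 * (2 / \<kappa>) \<le> (g + M * \<kappa>) * (2 / \<kappa>)" using \<kappa> by (intro mult_right_mono) auto
    moreover have e: "a * \<kappa> / 2 * (2 / \<kappa>) = a" "(g + M * \<kappa>) * (2 / \<kappa>) = (2 / \<kappa>) * g + 2 * M"
      using \<kappa>(1) by (simp_all add: add_divide_distrib)
    moreover have e2: "2 / \<kappa> = 16 * real r" by (simp add: \<kappa>_def)
    ultimately have "a \<le> (2 / \<kappa>) * g + 2 * M" by (simp only:)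
    then have "a \<le> 2 * M + 16 * real r * g" unfolding e2 by simp
    then have "ennreal a \<le> ennreal (2 * M) + ennreal (16 * real r) * ennreal g"
      using M real by (simp add: ennreal_leI flip: ennreal_mult' ennreal_plus)
    then show ?thesis using real by (simp add: a_def M_def)
  next
    case top
    then show ?thesis using rp by (simp add: ennreal_mult_top)
  qed
qed

lemma davg_measurable [measurable]:
  assumes [measurable]: "f \<in> borel_measurable borel"
  shows "davg p r f \<in> borel_measurable borel"
  unfolding davg_def[abs_def] dbase_def by measurable

text \<open>Fubini; depending on the half in which \<open>x\<close> lies it is the left or the right
  node, and each alternative is at most one copy of \<open>dint\<close> after a translation.\<close>

lemma nn_integral_davg_le:
  assumes r: "1 \<le> r" and [measurable]: "f \<in> borel_measurable borel"
  shows "(\<integral>\<^sup>+x\<in>{0..1}. davg p r f x \<partial>lborel) \<le> 2 * dint p r f"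
proof -
  define \<kappa> where "\<kappa> = 1 / (8 * real r)"
  have rp: "1 \<le> real r" using r by simp
  have \<kappa>: "0 < \<kappa>" "real r * \<kappa> = 1 / 8" "2 / (8 * real r) = 2 * \<kappa>" using rp by (auto simp: \<kappa>_def)
  let ?I = "indicator {\<kappa>..2 * \<kappa>} :: real \<Rightarrow> ennreal"
  have rh: "0 \<le> real r * h" "real r * h \<le> 1 / 4" if "h \<in> {\<kappa>..2 * \<kappa>}" for h
  proof -
    have h: "0 \<le> h" "h \<le> 2 * \<kappa>" using that \<kappa>(1) by auto
    then show "0 \<le> real r * h" by simp
    have "real r * h \<le> real r * (2 * \<kappa>)" by (rule mult_left_mono[OF h(2)]) simp
    also have "\<dots> = 2 * (real r * \<kappa>)" by simp
    finally show "real r * h \<le> 1 / 4" unfolding \<kappa>(2) by simp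
  qed
  have "(\<integral>\<^sup>+x\<in>{0..1}. davg p r f x \<partial>lborel) =
      (\<integral>\<^sup>+x. (\<integral>\<^sup>+h. ennreal (\<bar>fdiff r h f (dbase r h x)\<bar> powr p) * ?I h * indicator {0..1} x \<partial>lborel) \<partial>lborel)"
    unfolding davg_def \<kappa>(3) \<kappa>_def[symmetric] dbase_def by (subst nn_integral_multc) auto
  also have "\<dots> = (\<integral>\<^sup>+h. (\<integral>\<^sup>+x. ennreal (\<bar>fdiff r h f (dbase r h x)\<bar> powr p) * ?I h * indicator {0..1} x \<partial>lborel) \<partial>lborel)"
    unfolding dbase_def by (subst lborel_pair.Fubini') auto
  also have "\<dots> \<le> (\<integral>\<^sup>+h. (\<integral>\<^sup>+x. dcell p r f h x + dcell p r f h (x - real r * h) \<partial>lborel) \<partial>lborel)"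
  proof (intro nn_integral_mono)
    fix h x :: real
    show "ennreal (\<bar>fdiff r h f (dbase r h x)\<bar> powr p) * ?I h * indicator {0..1} x \<le> dcell p r f h x + dcell p r f h (x - real r * h)"
    proof (cases "h \<in> {\<kappa>..2 * \<kappa>} \<and> x \<in> {0..1}")
      case True
      then show ?thesis using rh[of h] \<kappa>(1) by (cases "x \<le> 1 / 2") (auto simp: dcell_def dbase_def)
    qed auto
  qed
  also have "\<dots> = (\<integral>\<^sup>+h. (\<integral>\<^sup>+x. dcell p r f h x \<partial>lborel) + (\<integral>\<^sup>+x. dcell p r f h x \<partial>lborel) \<partial>lborel)"
  proof (intro nn_integral_cong)
    fix h :: real
    have "(\<integral>\<^sup>+x. dcell p r f h x \<partial>lborel) = (\<integral>\<^sup>+x. dcell p r f h (x - real r * h) \<partial>lborel)"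
      by (subst nn_integral_real_affine[where c = 1 and t = "- real r * h"]) (auto simp: algebra_simps)
    then show "(\<integral>\<^sup>+x. dcell p r f h x + dcell p r f h (x - real r * h) \<partial>lborel) = (\<integral>\<^sup>+x. dcell p r f h x \<partial>lborel) + (\<integral>\<^sup>+x. dcell p r f h x \<partial>lborel)"
      by (subst nn_integral_add) auto
  qed
  also have "\<dots> = 2 * dint p r f"
    unfolding dint_def by (subst nn_integral_add) (auto simp: mult_2)
  finally show ?thesis .
qed

lemma dint_le_uint:
  assumes p: "0 < p" "p \<le> 1" and r: "1 \<le> r" and [measurable]: "u \<in> borel_measurable borel"
  shows "dint p r u \<le> ennreal (2 ^ Suc r) * uint p u"
proof -
  have rp: "1 \<le> real r" using r by simp
  let ?i = "indicator {0..1 / real r} :: real \<Rightarrow> ennreal"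
  have "dint p r u \<le> (\<integral>\<^sup>+h. ennreal (real (Suc r) * 2 ^ r) * uint p u * ?i h \<partial>lborel)"
    unfolding dint_def
  proof (rule nn_integral_mono)
    fix h :: real
    show "(\<integral>\<^sup>+x. dcell p r u h x \<partial>lborel) \<le> ennreal (real (Suc r) * 2 ^ r) * uint p u * ?i h"
    proof (cases "h \<in> {0..1 / real r}")
      case True
      have "(\<integral>\<^sup>+x. dcell p r u h x \<partial>lborel) \<le> (\<integral>\<^sup>+x. (\<Sum>i\<le>r. ennreal (2 ^ r) * (ennreal (\<bar>u (x + real i * h)\<bar> powr p) * indicator {0..1} (x + real i * h))) \<partial>lborel)"
      proof (rule nn_integral_mono)
        fix x :: real
        show "dcell p r u h x \<le> (\<Sum>i\<le>r. ennreal (2 ^ r) * (ennreal (\<bar>u (x + real i * h)\<bar> powr p) * indicator {0..1} (x + real i * h)))"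
        proof (cases "0 \<le> h \<and> 0 \<le> x \<and> x + real r * h \<le> 1")
          case h: True
          have in01: "x + real i * h \<in> {0..1}" if "i \<le> r" for i
          proof -
            have "0 \<le> real i * h" "real i * h \<le> real r * h" using that h by (auto intro: mult_right_mono)
            then show ?thesis using h by auto
          qed
          have "\<bar>fdiff r h u x\<bar> powr p \<le> (\<Sum>i\<le>r. 2 ^ r * \<bar>u (x + real i * h)\<bar> powr p)"
            unfolding fdiff_def by (intro order_trans[OF powr_sum_le[OF p]] sum_mono binomial_powr_le p)
          then have "ennreal (\<bar>fdiff r h u x\<bar> powr p) \<le> (\<Sum>i\<le>r. ennreal (2 ^ r * \<bar>u (x + real i * h)\<bar> powr p))"
            by (subst sum_ennreal) (auto intro: ennreal_leI)
          also have "\<dots> = (\<Sum>i\<le>r. ennreal (2 ^ r) * (ennreal (\<bar>u (x + real i * h)\<bar> powr p) * indicator {0..1} (x + real i * h)))"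
            using in01 by (intro sum.cong) (auto simp: ennreal_mult')
          finally show ?thesis using h by (simp add: dcell_def)
        qed (auto simp: dcell_def)
      qed
      also have "\<dots> = (\<Sum>i\<le>r. ennreal (2 ^ r) * (\<integral>\<^sup>+x. ennreal (\<bar>u (x + real i * h)\<bar> powr p) * indicator {0..1} (x + real i * h) \<partial>lborel))"
        by (subst nn_integral_sum) (auto intro!: sum.cong nn_integral_cmult)
      also have "\<dots> = (\<Sum>i\<le>r. ennreal (2 ^ r) * uint p u)"
      proof (intro sum.cong refl arg_cong2[where f = "(*)"])
        fix i
        show "(\<integral>\<^sup>+x. ennreal (\<bar>u (x + real i * h)\<bar> powr p) * indicator {0..1} (x + real i * h) \<partial>lborel) = uint p u"
          unfolding uint_def by (subst nn_integral_real_affine[where c = 1 and t = "real i * h"]) (auto simp: add.commute)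
      qed
      also have "\<dots> = ennreal (real (Suc r) * 2 ^ r) * uint p u"
        by (simp add: ennreal_of_nat_eq_real_of_nat ennreal_mult' mult.assoc del: of_nat_Suc)
      finally show ?thesis using True by simp
    next
      case False
      have "dcell p r u h x = 0" for x
        using False rp unfolding dcell_def by (auto simp: field_simps)
      then show ?thesis by simp
    qed
  qed
  also have "\<dots> = ennreal (real (Suc r) * 2 ^ r) * uint p u * ennreal (1 / real r)"
    using rp by (subst nn_integral_cmult_indicator) auto
  also have "\<dots> = ennreal (1 / real r * (real (Suc r) * 2 ^ r)) * uint p u"
    using ennreal_mult_assoc[of "1 / real r" "real (Suc r) * 2 ^ r" "uint p u"] by (simp only: mult.commute[of _ "ennreal (1 / real r)"]) simp
  also have "\<dots> \<le> ennreal (2 ^ Suc r) * uint p u"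
    using rp by (intro mult_right_mono ennreal_leI) (auto simp: field_simps)
  finally show ?thesis .
qed

lemma fdiff_diff: "fdiff r h (\<lambda>x. f x - g x) x = fdiff r h f x - fdiff r h g x"
  by (simp add: fdiff_def right_diff_distrib sum_subtractf)

lemma dint_perturb:
  assumes p: "0 < p" "p \<le> 1" and r: "1 \<le> r" and [measurable]: "f \<in> borel_measurable borel" "g \<in> borel_measurable borel"
  shows "dint p r g \<le> dint p r f + ennreal (2 ^ Suc r) * uint p (\<lambda>x. f x - g x)"
proof -
  have "dint p r g \<le> (\<integral>\<^sup>+h. (\<integral>\<^sup>+x. dcell p r f h x + dcell p r (\<lambda>x. f x - g x) h x \<partial>lborel) \<partial>lborel)"
    unfolding dint_def
  proof (intro nn_integral_mono)
    fix h x :: real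
    have "\<bar>fdiff r h g x\<bar> powr p \<le> (\<bar>fdiff r h f x\<bar> + \<bar>fdiff r h (\<lambda>x. f x - g x) x\<bar>) powr p"
      using p by (intro powr_mono2) (auto simp: fdiff_diff)
    also have "\<dots> \<le> \<bar>fdiff r h f x\<bar> powr p + \<bar>fdiff r h (\<lambda>x. f x - g x) x\<bar> powr p" using p by (intro powr_add_le) auto
    finally show "dcell p r g h x \<le> dcell p r f h x + dcell p r (\<lambda>x. f x - g x) h x"
      by (auto simp: dcell_def ennreal_leI simp flip: ennreal_plus)
  qed
  also have "\<dots> = dint p r f + dint p r (\<lambda>x. f x - g x)"
    unfolding dint_def by (subst nn_integral_add[symmetric]) (auto intro!: nn_integral_cong nn_integral_add)
  also have "\<dots> \<le> dint p r f + ennreal (2 ^ Suc r) * uint p (\<lambda>x. f x - g x)"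
    by (intro add_left_mono dint_le_uint p r) measurable
  finally show ?thesis .
qed

text \<open>For bounded \<open>f\<close> the differences are at most \<open>4 ^ r * L\<close>, and
  \<open>|D| \<le> (4 ^ r * L)^(1-p) |D|^p\<close>: smallness in \<open>p\<close>-th powers implies
  smallness in \<open>L_1\<close>, where averaging is possible.\<close>

lemma dint_one_le:
  assumes p: "0 < p" "p \<le> 1" and [measurable]: "f \<in> borel_measurable borel" and L: "0 \<le> L" "\<And>x. \<bar>f x\<bar> \<le> L"
  shows "dint 1 r f \<le> ennreal ((4 ^ r * L) powr (1 - p)) * dint p r f"
proof -
  have b: "\<bar>fdiff r h f x\<bar> \<le> 4 ^ r * L" for h x
  proof -
    have "\<bar>fdiff r h f x\<bar> \<le> (\<Sum>i\<le>r. real (r choose i) * L)"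
      unfolding fdiff_def by (intro order_trans[OF sum_abs] sum_mono) (auto simp: abs_mult power_abs intro!: mult_left_mono L)
    also have "\<dots> = 2 ^ r * L"
    proof -
      have "(\<Sum>i\<le>r. real (r choose i)) = 2 ^ r" by (metis choose_row_sum of_nat_numeral of_nat_power of_nat_sum)
      then show ?thesis by (simp flip: sum_distrib_right)
    qed
    also have "\<dots> \<le> 4 ^ r * L" using L by (intro mult_right_mono power_mono) auto
    finally show ?thesis .
  qed
  have "dint 1 r f \<le> (\<integral>\<^sup>+h. (\<integral>\<^sup>+x. ennreal ((4 ^ r * L) powr (1 - p)) * dcell p r f h x \<partial>lborel) \<partial>lborel)"
    unfolding dint_def
  proof (intro nn_integral_mono)
    fix h x :: real
    have "\<bar>fdiff r h f x\<bar> powr 1 = \<bar>fdiff r h f x\<bar> powr (1 - p) * \<bar>fdiff r h f x\<bar> powr p" by (simp flip: powr_add)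
    also have "\<dots> \<le> (4 ^ r * L) powr (1 - p) * \<bar>fdiff r h f x\<bar> powr p"
      using b p by (intro mult_right_mono powr_mono2) auto
    finally show "dcell 1 r f h x \<le> ennreal ((4 ^ r * L) powr (1 - p)) * dcell p r f h x"
      by (auto simp: dcell_def ennreal_leI simp flip: ennreal_mult')
  qed
  also have "\<dots> = ennreal ((4 ^ r * L) powr (1 - p)) * dint p r f"
    unfolding dint_def by (subst nn_integral_cmult[symmetric]) (auto intro!: nn_integral_cong nn_integral_cmult)
  finally show ?thesis .
qed

section \<open>Steklov means\<close>

definition smean :: "real \<Rightarrow> (real \<Rightarrow> real) \<Rightarrow> nat \<Rightarrow> real \<Rightarrow> real" where
  "smean d f i x = (1 / d) * (LINT h|lborel. indicator {0..d} h * f (x + real i * h))"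

lemma integrable_indicator_Icc: "integrable lborel (indicator {a..b::real} :: real \<Rightarrow> real)"
  by (rule integrable_real_indicator) (auto simp: emeasure_lborel_Icc_eq)

lemma bounded_interval_integrable:
  fixes f :: "real \<Rightarrow> real"
  assumes [measurable]: "f \<in> borel_measurable borel" and L: "\<And>x. \<bar>f x\<bar> \<le> L"
  shows "integrable lborel (\<lambda>h. indicator {a..b} h * f h)"
proof (rule Bochner_Integration.integrable_bound)
  show "integrable lborel (\<lambda>h. L * indicator {a..b} h :: real)" by (intro integrable_mult_right integrable_indicator_Icc)
  show "AE h in lborel. norm (indicator {a..b} h * f h) \<le> norm (L * indicator {a..b} h)"
    using L by (auto simp: indicator_def intro: order_trans[OF _ abs_ge_self])
qed measurable

lemma smean_bound:
  assumes [measurable]: "f \<in> borel_measurable borel" and L: "\<And>x. \<bar>f x\<bar> \<le> L" and d: "0 < d"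
  shows "\<bar>smean d f i x\<bar> \<le> L"
proof -
  have "\<bar>LINT h|lborel. indicator {0..d} h * f (x + real i * h)\<bar> \<le> (LINT h|lborel. \<bar>indicator {0..d} h * f (x + real i * h)\<bar>)"
    by (rule integral_abs_bound)
  also have "\<dots> \<le> (LINT h|lborel. L * indicator {0..d} h)"
  proof (rule integral_mono)
    show "integrable lborel (\<lambda>h. \<bar>indicator {0..d} h * f (x + real i * h)\<bar>)"
      using L by (intro integrable_abs bounded_interval_integrable[where f = "\<lambda>h. f (x + real i * h)"]) auto
    show "integrable lborel (\<lambda>h. L * indicator {0..d} h)" by (intro integrable_mult_right integrable_indicator_Icc)
    show "\<bar>indicator {0..d} h * f (x + real i * h)\<bar> \<le> L * indicator {0..d} h" for h
      using L by (auto simp: indicator_def)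
  qed
  also have "\<dots> = L * d" using d by simp
  finally show ?thesis using d by (simp add: smean_def abs_mult field_simps)
qed

text \<open>For \<open>i \<ge> 1\<close> the substitution \<open>u = x + i h\<close> turns the mean
  into an integral over an interval that moves with \<open>x\<close>; only end pieces of length at
  most \<open>y - x\<close> change. With \<open>i = 0\<close> nothing is averaged.\<close>

lemma smean_lipschitz:
  assumes [measurable]: "f \<in> borel_measurable borel" and L: "\<And>x. \<bar>f x\<bar> \<le> L" and d: "0 < d" and i: "1 \<le> i" and xy: "x \<le> y"
  shows "\<bar>smean d f i y - smean d f i x\<bar> \<le> 2 * L / d * (y - x)"
proof -
  have ip: "1 \<le> real i" using i by simp
  have eq: "(LINT h|lborel. indicator {0..d} h * f (z + real i * h)) = (1 / real i) * (LINT u|lborel. indicator {z..z + real i * d} u * f u)" for z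
  proof -
    have "(LINT u|lborel. indicator {z..z + real i * d} u * f u) = \<bar>real i\<bar> *\<^sub>R (LINT h|lborel. indicator {z..z + real i * d} (z + real i * h) * f (z + real i * h))"
      using ip by (intro lborel_integral_real_affine) auto
    also have "(\<lambda>h. indicator {z..z + real i * d} (z + real i * h) * f (z + real i * h)) = (\<lambda>h. indicator {0..d} h * f (z + real i * h))"
      using ip by (auto simp: indicator_def fun_eq_iff zero_le_mult_iff)
    finally show ?thesis using ip by simp
  qed
  let ?J = "\<lambda>z. LINT u|lborel. indicator {z..z + real i * d} u * f u"
  have int: "integrable lborel (\<lambda>u. indicator {a..b} u * f u)" for a b
    by (rule bounded_interval_integrable[OF _ L]) measurable
  have "\<bar>?J y - ?J x\<bar> = \<bar>LINT u|lborel. indicator {y..y + real i * d} u * f u - indicator {x..x + real i * d} u * f u\<bar>"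
    by (simp add: int)
  also have "\<dots> \<le> (LINT u|lborel. \<bar>indicator {y..y + real i * d} u * f u - indicator {x..x + real i * d} u * f u\<bar>)"
    by (rule integral_abs_bound)
  also have "\<dots> \<le> (LINT u|lborel. L * (indicator {x..y} u + indicator {x + real i * d..y + real i * d} u))"
  proof (rule integral_mono)
    fix u
    have "\<bar>indicator {y..y + real i * d} u * f u - indicator {x..x + real i * d} u * f u\<bar>
       = \<bar>indicator {y..y + real i * d} u - indicator {x..x + real i * d} u\<bar> * \<bar>f u\<bar>"
      by (simp add: left_diff_distrib[symmetric] abs_mult)
    also have "\<dots> \<le> (indicator {x..y} u + indicator {x + real i * d..y + real i * d} u) * L"
      using xy L[of u] by (intro mult_mono) (auto simp: indicator_def)
    finally show "\<bar>indicator {y..y + real i * d} u * f u - indicator {x..x + real i * d} u * f u\<bar> \<le> L * (indicator {x..y} u + indicator {x + real i * d..y + real i * d} u)"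
      by (simp add: mult.commute)
  next
    show "integrable lborel (\<lambda>u. \<bar>indicator {y..y + real i * d} u * f u - indicator {x..x + real i * d} u * f u\<bar>)"
      by (intro integrable_abs Bochner_Integration.integrable_diff int)
    show "integrable lborel (\<lambda>u. L * (indicator {x..y} u + indicator {x + real i * d..y + real i * d} u))"
      by (intro integrable_mult_right Bochner_Integration.integrable_add integrable_indicator_Icc)
  qed
  also have "\<dots> = L * ((y - x) + (y - x))"
    using xy by (subst integral_mult_right_zero, subst Bochner_Integration.integral_add) auto
  finally have J: "\<bar>?J y - ?J x\<bar> \<le> 2 * L * (y - x)" by (simp add: algebra_simps)
  have "smean d f i y - smean d f i x = (1 / d) * ((1 / real i) * (?J y - ?J x))"
    by (simp add: smean_def eq right_diff_distrib)
  then have "\<bar>smean d f i y - smean d f i x\<bar> = (1 / d) * ((1 / real i) * \<bar>?J y - ?J x\<bar>)" using d by (simp add: abs_mult)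
  also have "\<dots> \<le> (1 / d) * (1 * (2 * L * (y - x)))"
    using J ip d by (intro mult_left_mono mult_mono) auto
  finally show ?thesis by simp
qed

text \<open>The average over \<open>h\<close> of the \<open>r\<close>-th difference contains
  \<open>f x\<close> up to sign as its term \<open>i = 0\<close>. Solving for it leaves a
  combination of the terms \<open>i \<ge> 1\<close>, which are Lipschitz for bounded
  \<open>f\<close>; the error \<open>f - smooth\<close> is the averaged difference up to
  sign.\<close>

definition smooth :: "nat \<Rightarrow> real \<Rightarrow> (real \<Rightarrow> real) \<Rightarrow> real \<Rightarrow> real" where
  "smooth r d f x = - ((-1) ^ r * (\<Sum>i\<in>{1..r}. real (r choose i) * (-1) ^ (r - i) * smean d f i x))"

lemma smooth_bound:
  assumes [measurable]: "f \<in> borel_measurable borel" and L: "\<And>x. \<bar>f x\<bar> \<le> L" "0 \<le> L" and d: "0 < d"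
  shows "\<bar>smooth r d f x\<bar> \<le> real r * 2 ^ r * L"
proof -
  have "\<bar>smooth r d f x\<bar> = \<bar>\<Sum>i\<in>{1..r}. real (r choose i) * (-1) ^ (r - i) * smean d f i x\<bar>"
    by (simp add: smooth_def abs_mult power_abs)
  also have "\<dots> \<le> (\<Sum>i\<in>{1..r}. \<bar>real (r choose i) * (-1) ^ (r - i) * smean d f i x\<bar>)"
    by (rule sum_abs)
  also have "\<dots> \<le> (\<Sum>i\<in>{1..r}. 2 ^ r * L)"
  proof (intro sum_mono)
    fix i
    have "real (r choose i) \<le> 2 ^ r" by (metis binomial_le_pow2 of_nat_le_iff of_nat_numeral of_nat_power)
    then have "real (r choose i) * \<bar>smean d f i x\<bar> \<le> 2 ^ r * L"
      using smean_bound[OF _ L(1) d] L by (intro mult_mono) auto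
    then show "\<bar>real (r choose i) * (-1) ^ (r - i) * smean d f i x\<bar> \<le> 2 ^ r * L" by (simp add: abs_mult power_abs)
  qed
  finally show ?thesis by simp
qed

lemma smooth_lipschitz:
  assumes [measurable]: "f \<in> borel_measurable borel" and L: "\<And>x. \<bar>f x\<bar> \<le> L" "0 \<le> L" and d: "0 < d"
  shows "\<bar>smooth r d f y - smooth r d f x\<bar> \<le> real r * 2 ^ r * (2 * L / d) * \<bar>y - x\<bar>"
proof -
  have sm: "\<bar>smean d f i y - smean d f i x\<bar> \<le> 2 * L / d * \<bar>y - x\<bar>" if "i \<in> {1..r}" for i
    using smean_lipschitz[OF assms(1) L(1) d, of i x y] smean_lipschitz[OF assms(1) L(1) d, of i y x] that
    by (cases "x \<le> y") (auto simp: abs_minus_commute)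
  have "\<bar>smooth r d f y - smooth r d f x\<bar> = \<bar>\<Sum>i\<in>{1..r}. real (r choose i) * (-1) ^ (r - i) * (smean d f i y - smean d f i x)\<bar>"
  proof -
    have "smooth r d f y - smooth r d f x = - ((-1) ^ r * (\<Sum>i\<in>{1..r}. real (r choose i) * (-1) ^ (r - i) * (smean d f i y - smean d f i x)))"
      by (simp add: smooth_def right_diff_distrib sum_subtractf)
    then show ?thesis by (simp add: abs_mult power_abs)
  qed
  also have "\<dots> \<le> (\<Sum>i\<in>{1..r}. 2 ^ r * (2 * L / d * \<bar>y - x\<bar>))"
  proof (intro order_trans[OF sum_abs] sum_mono)
    fix i assume i: "i \<in> {1..r}"
    have "real (r choose i) \<le> 2 ^ r" by (metis binomial_le_pow2 of_nat_le_iff of_nat_numeral of_nat_power)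
    then have "real (r choose i) * \<bar>smean d f i y - smean d f i x\<bar> \<le> 2 ^ r * (2 * L / d * \<bar>y - x\<bar>)"
      using sm[OF i] by (intro mult_mono) auto
    then show "\<bar>real (r choose i) * (-1) ^ (r - i) * (smean d f i y - smean d f i x)\<bar> \<le> 2 ^ r * (2 * L / d * \<bar>y - x\<bar>)"
      by (simp add: abs_mult power_abs)
  qed
  finally show ?thesis by (simp add: mult.assoc)
qed

lemma smooth_error:
  assumes [measurable]: "f \<in> borel_measurable borel" and L: "\<And>x. \<bar>f x\<bar> \<le> L" and d: "0 < d"
  shows "ennreal \<bar>f x - smooth r d f x\<bar> \<le> ennreal (1 / d) * (\<integral>\<^sup>+h\<in>{0..d}. ennreal \<bar>fdiff r h f x\<bar> \<partial>lborel)"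
proof -
  let ?a = "\<lambda>i. real (r choose i) * (-1) ^ (r - i)"
  have int: "integrable lborel (\<lambda>h. indicator {0..d} h * f (x + real i * h))" for i
    using bounded_interval_integrable[of "\<lambda>h. f (x + real i * h)" L 0 d] L by simp
  have eq: "(\<lambda>h. indicator {0..d} h * fdiff r h f x) = (\<lambda>h. \<Sum>i\<le>r. ?a i * (indicator {0..d} h * f (x + real i * h)))"
    by (simp add: fdiff_def sum_distrib_left mult_ac)
  have fint: "integrable lborel (\<lambda>h. indicator {0..d} h * fdiff r h f x)"
    unfolding eq by (intro Bochner_Integration.integrable_sum integrable_mult_right int)
  have "(1 / d) * (LINT h|lborel. indicator {0..d} h * fdiff r h f x) = (\<Sum>i\<le>r. ?a i * smean d f i x)"
    unfolding eq Bochner_Integration.integral_sum[OF integrable_mult_right[OF int]] integral_mult_right_zero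
    by (simp add: smean_def sum_distrib_left mult_ac)
  also have "\<dots> = ?a 0 * smean d f 0 x + (\<Sum>i\<in>{1..r}. ?a i * smean d f i x)"
  proof -
    have "{..r} = insert 0 {1..r}" by auto
    then show ?thesis by simp
  qed
  also have "smean d f 0 x = f x" using d by (simp add: smean_def)
  finally have "(-1) ^ r * ((1 / d) * (LINT h|lborel. indicator {0..d} h * fdiff r h f x)) = f x - smooth r d f x"
    by (simp add: smooth_def distrib_left)
  then have "\<bar>f x - smooth r d f x\<bar> = \<bar>(-1) ^ r * ((1 / d) * (LINT h|lborel. indicator {0..d} h * fdiff r h f x))\<bar>" by simp
  also have "\<dots> = (1 / d) * \<bar>LINT h|lborel. indicator {0..d} h * fdiff r h f x\<bar>" using d by (simp add: abs_mult power_abs)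
  finally have "ennreal \<bar>f x - smooth r d f x\<bar> = ennreal (1 / d) * ennreal (norm (LINT h|lborel. indicator {0..d} h * fdiff r h f x))"
    using d by (simp flip: ennreal_mult')
  also have "\<dots> \<le> ennreal (1 / d) * (\<integral>\<^sup>+h. ennreal (norm (indicator {0..d} h * fdiff r h f x)) \<partial>lborel)"
    by (intro mult_left_mono integral_norm_bound_ennreal fint) auto
  also have "(\<integral>\<^sup>+h. ennreal (norm (indicator {0..d} h * fdiff r h f x)) \<partial>lborel) = (\<integral>\<^sup>+h\<in>{0..d}. ennreal \<bar>fdiff r h f x\<bar> \<partial>lborel)"
    by (intro nn_integral_cong) (auto simp: indicator_def)
  finally show ?thesis .
qed

lemma smean_measurable [measurable]:
  assumes [measurable]: "f \<in> borel_measurable borel"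
  shows "smean d f i \<in> borel_measurable borel"
  unfolding smean_def[abs_def] by measurable

lemma smooth_measurable [measurable]:
  assumes [measurable]: "f \<in> borel_measurable borel"
  shows "smooth r d f \<in> borel_measurable borel"
  unfolding smooth_def[abs_def] by measurable

text \<open>For \<open>x \<le> 1 - r d\<close> and \<open>h \<le> d\<close> all nodes stay in
  \<open>[0, 1]\<close>, so the averaged error is part of \<open>dint\<close>.\<close>

lemma nn_integral_smooth_error:
  assumes [measurable]: "f \<in> borel_measurable borel" and L: "\<And>x. \<bar>f x\<bar> \<le> L" and d: "0 < d"
  shows "(\<integral>\<^sup>+x\<in>{0..1 - real r * d}. ennreal \<bar>f x - smooth r d f x\<bar> \<partial>lborel) \<le> ennreal (1 / d) * dint 1 r f"
proof -
  let ?i = "indicator {0..1 - real r * d} :: real \<Rightarrow> ennreal"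
  have "(\<integral>\<^sup>+x\<in>{0..1 - real r * d}. ennreal \<bar>f x - smooth r d f x\<bar> \<partial>lborel)
     \<le> (\<integral>\<^sup>+x. ennreal (1 / d) * (\<integral>\<^sup>+h. dcell 1 r f h x \<partial>lborel) \<partial>lborel)"
  proof (rule nn_integral_mono)
    fix x :: real
    show "ennreal \<bar>f x - smooth r d f x\<bar> * ?i x \<le> ennreal (1 / d) * (\<integral>\<^sup>+h. dcell 1 r f h x \<partial>lborel)"
    proof (cases "x \<in> {0..1 - real r * d}")
      case True
      have "ennreal \<bar>f x - smooth r d f x\<bar> \<le> ennreal (1 / d) * (\<integral>\<^sup>+h\<in>{0..d}. ennreal \<bar>fdiff r h f x\<bar> \<partial>lborel)"
        by (rule smooth_error[OF _ L d]) measurable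
      also have "\<dots> \<le> ennreal (1 / d) * (\<integral>\<^sup>+h. dcell 1 r f h x \<partial>lborel)"
      proof (intro mult_left_mono nn_integral_mono)
        fix h :: real
        have "real r * h \<le> real r * d" if "h \<le> d" using that by (intro mult_left_mono) auto
        then show "ennreal \<bar>fdiff r h f x\<bar> * indicator {0..d} h \<le> dcell 1 r f h x"
          using True by (auto simp: dcell_def indicator_def)
      qed simp
      finally show ?thesis using True by simp
    qed simp
  qed
  also have "\<dots> = ennreal (1 / d) * (\<integral>\<^sup>+x. (\<integral>\<^sup>+h. dcell 1 r f h x \<partial>lborel) \<partial>lborel)"
    by (rule nn_integral_cmult) measurable
  also have "(\<integral>\<^sup>+x. (\<integral>\<^sup>+h. dcell 1 r f h x \<partial>lborel) \<partial>lborel) = dint 1 r f"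
    unfolding dint_def by (rule lborel_pair.Fubini') measurable
  finally show ?thesis .
qed

section \<open>A polynomial from a lattice with small differences\<close>

lemma nn_integral_translate:
  fixes f :: "real \<Rightarrow> ennreal"
  assumes [measurable]: "f \<in> borel_measurable borel"
  shows "(\<integral>\<^sup>+x. f (x + c) \<partial>lborel) = (\<integral>\<^sup>+x. f x \<partial>lborel)"
  using nn_integral_real_affine[of f 1 c] by (simp add: add.commute)

text \<open>By averaging there is a lattice on which all \<open>r\<close>-th differences of
  \<open>f\<close> and, inside \<open>[0, 1 - \<kappa>]\<close>, all deviations \<open>f - g\<close>
  are at most \<sigma>. Newton's formula gives a polynomial close to \<open>f\<close>, hence to
  \<open>g\<close>, at these lattice points; between them \<open>g\<close> is Lipschitz and the
  polynomial is controlled by Markov's inequality.\<close>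

lemma grid_poly:
  fixes \<kappa> \<epsilon> G0 \<Lambda> :: real
  assumes r: "1 \<le> r" and \<kappa>: "0 < \<kappa>" "\<kappa> \<le> 1 / 8" and \<epsilon>: "0 < \<epsilon>" and G0: "0 \<le> G0" and \<Lambda>: "0 \<le> \<Lambda>"
  obtains \<tau> where "0 < \<tau>" "\<And>f g. f \<in> borel_measurable borel \<Longrightarrow> g \<in> borel_measurable borel \<Longrightarrow> (\<And>x. \<bar>g x\<bar> \<le> G0) \<Longrightarrow>
     (\<And>x y. \<bar>g y - g x\<bar> \<le> \<Lambda> * \<bar>y - x\<bar>) \<Longrightarrow> dint 1 r f \<le> ennreal \<tau> \<Longrightarrow>
     (\<integral>\<^sup>+x\<in>{0..1 - \<kappa>}. ennreal \<bar>f x - g x\<bar> \<partial>lborel) \<le> ennreal \<tau> \<Longrightarrow>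
     \<exists>P. degree P \<le> r - 1 \<and> (\<forall>x\<in>{0..1 - \<kappa>}. \<bar>g x - poly P x\<bar> \<le> \<epsilon>)"
proof -
  obtain CM where CM: "0 < CM" "\<And>(P::real poly) S x. degree P \<le> r - 1 \<Longrightarrow> (\<And>x. x \<in> {0..1 - \<kappa>} \<Longrightarrow> \<bar>poly P x\<bar> \<le> S) \<Longrightarrow> x \<in> {0..1 - \<kappa>} \<Longrightarrow> \<bar>poly (pderiv P) x\<bar> \<le> CM * S"
    by (rule poly_markov_interval[of 0 "1 - \<kappa>" "r - 1"]) (use \<kappa> in auto)
  define E where "E = \<Lambda> + CM * (2 * (G0 + 1))"
  have E: "0 \<le> E" using \<Lambda> CM G0 by (simp add: E_def)
  \<comment> \<open>The three summands make the spacing \<open>h0 = 1 / N\<close> small against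
    \<kappa>, against the Markov constant and against the tolerance \<epsilon>.\<close>
  define K where "K = nat \<lceil>4 / \<kappa> + 2 * CM + 2 * E / \<epsilon>\<rceil>"
  define N where "N = Suc K"
  have Nge: "4 / \<kappa> + 2 * CM + 2 * E / \<epsilon> \<le> real N" using real_nat_ceiling_ge[of "4 / \<kappa> + 2 * CM + 2 * E / \<epsilon>"] by (simp add: N_def K_def)
  have N0: "0 < real N" by (simp add: N_def)
  have p3: "0 < 4 / \<kappa>" "0 \<le> 2 * CM" "0 \<le> 2 * E / \<epsilon>" using \<kappa> CM E \<epsilon> by auto
  have N1: "4 / \<kappa> \<le> real N" "2 * CM \<le> real N" "2 * E / \<epsilon> \<le> real N" using Nge p3 by linarith+
  define h0 where "h0 = 1 / real N"
  have h0: "0 < h0" "h0 \<le> \<kappa> / 4" "CM * h0 \<le> 1 / 2" "E * h0 \<le> \<epsilon> / 2" "real N * h0 = 1"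
  proof -
    show "0 < h0" "real N * h0 = 1" using N0 by (simp_all add: h0_def)
    show "h0 \<le> \<kappa> / 4" using N1(1) N0 \<kappa> by (simp add: h0_def field_simps)
    show "CM * h0 \<le> 1 / 2" using N1(2) N0 by (simp add: h0_def field_simps)
    show "E * h0 \<le> \<epsilon> / 2" using N1(3) N0 \<epsilon> by (simp add: h0_def field_simps)
  qed
  \<comment> \<open>Relative width of the range of steps: even with the smallest step
    \<open>(1 - \<theta>) * h0\<close> the lattice of \<open>N\<close> points reaches beyond
    \<open>1 - \<kappa>\<close>.\<close>
  define \<theta> where "\<theta> = \<kappa> / 4"
  have \<theta>: "0 < \<theta>" "\<theta> < 1" using \<kappa> by (auto simp: \<theta>_def)
  define \<sigma> where "\<sigma> = min 1 (\<epsilon> / 2) / (real N ^ r + 1)"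
  have Nr: "0 < real N ^ r + 1" using N0 by (simp add: add_pos_pos)
  have \<sigma>: "0 < \<sigma>" using \<epsilon> Nr by (simp add: \<sigma>_def)
  have \<sigma>': "(real N ^ r + 1) * \<sigma> \<le> 1" "(real N ^ r + 1) * \<sigma> \<le> \<epsilon> / 2" using Nr by (auto simp: \<sigma>_def)
  define \<tau> where "\<tau> = \<sigma> * (\<theta> * h0) * h0 / (4 * real N)"
  have \<tau>: "0 < \<tau>" using \<sigma> \<theta> h0 N0 by (simp add: \<tau>_def)
  show ?thesis
  proof (rule that[OF \<tau>])
    fix f g :: "real \<Rightarrow> real"
    assume [measurable]: "f \<in> borel_measurable borel" "g \<in> borel_measurable borel"
      and g: "\<And>x. \<bar>g x\<bar> \<le> G0" and lip: "\<And>x y. \<bar>g y - g x\<bar> \<le> \<Lambda> * \<bar>y - x\<bar>" and d: "dint 1 r f \<le> ennreal \<tau>"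
      and fg: "(\<integral>\<^sup>+x\<in>{0..1 - \<kappa>}. ennreal \<bar>f x - g x\<bar> \<partial>lborel) \<le> ennreal \<tau>"
    let ?Y = "{0..1 - \<kappa>}"
    define a where "a h x k = (if k + r \<le> K then ennreal \<bar>fdiff r h f (x + real k * h)\<bar> else 0)" for h x k
    define b where "b h x k = ennreal \<bar>f (x + real k * h) - g (x + real k * h)\<bar> * indicator ?Y (x + real k * h)" for h x k
    \<comment> \<open>One quantity for all nodes at once; a single pair \<open>h\<close>,
      \<open>x\<close> with \<open>F h x \<le> \<sigma>\<close> makes every term small.\<close>
    define F where "F h x = (\<Sum>k\<le>K. a h x k + b h x k)" for h x
    let ?H = "{(1 - \<theta>) * h0..h0}" and ?X = "{0..h0}"
    have [measurable]: "(\<lambda>z. a (fst z) (snd z) k) \<in> borel_measurable (borel \<Otimes>\<^sub>M borel)" "(\<lambda>z. b (fst z) (snd z) k) \<in> borel_measurable (borel \<Otimes>\<^sub>M borel)"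
      "(\<lambda>x. a h x k) \<in> borel_measurable borel" "(\<lambda>x. b h x k) \<in> borel_measurable borel" for k h
      unfolding a_def b_def by measurable
    have Hpos: "0 < h" "h \<le> h0" if "h \<in> ?H" for h
    proof -
      have "0 < (1 - \<theta>) * h0" using \<theta> h0 by simp
      then show "0 < h" "h \<le> h0" using that by auto
    qed
    have up: "(\<integral>\<^sup>+h\<in>?H. (\<integral>\<^sup>+x\<in>?X. F h x \<partial>lborel) \<partial>lborel) \<le> ennreal (2 * real N * \<tau>)"
    proof -
      have "(\<integral>\<^sup>+h\<in>?H. (\<integral>\<^sup>+x\<in>?X. F h x \<partial>lborel) \<partial>lborel) \<le> (\<integral>\<^sup>+h. ennreal (real N) * (\<integral>\<^sup>+x. dcell 1 r f h x \<partial>lborel) + ennreal (real N * \<tau>) * indicator ?H h \<partial>lborel)"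
      proof (rule nn_integral_mono)
        fix h :: real
        show "(\<integral>\<^sup>+x\<in>?X. F h x \<partial>lborel) * indicator ?H h \<le> ennreal (real N) * (\<integral>\<^sup>+x. dcell 1 r f h x \<partial>lborel) + ennreal (real N * \<tau>) * indicator ?H h"
        proof (cases "h \<in> ?H")
          case True
          note hp = Hpos[OF True]
          have "(\<integral>\<^sup>+x\<in>?X. F h x \<partial>lborel) \<le> (\<integral>\<^sup>+x. (\<Sum>k\<le>K. dcell 1 r f h (x + real k * h) + b h x k) \<partial>lborel)"
          proof (rule nn_integral_mono)
            fix x :: real
            show "F h x * indicator ?X x \<le> (\<Sum>k\<le>K. dcell 1 r f h (x + real k * h) + b h x k)"
            proof (cases "x \<in> ?X")
              case True
              have "a h x k \<le> dcell 1 r f h (x + real k * h)" for k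
              proof (cases "k + r \<le> K")
                case kr: True
                have "real (k + r) * h \<le> real K * h0" using kr hp by (intro mult_mono) auto
                also have "\<dots> = 1 - h0" using h0(5) by (simp add: N_def algebra_simps)
                finally have "x + real k * h + real r * h \<le> 1" using True by (simp add: algebra_simps)
                then show ?thesis using True hp by (simp add: a_def dcell_def)
              qed (simp add: a_def)
              then show ?thesis using True by (auto simp: F_def intro!: sum_mono add_right_mono)
            qed simp
          qed
          also have "\<dots> = (\<Sum>k\<le>K. (\<integral>\<^sup>+x. dcell 1 r f h (x + real k * h) + b h x k \<partial>lborel))"
            by (rule nn_integral_sum) measurable
          also have "\<dots> = (\<Sum>k\<le>K. (\<integral>\<^sup>+x. dcell 1 r f h (x + real k * h) \<partial>lborel) + (\<integral>\<^sup>+x. b h x k \<partial>lborel))"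
            by (intro sum.cong refl nn_integral_add) measurable
          also have "\<dots> = (\<Sum>k\<le>K. (\<integral>\<^sup>+x. dcell 1 r f h x \<partial>lborel) + (\<integral>\<^sup>+x\<in>?Y. ennreal \<bar>f x - g x\<bar> \<partial>lborel))"
            unfolding b_def
            by (intro sum.cong refl arg_cong2[where f = "(+)"] nn_integral_translate
                nn_integral_translate[where f = "\<lambda>x. ennreal \<bar>f x - g x\<bar> * indicator ?Y x"]) measurable
          also have "\<dots> \<le> (\<Sum>k\<le>K. (\<integral>\<^sup>+x. dcell 1 r f h x \<partial>lborel) + ennreal \<tau>)"
            by (intro sum_mono add_left_mono fg)
          also have "\<dots> = ennreal (real N) * (\<integral>\<^sup>+x. dcell 1 r f h x \<partial>lborel) + ennreal (real N * \<tau>)"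
            by (simp add: N_def distrib_left ennreal_of_nat_eq_real_of_nat ennreal_mult' del: of_nat_Suc)
          finally show ?thesis using True by simp
        qed simp
      qed
      also have "\<dots> = ennreal (real N) * dint 1 r f + ennreal (real N * \<tau>) * emeasure lborel ?H"
        unfolding dint_def by (subst nn_integral_add, measurable, subst nn_integral_cmult, measurable, subst nn_integral_cmult_indicator, measurable)
      also have "\<dots> \<le> ennreal (real N) * ennreal \<tau> + ennreal (real N * \<tau>) * ennreal 1"
      proof (intro add_mono mult_left_mono d)
        have "emeasure lborel ?H = ennreal (h0 - (1 - \<theta>) * h0)" using \<theta> h0 by (intro emeasure_lborel_Icc) (simp add: mult_left_le_one_le)
        also have "\<dots> \<le> ennreal 1" using \<theta> h0 \<kappa> by (intro ennreal_leI) (simp add: algebra_simps mult_le_one)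
        finally show "emeasure lborel ?H \<le> ennreal 1" .
      qed auto
      also have "\<dots> = ennreal (2 * real N * \<tau>)" using \<tau> by (simp add: mult.assoc flip: ennreal_mult' ennreal_plus)
      finally show ?thesis .
    qed
    \<comment> \<open>Otherwise the integral of \<open>F\<close> over a rectangle of area
      \<open>\<theta> * h0 * h0\<close> would be at least
      \<open>\<sigma> * \<theta> * h0 * h0 = 4 N \<tau>\<close>, twice its upper bound.\<close>
    have "\<exists>h x. h \<in> ?H \<and> x \<in> ?X \<and> F h x \<le> ennreal \<sigma>"
    proof (rule ccontr)
      assume "\<not> ?thesis"
      then have big: "ennreal \<sigma> \<le> F h x" if "h \<in> ?H" "x \<in> ?X" for h x using that by (meson less_imp_le not_le)
      have lenH: "h0 - (1 - \<theta>) * h0 = \<theta> * h0" by (simp add: algebra_simps)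
      have eH: "emeasure lborel ?H = ennreal (\<theta> * h0)" unfolding lenH[symmetric] using \<theta> h0 by (intro emeasure_lborel_Icc) (simp add: mult_left_le_one_le)
      have "ennreal (4 * real N * \<tau>) = ennreal (\<sigma> * h0) * ennreal (\<theta> * h0)"
        using N0 \<sigma> h0 by (simp add: \<tau>_def mult_ac flip: ennreal_mult')
      also have "\<dots> = (\<integral>\<^sup>+h. ennreal (\<sigma> * h0) * indicator ?H h \<partial>lborel)" by (subst nn_integral_cmult_indicator) (auto simp: eH)
      also have "\<dots> \<le> (\<integral>\<^sup>+h\<in>?H. (\<integral>\<^sup>+x\<in>?X. F h x \<partial>lborel) \<partial>lborel)"
      proof (intro nn_integral_mono)
        fix h :: real
        show "ennreal (\<sigma> * h0) * indicator ?H h \<le> (\<integral>\<^sup>+x\<in>?X. F h x \<partial>lborel) * indicator ?H h"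
        proof (cases "h \<in> ?H")
          case True
          have "ennreal (\<sigma> * h0) = (\<integral>\<^sup>+x. ennreal \<sigma> * indicator ?X x \<partial>lborel)"
            using h0 \<sigma> by (subst nn_integral_cmult_indicator) (auto simp: ennreal_mult')
          also have "\<dots> \<le> (\<integral>\<^sup>+x\<in>?X. F h x \<partial>lborel)" using big[OF True] by (intro nn_integral_mono) (auto simp: indicator_def)
          finally show ?thesis by (intro mult_right_mono) auto
        qed simp
      qed
      also have "\<dots> \<le> ennreal (2 * real N * \<tau>)" by (rule up)
      finally have "4 * real N * \<tau> \<le> 2 * real N * \<tau>" using N0 \<tau> by (subst (asm) ennreal_le_iff) auto
      moreover have "0 < real N * \<tau>" using N0 \<tau> by simp
      ultimately show False by linarith
    qed
    then obtain h x0 where h: "h \<in> ?H" and x0: "x0 \<in> ?X" and Fs: "F h x0 \<le> ennreal \<sigma>" by blast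
    note hp = Hpos[OF h]
    have each: "a h x0 k + b h x0 k \<le> ennreal \<sigma>" if "k \<le> K" for k
      using that by (intro order_trans[OF _ Fs]) (auto simp: F_def intro!: member_le_sum[of k "{..K}" "\<lambda>k. a h x0 k + b h x0 k"])
    have A: "\<bar>fdiff r h f (x0 + real k * h)\<bar> \<le> \<sigma>" if "k + r \<le> K" for k
    proof -
      have "a h x0 k \<le> ennreal \<sigma>" using that by (intro order_trans[OF _ each[of k]]) auto
      then show ?thesis using that \<sigma> by (simp add: a_def)
    qed
    have Bd: "\<bar>f (x0 + real k * h) - g (x0 + real k * h)\<bar> \<le> \<sigma>" if "k \<le> K" "x0 + real k * h \<in> ?Y" for k
    proof -
      have "b h x0 k \<le> ennreal \<sigma>" by (intro order_trans[OF _ each[OF that(1)]]) auto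
      then show ?thesis using that \<sigma> by (simp add: b_def)
    qed
    obtain P where P: "degree P \<le> r - 1" "\<And>k. k \<le> K \<Longrightarrow> \<bar>f (x0 + real k * h) - poly P (x0 + real k * h)\<bar> \<le> real K ^ r * \<sigma>"
      by (rule lattice_poly[OF A less_imp_le[OF \<sigma>] r, where K = K]) (use hp in auto)
    have node: "\<bar>g (x0 + real k * h) - poly P (x0 + real k * h)\<bar> \<le> (real N ^ r + 1) * \<sigma>" if "k \<le> K" "x0 + real k * h \<in> ?Y" for k
    proof -
      have "real K ^ r * \<sigma> \<le> real N ^ r * \<sigma>" using \<sigma> by (intro mult_right_mono power_mono) (auto simp: N_def)
      then show ?thesis using Bd[OF that] P(2)[OF that(1)] by (simp add: distrib_right)
    qed
    have near: "\<exists>k\<le>K. x0 + real k * h \<in> ?Y \<and> \<bar>x - (x0 + real k * h)\<bar> \<le> h0" if x: "x \<in> ?Y" for x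
    proof (cases "x < x0")
      case True
      then show ?thesis using x x0 h0 \<kappa> by (intro exI[of _ 0]) auto
    next
      case False
      define k where "k = nat \<lfloor>(x - x0) / h\<rfloor>"
      have "0 \<le> (x - x0) / h" using False hp by simp
      then have k: "real k \<le> (x - x0) / h" "(x - x0) / h < real k + 1" unfolding k_def by linarith+
      then have kh: "real k * h \<le> x - x0" "x - x0 < (real k + 1) * h" using hp by (simp_all add: field_simps)
      have "k \<le> K"
      proof (rule ccontr)
        assume "\<not> k \<le> K"
        then have "real N \<le> real k" by (simp add: N_def)
        then have "real N * ((1 - \<theta>) * h0) \<le> real k * h" using h \<theta> h0 by (intro mult_mono) auto
        moreover have "real N * ((1 - \<theta>) * h0) = 1 - \<theta>" using h0(5) by (metis mult.commute mult.left_commute mult_1)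
        ultimately have "1 - \<kappa> / 4 \<le> real k * h" by (simp only: \<theta>_def)
        then show False using kh(1) x x0 \<kappa> by auto
      qed
      then show ?thesis using kh x x0 hp by (intro exI[of _ k]) (auto simp: algebra_simps)
    qed
    obtain z where z: "z \<in> ?Y" "\<And>y. y \<in> ?Y \<Longrightarrow> \<bar>poly P y\<bar> \<le> \<bar>poly P z\<bar>"
    proof -
      have "\<exists>x\<in>?Y. \<forall>y\<in>?Y. \<bar>poly P y\<bar> \<le> \<bar>poly P x\<bar>"
        by (rule continuous_attains_sup) (use \<kappa> in \<open>auto intro!: continuous_intros\<close>)
      then show ?thesis using that by blast
    qed
    define S where "S = \<bar>poly P z\<bar>"
    have S0: "0 \<le> S" by (simp add: S_def)
    have Plip: "\<bar>poly P x - poly P y\<bar> \<le> CM * S * \<bar>x - y\<bar>" if "x \<in> ?Y" "y \<in> ?Y" for x y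
    proof -
      have *: "\<bar>poly P v - poly P u\<bar> \<le> CM * S * (v - u)" if uv: "u \<in> ?Y" "v \<in> ?Y" "u < v" for u v
      proof -
        obtain w where w: "u < w" "w < v" "poly P v - poly P u = (v - u) * poly (pderiv P) w"
          using poly_MVT[OF uv(3), of P] by blast
        have "\<bar>poly (pderiv P) w\<bar> \<le> CM * S" using CM(2)[OF P(1), of S w] z(2) w uv by (auto simp: S_def)
        then show ?thesis using w(3) uv(3) by (simp add: abs_mult mult.commute mult_left_mono)
      qed
      show ?thesis using *[of x y] *[of y x] that by (cases x y rule: linorder_cases) (auto simp: abs_minus_commute)
    qed
    have step: "\<bar>poly P x - poly P y\<bar> \<le> CM * h0 * S" if "x \<in> ?Y" "y \<in> ?Y" "\<bar>x - y\<bar> \<le> h0" for x y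
    proof -
      have "CM * S * \<bar>x - y\<bar> \<le> CM * S * h0" using that CM S0 by (intro mult_left_mono) auto
      with Plip[OF that(1,2)] show ?thesis by (simp add: mult_ac)
    qed
    \<comment> \<open>The bound on \<open>P\<close> at the nodes extends to its maximum
      \<open>S\<close> by absorption: moving to the nearest node changes \<open>P\<close> by at most
      \<open>S / 2\<close>.\<close>
    have S2: "S \<le> 2 * (G0 + 1)"
    proof -
      obtain k where k: "k \<le> K" "x0 + real k * h \<in> ?Y" "\<bar>z - (x0 + real k * h)\<bar> \<le> h0" using near[OF z(1)] by blast
      have "S \<le> \<bar>poly P (x0 + real k * h)\<bar> + CM * h0 * S" using step[OF z(1) k(2,3)] by (simp add: S_def)
      moreover have "\<bar>poly P (x0 + real k * h)\<bar> \<le> G0 + 1" using node[OF k(1,2)] g[of "x0 + real k * h"] \<sigma>'(1) by linarith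
      moreover have "CM * h0 * S \<le> 1 / 2 * S" using h0(3) S0 by (intro mult_right_mono) auto
      ultimately have "S \<le> (G0 + 1) + 1 / 2 * S" by (meson add_mono order_trans)
      then show ?thesis by simp
    qed
    have "\<bar>g x - poly P x\<bar> \<le> \<epsilon>" if x: "x \<in> ?Y" for x
    proof -
      obtain k where k: "k \<le> K" "x0 + real k * h \<in> ?Y" "\<bar>x - (x0 + real k * h)\<bar> \<le> h0" using near[OF x] by blast
      have "\<bar>g x - g (x0 + real k * h)\<bar> \<le> \<Lambda> * h0" using lip[where x = "x0 + real k * h" and y = x] k(3) \<Lambda> by (meson mult_left_mono order_trans)
      moreover have "\<bar>poly P x - poly P (x0 + real k * h)\<bar> \<le> CM * h0 * (2 * (G0 + 1))"
        using step[OF x k(2,3)] S2 CM h0 by (meson mult_left_mono mult_nonneg_nonneg less_imp_le order_trans)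
      moreover have "\<Lambda> * h0 + CM * h0 * (2 * (G0 + 1)) = E * h0" by (simp add: E_def algebra_simps)
      ultimately show ?thesis using node[OF k(1,2)] \<sigma>'(2) h0(4) by linarith
    qed
    then show "\<exists>P. degree P \<le> r - 1 \<and> (\<forall>x\<in>?Y. \<bar>g x - poly P x\<bar> \<le> \<epsilon>)" using P(1) by blast
  qed
qed

lemma fdiff_poly_zero:
  assumes "degree P \<le> r - 1" "1 \<le> r" "0 \<le> h"
  shows "fdiff r h (poly P) x = 0"
proof -
  have dg: "degree P < r \<Longrightarrow> (pderiv ^^ r) P = 0" for P :: "real poly" and r
  proof (induction r arbitrary: P)
    case (Suc r)
    show ?case
    proof (cases "degree P")
      case 0
      then have z: "pderiv P = 0" by (simp add: pderiv_eq_0_iff)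
      have "(pderiv ^^ k) (0::real poly) = 0" for k by (induction k) auto
      then show ?thesis using z by (simp add: funpow_swap1)
    next
      case (Suc d)
      then have "(pderiv ^^ r) (pderiv P) = 0" using Suc.prems by (intro Suc.IH) (auto simp: degree_pderiv)
      then show ?thesis by (simp add: funpow_swap1)
    qed
  qed simp
  have "(pderiv ^^ r) P = 0" using assms by (intro dg) auto
  then have "\<bar>fdiff r h (poly P) x\<bar> \<le> h ^ r * 0" using assms by (intro fdiff_poly_le) auto
  then show ?thesis by simp
qed

lemma dint_minus_poly:
  assumes "degree P \<le> r - 1" "1 \<le> r"
  shows "dint p r (\<lambda>x. f x - poly P x) = dint p r f"
  unfolding dint_def dcell_def
  by (intro nn_integral_cong) (auto simp: fdiff_diff fdiff_poly_zero[OF assms])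

subsection \<open>Whitney's inequality for \<open>0 < p \<le> 1\<close>\<close>

text \<open>Chebyshev's inequality; the case distinction serves to cancel \<open>c\<close> in
  \<open>ennreal\<close>.\<close>

lemma emeasure_le_nn_integral:
  fixes u :: "real \<Rightarrow> ennreal"
  assumes [measurable]: "u \<in> borel_measurable borel" and c: "0 < c" and A: "A \<in> sets borel" "\<And>x. x \<in> A \<Longrightarrow> ennreal c \<le> u x * indicator B x"
    and I: "(\<integral>\<^sup>+x. u x * indicator B x \<partial>lborel) \<le> ennreal K" and K: "K \<le> c * m" "0 \<le> K"
  shows "emeasure lborel A \<le> ennreal m"
proof -
  have "ennreal c * emeasure lborel A = (\<integral>\<^sup>+x. ennreal c * indicator A x \<partial>lborel)"
    using A by (subst nn_integral_cmult_indicator) auto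
  also have "\<dots> \<le> (\<integral>\<^sup>+x. u x * indicator B x \<partial>lborel)"
  proof (rule nn_integral_mono)
    fix x
    show "ennreal c * indicator A x \<le> u x * indicator B x" using A(2)[of x] by (cases "x \<in> A") auto
  qed
  also have "\<dots> \<le> ennreal (c * m)" using I K by (meson ennreal_leI order_trans)
  finally have le: "ennreal c * emeasure lborel A \<le> ennreal (c * m)" .
  have m0: "0 \<le> m" using K c by (metis less_le_not_le linorder_not_le mult_pos_neg order_trans)
  show ?thesis
  proof (cases "emeasure lborel A")
    case (real x)
    then have "c * x \<le> c * m" using le c m0 by (simp flip: ennreal_mult' add: ennreal_le_iff)
    then show ?thesis using real c by (simp add: ennreal_leI)
  next
    case top
    then show ?thesis using le c by (simp add: ennreal_mult_top top_unique)
  qed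
qed

text \<open>For \<open>p < 1\<close> a function with small averaged difference is first replaced by a bounded one, at the
  cost of the difference itself; for bounded functions averaging over \<open>h\<close> gives a Lipschitz function.\<close>

lemma whitney_core:
  assumes p: "0 < p" "p \<le> 1" and r: "1 \<le> r"
  obtains \<tau> where "0 < \<tau>" "\<And>f. f \<in> borel_measurable borel \<Longrightarrow> uint p f \<le> 2 \<Longrightarrow> dint p r f \<le> ennreal \<tau> \<Longrightarrow>
     \<exists>Q. degree Q \<le> r - 1 \<and> uint p (\<lambda>x. f x - poly Q x) \<le> ennreal (1 / 2)"
proof -
  have rp: "1 \<le> real r" using r by simp
  define \<kappa> where "\<kappa> = 1 / (8 * real r)"
  have \<kappa>: "0 < \<kappa>" "\<kappa> \<le> 1 / 8" using rp by (auto simp: \<kappa>_def field_simps)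
  define \<eta> where "\<eta> = 1 / (16 * (real r)\<^sup>2)"
  have \<eta>: "0 < \<eta>" using rp by (simp add: \<eta>_def)
  \<comment> \<open>\<open>M\<close> is twice the constant term that \<open>self_improvement\<close>
    produces at the level \<open>2 / \<eta>\<close>; where \<open>|f|^p > M\<close> that term is
    absorbed and \<open>|f|^p\<close> is bounded by the averaged difference alone.\<close>
  define M where "M = 4 * (real r * 2 ^ r * (2 / \<eta>))"
  have M: "0 < M" using rp \<eta> by (simp add: M_def)
  define L where "L = M powr (1 / p)"
  have L: "0 < L" "L powr p = M" using M p by (auto simp: L_def powr_powr)
  define c1 where "c1 = 1 + 2 ^ Suc r * (64 * real r)"
  define c2 where "c2 = (4 ^ r * L) powr (1 - p)"
  have c12: "0 < c1" "0 < c2" using rp L by (auto simp: c1_def c2_def add_pos_nonneg)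
  define d where "d = \<kappa> / real r"
  have d: "0 < d" "real r * d = \<kappa>" using \<kappa> rp by (auto simp: d_def)
  \<comment> \<open>Chosen so that the constant term of \<open>self_improvement\<close> at the level
    \<open>l powr p\<close> is \<open>1 / 4\<close>.\<close>
  define l where "l = (1 / (8 * (real r * 2 ^ r))) powr (1 / p)"
  have l: "0 < l" "l powr p = 1 / (8 * (real r * 2 ^ r))" using rp p by (auto simp: l_def powr_powr)
  obtain \<tau>1 where \<tau>1: "0 < \<tau>1" "\<And>f g. f \<in> borel_measurable borel \<Longrightarrow> g \<in> borel_measurable borel \<Longrightarrow> (\<And>x. \<bar>g x\<bar> \<le> real r * 2 ^ r * L) \<Longrightarrow>
     (\<And>x y. \<bar>g y - g x\<bar> \<le> real r * 2 ^ r * (2 * L / d) * \<bar>y - x\<bar>) \<Longrightarrow> dint 1 r f \<le> ennreal \<tau>1 \<Longrightarrow>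
     (\<integral>\<^sup>+x\<in>{0..1 - \<kappa>}. ennreal \<bar>f x - g x\<bar> \<partial>lborel) \<le> ennreal \<tau>1 \<Longrightarrow>
     \<exists>P. degree P \<le> r - 1 \<and> (\<forall>x\<in>{0..1 - \<kappa>}. \<bar>g x - poly P x\<bar> \<le> l / 2)"
    by (rule grid_poly[OF r \<kappa>, of "l / 2" "real r * 2 ^ r * L" "real r * 2 ^ r * (2 * L / d)"]) (use l L d rp in auto)
  \<comment> \<open>In this order: the two smallness hypotheses of \<open>grid_poly\<close>, half of
    the bad-set budget \<eta> for the truncation, the other half for the smoothing, and a final
    contribution of at most \<open>1 / 4\<close>.\<close>
  define \<tau> where "\<tau> = Min {\<tau>1 / (c2 * c1), \<tau>1 / (1 / d * (c2 * c1)), M * (\<eta> / 2) / (64 * real r), l / 2 * (\<eta> / 2) / (1 / d * (c2 * c1)), 1 / (128 * real r)}"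
  have \<tau>: "0 < \<tau>" using \<tau>1 c12 d \<eta> M l rp by (simp add: \<tau>_def)
  have \<tau>s: "c2 * c1 * \<tau> \<le> \<tau>1" "1 / d * (c2 * c1) * \<tau> \<le> \<tau>1" "64 * real r * \<tau> \<le> M * (\<eta> / 2)"
    "1 / d * (c2 * c1) * \<tau> \<le> l / 2 * (\<eta> / 2)" "32 * real r * \<tau> \<le> 1 / 4"
  proof -
    have *: "x * \<tau> \<le> y" if "\<tau> \<le> y / x" "0 < x" for x y using that by (simp add: field_simps)
    have pos: "0 < c2 * c1" "0 < 1 / d * (c2 * c1)" "0 < 64 * real r" using c12 d rp by auto
    show "c2 * c1 * \<tau> \<le> \<tau>1" by (rule * [OF _ pos(1)]) (simp add: \<tau>_def)
    show "1 / d * (c2 * c1) * \<tau> \<le> \<tau>1" by (rule * [OF _ pos(2)]) (simp add: \<tau>_def)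
    show "64 * real r * \<tau> \<le> M * (\<eta> / 2)" by (rule * [OF _ pos(3)]) (simp add: \<tau>_def)
    show "1 / d * (c2 * c1) * \<tau> \<le> l / 2 * (\<eta> / 2)" by (rule * [OF _ pos(2)]) (simp add: \<tau>_def)
    have "\<tau> \<le> (1 / 4) / (32 * real r)" by (simp add: \<tau>_def)
    then show "32 * real r * \<tau> \<le> 1 / 4" by (rule *) (use rp in auto)
  qed
  show ?thesis
  proof (rule that[OF \<tau>])
    fix f :: "real \<Rightarrow> real"
    assume [measurable]: "f \<in> borel_measurable borel" and f2: "uint p f \<le> 2" and A: "dint p r f \<le> ennreal \<tau>"
    have pm: "(\<lambda>x. ennreal (\<bar>u x\<bar> powr p)) \<in> borel_measurable borel" if [measurable]: "u \<in> borel_measurable borel" for u :: "real \<Rightarrow> real"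
      by measurable
    have davgI: "(\<integral>\<^sup>+x\<in>{0..1}. davg p r u x \<partial>lborel) \<le> ennreal (2 * \<tau>)" if [measurable]: "u \<in> borel_measurable borel" and "dint p r u \<le> ennreal \<tau>" for u
    proof -
      have "(\<integral>\<^sup>+x\<in>{0..1}. davg p r u x \<partial>lborel) \<le> 2 * dint p r u" by (rule nn_integral_davg_le[OF r]) measurable
      also have "\<dots> \<le> 2 * ennreal \<tau>" by (intro mult_left_mono that) auto
      finally show ?thesis using \<tau> by (simp add: ennreal_mult')
    qed
    \<comment> \<open>Chebyshev's inequality with the normalisation \<open>uint p f \<le> 2\<close>;
      this starts the first use of \<open>self_improvement\<close>, on \<open>f\<close>
      itself.\<close>
    have bad1: "emeasure lborel {x \<in> {0..1 - \<kappa>}. 2 / \<eta> < \<bar>f x\<bar> powr p} \<le> ennreal \<eta>"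
    proof (rule emeasure_le_nn_integral[OF pm, where B = "{0..1}" and c = "2 / \<eta>" and K = 2])
      show "(\<integral>\<^sup>+x. ennreal (\<bar>f x\<bar> powr p) * indicator {0..1} x \<partial>lborel) \<le> ennreal 2" using f2 by (simp add: uint_def)
      show "{x \<in> {0..1 - \<kappa>}. 2 / \<eta> < \<bar>f x\<bar> powr p} \<in> sets borel" by measurable
    qed (use \<eta> \<kappa> in \<open>auto simp: indicator_def intro!: ennreal_leI\<close>)
    \<comment> \<open>The bounded replacement: large values are set to 0 rather than clipped, so
      that on \<open>[0, 1]\<close> the difference \<open>f - g2\<close> is either 0 or
      \<open>f\<close> with \<open>|f|^p > M\<close>.\<close>
    define g2 where "g2 x = (if x \<in> {0..1} \<and> \<bar>f x\<bar> powr p \<le> M then f x else 0)" for x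
    have [measurable]: "g2 \<in> borel_measurable borel" unfolding g2_def by measurable
    have g2L: "\<bar>g2 x\<bar> \<le> L" for x
    proof (cases "x \<in> {0..1} \<and> \<bar>f x\<bar> powr p \<le> M")
      case True
      then have "(\<bar>f x\<bar> powr p) powr (1 / p) \<le> L" unfolding L_def using p by (intro powr_mono2) auto
      then show ?thesis using True p by (simp add: g2_def powr_powr)
    next
      case False then show ?thesis using L by (auto simp: g2_def)
    qed
    have tail: "ennreal (\<bar>f x - g2 x\<bar> powr p) * indicator {0..1} x \<le> ennreal (32 * real r) * (davg p r f x * indicator {0..1} x)" for x
    proof (cases "x \<in> {0..1} \<and> M < \<bar>f x\<bar> powr p")
      case True
      let ?a = "\<bar>f x\<bar> powr p"
      have "ennreal ?a \<le> ennreal (2 * (real r * 2 ^ r * (2 / \<eta>))) + ennreal (16 * real r) * davg p r f x"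
        using True \<eta> bad1 by (intro self_improvement[OF p r]) (auto simp: \<eta>_def \<kappa>_def)
      then have le: "ennreal ?a \<le> ennreal (M / 2) + ennreal (16 * real r) * davg p r f x" by (simp add: M_def)
      have "ennreal ?a \<le> ennreal (32 * real r) * davg p r f x"
      proof (cases "davg p r f x")
        case (real y)
        then have "ennreal ?a \<le> ennreal (M / 2 + 16 * real r * y)" using le M by (simp flip: ennreal_mult' ennreal_plus)
        then have "?a \<le> M / 2 + 16 * real r * y" using real M by (subst (asm) ennreal_le_iff) auto
        then have "?a \<le> 32 * real r * y" using True by simp
        then show ?thesis using real by (simp add: ennreal_leI flip: ennreal_mult')
      next
        case top then show ?thesis using rp by (simp add: ennreal_mult_top)
      qed
      then show ?thesis using True by (simp add: g2_def)
    next
      case False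
      then show ?thesis using p by (auto simp: g2_def indicator_def)
    qed
    have fg2: "uint p (\<lambda>x. f x - g2 x) \<le> ennreal (64 * real r * \<tau>)"
    proof -
      have "uint p (\<lambda>x. f x - g2 x) \<le> (\<integral>\<^sup>+x. ennreal (32 * real r) * (davg p r f x * indicator {0..1} x) \<partial>lborel)"
        unfolding uint_def by (intro nn_integral_mono tail)
      also have "\<dots> = ennreal (32 * real r) * (\<integral>\<^sup>+x\<in>{0..1}. davg p r f x \<partial>lborel)" by (rule nn_integral_cmult) measurable
      also have "\<dots> \<le> ennreal (32 * real r) * ennreal (2 * \<tau>)" by (intro mult_left_mono davgI A) auto
      also have "\<dots> = ennreal (64 * real r * \<tau>)" using \<tau> by (subst ennreal_mult'[symmetric]) auto
      finally show ?thesis .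
    qed
    have dg2: "dint p r g2 \<le> ennreal (c1 * \<tau>)"
    proof -
      have "dint p r g2 \<le> dint p r f + ennreal (2 ^ Suc r) * uint p (\<lambda>x. f x - g2 x)"
        by (rule dint_perturb[OF p r]) measurable
      also have "\<dots> \<le> ennreal \<tau> + ennreal (2 ^ Suc r) * ennreal (64 * real r * \<tau>)"
        by (intro add_mono mult_left_mono A fg2) auto
      also have "\<dots> = ennreal (\<tau> + 2 ^ Suc r * (64 * real r * \<tau>))" using \<tau> by (simp only: ennreal_mult'[symmetric] ennreal_plus zero_le_power zero_le_numeral mult_nonneg_nonneg less_imp_le of_nat_0_le_iff)
      also have "\<tau> + 2 ^ Suc r * (64 * real r * \<tau>) = c1 * \<tau>" by (simp add: c1_def distrib_right)
      finally show ?thesis .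
    qed
    have d1: "dint 1 r g2 \<le> ennreal (c2 * c1 * \<tau>)"
    proof -
      have "dint 1 r g2 \<le> ennreal c2 * dint p r g2" unfolding c2_def using L g2L by (intro dint_one_le[OF p]) auto
      also have "\<dots> \<le> ennreal c2 * ennreal (c1 * \<tau>)" by (intro mult_left_mono dg2) auto
      finally show ?thesis using c12 by (simp add: mult.assoc flip: ennreal_mult')
    qed
    define g where "g = smooth r d g2"
    have [measurable]: "g \<in> borel_measurable borel" unfolding g_def by measurable
    have gerr: "(\<integral>\<^sup>+x\<in>{0..1 - \<kappa>}. ennreal \<bar>g2 x - g x\<bar> \<partial>lborel) \<le> ennreal (1 / d * (c2 * c1) * \<tau>)"
    proof -
      have "(\<integral>\<^sup>+x\<in>{0..1 - \<kappa>}. ennreal \<bar>g2 x - g x\<bar> \<partial>lborel) \<le> ennreal (1 / d) * dint 1 r g2"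
        unfolding g_def d(2)[symmetric] using g2L d by (intro nn_integral_smooth_error) auto
      also have "\<dots> \<le> ennreal (1 / d) * ennreal (c2 * c1 * \<tau>)" by (intro mult_left_mono d1) auto
      also have "\<dots> = ennreal (1 / d * (c2 * c1) * \<tau>)" using d by (simp add: mult.assoc ennreal_mult'[symmetric])
      finally show ?thesis .
    qed
    have "\<exists>P. degree P \<le> r - 1 \<and> (\<forall>x\<in>{0..1 - \<kappa>}. \<bar>g x - poly P x\<bar> \<le> l / 2)"
    proof (rule \<tau>1(2))
      show "\<bar>g x\<bar> \<le> real r * 2 ^ r * L" for x unfolding g_def using g2L L d by (intro smooth_bound) auto
      show "\<bar>g y - g x\<bar> \<le> real r * 2 ^ r * (2 * L / d) * \<bar>y - x\<bar>" for x y unfolding g_def using g2L L d by (intro smooth_lipschitz) auto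
      show "dint 1 r g2 \<le> ennreal \<tau>1" using d1 \<tau>s(1) by (meson ennreal_leI order_trans)
      show "(\<integral>\<^sup>+x\<in>{0..1 - \<kappa>}. ennreal \<bar>g2 x - g x\<bar> \<partial>lborel) \<le> ennreal \<tau>1" using gerr \<tau>s(2) by (meson ennreal_leI order_trans)
    qed measurable
    then obtain P where P: "degree P \<le> r - 1" "\<And>x. x \<in> {0..1 - \<kappa>} \<Longrightarrow> \<bar>g x - poly P x\<bar> \<le> l / 2" by blast
    define e where "e x = f x - poly P x" for x
    have [measurable]: "e \<in> borel_measurable borel" unfolding e_def by measurable
    have de: "dint p r e \<le> ennreal \<tau>" using A dint_minus_poly[OF P(1) r, of p f] by (simp add: e_def[abs_def])
    \<comment> \<open>On \<open>[0, 1 - \<kappa>]\<close> and outside \<open>B1\<close> and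
      \<open>B2\<close>, \<open>f\<close> equals \<open>g2\<close>, which is within
      \<open>l / 2\<close> of \<open>g\<close>, which is within \<open>l / 2\<close> of
      \<open>P\<close>; so \<open>|e|\<close> exceeds \<open>l\<close> only on these two
      sets.\<close>
    define B1 where "B1 = {x \<in> {0..1}. f x \<noteq> g2 x}"
    define B2 where "B2 = {x \<in> {0..1 - \<kappa>}. l / 2 \<le> \<bar>g2 x - g x\<bar>}"
    have [measurable]: "B1 \<in> sets borel" "B2 \<in> sets borel" unfolding B1_def B2_def by measurable
    have b1: "emeasure lborel B1 \<le> ennreal (\<eta> / 2)"
    proof (rule emeasure_le_nn_integral[OF pm, where B = "{0..1}" and c = M and K = "64 * real r * \<tau>" and u1 = "\<lambda>x. f x - g2 x"])
      show "(\<integral>\<^sup>+x. ennreal (\<bar>f x - g2 x\<bar> powr p) * indicator {0..1} x \<partial>lborel) \<le> ennreal (64 * real r * \<tau>)" using fg2 by (simp add: uint_def)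
      fix x assume "x \<in> B1"
      then show "ennreal M \<le> ennreal (\<bar>f x - g2 x\<bar> powr p) * indicator {0..1} x"
        by (auto simp: B1_def g2_def indicator_def intro!: ennreal_leI split: if_splits)
    qed (use M \<tau>s \<tau> rp in auto)
    have b2: "emeasure lborel B2 \<le> ennreal (\<eta> / 2)"
    proof (rule emeasure_le_nn_integral[where B = "{0..1 - \<kappa>}" and c = "l / 2" and K = "1 / d * (c2 * c1) * \<tau>" and u = "\<lambda>x. ennreal \<bar>g2 x - g x\<bar>"])
      show "(\<integral>\<^sup>+x. ennreal \<bar>g2 x - g x\<bar> * indicator {0..1 - \<kappa>} x \<partial>lborel) \<le> ennreal (1 / d * (c2 * c1) * \<tau>)" by (rule gerr)
      fix x assume "x \<in> B2"
      then show "ennreal (l / 2) \<le> ennreal \<bar>g2 x - g x\<bar> * indicator {0..1 - \<kappa>} x"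
        by (auto simp: B2_def intro!: ennreal_leI)
    qed (use l \<tau>s \<tau> c12 d in auto)
    have bad2: "emeasure lborel {x \<in> {0..1 - 1 / (8 * real r)}. l powr p < \<bar>e x\<bar> powr p} \<le> ennreal (1 / (16 * (real r)\<^sup>2))"
    proof -
      have "emeasure lborel {x \<in> {0..1 - 1 / (8 * real r)}. l powr p < \<bar>e x\<bar> powr p} \<le> emeasure lborel (B1 \<union> B2)"
      proof (rule emeasure_mono)
        show "{x \<in> {0..1 - 1 / (8 * real r)}. l powr p < \<bar>e x\<bar> powr p} \<subseteq> B1 \<union> B2"
        proof
          fix x assume x: "x \<in> {x \<in> {0..1 - 1 / (8 * real r)}. l powr p < \<bar>e x\<bar> powr p}"
          then have xY: "x \<in> {0..1 - \<kappa>}" by (simp add: \<kappa>_def)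
          have "\<not> \<bar>e x\<bar> \<le> l" using x powr_mono2[of p "\<bar>e x\<bar>" l] p by force
          then have "l < \<bar>f x - poly P x\<bar>" by (simp add: e_def)
          then show "x \<in> B1 \<union> B2" using P(2)[OF xY] xY \<kappa> abs_triangle_ineq[of "g2 x - g x" "g x - poly P x"] by (cases "f x = g2 x") (auto simp: B1_def B2_def)
        qed
      qed measurable
      also have "\<dots> \<le> emeasure lborel B1 + emeasure lborel B2" by (rule emeasure_subadditive) auto
      also have "\<dots> \<le> ennreal (\<eta> / 2) + ennreal (\<eta> / 2)" by (intro add_mono b1 b2)
      also have "\<dots> = ennreal \<eta>" using \<eta> by (simp flip: ennreal_plus)
      finally show ?thesis by (simp add: \<eta>_def)
    qed
    \<comment> \<open>The second use of \<open>self_improvement\<close>, now for the error; it also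
      covers the remaining piece \<open>(1 - \<kappa>, 1]\<close>.\<close>
    have "uint p e \<le> (\<integral>\<^sup>+x. ennreal (1 / 4) * indicator {0..1} x + ennreal (16 * real r) * (davg p r e x * indicator {0..1} x) \<partial>lborel)"
      unfolding uint_def
    proof (rule nn_integral_mono)
      fix x :: real
      show "ennreal (\<bar>e x\<bar> powr p) * indicator {0..1} x \<le> ennreal (1 / 4) * indicator {0..1} x + ennreal (16 * real r) * (davg p r e x * indicator {0..1} x)"
      proof (cases "x \<in> {0..1}")
        case True
        have "ennreal (\<bar>e x\<bar> powr p) \<le> ennreal (2 * (real r * 2 ^ r * l powr p)) + ennreal (16 * real r) * davg p r e x"
          by (rule self_improvement[OF p r _ _ bad2 True]) auto
        also have "2 * (real r * 2 ^ r * l powr p) = 1 / 4" using rp by (simp add: l(2))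
        finally show ?thesis using True by simp
      qed simp
    qed
    also have "\<dots> = ennreal (1 / 4) * emeasure lborel {0..1::real} + ennreal (16 * real r) * (\<integral>\<^sup>+x\<in>{0..1}. davg p r e x \<partial>lborel)"
      by (subst nn_integral_add, measurable, subst nn_integral_cmult_indicator, measurable, subst nn_integral_cmult, measurable)
    also have "\<dots> \<le> ennreal (1 / 4) * 1 + ennreal (16 * real r) * ennreal (2 * \<tau>)"
      by (intro add_mono mult_left_mono davgI de) auto
    also have "\<dots> = ennreal (1 / 4 + 32 * real r * \<tau>)" using \<tau> by (subst ennreal_plus) (auto simp: mult_ac ennreal_mult'[symmetric])
    also have "\<dots> \<le> ennreal (1 / 2)" using \<tau>s(5) by (intro ennreal_leI) simp
    finally have "uint p e \<le> ennreal (1 / 2)" .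
    then show "\<exists>Q. degree Q \<le> r - 1 \<and> uint p (\<lambda>x. f x - poly Q x) \<le> ennreal (1 / 2)"
      using P(1) by (auto simp: e_def[abs_def])
  qed
qed

section \<open>Homogeneity and transfer to arbitrary intervals\<close>

lemma uint_cmult:
  assumes [measurable]: "f \<in> borel_measurable borel"
  shows "uint p (\<lambda>x. c * f x) = ennreal (\<bar>c\<bar> powr p) * uint p f"
proof -
  have "uint p (\<lambda>x. c * f x) = (\<integral>\<^sup>+x. ennreal (\<bar>c\<bar> powr p) * (ennreal (\<bar>f x\<bar> powr p) * indicator {0..1} x) \<partial>lborel)"
    unfolding uint_def by (intro nn_integral_cong) (simp add: abs_mult powr_mult ennreal_mult' mult.assoc)
  also have "\<dots> = ennreal (\<bar>c\<bar> powr p) * uint p f" unfolding uint_def by (rule nn_integral_cmult) measurable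
  finally show ?thesis .
qed

lemma fdiff_cmult: "fdiff r h (\<lambda>x. c * f x) x = c * fdiff r h f x"
  by (simp add: fdiff_def sum_distrib_left mult_ac)

lemma dint_cmult:
  assumes [measurable]: "f \<in> borel_measurable borel"
  shows "dint p r (\<lambda>x. c * f x) = ennreal (\<bar>c\<bar> powr p) * dint p r f"
proof -
  have e: "dcell p r (\<lambda>x. c * f x) h x = ennreal (\<bar>c\<bar> powr p) * dcell p r f h x" for h x
    by (simp add: dcell_def fdiff_cmult abs_mult powr_mult ennreal_mult')
  have "dint p r (\<lambda>x. c * f x) = (\<integral>\<^sup>+h. ennreal (\<bar>c\<bar> powr p) * (\<integral>\<^sup>+x. dcell p r f h x \<partial>lborel) \<partial>lborel)"
    unfolding dint_def e by (intro nn_integral_cong nn_integral_cmult) measurable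
  also have "\<dots> = ennreal (\<bar>c\<bar> powr p) * dint p r f" unfolding dint_def by (rule nn_integral_cmult) measurable
  finally show ?thesis .
qed

text \<open>Suppose the infimum \<open>y\<close> of the errors exceeded
  \<open>dint / \<tau>\<close>. A polynomial with error below \<open>2 y\<close> is subtracted and
  the rest scaled to error at most 2; its averaged difference is then at most \<tau>, and
  \<open>whitney_core\<close> yields an error of at most \<open>y / 2\<close>, below the infimum.
  The slack \<epsilon> avoids the question whether the infimum is attained.\<close>

lemma whitney_unit:
  assumes p: "0 < p" "p \<le> 1" and r: "1 \<le> r"
  obtains C where "0 < C" "\<And>f \<epsilon>. f \<in> borel_measurable borel \<Longrightarrow> uint p f < \<infinity> \<Longrightarrow> 0 < \<epsilon> \<Longrightarrow>
     \<exists>P. degree P \<le> r - 1 \<and> uint p (\<lambda>x. f x - poly P x) \<le> ennreal C * dint p r f + ennreal \<epsilon>"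
proof -
  obtain \<tau> where \<tau>: "0 < \<tau>" "\<And>f. f \<in> borel_measurable borel \<Longrightarrow> uint p f \<le> 2 \<Longrightarrow> dint p r f \<le> ennreal \<tau> \<Longrightarrow>
     \<exists>Q. degree Q \<le> r - 1 \<and> uint p (\<lambda>x. f x - poly Q x) \<le> ennreal (1 / 2)"
    by (rule whitney_core[OF p r]) blast
  show ?thesis
  proof (rule that[of "1 / \<tau>"])
    show "0 < 1 / \<tau>" using \<tau> by simp
    fix f :: "real \<Rightarrow> real" and \<epsilon> :: real
    assume [measurable]: "f \<in> borel_measurable borel" and fin: "uint p f < \<infinity>" and \<epsilon>: "0 < \<epsilon>"
    define E where "E = (INF P\<in>{P. degree P \<le> r - 1}. uint p (\<lambda>x. f x - poly P x))"
    have "E \<le> uint p (\<lambda>x. f x - poly 0 x)" unfolding E_def by (rule INF_lower) simp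
    then have "E < \<infinity>" using fin by (simp add: le_less_trans)
    then obtain y where y: "E = ennreal y" "0 \<le> y" by (cases E) auto
    have near: "\<exists>P. degree P \<le> r - 1 \<and> uint p (\<lambda>x. f x - poly P x) < ennreal (y + t)" if t: "0 < t" for t
    proof -
      have "E < ennreal (y + t)" using y t by (simp add: ennreal_less_iff)
      then show ?thesis unfolding E_def INF_less_iff by auto
    qed
    have Ele: "E \<le> ennreal (1 / \<tau>) * dint p r f"
    proof (rule ccontr)
      assume n: "\<not> E \<le> ennreal (1 / \<tau>) * dint p r f"
      have y0: "0 < y" using n y by (cases "y = 0") auto
      obtain P where P: "degree P \<le> r - 1" "uint p (\<lambda>x. f x - poly P x) < ennreal (y + y)" using near[OF y0] by blast
      define c where "c = (1 / y) powr (1 / p)"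
      have c: "0 < c" "\<bar>c\<bar> powr p = 1 / y" using y0 p by (auto simp: c_def powr_powr)
      define g where "g x = c * (f x - poly P x)" for x
      have [measurable]: "g \<in> borel_measurable borel" unfolding g_def by measurable
      have "uint p g = ennreal (1 / y) * uint p (\<lambda>x. f x - poly P x)"
        unfolding g_def by (subst uint_cmult) (auto simp: c)
      also have "\<dots> \<le> ennreal (1 / y) * ennreal (y + y)" using P(2) by (intro mult_left_mono) auto
      also have "\<dots> = 2" using y0 by (simp flip: ennreal_mult')
      finally have u2: "uint p g \<le> 2" .
      have dg: "dint p r g = ennreal (1 / y) * dint p r f"
        unfolding g_def by (subst dint_cmult) (auto simp: c dint_minus_poly[OF P(1) r])
      have "dint p r f < ennreal (y * \<tau>)"
      proof (rule ccontr)
        assume "\<not> dint p r f < ennreal (y * \<tau>)"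
        then have "ennreal (1 / \<tau>) * ennreal (y * \<tau>) \<le> ennreal (1 / \<tau>) * dint p r f" by (intro mult_left_mono) auto
        moreover have "ennreal (1 / \<tau>) * ennreal (y * \<tau>) = E" using \<tau> y by (simp flip: ennreal_mult')
        ultimately show False using n by simp
      qed
      then have "ennreal (1 / y) * dint p r f \<le> ennreal (1 / y) * ennreal (y * \<tau>)" by (intro mult_left_mono) auto
      also have "\<dots> = ennreal \<tau>" using y0 by (simp flip: ennreal_mult')
      finally have "dint p r g \<le> ennreal \<tau>" unfolding dg .
      then obtain Q where Q: "degree Q \<le> r - 1" "uint p (\<lambda>x. g x - poly Q x) \<le> ennreal (1 / 2)" using \<tau>(2)[of g] u2 by auto
      define R where "R = P + smult (1 / c) Q"
      have dR: "degree R \<le> r - 1" unfolding R_def using P(1) Q(1) by (intro degree_add_le order_trans[OF degree_smult_le]) auto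
      have "(\<lambda>x. f x - poly R x) = (\<lambda>x. 1 / c * (g x - poly Q x))" using c by (auto simp: R_def g_def field_simps)
      then have "uint p (\<lambda>x. f x - poly R x) = ennreal (\<bar>1 / c\<bar> powr p) * uint p (\<lambda>x. g x - poly Q x)"
        by (simp only:) (rule uint_cmult, measurable)
      also have "\<bar>1 / c\<bar> powr p = y" using c y0 by (simp add: powr_divide)
      also have "ennreal y * uint p (\<lambda>x. g x - poly Q x) \<le> ennreal y * ennreal (1 / 2)" by (intro mult_left_mono Q) auto
      also have "\<dots> = ennreal (y / 2)" using y by (subst ennreal_mult'[symmetric]) auto
      also have "\<dots> < ennreal y" using y0 by (simp add: ennreal_less_iff)
      finally have "uint p (\<lambda>x. f x - poly R x) < E" using y by simp
      moreover have "E \<le> uint p (\<lambda>x. f x - poly R x)" unfolding E_def by (rule INF_lower) (use dR in simp)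
      ultimately show False by simp
    qed
    obtain P where P: "degree P \<le> r - 1" "uint p (\<lambda>x. f x - poly P x) < ennreal (y + \<epsilon>)" using near[OF \<epsilon>] by blast
    have "ennreal (y + \<epsilon>) = E + ennreal \<epsilon>" using y \<epsilon> by simp
    also have "\<dots> \<le> ennreal (1 / \<tau>) * dint p r f + ennreal \<epsilon>" by (rule add_right_mono[OF Ele])
    finally show "\<exists>P. degree P \<le> r - 1 \<and> uint p (\<lambda>x. f x - poly P x) \<le> ennreal (1 / \<tau>) * dint p r f + ennreal \<epsilon>"
      using P by (meson less_imp_le order_trans)
  qed
qed

text \<open>The analogue of \<open>dcell\<close> on \<open>[a, b]\<close>, but indexed by the centre
  \<open>x\<close> of the stencil as in \<open>sym_difference\<close>, because the step of the
  modulus is proportional to \<open>phi\<close> at the centre.\<close>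

definition scell :: "real \<Rightarrow> nat \<Rightarrow> (real \<Rightarrow> real) \<Rightarrow> real \<Rightarrow> real \<Rightarrow> real \<Rightarrow> real \<Rightarrow> ennreal" where
  "scell p r f a b x h = (if 0 \<le> h \<and> a \<le> x - real r * h / 2 \<and> x + real r * h / 2 \<le> b
      then ennreal (\<bar>fdiff r h f (x - real r * h / 2)\<bar> powr p) else 0)"

lemma scell_measurable [measurable (raw)]:
  assumes [measurable]: "f \<in> borel_measurable borel" "c \<in> borel_measurable M" "d \<in> borel_measurable M"
  shows "(\<lambda>z. scell p r f a b (c z) (d z)) \<in> borel_measurable M"
  unfolding scell_def by measurable

lemma nn_integral_Icc_affine:
  fixes G :: "real \<Rightarrow> ennreal"
  assumes [measurable]: "G \<in> borel_measurable borel" and "a < b"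
  shows "(\<integral>\<^sup>+x\<in>{a..b}. G x \<partial>lborel) = ennreal (b - a) * (\<integral>\<^sup>+y\<in>{0..1}. G (a + (b - a) * y) \<partial>lborel)"
proof -
  have i: "indicator {a..b} (a + (b - a) * y) = (indicator {0..1} y :: ennreal)" for y
  proof -
    have "a + z \<le> b \<longleftrightarrow> z \<le> (b - a) * 1" for z by auto
    then have "a + (b - a) * y \<le> b \<longleftrightarrow> y \<le> 1" using assms(2) by (simp only: mult_le_cancel_left_pos diff_gt_0_iff_gt)
    then show ?thesis using assms(2) by (simp add: indicator_def zero_le_mult_iff)
  qed
  show ?thesis using assms(2)
    by (subst nn_integral_real_affine[where c = "b - a" and t = a]) (auto simp: i)
qed

text \<open>One factor \<open>b - a\<close> comes from the step and one from the position; the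
  passage from centre to left node is a translation for each fixed step.\<close>

lemma dint_rescale:
  assumes ab: "a < b" and [measurable]: "f \<in> borel_measurable borel"
  shows "(\<integral>\<^sup>+x. (\<integral>\<^sup>+h. scell p r f a b x h \<partial>lborel) \<partial>lborel) = ennreal ((b - a) * (b - a)) * dint p r (\<lambda>y. f (a + (b - a) * y))"
proof -
  let ?l = "b - a"
  have l: "0 < ?l" using ab by simp
  have cell: "scell p r f a b (a + ?l * x + real r * (?l * h) / 2) (?l * h) = dcell p r (\<lambda>y. f (a + ?l * y)) h x" for h x
  proof -
    have "fdiff r (?l * h) f (a + ?l * x) = fdiff r h (\<lambda>y. f (a + ?l * y)) x"
      unfolding fdiff_def by (intro sum.cong refl) (simp add: algebra_simps)
    moreover have "0 \<le> ?l * h \<longleftrightarrow> 0 \<le> h" "a \<le> a + ?l * x \<longleftrightarrow> 0 \<le> x" using l by (auto simp: zero_le_mult_iff)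
    moreover have "a + ?l * x + real r * (?l * h) / 2 + real r * (?l * h) / 2 \<le> b \<longleftrightarrow> x + real r * h \<le> 1"
    proof -
      have "a + ?l * x + real r * (?l * h) / 2 + real r * (?l * h) / 2 = a + ?l * (x + real r * h)" by (simp add: algebra_simps)
      then show ?thesis using mult_le_cancel_left_pos[OF l, of "x + real r * h" 1] by auto
    qed
    ultimately show ?thesis by (auto simp: scell_def dcell_def)
  qed
  have "(\<integral>\<^sup>+x. (\<integral>\<^sup>+h. scell p r f a b x h \<partial>lborel) \<partial>lborel) = (\<integral>\<^sup>+h. (\<integral>\<^sup>+x. scell p r f a b x h \<partial>lborel) \<partial>lborel)"
    by (rule lborel_pair.Fubini') measurable
  also have "\<dots> = ennreal \<bar>?l\<bar> * (\<integral>\<^sup>+h. (\<integral>\<^sup>+x. scell p r f a b x (0 + ?l * h) \<partial>lborel) \<partial>lborel)"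
    by (rule nn_integral_real_affine) (use l in auto)
  also have "\<dots> = ennreal ?l * (\<integral>\<^sup>+h. ennreal ?l * (\<integral>\<^sup>+x. dcell p r (\<lambda>y. f (a + ?l * y)) h x \<partial>lborel) \<partial>lborel)"
  proof -
    have "(\<integral>\<^sup>+x. scell p r f a b x (0 + ?l * h) \<partial>lborel) = ennreal ?l * (\<integral>\<^sup>+x. dcell p r (\<lambda>y. f (a + ?l * y)) h x \<partial>lborel)" for h
      using l nn_integral_real_affine[of "\<lambda>x. scell p r f a b x (?l * h)" ?l "a + real r * (?l * h) / 2"]
      by (simp add: cell[symmetric] add_ac)
    then show ?thesis using l by simp
  qed
  also have "\<dots> = ennreal (?l * ?l) * dint p r (\<lambda>y. f (a + ?l * y))"
    unfolding dint_def using l by (subst nn_integral_cmult) (auto simp: ennreal_mult' mult.assoc)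
  finally show ?thesis .
qed

text \<open>The left-hand side scales with \<open>b - a\<close> and the double integral with its
  square; the factor \<open>1 / (b - a)\<close> in effect turns the integral over \<open>h\<close>
  into an average.\<close>

lemma whitney_interval:
  assumes p: "0 < p" "p \<le> 1" and r: "1 \<le> r"
  obtains C where "0 < C" "\<And>f a b \<epsilon>. a < b \<Longrightarrow> f \<in> borel_measurable borel \<Longrightarrow> (\<integral>\<^sup>+x\<in>{a..b}. ennreal (\<bar>f x\<bar> powr p) \<partial>lborel) < \<infinity> \<Longrightarrow> 0 < \<epsilon> \<Longrightarrow>
     \<exists>P. degree P \<le> r - 1 \<and> (\<integral>\<^sup>+x\<in>{a..b}. ennreal (\<bar>f x - poly P x\<bar> powr p) \<partial>lborel)
        \<le> ennreal (C / (b - a)) * (\<integral>\<^sup>+x. (\<integral>\<^sup>+h. scell p r f a b x h \<partial>lborel) \<partial>lborel) + ennreal \<epsilon>"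
proof -
  obtain C where C: "0 < C" "\<And>f \<epsilon>. f \<in> borel_measurable borel \<Longrightarrow> uint p f < \<infinity> \<Longrightarrow> 0 < \<epsilon> \<Longrightarrow>
     \<exists>P. degree P \<le> r - 1 \<and> uint p (\<lambda>x. f x - poly P x) \<le> ennreal C * dint p r f + ennreal \<epsilon>"
    by (rule whitney_unit[OF p r]) blast
  show ?thesis
  proof (rule that[OF C(1)])
    fix f :: "real \<Rightarrow> real" and a b \<epsilon> :: real
    assume ab: "a < b" and [measurable]: "f \<in> borel_measurable borel" and fin: "(\<integral>\<^sup>+x\<in>{a..b}. ennreal (\<bar>f x\<bar> powr p) \<partial>lborel) < \<infinity>" and \<epsilon>: "0 < \<epsilon>"
    let ?l = "b - a" and ?S = "\<integral>\<^sup>+x. (\<integral>\<^sup>+h. scell p r f a b x h \<partial>lborel) \<partial>lborel"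
    have l: "0 < ?l" using ab by simp
    define F where "F y = f (a + ?l * y)" for y
    have [measurable]: "F \<in> borel_measurable borel" unfolding F_def by measurable
    have "ennreal ?l * uint p F < \<infinity>" using fin unfolding uint_def F_def by (subst (asm) nn_integral_Icc_affine[OF _ ab]) auto
    then have "uint p F < \<infinity>" using l by (auto simp: ennreal_mult_less_top)
    then obtain Q where Q: "degree Q \<le> r - 1" "uint p (\<lambda>x. F x - poly Q x) \<le> ennreal C * dint p r F + ennreal (\<epsilon> / ?l)"
      using C(2)[of F "\<epsilon> / ?l"] \<epsilon> l by auto
    define P where "P = pcompose Q [:- a / ?l, 1 / ?l:]"
    have dP: "degree P \<le> r - 1" using Q(1) l by (simp add: P_def degree_pcompose)
    have Pe: "poly P (a + ?l * y) = poly Q y" for y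
    proof -
      have "- a / d + (a + d * y) * (1 / d) = y" if "0 < d" for d using that by (simp add: field_simps)
      from this[OF l] have "- a / ?l + (a + ?l * y) * (1 / ?l) = y" .
      then show ?thesis by (simp add: P_def poly_pcompose)
    qed
    have "(\<integral>\<^sup>+x\<in>{a..b}. ennreal (\<bar>f x - poly P x\<bar> powr p) \<partial>lborel) = ennreal ?l * uint p (\<lambda>x. F x - poly Q x)"
      unfolding uint_def F_def by (subst nn_integral_Icc_affine[OF _ ab]) (auto simp: Pe)
    also have "\<dots> \<le> ennreal ?l * (ennreal C * dint p r F + ennreal (\<epsilon> / ?l))" by (intro mult_left_mono Q) auto
    also have "\<dots> = ennreal (?l * C) * dint p r F + ennreal \<epsilon>"
      using l \<epsilon> by (simp add: distrib_left ennreal_mult_assoc flip: ennreal_mult')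
    also have "ennreal (?l * C) * dint p r F = ennreal (C / ?l) * ?S"
    proof -
      have "C / ?l * (?l * ?l) = ?l * C" using l by simp
      then have "ennreal (C / ?l) * (ennreal (?l * ?l) * dint p r F) = ennreal (?l * C) * dint p r F"
        using C(1) l by (subst ennreal_mult_assoc) (auto simp: mult.commute)
      then show ?thesis unfolding F_def[abs_def] by (subst dint_rescale[OF ab]) auto
    qed
    finally show "\<exists>P. degree P \<le> r - 1 \<and> (\<integral>\<^sup>+x\<in>{a..b}. ennreal (\<bar>f x - poly P x\<bar> powr p) \<partial>lborel) \<le> ennreal (C / ?l) * ?S + ennreal \<epsilon>"
      using dP by blast
  qed
qed

lemma poly_Lp_growth_interval:
  assumes p: "0 < p" "p \<le> 1"
  obtains C where "0 < C" "\<And>Q a b x. degree Q \<le> d \<Longrightarrow> a < b \<Longrightarrow>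
     ennreal (\<bar>poly Q x\<bar> powr p) \<le> ennreal (C / (b - a) * (2 + 2 * \<bar>x - a\<bar> / (b - a)) powr (real d * p)) * (\<integral>\<^sup>+y\<in>{a..b}. ennreal (\<bar>poly Q y\<bar> powr p) \<partial>lborel)"
proof -
  obtain C where C: "0 < C" "\<And>Q x. degree Q \<le> d \<Longrightarrow>
     ennreal (\<bar>poly Q x\<bar> powr p) \<le> ennreal (C * (1 + \<bar>x\<bar>) powr (real d * p)) * (\<integral>\<^sup>+y\<in>{-1..1}. ennreal (\<bar>poly Q y\<bar> powr p) \<partial>lborel)"
    by (rule poly_Lp_growth[OF p]) blast
  show ?thesis
  proof (rule that[of "2 * C"])
    show "0 < 2 * C" using C by simp
    fix Q :: "real poly" and a b x :: real assume Q: "degree Q \<le> d" and ab: "a < b"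
    define m l where "m = (a + b) / 2" and "l = (b - a) / 2"
    have l: "0 < l" "b - a = 2 * l" "a = m - l" "b = m + l" using ab by (auto simp: m_def l_def field_simps)
    define R where "R = pcompose Q [:m, l:]"
    have dR: "degree R \<le> d" using Q l by (simp add: R_def degree_pcompose)
    have Re: "poly R y = poly Q (m + l * y)" for y by (simp add: R_def poly_pcompose mult.commute)
    have i: "indicator {m - l..m + l} (m + l * y) = (indicator {-1..1} y :: ennreal)" for y
    proof -
      have "m - l \<le> m + l * y \<longleftrightarrow> - 1 \<le> y" using mult_le_cancel_left_pos[OF l(1), of "-1" y] by auto
      moreover have "m + l * y \<le> m + l \<longleftrightarrow> y \<le> 1" using mult_le_cancel_left_pos[OF l(1), of y 1] by auto
      ultimately show ?thesis by (simp add: indicator_def)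
    qed
    have I: "(\<integral>\<^sup>+y\<in>{a..b}. ennreal (\<bar>poly Q y\<bar> powr p) \<partial>lborel) = ennreal l * (\<integral>\<^sup>+y\<in>{-1..1}. ennreal (\<bar>poly R y\<bar> powr p) \<partial>lborel)"
      using l(1) unfolding l(3,4) by (subst nn_integral_real_affine[where c = l and t = m]) (auto simp: Re i)
    let ?z = "(x - m) / l"
    have "poly Q x = poly R ?z" using l(1) by (simp add: Re)
    then have "ennreal (\<bar>poly Q x\<bar> powr p) \<le> ennreal (C * (1 + \<bar>?z\<bar>) powr (real d * p)) * (\<integral>\<^sup>+y\<in>{-1..1}. ennreal (\<bar>poly R y\<bar> powr p) \<partial>lborel)"
      using C(2)[OF dR, of ?z] by simp
    also have "\<dots> \<le> ennreal (C * (2 + 2 * \<bar>x - a\<bar> / (b - a)) powr (real d * p)) * (\<integral>\<^sup>+y\<in>{-1..1}. ennreal (\<bar>poly R y\<bar> powr p) \<partial>lborel)"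
    proof (intro mult_right_mono ennreal_leI mult_left_mono powr_mono2)
      have "\<bar>x - m\<bar> \<le> \<bar>x - a\<bar> + l" using l by (simp add: abs_if)
      then have "\<bar>x - m\<bar> / l \<le> (\<bar>x - a\<bar> + l) / l" using l by (intro divide_right_mono) auto
      then show "1 + \<bar>?z\<bar> \<le> 2 + 2 * \<bar>x - a\<bar> / (b - a)" using l(1) unfolding l(2) by (simp add: add_divide_distrib)
    qed (use C p in auto)
    also have "\<dots> = ennreal (2 * C / (b - a) * (2 + 2 * \<bar>x - a\<bar> / (b - a)) powr (real d * p)) * (ennreal l * (\<integral>\<^sup>+y\<in>{-1..1}. ennreal (\<bar>poly R y\<bar> powr p) \<partial>lborel))"
    proof -
      have "2 * C / (b - a) * (2 + 2 * \<bar>x - a\<bar> / (b - a)) powr (real d * p) * l = C * (2 + 2 * \<bar>x - a\<bar> / (b - a)) powr (real d * p)"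
        using l(1) unfolding l(2) by simp
      moreover have "0 \<le> 2 * C / (b - a) * (2 + 2 * \<bar>x - a\<bar> / (b - a)) powr (real d * p)" using C(1) ab by simp
      ultimately show ?thesis by (subst ennreal_mult_assoc) auto
    qed
    finally show "ennreal (\<bar>poly Q x\<bar> powr p) \<le> ennreal (2 * C / (b - a) * (2 + 2 * \<bar>x - a\<bar> / (b - a)) powr (real d * p)) * (\<integral>\<^sup>+y\<in>{a..b}. ennreal (\<bar>poly Q y\<bar> powr p) \<partial>lborel)"
      unfolding I .
  qed
qed

text \<open>The primitive \<open>A\<close> of the Jackson kernel satisfies \<open>A (u + 2 * pi) = A u + 2 * A pi\<close>, and
  \<open>A (t + s) - A (t - s)\<close> is an even trigonometric polynomial in \<open>t\<close>.\<close>

lemma step_poly: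
  obtains C where "0 < C" "\<And>n s. 1 \<le> n \<Longrightarrow> s \<in> {0..pi} \<Longrightarrow> \<exists>X. degree X \<le> Suc M * n \<and>
     (\<forall>t\<in>{0..pi}. \<bar>(if t < s then 1 else 0) - poly X (cos t)\<bar> \<le> C / (1 + real n * \<bar>t - s\<bar>) ^ (2 * M))"
proof -
  define c where "c = (1 + pi) ^ (2 * Suc M)"
  have c: "0 < c" by (simp add: c_def add_pos_pos)
  define C where "C = c * 2 * 4 ^ Suc M"
  have C: "0 < C" using c by (simp add: C_def)
  show ?thesis
  proof (rule that[OF C])
    fix n :: nat and s :: real assume n: "1 \<le> n" and s: "s \<in> {0..pi}"
    have np: "0 < real n" using n by simp
    obtain q where q: "degree q \<le> Suc M * n" "poly q 1 = 1" "\<And>u. 0 \<le> poly q (cos u)"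
      "\<And>u. \<bar>u\<bar> \<le> pi \<Longrightarrow> poly q (cos u) \<le> (1 + pi) ^ (2 * Suc M) / (1 + real n * \<bar>u\<bar>) ^ (2 * Suc M)"
      "\<And>u. real n * \<bar>u\<bar> \<le> pi \<Longrightarrow> (1 / 4) ^ Suc M \<le> poly q (cos u)"
      by (rule jackson_poly[OF n, of "Suc M"]) blast
    let ?J = "\<lambda>u. poly q (cos u)"
    define N where "N = Suc M * n"
    obtain b where b: "\<And>u. ?J u = (\<Sum>j\<le>N. b j * cos (real j * u))"
      using cos_sum_poly[OF q(1)] by (auto simp: cos_sum_def N_def)
    \<comment> \<open>The termwise primitive vanishing at 0: odd, nondecreasing because the kernel
      is nonnegative, and periodic up to the linear term \<open>b 0 * u\<close>.\<close>
    define A where "A u = b 0 * u + (\<Sum>j\<in>{1..N}. b j / real j * sin (real j * u))" for u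
    have dA: "(A has_real_derivative ?J u) (at u within S)" for u S
    proof -
      have "(A has_real_derivative (b 0 + (\<Sum>j\<in>{1..N}. b j * cos (real j * u)))) (at u within S)"
        unfolding A_def by (auto intro!: derivative_eq_intros sum.cong)
      moreover have "{..N} = insert 0 {1..N}" by auto
      ultimately show ?thesis by (simp add: b)
    qed
    have mono: "A u \<le> A v" if "u \<le> v" for u v
      using DERIV_nonneg_imp_nondecreasing[OF that, of A] dA q(3) by blast
    have odd: "A (- u) = - A u" for u by (simp add: A_def sum_negf)
    have per: "A (u + 2 * pi) = A u + 2 * A pi" for u
    proof -
      have "sin (x + real j * (2 * pi)) = sin x" for x j
      proof (induction j)
        case (Suc j)
        have "sin (x + real (Suc j) * (2 * pi)) = sin (x + real j * (2 * pi) + 2 * pi)" by (simp add: algebra_simps)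
        then show ?case using Suc by (simp only: sin_periodic)
      qed simp
      then have "sin (real j * (u + 2 * pi)) = sin (real j * u)" for j by (simp add: distrib_left)
      moreover have "sin (real j * pi) = 0" for j using sin_npi2[of j] by (simp add: mult.commute)
      ultimately show ?thesis by (simp add: A_def distrib_left)
    qed
    define I where "I = A pi"
    define T where "T v = I - A v" for v
    have FTC: "(?J has_integral (A y - A x)) {x..y}" if "x \<le> y" for x y
      using that dA by (intro fundamental_theorem_of_calculus) (auto simp flip: has_real_derivative_iff_has_vector_derivative)
    have A0: "A 0 = 0" by (simp add: A_def)
    \<comment> \<open>The lower bound of the kernel on \<open>[0, pi / n]\<close> forces its mass to
      be at least of order \<open>1 / n\<close>; the tails are compared with this mass.\<close>
    have I1: "1 / (real n * 4 ^ Suc M) \<le> I"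
    proof -
      have "pi / real n * (1 / 4) ^ Suc M \<le> A (pi / real n) - A 0"
      proof (rule has_integral_le[OF _ FTC])
        show "((\<lambda>_. (1 / 4) ^ Suc M) has_integral pi / real n * (1 / 4) ^ Suc M) {0..pi / real n}"
          using has_integral_const_real[of "(1 / 4 :: real) ^ Suc M" 0 "pi / real n"] np by simp
        show "(1 / 4) ^ Suc M \<le> ?J u" if "u \<in> {0..pi / real n}" for u
          using that np by (intro q(5)) (auto simp: field_simps)
      qed (use np in auto)
      moreover have "A (pi / real n) \<le> I" unfolding I_def using n by (intro mono) (auto simp: field_simps)
      moreover have "1 / (real n * 4 ^ Suc M) \<le> pi / real n * (1 / 4) ^ Suc M"
        using np pi_gt3 by (simp add: power_divide divide_simps)
      ultimately show ?thesis using A0 by linarith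
    qed
    have "0 < 1 / (real n * 4 ^ Suc M)" using np by simp
    then have I0: "0 < I" using I1 by (rule less_le_trans)
    have T0: "0 \<le> T v" if "v \<le> pi" for v using mono[OF that] by (simp add: T_def I_def)
    have Tmono: "T v \<le> T u" if "u \<le> v" for u v using mono[OF that] by (simp add: T_def)
    \<comment> \<open>Of the decay order \<open>2 * Suc M\<close>, two powers are spent on
      integrability, which yields \<open>2 / n\<close>, at most a multiple of \<open>I\<close>; the
      other \<open>2 * M\<close> remain.\<close>
    have Tb: "T v \<le> C * I / (1 + real n * v) ^ (2 * M)" if v: "0 \<le> v" "v \<le> pi" for v
    proof -
      let ?k = "\<lambda>u. 1 / (1 + real n * \<bar>0 - u\<bar>)\<^sup>2"
      have int: "?k integrable_on {0..pi}" and le2: "integral {0..pi} ?k \<le> 2 / real n"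
        using integral_decay_le[OF n, of 0] by auto
      have int': "?k integrable_on {v..pi}" by (rule integrable_on_subinterval[OF int]) (use v in auto)
      have pos: "0 < 1 + real n * v" using np v by (simp add: add_pos_nonneg)
      have "T v = integral {v..pi} ?J" using integral_unique[OF FTC[OF v(2)]] by (simp add: T_def I_def)
      also have "\<dots> \<le> integral {v..pi} (\<lambda>u. c / (1 + real n * v) ^ (2 * M) * ?k u)"
      proof (rule integral_le)
        show "?J integrable_on {v..pi}" using FTC[OF v(2)] by blast
        show "(\<lambda>u. c / (1 + real n * v) ^ (2 * M) * ?k u) integrable_on {v..pi}"
          using integrable_on_mult_right[OF int', of "c / (1 + real n * v) ^ (2 * M)"] by simp
        fix u assume u: "u \<in> {v..pi}"
        have upos: "0 < 1 + real n * u" using np u v by (simp add: add_pos_nonneg)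
        have "?J u \<le> c / (1 + real n * u) ^ (2 * Suc M)" using q(4)[of u] u v by (simp add: c_def)
        also have "\<dots> = c / ((1 + real n * u) ^ (2 * M) * (1 + real n * u)\<^sup>2)" by (simp add: power2_eq_square mult_ac)
        also have "\<dots> \<le> c / ((1 + real n * v) ^ (2 * M) * (1 + real n * u)\<^sup>2)"
          using c u np v pos upos by (intro divide_left_mono mult_right_mono power_mono) auto
        finally show "?J u \<le> c / (1 + real n * v) ^ (2 * M) * ?k u" using u v by simp
      qed
      also have "\<dots> = c / (1 + real n * v) ^ (2 * M) * integral {v..pi} ?k" by (rule integral_mult_right)
      also have "\<dots> \<le> c / (1 + real n * v) ^ (2 * M) * (2 / real n)"
      proof (rule mult_left_mono)
        have "integral {v..pi} ?k \<le> integral {0..pi} ?k"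
          by (rule integral_subset_le) (use v int int' in auto)
        then show "integral {v..pi} ?k \<le> 2 / real n" using le2 by linarith
      qed (use c pos in auto)
      also have "\<dots> \<le> c / (1 + real n * v) ^ (2 * M) * (2 * 4 ^ Suc M * I)"
      proof (intro mult_left_mono)
        have "1 / real n = 4 ^ Suc M * (1 / (real n * 4 ^ Suc M))" by simp
        also have "\<dots> \<le> 4 ^ Suc M * I" by (intro mult_left_mono I1) auto
        finally show "2 / real n \<le> 2 * 4 ^ Suc M * I" by simp
      qed (use c pos in auto)
      finally show ?thesis by (simp add: C_def mult_ac)
    qed
    \<comment> \<open>Up to tails of the kernel, \<open>A (t + s)\<close> and
      \<open>- A (t - s)\<close> both equal \<open>I\<close> for \<open>t < s\<close> and cancel for
      \<open>t > s\<close>; so the quotient approximates the indicator of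
      \<open>t < s\<close>.\<close>
    have "cos_sum N (\<lambda>t. (A (t + s) - A (t - s)) / (2 * I))"
      unfolding cos_sum_def
    proof (intro exI allI)
      fix t
      have sp: "sin (real j * (t + s)) - sin (real j * (t - s)) = 2 * sin (real j * s) * cos (real j * t)" for j
        by (simp add: distrib_left right_diff_distrib sin_add sin_diff)
      have "A (t + s) - A (t - s) = 2 * b 0 * s + (\<Sum>j\<in>{1..N}. b j / real j * (sin (real j * (t + s)) - sin (real j * (t - s))))"
        by (simp add: A_def algebra_simps sum_subtractf)
      also have "\<dots> = (\<Sum>j\<le>N. (if j = 0 then 2 * b 0 * s else b j / real j * (2 * sin (real j * s))) * cos (real j * t))"
      proof -
        have "{..N} = insert 0 {1..N}" by auto
        then show ?thesis unfolding sp by (simp add: mult.assoc)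
      qed
      finally show "(A (t + s) - A (t - s)) / (2 * I) = (\<Sum>j\<le>N. ((if j = 0 then 2 * b 0 * s else b j / real j * (2 * sin (real j * s))) / (2 * I)) * cos (real j * t))"
        by (simp add: sum_divide_distrib)
    qed
    then obtain X where X: "degree X \<le> N" "\<And>t. (A (t + s) - A (t - s)) / (2 * I) = poly X (cos t)"
      by (rule cos_sum_imp_poly) blast
    have "\<bar>(if t < s then 1 else 0) - poly X (cos t)\<bar> \<le> C / (1 + real n * \<bar>t - s\<bar>) ^ (2 * M)" if t: "t \<in> {0..pi}" for t
    proof -
      let ?v = "\<bar>t - s\<bar>"
      have v: "0 \<le> ?v" "?v \<le> pi" using t s by auto
      \<comment> \<open>For \<open>t + s > pi\<close> the tail is measured at the reflected angle,
        by quasi-periodicity and oddness of \<open>A\<close>.\<close>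
      have refl: "A (t + s) = 2 * I - A (2 * pi - (t + s))"
        using per[of "t + s - 2 * pi"] odd[of "2 * pi - (t + s)"] by (simp add: I_def)
      have w: "?v \<le> 2 * pi - (t + s)" "?v \<le> t + s" using t s by auto
      have Av: "A (t - s) = (if t < s then - A ?v else A ?v)" using odd[of "s - t"] by auto
      have "\<bar>(if t < s then 2 * I else 0) - (A (t + s) - A (t - s))\<bar> \<le> 2 * T ?v"
      proof (cases "t + s \<le> pi")
        case True
        have "0 \<le> T (t + s)" "T (t + s) \<le> T ?v" "0 \<le> T ?v" "A ?v \<le> A (t + s)" using T0 Tmono True v w mono by auto
        then show ?thesis unfolding Av T_def by (auto simp: abs_le_iff)
      next
        case False
        then have "0 \<le> T (2 * pi - (t + s))" "T (2 * pi - (t + s)) \<le> T ?v" "0 \<le> T ?v" "A ?v \<le> A (2 * pi - (t + s))"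
          using T0 Tmono v w mono by auto
        then show ?thesis unfolding Av refl T_def by (auto simp: abs_le_iff)
      qed
      then have "\<bar>(if t < s then 2 * I else 0) - (A (t + s) - A (t - s))\<bar> / (2 * I) \<le> 2 * T ?v / (2 * I)"
        using I0 by (intro divide_right_mono) auto
      moreover have "\<bar>(if t < s then 1 else 0) - poly X (cos t)\<bar> = \<bar>(if t < s then 2 * I else 0) - (A (t + s) - A (t - s))\<bar> / (2 * I)"
      proof -
        have "(if t < s then 1 else 0) - poly X (cos t) = ((if t < s then 2 * I else 0) - (A (t + s) - A (t - s))) / (2 * I)"
          unfolding X(2)[symmetric] using I0 by (simp add: diff_divide_distrib)
        then show ?thesis using I0 by (simp add: abs_divide)
      qed
      moreover have "2 * T ?v / (2 * I) \<le> C / (1 + real n * ?v) ^ (2 * M)"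
      proof -
        have "T ?v / I \<le> (C * I / (1 + real n * ?v) ^ (2 * M)) / I" using Tb[OF v] I0 by (intro divide_right_mono) auto
        then show ?thesis using I0 by simp
      qed
      ultimately show ?thesis by linarith
    qed
    then show "\<exists>X. degree X \<le> Suc M * n \<and> (\<forall>t\<in>{0..pi}. \<bar>(if t < s then 1 else 0) - poly X (cos t)\<bar> \<le> C / (1 + real n * \<bar>t - s\<bar>) ^ (2 * M))"
      using X(1) unfolding N_def by blast
  qed
qed

subsection \<open>Chebyshev cells\<close>

definition node :: "nat \<Rightarrow> nat \<Rightarrow> real" where
  "node n k = real k * pi / real n"

lemma node_mono: "j \<le> k \<Longrightarrow> node n j \<le> node n k"
  unfolding node_def by (intro divide_right_mono mult_right_mono) auto

lemma node_Suc: "node n (Suc k) = node n k + pi / real n"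
  by (simp add: node_def distrib_right add_divide_distrib)

lemma node_range: "1 \<le> n \<Longrightarrow> k \<le> n \<Longrightarrow> node n k \<in> {0..pi}"
  using node_mono[of 0 k n] node_mono[of k n n] by (auto simp: node_def)

lemma node_n: "1 \<le> n \<Longrightarrow> node n n = pi"
  by (simp add: node_def)

lemma cos_le_iff: "t \<in> {0..pi} \<Longrightarrow> s \<in> {0..pi} \<Longrightarrow> cos t \<le> cos s \<longleftrightarrow> s \<le> t"
  by (rule cos_mono_le_eq) auto

lemma cos_less_iff: "t \<in> {0..pi} \<Longrightarrow> s \<in> {0..pi} \<Longrightarrow> cos t < cos s \<longleftrightarrow> s < t"
  by (rule cos_mono_less_eq) auto

lemma sin_pi_div_ge:
  assumes "2 \<le> n"
  shows "2 / real n \<le> sin (pi / real n)"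
proof -
  have "pi / real n \<le> pi / 2" using assms by (intro divide_left_mono) auto
  then have "2 * (pi / real n) / pi \<le> sin (pi / real n)" by (intro sin_ge_linear) auto
  then show ?thesis by simp
qed

text \<open>The overlapping cell around the \<open>k\<close>-th node; the cell of index \<open>k\<close> is meant for \<open>1 \<le> k < n\<close>.\<close>

definition lo :: "nat \<Rightarrow> nat \<Rightarrow> real" where "lo n k = cos (node n (k + 1))"
definition hi :: "nat \<Rightarrow> nat \<Rightarrow> real" where "hi n k = cos (node n (k - 1))"

lemma cell_facts:
  assumes n: "2 \<le> n" and k: "k \<in> {1..<n}"
  shows "node n k \<in> {0..pi}" "hi n k - lo n k = 2 * sin (node n k) * sin (pi / real n)" "0 < sin (node n k)" "lo n k < hi n k"
    "-1 \<le> lo n k" "hi n k \<le> 1" "sin (pi / real n) \<le> sin (node n k)"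
proof -
  have np: "0 < real n" using n by simp
  show nk: "node n k \<in> {0..pi}" using n k by (intro node_range) auto
  have e: "node n (k + 1) = node n k + pi / real n" "node n (k - 1) = node n k - pi / real n"
    using node_Suc[of n k] node_Suc[of n "k - 1"] k by auto
  show d: "hi n k - lo n k = 2 * sin (node n k) * sin (pi / real n)"
    unfolding hi_def lo_def e by (simp add: cos_add cos_diff)
  have "0 < pi / real n" using np by simp
  have lb: "pi / real n \<le> node n k" using node_mono[of 1 k n] k by (simp add: node_def)
  have ub: "node n k \<le> pi - pi / real n"
  proof -
    have "node n (Suc k) \<le> node n n" using k by (intro node_mono) auto
    then show ?thesis using node_Suc[of n k] node_n[of n] n by simp
  qed
  show sp: "0 < sin (node n k)" using lb ub \<open>0 < pi / real n\<close> by (intro sin_gt_zero) auto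
  have s0: "0 < sin (pi / real n)" using sin_pi_div_ge[OF n] np by (metis divide_pos_pos less_le_trans zero_less_numeral)
  show "lo n k < hi n k" using d sp s0 by (metis diff_gt_0_iff_gt mult_pos_pos zero_less_numeral)
  show "-1 \<le> lo n k" "hi n k \<le> 1" by (auto simp: lo_def hi_def)
  show "sin (pi / real n) \<le> sin (node n k)"
  proof (cases "node n k \<le> pi / 2")
    case True
    then show ?thesis using lb \<open>0 < pi / real n\<close> by (intro sin_monotone_2pi_le) auto
  next
    case False
    have "sin (pi / real n) \<le> sin (pi - node n k)" using False ub \<open>0 < pi / real n\<close> by (intro sin_monotone_2pi_le) auto
    then show ?thesis by simp
  qed
qed

lemma cell_angle:
  assumes n: "2 \<le> n" and k: "k \<in> {1..<n}" and t: "t \<in> {0..pi}"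
  shows "cos t \<in> {lo n k..hi n k} \<longleftrightarrow> node n (k - 1) \<le> t \<and> t \<le> node n (k + 1)"
proof -
  have "node n (k + 1) \<in> {0..pi}" "node n (k - 1) \<in> {0..pi}" using n k by (auto intro!: node_range simp del: atLeastAtMost_iff)
  then show ?thesis using cos_le_iff[OF t] cos_le_iff[OF _ t] by (auto simp: lo_def hi_def)
qed

lemma cell_near:
  assumes n: "2 \<le> n" and k: "k \<in> {1..<n}" and t: "t \<in> {0..pi}" and c: "cos t \<in> {lo n k..hi n k}"
  shows "\<bar>t - node n k\<bar> \<le> pi / real n"
proof -
  have "node n (k + 1) = node n k + pi / real n" "node n (k - 1) = node n k - pi / real n"
    using node_Suc[of n k] node_Suc[of n "k - 1"] k by auto
  then show ?thesis using c cell_angle[OF n k t] by (auto simp: abs_le_iff)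
qed

lemma abs_sin_eq:
  fixes z :: real
  assumes "\<bar>z\<bar> \<le> pi / 2"
  shows "\<bar>sin z\<bar> = sin \<bar>z\<bar>"
proof (cases "0 \<le> z")
  case True
  then show ?thesis using assms sin_ge_zero[of z] by simp
next
  case False
  then have "0 \<le> sin (- z)" using assms by (intro sin_ge_zero) auto
  then show ?thesis using False by simp
qed

text \<open>Within a cell \<open>sin t\<close> is at most twice its value at the node, and the cell
  length is at least \<open>4 / n\<close> times the latter. The resulting bound cancels the Jacobian
  produced by steps proportional to \<open>phi\<close>.\<close>

lemma cell_sin:
  assumes n: "2 \<le> n" and k: "k \<in> {1..<n}" and t: "t \<in> {0..pi}" and c: "cos t \<in> {lo n k..hi n k}"
  shows "sin t / (hi n k - lo n k) \<le> real n / 2"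
proof -
  note cf = cell_facts[OF n k]
  let ?m = "node n k"
  have near: "\<bar>t - ?m\<bar> \<le> pi / real n" by (rule cell_near[OF n k t c])
  have np: "0 < real n" using n by simp
  have pn2: "pi / real n \<le> pi / 2" using n by (intro divide_left_mono) auto
  have "sin t = sin ?m * cos (t - ?m) + cos ?m * sin (t - ?m)" by (simp flip: sin_add)
  also have "\<dots> \<le> sin ?m * 1 + \<bar>cos ?m * sin (t - ?m)\<bar>" using cf(3) by (intro add_mono mult_left_mono) auto
  also have "\<bar>cos ?m * sin (t - ?m)\<bar> \<le> 1 * sin (pi / real n)"
    unfolding abs_mult
  proof (intro mult_mono)
    have "\<bar>sin (t - ?m)\<bar> = sin \<bar>t - ?m\<bar>" by (rule abs_sin_eq) (use near pn2 in linarith)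
    also have "\<dots> \<le> sin (pi / real n)" by (intro sin_monotone_2pi_le) (use near pn2 pi_gt_zero in linarith)+
    finally show "\<bar>sin (t - ?m)\<bar> \<le> sin (pi / real n)" .
  qed auto
  finally have st: "sin t \<le> 2 * sin ?m" using cf(7) by simp
  have "2 * sin ?m * (2 / real n) \<le> hi n k - lo n k" unfolding cf(2) using cf(3) sin_pi_div_ge[OF n] by (intro mult_left_mono) auto
  then have "sin t * (2 / real n) \<le> hi n k - lo n k" using st np mult_right_mono[OF st, of "2 / real n"] by simp
  then show ?thesis using cf(4) np by (simp add: pos_divide_le_eq field_simps)
qed

text \<open>The half-width \<open>r * h / 2\<close> of the stencil is at most the distance from
  \<open>cos t\<close> to the cell end on the side of the nearer end point of
  \<open>[-1, 1]\<close>. On that side the sine at the mean angle is at most \<open>sin t\<close>,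
  so no term \<open>1 / n^2\<close> appears even next to the end points. The constant comes from
  \<open>4 * pi < 13\<close>.\<close>

lemma cell_step:
  assumes n: "2 \<le> n" and k: "k \<in> {1..<n}" and t: "t \<in> {0..pi}" and r: "1 \<le> r"
    and h: "0 \<le> h" "lo n k \<le> cos t - real r * h / 2" "cos t + real r * h / 2 \<le> hi n k"
  shows "h \<le> 13 / real n * sin t"
proof -
  have np: "0 < real n" using n by simp
  have rh: "0 \<le> real r * h / 2" using h r by simp
  have "lo n k \<le> cos t" "cos t \<le> hi n k" using h(2,3) rh by linarith+
  then have c: "cos t \<in> {lo n k..hi n k}" by simp
  have e: "node n (k + 1) = node n (k - 1) + 2 * (pi / real n)" using node_Suc[of n k] node_Suc[of n "k - 1"] k by auto
  have tb: "node n (k - 1) \<le> t" "t \<le> node n (k + 1)" using c cell_angle[OF n k t] by auto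
  have rng: "node n (k + 1) \<in> {0..pi}" "node n (k - 1) \<in> {0..pi}" using n k by (auto intro!: node_range simp del: atLeastAtMost_iff)
  have st: "0 \<le> sin t" using t by (auto intro: sin_ge_zero)
  have diff: "cos x - cos y \<le> (y - x) * sin ((x + y) / 2)" if "x \<le> y" "0 \<le> sin ((x + y) / 2)" for x y :: real
  proof -
    have "cos x - cos y = 2 * sin ((x + y) / 2) * sin ((y - x) / 2)" by (simp add: cos_diff_cos)
    also have "\<dots> \<le> 2 * sin ((x + y) / 2) * ((y - x) / 2)" using that by (intro mult_left_mono sin_x_le_x) auto
    finally show ?thesis by (simp add: mult.commute)
  qed
  have "real r * h / 2 \<le> 2 * (pi / real n) * sin t"
  proof (cases "t \<le> pi / 2")
    case True
    let ?x = "node n (k - 1)"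
    have xt: "0 \<le> (?x + t) / 2" "(?x + t) / 2 \<le> t" using tb rng t by auto
    have s: "0 \<le> sin ((?x + t) / 2)" using xt t True pi_gt_zero by (intro sin_ge_zero) auto
    have "sin ((?x + t) / 2) \<le> sin t" using xt True pi_gt_zero by (intro sin_monotone_2pi_le) auto
    have "real r * h / 2 \<le> cos ?x - cos t" using h by (simp add: hi_def)
    also have "\<dots> \<le> (t - ?x) * sin ((?x + t) / 2)" by (rule diff[OF tb(1) s])
    also have "\<dots> \<le> 2 * (pi / real n) * sin t" using tb e s \<open>sin ((?x + t) / 2) \<le> sin t\<close> np by (intro mult_mono) auto
    finally show ?thesis .
  next
    case False
    let ?y = "node n (k + 1)"
    have xt: "t \<le> (t + ?y) / 2" "(t + ?y) / 2 \<le> pi" using tb rng t by auto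
    have s: "0 \<le> sin ((t + ?y) / 2)" using xt t by (intro sin_ge_zero) auto
    have "sin (pi - (t + ?y) / 2) \<le> sin (pi - t)" by (intro sin_monotone_2pi_le) (use xt False pi_gt_zero in linarith)+
    then have le: "sin ((t + ?y) / 2) \<le> sin t" by simp
    have "real r * h / 2 \<le> cos t - cos ?y" using h by (simp add: lo_def)
    also have "\<dots> \<le> (?y - t) * sin ((t + ?y) / 2)" by (rule diff[OF tb(2) s])
    also have "\<dots> \<le> 2 * (pi / real n) * sin t" using tb e s le np by (intro mult_mono) auto
    finally show ?thesis .
  qed
  moreover have "h / 2 \<le> real r * h / 2" using mult_right_mono[of 1 "real r" h] r h by simp
  ultimately have "h \<le> 4 * pi * (sin t / real n)" by simp
  also have "\<dots> \<le> 13 * (sin t / real n)"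
  proof (intro mult_right_mono)
    have "pi \<le> 3.25" using pi_approx by simp
    then show "4 * pi \<le> 13" by simp
  qed (use st np in auto)
  finally show ?thesis by simp
qed

lemma card_near_le:
  assumes "finite A" "\<And>i j. i \<in> A \<Longrightarrow> j \<in> A \<Longrightarrow> j \<le> i + (2::nat)"
  shows "card A \<le> 3"
proof (cases "A = {}")
  case False
  have "A \<subseteq> {Min A..Min A + 2}"
  proof
    fix x assume x: "x \<in> A"
    show "x \<in> {Min A..Min A + 2}" using assms(2)[OF Min_in[OF assms(1) False] x] Min_le[OF assms(1) x] by simp
  qed
  then have "card A \<le> card {Min A..Min A + 2}" by (intro card_mono) auto
  then show ?thesis by simp
qed simp

text \<open>Cell \<open>k\<close> covers the angles from node \<open>k - 1\<close> to node
  \<open>k + 1\<close>, so the indices of cells with a common point differ by at most 2.\<close>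

lemma cell_count:
  assumes n: "2 \<le> n" and x: "x \<in> {-1..1}"
  shows "(\<Sum>k\<in>{1..<n}. indicator {lo n k..hi n k} x :: ennreal) \<le> 3"
proof -
  let ?A = "{k \<in> {1..<n}. x \<in> {lo n k..hi n k}}"
  have np: "0 < real n" using n by simp
  define t where "t = arccos x"
  have t: "t \<in> {0..pi}" "cos t = x" using x by (auto simp: t_def arccos_lbound arccos_ubound)
  have "card ?A \<le> 3"
  proof (rule card_near_le)
    fix i j assume i: "i \<in> ?A" and j: "j \<in> ?A"
    have "node n (j - 1) \<le> t" "t \<le> node n (i + 1)" using i j cell_angle[OF n _ t(1)] t(2) by auto
    then have "node n (j - 1) \<le> node n (i + 1)" by linarith
    then have "real (j - 1) * pi \<le> real (i + 1) * pi" unfolding node_def using np by (simp add: divide_le_cancel)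
    then have "real (j - 1) \<le> real (i + 1)" using pi_gt_zero by (simp only: mult_le_cancel_right_pos)
    then show "j \<le> i + 2" by linarith
  qed simp
  moreover have "(\<Sum>k\<in>{1..<n}. indicator {lo n k..hi n k} x :: ennreal) = (\<Sum>k\<in>?A. 1)"
    by (rule sum.mono_neutral_cong_right) (auto simp: indicator_def)
  moreover have "(\<Sum>k\<in>?A. 1::ennreal) = of_nat (card ?A)" by simp
  moreover have "of_nat (card ?A) \<le> (of_nat 3 :: ennreal)" using \<open>card ?A \<le> 3\<close> by (simp only: of_nat_le_iff)
  ultimately show ?thesis by (simp only: of_nat_numeral)
qed

text \<open>Replacing \<open>h\<close> by \<open>phi x * h\<close> converts a fixed step into the
  step of the modulus at the price of the Jacobian \<open>phi x\<close>, and
  \<open>cell_step\<close> bounds the new step by \<open>13 / n\<close>. End points are excluded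
  because \<open>phi\<close> vanishes there.\<close>

lemma scell_le:
  assumes n: "2 \<le> n" and k: "k \<in> {1..<n}" and r: "1 \<le> r" and [measurable]: "f \<in> borel_measurable borel" and x: "x \<in> {-1<..<1}"
  shows "(\<integral>\<^sup>+h. scell p r f (lo n k) (hi n k) x h \<partial>lborel)
    \<le> ennreal (phi x) * ((\<integral>\<^sup>+h\<in>{0..13 / real n}. ennreal (\<bar>sym_difference r (h * phi x) f x\<bar> powr p) \<partial>lborel) * indicator {lo n k..hi n k} x)"
proof -
  define t where "t = arccos x"
  have t: "t \<in> {0..pi}" "cos t = x" using x by (auto simp: t_def arccos_lbound arccos_ubound)
  have ph: "0 < phi x"
  proof -
    have "x\<^sup>2 < 1" using x by (auto simp: abs_square_less_1 abs_less_iff)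
    then show ?thesis by (simp add: phi_def)
  qed
  have ps: "phi x = sin t" using phi_cos[OF t(1)] t(2) by simp
  note cf = cell_facts[OF n k]
  have "(\<integral>\<^sup>+h. scell p r f (lo n k) (hi n k) x h \<partial>lborel) = ennreal \<bar>phi x\<bar> * (\<integral>\<^sup>+h. scell p r f (lo n k) (hi n k) x (0 + phi x * h) \<partial>lborel)"
    by (rule nn_integral_real_affine) (use ph in auto)
  also have "\<dots> \<le> ennreal (phi x) * (\<integral>\<^sup>+h. ennreal (\<bar>sym_difference r (h * phi x) f x\<bar> powr p) * indicator {0..13 / real n} h * indicator {lo n k..hi n k} x \<partial>lborel)"
  proof -
    have "scell p r f (lo n k) (hi n k) x (0 + phi x * h) \<le> ennreal (\<bar>sym_difference r (h * phi x) f x\<bar> powr p) * indicator {0..13 / real n} h * indicator {lo n k..hi n k} x" for h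
    proof (cases "0 \<le> phi x * h \<and> lo n k \<le> x - real r * (phi x * h) / 2 \<and> x + real r * (phi x * h) / 2 \<le> hi n k")
      case True
      have h0: "0 \<le> h" using True ph by (auto simp: zero_le_mult_iff)
      have rh: "0 \<le> real r * (phi x * h) / 2" using True by simp
      have "phi x * h \<le> 13 / real n * sin t" by (rule cell_step[OF n k t(1) r]) (use True t in auto)
      then have "h * phi x \<le> 13 / real n * phi x" unfolding ps by (simp only: mult.commute[of h])
      then have "h \<le> 13 / real n" by (simp only: mult_le_cancel_right_pos[OF ph])
      moreover have "sym_difference r (h * phi x) f x = fdiff r (phi x * h) f (x - real r * (phi x * h) / 2)"
      proof -
        have "-1 \<le> x - real r * (phi x * h) / 2" "x - real r * (phi x * h) / 2 \<le> 1"
          "-1 \<le> x + real r * (phi x * h) / 2" "x + real r * (phi x * h) / 2 \<le> 1"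
          using True rh cf(5,6) by linarith+
        then show ?thesis unfolding sym_difference_fdiff by (simp add: mult.commute[of h])
      qed
      moreover have "lo n k \<le> x" "x \<le> hi n k" using True rh by linarith+
      ultimately show ?thesis using True h0 by (simp add: scell_def)
    next
      case False then show ?thesis by (auto simp: scell_def)
    qed
    then show ?thesis using ph by (intro mult_mono nn_integral_mono) auto
  qed
  also have "(\<integral>\<^sup>+h. ennreal (\<bar>sym_difference r (h * phi x) f x\<bar> powr p) * indicator {0..13 / real n} h * indicator {lo n k..hi n k} x \<partial>lborel)
     = (\<integral>\<^sup>+h\<in>{0..13 / real n}. ennreal (\<bar>sym_difference r (h * phi x) f x\<bar> powr p) \<partial>lborel) * indicator {lo n k..hi n k} x"
    by (rule nn_integral_multc) (unfold sym_difference_def atLeastAtMost_iff, measurable)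
  finally show ?thesis .
qed

lemma slow_cell:
  assumes V: "slow C d n (\<lambda>t. v (cos t))" and C: "0 \<le> C" and n: "2 \<le> n" and k: "k \<in> {1..<n}" and x: "x \<in> {-1..1}" "x \<in> {lo n k..hi n k}"
  shows "v (cos (node n k)) \<le> C * (1 + pi) ^ d * v x" "v x \<le> C * (1 + pi) ^ d * v (cos (node n k))"
proof -
  have np: "0 < real n" using n by simp
  define t where "t = arccos x"
  have t: "t \<in> {0..pi}" "cos t = x" using x by (auto simp: t_def arccos_lbound arccos_ubound)
  note cf = cell_facts[OF n k]
  have "\<bar>t - node n k\<bar> \<le> pi / real n" using cell_near[OF n k t(1)] x t by simp
  then have "real n * \<bar>t - node n k\<bar> \<le> real n * (pi / real n)" by (intro mult_left_mono) auto
  then have D: "real n * \<bar>t - node n k\<bar> \<le> pi" using np by simp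
  have le: "C * (1 + real n * \<bar>t - node n k\<bar>) ^ d * v y \<le> C * (1 + pi) ^ d * v y" if "0 \<le> v y" for y
    using D C that by (intro mult_right_mono mult_left_mono power_mono) auto
  show "v (cos (node n k)) \<le> C * (1 + pi) ^ d * v x" "v x \<le> C * (1 + pi) ^ d * v (cos (node n k))"
    using slowD[OF V t(1) cf(1)] slowD[OF V cf(1) t(1)] le[of x] le[of "cos (node n k)"] slow_nonneg[OF V t(1)] slow_nonneg[OF V cf(1)] t(2)
    by (simp_all add: abs_minus_commute)
qed

subsection \<open>The direct estimate\<close>

text \<open>Prepares the summation of the Whitney bounds: Jacobian over cell length is at most
  \<open>n / 2\<close>, at most three cells overlap, and the step ranges over an interval of length
  \<open>13 / n\<close>, so the powers of \<open>n\<close> cancel.\<close>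

lemma wnorm_cells_sum:
  assumes w: "doubling_weight w" and p: "0 < p" "p \<le> 1" and r: "1 \<le> r"
  obtains C where "0 < C" "\<And>n f \<Omega>. 2 \<le> n \<Longrightarrow> f \<in> borel_measurable borel \<Longrightarrow>
     (\<And>h. 0 < h \<Longrightarrow> h \<le> 13 / real n \<Longrightarrow> wnorm p (avg_weight w n) (\<lambda>x. sym_difference r (h * phi x) f x) \<le> \<Omega>) \<Longrightarrow>
     (\<Sum>k\<in>{1..<n}. ennreal (avg_weight w n (cos (node n k)) / (hi n k - lo n k)) *
        (\<integral>\<^sup>+x. (\<integral>\<^sup>+h. scell p r f (lo n k) (hi n k) x h \<partial>lborel) \<partial>lborel)) \<le> ennreal C * \<Omega>"
proof -
  obtain C d where C: "0 < C" "\<And>n. 1 \<le> n \<Longrightarrow> slow C d n (\<lambda>t. avg_weight w n (cos t))"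
    by (rule slow_avg_weight[OF w]) blast
  define E where "E = C * (1 + pi) ^ d"
  have E0: "0 < E" using C by (simp add: E_def add_pos_pos)
  show ?thesis
  \<comment> \<open>\<open>3 * 13 / 2 = 19.5\<close>, rounded up.\<close>
  proof (rule that[of "20 * E"])
    show "0 < 20 * E" using E0 by simp
    fix n :: nat and f :: "real \<Rightarrow> real" and \<Omega> :: ennreal
    assume n: "2 \<le> n" and [measurable]: "f \<in> borel_measurable borel"
      and \<Omega>: "\<And>h. 0 < h \<Longrightarrow> h \<le> 13 / real n \<Longrightarrow> wnorm p (avg_weight w n) (\<lambda>x. sym_difference r (h * phi x) f x) \<le> \<Omega>"
    note [measurable] = avg_weight_measurable[OF w]
    have np: "0 < real n" using n by simp
    let ?v = "avg_weight w n"
    define S where "S x h = ennreal (\<bar>sym_difference r (h * phi x) f x\<bar> powr p)" for x h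
    have Sm [measurable]: "(\<lambda>z. S (fst z) (snd z)) \<in> borel_measurable (borel \<Otimes>\<^sub>M borel)"
      unfolding S_def sym_difference_def atLeastAtMost_iff by measurable
    define H where "H x = (\<integral>\<^sup>+h\<in>{0..13 / real n}. S x h \<partial>lborel)" for x
    have [measurable]: "H \<in> borel_measurable borel" unfolding H_def S_def sym_difference_def atLeastAtMost_iff by measurable
    have ae: "AE x::real in lborel. x \<noteq> -1 \<and> x \<noteq> 1"
    proof -
      have "{-1, 1::real} \<in> null_sets lborel" by (simp add: finite_imp_null_set_lborel)
      from AE_not_in[OF this] show ?thesis by eventually_elim auto
    qed
    have one: "ennreal (?v (cos (node n k)) / (hi n k - lo n k)) * (\<integral>\<^sup>+x. (\<integral>\<^sup>+h. scell p r f (lo n k) (hi n k) x h \<partial>lborel) \<partial>lborel)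
       \<le> (\<integral>\<^sup>+x. ennreal (E * (real n / 2)) * (H x * ennreal (?v x) * indicator {-1..1} x * indicator {lo n k..hi n k} x) \<partial>lborel)" if k: "k \<in> {1..<n}" for k
    proof -
      note cf = cell_facts[OF n k]
      let ?c = "?v (cos (node n k)) / (hi n k - lo n k)"
      have v0: "0 \<le> ?v (cos (node n k))" by (rule avg_weight_nonneg[OF _ w]) simp
      have c0: "0 \<le> ?c" using v0 cf(4) by simp
      have "ennreal ?c * (\<integral>\<^sup>+x. (\<integral>\<^sup>+h. scell p r f (lo n k) (hi n k) x h \<partial>lborel) \<partial>lborel)
        = (\<integral>\<^sup>+x. ennreal ?c * (\<integral>\<^sup>+h. scell p r f (lo n k) (hi n k) x h \<partial>lborel) \<partial>lborel)"
        by (rule nn_integral_cmult[symmetric]) measurable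
      also have "\<dots> \<le> (\<integral>\<^sup>+x. ennreal (E * (real n / 2)) * (H x * ennreal (?v x) * indicator {-1..1} x * indicator {lo n k..hi n k} x) \<partial>lborel)"
      proof (rule nn_integral_mono_AE, use ae in eventually_elim)
        case (elim x)
        show ?case
        proof (cases "x \<in> {lo n k..hi n k}")
          case True
          then have x1: "x \<in> {-1..1}" and x2: "x \<in> {-1<..<1}" using cf(5,6) elim by auto
          define t where "t = arccos x"
          have t: "t \<in> {0..pi}" "cos t = x" using x1 by (auto simp: t_def arccos_lbound arccos_ubound)
          have ps: "phi x = sin t" using phi_cos[OF t(1)] t(2) by simp
          have st: "sin t / (hi n k - lo n k) \<le> real n / 2" using cell_sin[OF n k t(1)] True t(2) by simp
          have vx: "?v (cos (node n k)) \<le> E * ?v x" unfolding E_def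
            using slow_cell(1)[OF C(2) _ n k x1 True] C(1) n by simp
          have vx0: "0 \<le> ?v x" by (rule avg_weight_nonneg[OF x1 w])
          have "?c * phi x = ?v (cos (node n k)) * (sin t / (hi n k - lo n k))" by (simp add: ps)
          also have "\<dots> \<le> (E * ?v x) * (real n / 2)"
            using vx st vx0 E0 cf(4) t(1) by (intro mult_mono) (auto intro!: divide_nonneg_nonneg sin_ge_zero)
          finally have cp: "?c * phi x \<le> E * (real n / 2) * ?v x" by (simp add: mult_ac)
          have "ennreal ?c * (\<integral>\<^sup>+h. scell p r f (lo n k) (hi n k) x h \<partial>lborel) \<le> ennreal ?c * (ennreal (phi x) * (H x * indicator {lo n k..hi n k} x))"
            unfolding H_def S_def by (intro mult_left_mono scell_le[OF n k r _ x2]) auto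
          also have "\<dots> = ennreal (?c * phi x) * H x" using True c0 by (subst ennreal_mult_assoc) auto
          also have "\<dots> \<le> ennreal (E * (real n / 2) * ?v x) * H x" by (intro mult_right_mono ennreal_leI cp) auto
          also have "\<dots> = ennreal (E * (real n / 2)) * (H x * ennreal (?v x))"
          proof -
            have *: "ennreal (K * v) * h = ennreal K * (h * ennreal v)" if "0 \<le> K" for K v h
              using that by (simp add: ennreal_mult' mult_ac)
            show ?thesis by (rule *) (use E0 in simp)
          qed
          finally show ?thesis using True x1 by simp
        next
          case False
          have "scell p r f (lo n k) (hi n k) x h = 0" for h
          proof (rule ccontr)
            assume "scell p r f (lo n k) (hi n k) x h \<noteq> 0"
            then have *: "0 \<le> h" "lo n k \<le> x - real r * h / 2" "x + real r * h / 2 \<le> hi n k" by (auto simp: scell_def split: if_splits)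
            have "0 \<le> real r * h / 2" using *(1) by simp
            then have "lo n k \<le> x" "x \<le> hi n k" using * by linarith+
            then show False using False by simp
          qed
          then show ?thesis by simp
        qed
      qed
      finally show ?thesis .
    qed
    have "(\<Sum>k\<in>{1..<n}. ennreal (?v (cos (node n k)) / (hi n k - lo n k)) * (\<integral>\<^sup>+x. (\<integral>\<^sup>+h. scell p r f (lo n k) (hi n k) x h \<partial>lborel) \<partial>lborel))
      \<le> (\<Sum>k\<in>{1..<n}. (\<integral>\<^sup>+x. ennreal (E * (real n / 2)) * (H x * ennreal (?v x) * indicator {-1..1} x * indicator {lo n k..hi n k} x) \<partial>lborel))"
      by (intro sum_mono one)
    also have "\<dots> = (\<integral>\<^sup>+x. (\<Sum>k\<in>{1..<n}. ennreal (E * (real n / 2)) * (H x * ennreal (?v x) * indicator {-1..1} x * indicator {lo n k..hi n k} x)) \<partial>lborel)"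
      by (rule nn_integral_sum[symmetric]) measurable
    also have "\<dots> \<le> (\<integral>\<^sup>+x. ennreal (E * (real n / 2)) * (3 * (H x * ennreal (?v x) * indicator {-1..1} x)) \<partial>lborel)"
    proof (rule nn_integral_mono)
      fix x :: real
      have "(\<Sum>k\<in>{1..<n}. ennreal (E * (real n / 2)) * (H x * ennreal (?v x) * indicator {-1..1} x * indicator {lo n k..hi n k} x))
        = ennreal (E * (real n / 2)) * (H x * ennreal (?v x) * indicator {-1..1} x * (\<Sum>k\<in>{1..<n}. indicator {lo n k..hi n k} x))"
        by (simp add: sum_distrib_left mult.assoc)
      also have "\<dots> \<le> ennreal (E * (real n / 2)) * (H x * ennreal (?v x) * indicator {-1..1} x * 3)"
      proof (cases "x \<in> {-1..1}")
        case True
        show ?thesis by (intro mult_left_mono cell_count[OF n True]) auto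
      qed simp
      finally show "(\<Sum>k\<in>{1..<n}. ennreal (E * (real n / 2)) * (H x * ennreal (?v x) * indicator {-1..1} x * indicator {lo n k..hi n k} x))
        \<le> ennreal (E * (real n / 2)) * (3 * (H x * ennreal (?v x) * indicator {-1..1} x))" by (simp add: mult.commute)
    qed
    also have "\<dots> = ennreal (E * (real n / 2)) * (3 * (\<integral>\<^sup>+x. H x * ennreal (?v x) * indicator {-1..1} x \<partial>lborel))"
      by (subst nn_integral_cmult, measurable, subst nn_integral_cmult, measurable)
    also have "(\<integral>\<^sup>+x. H x * ennreal (?v x) * indicator {-1..1} x \<partial>lborel)
       = (\<integral>\<^sup>+x. (\<integral>\<^sup>+h. S x h * indicator {0..13 / real n} h * (ennreal (?v x) * indicator {-1..1} x) \<partial>lborel) \<partial>lborel)"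
      unfolding H_def S_def sym_difference_def atLeastAtMost_iff by (subst nn_integral_multc) (measurable, simp add: mult.assoc)
    also have "\<dots> = (\<integral>\<^sup>+h. (\<integral>\<^sup>+x. S x h * indicator {0..13 / real n} h * (ennreal (?v x) * indicator {-1..1} x) \<partial>lborel) \<partial>lborel)"
      unfolding S_def sym_difference_def atLeastAtMost_iff by (rule lborel_pair.Fubini') measurable
    also have "\<dots> \<le> (\<integral>\<^sup>+h. \<Omega> * indicator {0..13 / real n} h \<partial>lborel)"
    proof (rule nn_integral_mono_AE, use AE_lborel_singleton[of "0::real"] in eventually_elim)
      case (elim h)
      show ?case
      proof (cases "h \<in> {0..13 / real n}")
        case True
        then have h: "0 < h" "h \<le> 13 / real n" using elim by auto
        have "(\<integral>\<^sup>+x. S x h * indicator {0..13 / real n} h * (ennreal (?v x) * indicator {-1..1} x) \<partial>lborel) = wnorm p ?v (\<lambda>x. sym_difference r (h * phi x) f x)"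
          unfolding wnorm_def S_def using True by (intro nn_integral_cong) (simp add: ennreal_mult' mult.assoc)
        then show ?thesis using \<Omega>[OF h] True by simp
      qed simp
    qed
    also have "\<dots> = \<Omega> * ennreal (13 / real n)" using np by (subst nn_integral_cmult_indicator) auto
    finally have "(\<Sum>k\<in>{1..<n}. ennreal (?v (cos (node n k)) / (hi n k - lo n k)) * (\<integral>\<^sup>+x. (\<integral>\<^sup>+h. scell p r f (lo n k) (hi n k) x h \<partial>lborel) \<partial>lborel))
      \<le> ennreal (E * (real n / 2)) * (3 * (\<Omega> * ennreal (13 / real n)))" by (simp add: mult_left_mono)
    also have "\<dots> = ennreal (E * (real n / 2)) * (ennreal (3 * (13 / real n)) * \<Omega>)"
    proof -
      have "3 * (z * ennreal b) = ennreal (3 * b) * z" for z b by (subst ennreal_mult') (auto simp: mult_ac)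
      then show ?thesis by (simp only:)
    qed
    also have "\<dots> = ennreal (E * (real n / 2) * (3 * (13 / real n))) * \<Omega>" using E0 by (intro ennreal_mult_assoc) simp
    also have "\<dots> \<le> ennreal (20 * E) * \<Omega>" using E0 np by (intro mult_right_mono ennreal_leI) (auto simp: field_simps)
    finally show "(\<Sum>k\<in>{1..<n}. ennreal (?v (cos (node n k)) / (hi n k - lo n k)) * (\<integral>\<^sup>+x. (\<integral>\<^sup>+h. scell p r f (lo n k) (hi n k) x h \<partial>lborel) \<partial>lborel)) \<le> ennreal (20 * E) * \<Omega>" .
  qed
qed

text \<open>Replacing the jump at the node \<open>j\<close> by the smooth step costs only the norm of \<open>R\<close> on the adjacent
  interval, because the step error decays faster than \<open>R\<close> and the weight can grow.\<close>

lemma step_replacement: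
  assumes w: "doubling_weight w" and p: "0 < p" "p \<le> 1"
  obtains C M where "0 < C" "\<And>n j. 2 \<le> n \<Longrightarrow> j \<in> {2..<n} \<Longrightarrow> \<exists>X. degree X \<le> M * n \<and>
     (\<forall>R. degree R \<le> d \<longrightarrow> wnorm p (avg_weight w n) (\<lambda>x. poly R x * ((if cos (node n j) < x then 1 else 0) - poly X x))
        \<le> ennreal (C * avg_weight w n (cos (node n j))) * (\<integral>\<^sup>+y\<in>{cos (node n j)..cos (node n (j - 1))}. ennreal (\<bar>poly R y\<bar> powr p) \<partial>lborel))"
proof -
  obtain C1 k where C1: "0 < C1" "\<And>n. 1 \<le> n \<Longrightarrow> slow C1 k n (\<lambda>t. avg_weight w n (cos t))"
    by (rule slow_avg_weight[OF w]) blast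
  obtain C2 where C2: "0 < C2" "\<And>Q a b x. degree Q \<le> d \<Longrightarrow> a < b \<Longrightarrow>
     ennreal (\<bar>poly Q x\<bar> powr p) \<le> ennreal (C2 / (b - a) * (2 + 2 * \<bar>x - a\<bar> / (b - a)) powr (real d * p)) * (\<integral>\<^sup>+y\<in>{a..b}. ennreal (\<bar>poly Q y\<bar> powr p) \<partial>lborel)"
    by (rule poly_Lp_growth_interval[OF p]) blast
  \<comment> \<open>Decay budget: \<open>2 * d\<close> for the growth of \<open>R\<close> at a
    distance of order \<open>D^2\<close> interval lengths, \<open>k\<close> for the weight, 1 for
    the Jacobian and 2 for integrability in \<open>t\<close>.\<close>
  define e where "e = 2 * d + k + 3"
  define M where "M = nat \<lceil>real e / p\<rceil>"
  have "real e / p \<le> 2 * real M" unfolding M_def using real_nat_ceiling_ge[of "real e / p"] by linarith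
  then have Me: "real e \<le> 2 * real M * p" using p by (simp add: field_simps)
  obtain C3 where C3: "0 < C3" "\<And>n s. 1 \<le> n \<Longrightarrow> s \<in> {0..pi} \<Longrightarrow> \<exists>X. degree X \<le> Suc M * n \<and>
     (\<forall>t\<in>{0..pi}. \<bar>(if t < s then 1 else 0) - poly X (cos t)\<bar> \<le> C3 / (1 + real n * \<bar>t - s\<bar>) ^ (2 * M))"
    by (rule step_poly[of M]) blast
  define C where "C = C2 * 5 powr (real d * p) * C3 powr p * C1 * 3"
  have C0: "0 < C" using C1 C2 C3 by (simp add: C_def)
  show ?thesis
  proof (rule that[OF C0])
    fix n j :: nat assume n: "2 \<le> n" and j: "j \<in> {2..<n}"
    note [measurable] = avg_weight_measurable[OF w]
    have n1: "1 \<le> n" and np: "0 < real n" using n by auto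
    let ?s = "node n j" and ?v = "avg_weight w n"
    let ?y = "cos (node n j)" and ?z = "cos (node n (j - 1))"
    have s: "?s \<in> {0..pi}" using n1 j by (intro node_range) auto
    obtain X where X: "degree X \<le> Suc M * n" "\<And>t. t \<in> {0..pi} \<Longrightarrow> \<bar>(if t < ?s then 1 else 0) - poly X (cos t)\<bar> \<le> C3 / (1 + real n * \<bar>t - ?s\<bar>) ^ (2 * M)"
      using C3(2)[OF n1 s] by blast
    \<comment> \<open>The adjacent interval is at least as long as a fixed fraction of
      \<open>rho\<close> at the node, so a distance of size \<open>D^2 * rho\<close> is at most a
      multiple of \<open>D^2\<close> times its length.\<close>
    have len: "rho n ?y \<le> 3 / 2 * (?z - ?y)" "?y < ?z"
    proof -
      define m where "m = ?s - pi / real n / 2"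
      define v where "v = pi / real n / 2"
      have sj: "node n (j - 1) = ?s - pi / real n" using node_Suc[of n "j - 1"] j by auto
      have e: "?z - ?y = 2 * sin m * sin v" unfolding sj
      proof -
        have e1: "?s - pi / real n = m - v" and e2: "?s = m + v" by (simp_all add: m_def v_def)
        show "cos (?s - pi / real n) - cos ?s = 2 * sin m * sin v" unfolding e1 unfolding e2 by (simp add: cos_add cos_diff)
      qed
      have v0: "0 < v" "v \<le> pi / 2" using np n by (auto simp: v_def field_simps)
      have sv: "1 / real n \<le> sin v" using sin_ge_linear[of v] v0 by (simp add: v_def)
      have "1 \<le> j - 1" using j by auto
      from node_mono[OF this, of n] have "pi / real n \<le> node n (j - 1)" by (simp add: node_def[of n "Suc 0"])
      then have mlo: "v \<le> m" using sj v0 unfolding m_def v_def by simp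
      have mhi: "m \<le> pi - v" using s v0 unfolding m_def v_def by simp
      have vm: "sin v \<le> sin m"
      proof (cases "m \<le> pi / 2")
        case True
        then show ?thesis using mlo v0 by (intro sin_monotone_2pi_le) auto
      next
        case False
        have "sin v \<le> sin (pi - m)" using False mhi v0 by (intro sin_monotone_2pi_le) auto
        then show ?thesis by simp
      qed
      have sm0: "0 < sin m" using vm sv np by (meson less_le_trans order_trans zero_less_divide_1_iff)
      have ss: "sin ?s \<le> 2 * sin m"
      proof -
        have "?s = m + v" by (simp add: m_def v_def)
        then have "sin ?s = sin m * cos v + cos m * sin v" by (simp add: sin_add)
        also have "\<dots> \<le> sin m * 1 + 1 * sin v" using sm0 vm sv np by (intro add_mono mult_left_mono mult_right_mono) (auto intro: order_trans[of 0 "1 / real n"])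
        finally show ?thesis using vm by simp
      qed
      have "rho n ?y = sin ?s * (1 / real n) + (1 / real n) * (1 / real n)" by (simp add: rho_cos[OF s] power2_eq_square)
      also have "\<dots> \<le> 2 * sin m * (1 / real n) + sin m * (1 / real n)" using ss vm sv np by (intro add_mono mult_right_mono) auto
      also have "\<dots> = 3 * sin m * (1 / real n)" by simp
      also have "\<dots> \<le> 3 * sin m * sin v" using sv sm0 by (intro mult_left_mono) auto
      finally show "rho n ?y \<le> 3 / 2 * (?z - ?y)" unfolding e by simp
      have "0 < sin v" using sv np by (meson less_le_trans zero_less_divide_1_iff)
      then show "?y < ?z" using e sm0 by (metis diff_gt_0_iff_gt mult_pos_pos zero_less_numeral)
    qed
    have rp: "0 < rho n ?y" by (rule rho_pos) (use n in auto)
    have vy: "0 \<le> ?v ?y" by (rule avg_weight_nonneg[OF _ w]) simp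
    have "wnorm p ?v (\<lambda>x. poly R x * ((if ?y < x then 1 else 0) - poly X x)) \<le> ennreal (C * ?v ?y) * (\<integral>\<^sup>+y\<in>{?y..?z}. ennreal (\<bar>poly R y\<bar> powr p) \<partial>lborel)"
      if R: "degree R \<le> d" for R
    proof -
      let ?I = "\<integral>\<^sup>+y\<in>{?y..?z}. ennreal (\<bar>poly R y\<bar> powr p) \<partial>lborel"
      define B where "B = C2 / (?z - ?y) * 5 powr (real d * p) * C3 powr p * (C1 * ?v ?y) * (real n * rho n ?y)"
      have B0: "0 \<le> B" using C1 C2 C3 len(2) vy rp by (simp add: B_def)
      have pt: "ennreal (\<bar>poly R (cos t) * ((if ?y < cos t then 1 else 0) - poly X (cos t))\<bar> powr p * (?v (cos t) * sin t)) \<le> ?I * ennreal B * ennreal (1 / (1 + real n * \<bar>?s - t\<bar>)\<^sup>2)"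
        if t: "t \<in> {0..pi}" for t
      proof -
        define D where "D = 1 + real n * \<bar>t - ?s\<bar>"
        have D1: "1 \<le> D" by (simp add: D_def)
        have iff: "(?y < cos t) = (t < ?s)" by (rule cos_less_iff[OF s t])
        have xy: "\<bar>cos t - ?y\<bar> \<le> D\<^sup>2 * rho n ?y"
          using cos_diff_rho_le[OF t s n1] rho_pos[of "cos t" n] n1 by (simp add: D_def)
        have gr: "2 + 2 * \<bar>cos t - ?y\<bar> / (?z - ?y) \<le> 5 * D\<^sup>2"
        proof -
          have "D\<^sup>2 * rho n ?y \<le> D\<^sup>2 * (3 / 2 * (?z - ?y))" using len(1) by (intro mult_left_mono) auto
          then have "2 * \<bar>cos t - ?y\<bar> \<le> (3 * D\<^sup>2) * (?z - ?y)" using xy by (simp add: algebra_simps)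
          then have "2 * \<bar>cos t - ?y\<bar> / (?z - ?y) \<le> 3 * D\<^sup>2" using len(2) by (simp add: pos_divide_le_eq)
          moreover have "1 \<le> D\<^sup>2" using D1 by (rule one_le_power)
          ultimately show ?thesis by linarith
        qed
        have "(2 + 2 * \<bar>cos t - ?y\<bar> / (?z - ?y)) powr (real d * p) \<le> (5 * D\<^sup>2) powr (real d * p)"
          using gr len(2) p by (intro powr_mono2) auto
        also have "\<dots> = 5 powr (real d * p) * D powr (2 * (real d * p))"
          using D1 by (simp add: powr_mult powr_powr flip: powr_numeral)
        also have "\<dots> \<le> 5 powr (real d * p) * D ^ (2 * d)"
        proof -
          have "D powr (2 * (real d * p)) \<le> D powr (real (2 * d))" using D1 p by (intro powr_mono) (auto simp: mult_left_le)
          also have "\<dots> = D ^ (2 * d)" using D1 by (subst powr_realpow) auto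
          finally show ?thesis by (intro mult_left_mono) auto
        qed
        finally have a1: "(2 + 2 * \<bar>cos t - ?y\<bar> / (?z - ?y)) powr (real d * p) \<le> 5 powr (real d * p) * D ^ (2 * d)" .
        have a2: "\<bar>(if ?y < cos t then 1 else 0) - poly X (cos t)\<bar> powr p \<le> C3 powr p / D ^ e"
        proof -
          have "\<bar>(if ?y < cos t then 1 else 0) - poly X (cos t)\<bar> powr p \<le> (C3 / D ^ (2 * M)) powr p"
            unfolding iff using X(2)[OF t] p by (intro powr_mono2) (auto simp: D_def)
          also have "\<dots> = C3 powr p / D powr (2 * real M * p)"
            using C3 D1 by (simp add: powr_divide powr_powr flip: powr_realpow)
          also have "\<dots> \<le> C3 powr p / D powr real e" using D1 Me by (intro divide_left_mono powr_mono) auto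
          finally show ?thesis using D1 by (simp add: powr_realpow)
        qed
        have a3: "?v (cos t) \<le> C1 * D ^ k * ?v ?y" using slowD[OF C1(2)[OF n1] t s] by (simp add: D_def)
        have a4: "sin t \<le> real n * (D * rho n ?y)"
        proof -
          have "sin t \<le> real n * rho n (cos t)" using np by (simp add: rho_cos[OF t] distrib_left)
          also have "\<dots> \<le> real n * (D * rho n ?y)" using rho_cos_le[OF t s n1] by (intro mult_left_mono) (auto simp: D_def)
          finally show ?thesis .
        qed
        have vt: "0 \<le> ?v (cos t)" by (rule avg_weight_nonneg[OF _ w]) simp
        have st: "0 \<le> sin t" using t by (auto intro: sin_ge_zero)
        have "C2 / (?z - ?y) * (2 + 2 * \<bar>cos t - ?y\<bar> / (?z - ?y)) powr (real d * p) * (\<bar>(if ?y < cos t then 1 else 0) - poly X (cos t)\<bar> powr p * (?v (cos t) * sin t))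
          \<le> C2 / (?z - ?y) * (5 powr (real d * p) * D ^ (2 * d)) * ((C3 powr p / D ^ e) * ((C1 * D ^ k * ?v ?y) * (real n * (D * rho n ?y))))"
          using a1 a2 a3 a4 vt st C2(1) C1(1) vy len(2) D1 rp by (intro mult_mono mult_left_mono) auto
        also have "\<dots> = B * (D ^ (2 * d) * D ^ k * D / D ^ e)" by (simp add: B_def)
        also have "D ^ (2 * d) * D ^ k * D / D ^ e = 1 / D\<^sup>2"
        proof -
          have "D ^ e = D ^ (2 * d) * D ^ k * D * D\<^sup>2" by (simp add: e_def power_add power3_eq_cube power2_eq_square mult_ac)
          then show ?thesis using D1 by simp
        qed
        finally have real_bound: "C2 / (?z - ?y) * (2 + 2 * \<bar>cos t - ?y\<bar> / (?z - ?y)) powr (real d * p) * (\<bar>(if ?y < cos t then 1 else 0) - poly X (cos t)\<bar> powr p * (?v (cos t) * sin t))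
          \<le> B * (1 / (1 + real n * \<bar>?s - t\<bar>)\<^sup>2)" by (simp add: D_def abs_minus_commute)
        have nn: "0 \<le> \<bar>(if ?y < cos t then 1 else 0) - poly X (cos t)\<bar> powr p * (?v (cos t) * sin t)" using vt st by simp
        have "ennreal (\<bar>poly R (cos t) * ((if ?y < cos t then 1 else 0) - poly X (cos t))\<bar> powr p * (?v (cos t) * sin t))
          = ennreal (\<bar>poly R (cos t)\<bar> powr p) * ennreal (\<bar>(if ?y < cos t then 1 else 0) - poly X (cos t)\<bar> powr p * (?v (cos t) * sin t))"
          by (simp add: abs_mult powr_mult mult.assoc flip: ennreal_mult')
        also have "\<dots> \<le> (ennreal (C2 / (?z - ?y) * (2 + 2 * \<bar>cos t - ?y\<bar> / (?z - ?y)) powr (real d * p)) * ?I) * ennreal (\<bar>(if ?y < cos t then 1 else 0) - poly X (cos t)\<bar> powr p * (?v (cos t) * sin t))"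
          by (intro mult_right_mono C2(2)[OF R len(2)]) auto
        also have "\<dots> = ?I * ennreal (C2 / (?z - ?y) * (2 + 2 * \<bar>cos t - ?y\<bar> / (?z - ?y)) powr (real d * p) * (\<bar>(if ?y < cos t then 1 else 0) - poly X (cos t)\<bar> powr p * (?v (cos t) * sin t)))"
          by (subst ennreal_mult''[OF nn]) (simp add: mult_ac)
        also have "\<dots> \<le> ?I * ennreal (B * (1 / (1 + real n * \<bar>?s - t\<bar>)\<^sup>2))"
          by (intro mult_left_mono ennreal_leI real_bound) auto
        also have "\<dots> = ?I * ennreal B * ennreal (1 / (1 + real n * \<bar>?s - t\<bar>)\<^sup>2)" using B0 by (simp only: ennreal_mult' mult.assoc)
        finally show ?thesis .
      qed
      have "wnorm p ?v (\<lambda>x. poly R x * ((if ?y < x then 1 else 0) - poly X x)) =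
         (\<integral>\<^sup>+t\<in>{0..pi}. ennreal (\<bar>poly R (cos t) * ((if ?y < cos t then 1 else 0) - poly X (cos t))\<bar> powr p * (?v (cos t) * sin t)) \<partial>lborel)"
        by (rule wnorm_cos) measurable
      also have "\<dots> \<le> (\<integral>\<^sup>+t. ?I * ennreal B * (ennreal (1 / (1 + real n * \<bar>?s - t\<bar>)\<^sup>2) * indicator {0..pi} t) \<partial>lborel)"
      proof (rule nn_integral_mono)
        fix t :: real
        show "ennreal (\<bar>poly R (cos t) * ((if ?y < cos t then 1 else 0) - poly X (cos t))\<bar> powr p * (?v (cos t) * sin t)) * indicator {0..pi} t
          \<le> ?I * ennreal B * (ennreal (1 / (1 + real n * \<bar>?s - t\<bar>)\<^sup>2) * indicator {0..pi} t)"
        proof (cases "t \<in> {0..pi}")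
          case True
          then show ?thesis using pt[OF True] by (simp only: indicator_simps mult_1_right)
        qed simp
      qed
      also have "\<dots> = ?I * ennreal B * (\<integral>\<^sup>+t\<in>{0..pi}. ennreal (1 / (1 + real n * \<bar>?s - t\<bar>)\<^sup>2) \<partial>lborel)"
        by (rule nn_integral_cmult) measurable
      also have "\<dots> \<le> ?I * ennreal B * ennreal (2 / real n)" by (intro mult_left_mono nn_decay_le n1 s) auto
      also have "\<dots> = ennreal (B * (2 / real n)) * ?I" using B0 by (simp only: ennreal_mult' mult_ac)
      also have "\<dots> \<le> ennreal (C * ?v ?y) * ?I"
      proof (intro mult_right_mono ennreal_leI)
        have q: "rho n ?y / (?z - ?y) \<le> 3 / 2" using len by (simp add: pos_divide_le_eq)
        have "B * (2 / real n) = C2 * 5 powr (real d * p) * C3 powr p * C1 * ?v ?y * (2 * (rho n ?y / (?z - ?y)))"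
          using np by (simp add: B_def)
        also have "\<dots> \<le> C2 * 5 powr (real d * p) * C3 powr p * C1 * ?v ?y * (2 * (3 / 2))"
          using q C1 C2 C3 vy by (intro mult_left_mono) auto
        finally show "B * (2 / real n) \<le> C * ?v ?y" by (simp add: C_def mult_ac)
      qed simp
      finally show ?thesis .
    qed
    then show "\<exists>X. degree X \<le> Suc M * n \<and>
     (\<forall>R. degree R \<le> d \<longrightarrow> wnorm p ?v (\<lambda>x. poly R x * ((if ?y < x then 1 else 0) - poly X x))
        \<le> ennreal (C * ?v ?y) * (\<integral>\<^sup>+y\<in>{?y..?z}. ennreal (\<bar>poly R y\<bar> powr p) \<partial>lborel))"
      using X(1) by blast
  qed
qed

text \<open>The jumps switched on at \<open>t\<close> telescope to the local polynomial of one cell,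
  and that cell contains \<open>cos t\<close>. Cells are ordered by the angle, so a jump is active
  while \<open>t\<close> lies before its node.\<close>

lemma telescope_cell:
  fixes P :: "nat \<Rightarrow> real"
  assumes n: "2 \<le> n" and t: "t \<in> {0..pi}"
  shows "\<exists>k\<in>{1..<n}. cos t \<in> {lo n k..hi n k} \<and>
     P (n - 1) + (\<Sum>i\<in>{1..<n - 1}. (P i - P (Suc i)) * (if t < node n (Suc i) then 1 else 0)) = P k"
proof -
  \<comment> \<open>The first index whose next node lies beyond \<open>t\<close>; the alternative
    \<open>n - 1 \<le> k\<close> caps it at the last cell, which also takes the end
    \<open>t = pi\<close>.\<close>
  define k where "k = (LEAST k. 1 \<le> k \<and> (t < node n (Suc k) \<or> n - 1 \<le> k))"
  have ex: "1 \<le> n - 1 \<and> (t < node n (Suc (n - 1)) \<or> n - 1 \<le> n - 1)" using n by simp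
  have k: "1 \<le> k \<and> (t < node n (Suc k) \<or> n - 1 \<le> k)"
    unfolding k_def using ex by (rule LeastI[where P="\<lambda>k. 1 \<le> k \<and> (t < node n (Suc k) \<or> n - 1 \<le> k)"])
  have kn: "k \<le> n - 1"
    unfolding k_def using ex by (rule Least_le[where P="\<lambda>k. 1 \<le> k \<and> (t < node n (Suc k) \<or> n - 1 \<le> k)"])
  have below: "node n (Suc i) \<le> t" if "1 \<le> i" "i < k" for i
  proof -
    have "\<not> (1 \<le> i \<and> (t < node n (Suc i) \<or> n - 1 \<le> i))"
      using that(2) unfolding k_def by (rule not_less_Least)
    then show ?thesis using that(1) by (simp add: not_less)
  qed
  have kr: "k \<in> {1..<n}" using k kn n by auto
  have above: "t < node n (Suc i)" if "k \<le> i" "i < n - 1" for i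
  proof -
    have "t < node n (Suc k)" using k that by auto
    also have "\<dots> \<le> node n (Suc i)" using that by (intro node_mono) auto
    finally show ?thesis .
  qed
  have "t \<le> node n (k + 1)"
  proof (cases "t < node n (Suc k)")
    case False
    then have "k = n - 1" using k kn by auto
    then show ?thesis using t node_n[of n] n by simp
  qed simp
  moreover have "node n (k - 1) \<le> t"
  proof (cases "k = 1")
    case True then show ?thesis using t by (simp add: node_def)
  next
    case False
    then have "1 \<le> k - 1" "k - 1 < k" using k by auto
    then have "node n (Suc (k - 1)) \<le> t" by (rule below)
    moreover have "node n (k - 1) \<le> node n (Suc (k - 1))" by (rule node_mono) simp
    ultimately show ?thesis by linarith
  qed
  ultimately have c: "cos t \<in> {lo n k..hi n k}" using cell_angle[OF n kr t] by blast
  have "(\<Sum>i\<in>{1..<n - 1}. (P i - P (Suc i)) * (if t < node n (Suc i) then 1 else 0)) = (\<Sum>i\<in>{k..<n - 1}. P i - P (Suc i))"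
  proof (intro sum.mono_neutral_cong_right ballI)
    show "{k..<n - 1} \<subseteq> {1..<n - 1}" using k by auto
    show "(P i - P (Suc i)) * (if t < node n (Suc i) then 1 else 0) = 0" if "i \<in> {1..<n - 1} - {k..<n - 1}" for i
      using below[of i] that by (cases "i < k") auto
    show "(P i - P (Suc i)) * (if t < node n (Suc i) then 1 else 0) = P i - P (Suc i)" if "i \<in> {k..<n - 1}" for i
      using above[of i] that by simp
  qed simp
  also have "\<dots> = P k - P (n - 1)" using sum_Suc_diff'[of k "n - 1" "\<lambda>i. - P i"] kn by simp
  finally have "P (n - 1) + (\<Sum>i\<in>{1..<n - 1}. (P i - P (Suc i)) * (if t < node n (Suc i) then 1 else 0)) = P k"
    by (simp only: add_diff_cancel_left' diff_add_cancel add.commute)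
  with kr c show ?thesis by blast
qed

lemma nn_integral_Lp_triangle:
  assumes p: "0 < p" "p \<le> 1" and [measurable]: "f \<in> borel_measurable borel"
    and sub: "{a..b} \<subseteq> {c..d}" "{a..b} \<subseteq> {c'..d'}"
  shows "(\<integral>\<^sup>+x\<in>{a..b}. ennreal (\<bar>poly (P - Q) x\<bar> powr p) \<partial>lborel)
    \<le> (\<integral>\<^sup>+x\<in>{c..d}. ennreal (\<bar>f x - poly P x\<bar> powr p) \<partial>lborel) + (\<integral>\<^sup>+x\<in>{c'..d'}. ennreal (\<bar>f x - poly Q x\<bar> powr p) \<partial>lborel)"
proof -
  have "(\<integral>\<^sup>+x\<in>{a..b}. ennreal (\<bar>poly (P - Q) x\<bar> powr p) \<partial>lborel) \<le>
     (\<integral>\<^sup>+x. ennreal (\<bar>f x - poly P x\<bar> powr p) * indicator {c..d} x + ennreal (\<bar>f x - poly Q x\<bar> powr p) * indicator {c'..d'} x \<partial>lborel)"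
  proof (rule nn_integral_mono)
    fix x
    have "\<bar>poly (P - Q) x\<bar> powr p \<le> (\<bar>f x - poly P x\<bar> + \<bar>f x - poly Q x\<bar>) powr p" using p by (intro powr_mono2) auto
    also have "\<dots> \<le> \<bar>f x - poly P x\<bar> powr p + \<bar>f x - poly Q x\<bar> powr p" using p by (intro powr_add_le) auto
    finally have "ennreal (\<bar>poly (P - Q) x\<bar> powr p) \<le> ennreal (\<bar>f x - poly P x\<bar> powr p + \<bar>f x - poly Q x\<bar> powr p)"
      by (rule ennreal_leI)
    also have "\<dots> = ennreal (\<bar>f x - poly P x\<bar> powr p) + ennreal (\<bar>f x - poly Q x\<bar> powr p)"
      by (rule ennreal_plus) auto
    finally have le: "ennreal (\<bar>poly (P - Q) x\<bar> powr p) \<le> ennreal (\<bar>f x - poly P x\<bar> powr p) + ennreal (\<bar>f x - poly Q x\<bar> powr p)" .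
    show "ennreal (\<bar>poly (P - Q) x\<bar> powr p) * indicator {a..b} x \<le> ennreal (\<bar>f x - poly P x\<bar> powr p) * indicator {c..d} x + ennreal (\<bar>f x - poly Q x\<bar> powr p) * indicator {c'..d'} x"
    proof (cases "x \<in> {a..b}")
      case True
      then have "x \<in> {c..d}" "x \<in> {c'..d'}" using sub by blast+
      with True le show ?thesis by (simp only: indicator_simps mult_1_right)
    qed simp
  qed
  also have "\<dots> = (\<integral>\<^sup>+x\<in>{c..d}. ennreal (\<bar>f x - poly P x\<bar> powr p) \<partial>lborel) + (\<integral>\<^sup>+x\<in>{c'..d'}. ennreal (\<bar>f x - poly Q x\<bar> powr p) \<partial>lborel)"
    by (rule nn_integral_add) measurable
  finally show ?thesis .
qed

text \<open>\<open>f - T\<close> is the error of the piecewise polynomial, bounded cell by cell,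
  plus the errors of replacing its jumps, bounded by the same local errors since a jump is a
  difference of neighbouring polynomials on the common part of their cells. The Whitney bounds use
  steps up to \<open>13 / n\<close>; taking \<open>n = 13 * m\<close> makes this
  \<open>1 / m\<close>.\<close>

theorem direct_bound:
  assumes w: "doubling_weight w" and p: "0 < p" "p \<le> 1" and r: "1 \<le> r"
  obtains K C where "13 \<le> K" "0 < C" "\<And>m f \<epsilon> \<Omega>. 1 \<le> m \<Longrightarrow> f \<in> borel_measurable borel \<Longrightarrow>
     (\<integral>\<^sup>+x\<in>{-1..1}. ennreal (\<bar>f x\<bar> powr p) \<partial>lborel) < \<infinity> \<Longrightarrow> 0 < \<epsilon> \<Longrightarrow> 0 \<le> \<Omega> \<Longrightarrow>
     (\<And>h. 0 < h \<Longrightarrow> h \<le> 1 / real m \<Longrightarrow> wnorm p (avg_weight w m) (\<lambda>x. sym_difference r (h * phi x) f x) \<le> ennreal \<Omega>) \<Longrightarrow>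
     \<exists>T. degree T \<le> K * m \<and> wnorm p (avg_weight w (13 * m)) (\<lambda>x. f x - poly T x) \<le> ennreal (C * (\<Omega> + \<epsilon>))"
proof -
  obtain C1 k where C1: "0 < C1" "\<And>n. 1 \<le> n \<Longrightarrow> slow C1 k n (\<lambda>t. avg_weight w n (cos t))"
    by (rule slow_avg_weight[OF w]) blast
  define E where "E = C1 * (1 + pi) ^ k"
  have E0: "0 < E" using C1 by (simp add: E_def add_pos_pos)
  obtain C2 where C2: "0 < C2" "\<And>f a b \<epsilon>. a < b \<Longrightarrow> f \<in> borel_measurable borel \<Longrightarrow> (\<integral>\<^sup>+x\<in>{a..b}. ennreal (\<bar>f x\<bar> powr p) \<partial>lborel) < \<infinity> \<Longrightarrow> 0 < \<epsilon> \<Longrightarrow>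
     \<exists>P. degree P \<le> r - 1 \<and> (\<integral>\<^sup>+x\<in>{a..b}. ennreal (\<bar>f x - poly P x\<bar> powr p) \<partial>lborel)
        \<le> ennreal (C2 / (b - a)) * (\<integral>\<^sup>+x. (\<integral>\<^sup>+h. scell p r f a b x h \<partial>lborel) \<partial>lborel) + ennreal \<epsilon>"
    by (rule whitney_interval[OF p r]) blast
  obtain C3 where C3: "0 < C3" "\<And>n f \<Omega>. 2 \<le> n \<Longrightarrow> f \<in> borel_measurable borel \<Longrightarrow>
     (\<And>h. 0 < h \<Longrightarrow> h \<le> 13 / real n \<Longrightarrow> wnorm p (avg_weight w n) (\<lambda>x. sym_difference r (h * phi x) f x) \<le> \<Omega>) \<Longrightarrow>
     (\<Sum>k\<in>{1..<n}. ennreal (avg_weight w n (cos (node n k)) / (hi n k - lo n k)) *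
        (\<integral>\<^sup>+x. (\<integral>\<^sup>+h. scell p r f (lo n k) (hi n k) x h \<partial>lborel) \<partial>lborel)) \<le> ennreal C3 * \<Omega>"
    by (rule wnorm_cells_sum[OF w p r]) blast
  obtain C4 M where C4: "0 < C4" "\<And>n j. 2 \<le> n \<Longrightarrow> j \<in> {2..<n} \<Longrightarrow> \<exists>X. degree X \<le> M * n \<and>
     (\<forall>R. degree R \<le> r - 1 \<longrightarrow> wnorm p (avg_weight w n) (\<lambda>x. poly R x * ((if cos (node n j) < x then 1 else 0) - poly X x))
        \<le> ennreal (C4 * avg_weight w n (cos (node n j))) * (\<integral>\<^sup>+y\<in>{cos (node n j)..cos (node n (j - 1))}. ennreal (\<bar>poly R y\<bar> powr p) \<partial>lborel))"
    by (rule step_replacement[OF w p, of "r - 1"]) blast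
  define C5 where "C5 = C2 * C3 * 169 + 1"
  have C5: "0 < C5" using C2 C3 by (simp add: C5_def add_pos_pos)
  define C6 where "C6 = E + C4 * (E + 1)"
  have C6: "0 < C6" using E0 C4 by (simp add: C6_def add_pos_pos)
  \<comment> \<open>\<open>T\<close> has degree at most \<open>r - 1 + M * n\<close>, which is at
    most \<open>K * m\<close> as \<open>n = 13 * m\<close>.\<close>
  define K where "K = 13 * (r + M + 1)"
  show ?thesis
  proof (rule that[of K "C6 * C5"])
    show "13 \<le> K" by (simp add: K_def)
    show "0 < C6 * C5" using C5 C6 by simp
    fix m :: nat and f :: "real \<Rightarrow> real" and \<epsilon> \<Omega> :: real
    assume m: "1 \<le> m" and [measurable]: "f \<in> borel_measurable borel" and fin: "(\<integral>\<^sup>+x\<in>{-1..1}. ennreal (\<bar>f x\<bar> powr p) \<partial>lborel) < \<infinity>"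
      and \<epsilon>: "0 < \<epsilon>" and \<Omega>0: "0 \<le> \<Omega>"
      and \<Omega>: "\<And>h. 0 < h \<Longrightarrow> h \<le> 1 / real m \<Longrightarrow> wnorm p (avg_weight w m) (\<lambda>x. sym_difference r (h * phi x) f x) \<le> ennreal \<Omega>"
    note [measurable] = avg_weight_measurable[OF w]
    define n where "n = 13 * m"
    have n: "2 \<le> n" "1 \<le> n" using m by (auto simp: n_def)
    let ?v = "avg_weight w n"
    have vnn: "0 \<le> ?v x" if "x \<in> {-1..1}" for x by (rule avg_weight_nonneg[OF that w])
    define v where "v i = ?v (cos (node n i))" for i
    have v0: "0 \<le> v i" for i unfolding v_def by (rule vnn) simp
    define s where "s = (\<Sum>i\<in>{1..<n}. v i)"
    have s0: "0 \<le> s" by (simp add: s_def sum_nonneg v0)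
    \<comment> \<open>The slack of each local bound is scaled by the total weight \<open>s\<close>,
      so that the weighted slacks together stay below \<epsilon>; the added 1 covers
      \<open>s = 0\<close>.\<close>
    define \<epsilon>' where "\<epsilon>' = \<epsilon> / (s + 1)"
    have \<epsilon>': "0 < \<epsilon>'" "s * \<epsilon>' \<le> \<epsilon>" using \<epsilon> s0 by (auto simp: \<epsilon>'_def field_simps)
    define S where "S i = (\<integral>\<^sup>+x. (\<integral>\<^sup>+h. scell p r f (lo n i) (hi n i) x h \<partial>lborel) \<partial>lborel)" for i
    have "\<exists>P. degree P \<le> r - 1 \<and> (\<integral>\<^sup>+x\<in>{lo n i..hi n i}. ennreal (\<bar>f x - poly P x\<bar> powr p) \<partial>lborel) \<le> ennreal (C2 / (hi n i - lo n i)) * S i + ennreal \<epsilon>'"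
      if i: "i \<in> {1..<n}" for i
      unfolding S_def
    proof (rule C2(2)[OF _ _ _ \<epsilon>'(1)])
      note cf = cell_facts[OF n(1) i]
      show "lo n i < hi n i" by (rule cf(4))
      have "(\<integral>\<^sup>+x\<in>{lo n i..hi n i}. ennreal (\<bar>f x\<bar> powr p) \<partial>lborel) \<le> (\<integral>\<^sup>+x\<in>{-1..1}. ennreal (\<bar>f x\<bar> powr p) \<partial>lborel)"
        using cf(5,6) by (intro nn_integral_mono) (auto simp: indicator_def)
      then show "(\<integral>\<^sup>+x\<in>{lo n i..hi n i}. ennreal (\<bar>f x\<bar> powr p) \<partial>lborel) < \<infinity>" using fin by (rule le_less_trans)
    qed measurable
    then have "\<forall>i\<in>{1..<n}. \<exists>P. degree P \<le> r - 1 \<and> (\<integral>\<^sup>+x\<in>{lo n i..hi n i}. ennreal (\<bar>f x - poly P x\<bar> powr p) \<partial>lborel) \<le> ennreal (C2 / (hi n i - lo n i)) * S i + ennreal \<epsilon>'"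
      by blast
    from bchoice[OF this] obtain P where "\<forall>i\<in>{1..<n}. degree (P i) \<le> r - 1 \<and> (\<integral>\<^sup>+x\<in>{lo n i..hi n i}. ennreal (\<bar>f x - poly (P i) x\<bar> powr p) \<partial>lborel) \<le> ennreal (C2 / (hi n i - lo n i)) * S i + ennreal \<epsilon>'" ..
    then have P: "\<And>i. i \<in> {1..<n} \<Longrightarrow> degree (P i) \<le> r - 1"
      "\<And>i. i \<in> {1..<n} \<Longrightarrow> (\<integral>\<^sup>+x\<in>{lo n i..hi n i}. ennreal (\<bar>f x - poly (P i) x\<bar> powr p) \<partial>lborel) \<le> ennreal (C2 / (hi n i - lo n i)) * S i + ennreal \<epsilon>'"
      by blast+
    define e where "e i = (\<integral>\<^sup>+x\<in>{lo n i..hi n i}. ennreal (\<bar>f x - poly (P i) x\<bar> powr p) \<partial>lborel)" for i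
    define V where "V = (\<Sum>i\<in>{1..<n}. ennreal (v i) * e i)"
    have sumS: "(\<Sum>i\<in>{1..<n}. ennreal (v i / (hi n i - lo n i)) * S i) \<le> ennreal C3 * ennreal (169 * \<Omega>)"
      unfolding v_def S_def
    proof (rule C3(2)[OF n(1)])
      fix h :: real assume h: "0 < h" "h \<le> 13 / real n"
      \<comment> \<open>The modulus is given with the weight of index \<open>m\<close>, the cells
        use index \<open>13 * m\<close>; the change costs \<open>13^2 = 169\<close>.\<close>
      have "wnorm p ?v (\<lambda>x. sym_difference r (h * phi x) f x) \<le> ennreal 169 * wnorm p (avg_weight w m) (\<lambda>x. sym_difference r (h * phi x) f x)"
      proof (rule wnorm_weight_mono)
        fix x :: real assume x: "x \<in> {-1..1}"
        have "?v x \<le> 13\<^sup>2 * avg_weight w m x" by (rule avg_weight_le_coarser[OF w x m]) (auto simp: n_def)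
        then show "?v x \<le> 169 * avg_weight w m x" by simp
      qed measurable
      also have "\<dots> \<le> ennreal 169 * ennreal \<Omega>" using h by (intro mult_left_mono \<Omega>) (auto simp: n_def)
      also have "\<dots> = ennreal (169 * \<Omega>)" by (subst ennreal_mult') auto
      finally show "wnorm p ?v (\<lambda>x. sym_difference r (h * phi x) f x) \<le> ennreal (169 * \<Omega>)" .
    qed measurable
    have Vb: "V \<le> ennreal (C5 * (\<Omega> + \<epsilon>))"
    proof -
      have "V \<le> (\<Sum>i\<in>{1..<n}. ennreal C2 * (ennreal (v i / (hi n i - lo n i)) * S i) + ennreal (v i * \<epsilon>'))"
        unfolding V_def
      proof (rule sum_mono)
        fix i assume i: "i \<in> {1..<n}"
        note cf = cell_facts[OF n(1) i]
        have "ennreal (v i) * e i \<le> ennreal (v i) * (ennreal (C2 / (hi n i - lo n i)) * S i + ennreal \<epsilon>')"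
          unfolding e_def by (intro mult_left_mono P(2)[OF i]) auto
        also have "\<dots> = ennreal (v i * (C2 / (hi n i - lo n i))) * S i + ennreal (v i * \<epsilon>')"
          using v0[of i] by (simp only: distrib_left ennreal_mult_assoc ennreal_mult'[symmetric])
        also have "v i * (C2 / (hi n i - lo n i)) = C2 * (v i / (hi n i - lo n i))" by simp
        also have "ennreal (C2 * (v i / (hi n i - lo n i))) * S i = ennreal C2 * (ennreal (v i / (hi n i - lo n i)) * S i)"
          using C2(1) by (intro ennreal_mult_assoc[symmetric]) simp
        finally show "ennreal (v i) * e i \<le> ennreal C2 * (ennreal (v i / (hi n i - lo n i)) * S i) + ennreal (v i * \<epsilon>')" .
      qed
      also have "\<dots> = ennreal C2 * (\<Sum>i\<in>{1..<n}. ennreal (v i / (hi n i - lo n i)) * S i) + ennreal (s * \<epsilon>')"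
        unfolding s_def sum.distrib sum_distrib_left[symmetric] sum_distrib_right
        by (subst sum_ennreal) (use v0 \<epsilon>' in auto)
      also have "\<dots> \<le> ennreal C2 * (ennreal C3 * ennreal (169 * \<Omega>)) + ennreal \<epsilon>"
        by (intro add_mono mult_left_mono sumS ennreal_leI \<epsilon>'(2)) auto
      also have "\<dots> = ennreal (C2 * (C3 * (169 * \<Omega>)) + \<epsilon>)"
        using C2(1) C3(1) \<Omega>0 \<epsilon> by (subst ennreal_plus) (auto simp: ennreal_mult')
      also have "\<dots> \<le> ennreal (C5 * (\<Omega> + \<epsilon>))"
      proof (rule ennreal_leI)
        have "0 \<le> C2 * C3 * 169 * \<epsilon>" using C2(1) C3(1) \<epsilon> by simp
        then show "C2 * (C3 * (169 * \<Omega>)) + \<epsilon> \<le> C5 * (\<Omega> + \<epsilon>)" using \<Omega>0 by (simp add: C5_def algebra_simps)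
      qed
      finally show ?thesis .
    qed
    have "\<forall>j\<in>{2..<n}. \<exists>X. degree X \<le> M * n \<and>
     (\<forall>R. degree R \<le> r - 1 \<longrightarrow> wnorm p ?v (\<lambda>x. poly R x * ((if cos (node n j) < x then 1 else 0) - poly X x))
        \<le> ennreal (C4 * v j) * (\<integral>\<^sup>+y\<in>{cos (node n j)..cos (node n (j - 1))}. ennreal (\<bar>poly R y\<bar> powr p) \<partial>lborel))"
      using C4(2)[OF n(1)] unfolding v_def by blast
    from bchoice[OF this] obtain X where "\<forall>j\<in>{2..<n}. degree (X j) \<le> M * n \<and>
     (\<forall>R. degree R \<le> r - 1 \<longrightarrow> wnorm p ?v (\<lambda>x. poly R x * ((if cos (node n j) < x then 1 else 0) - poly (X j) x))
        \<le> ennreal (C4 * v j) * (\<integral>\<^sup>+y\<in>{cos (node n j)..cos (node n (j - 1))}. ennreal (\<bar>poly R y\<bar> powr p) \<partial>lborel))" ..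
    then have X: "\<And>j. j \<in> {2..<n} \<Longrightarrow> degree (X j) \<le> M * n"
      "\<And>j R. j \<in> {2..<n} \<Longrightarrow> degree R \<le> r - 1 \<Longrightarrow> wnorm p ?v (\<lambda>x. poly R x * ((if cos (node n j) < x then 1 else 0) - poly (X j) x))
        \<le> ennreal (C4 * v j) * (\<integral>\<^sup>+y\<in>{cos (node n j)..cos (node n (j - 1))}. ennreal (\<bar>poly R y\<bar> powr p) \<partial>lborel)"
      by blast+
    define D where "D i = P i - P (Suc i)" for i
    define T where "T = P (n - 1) + (\<Sum>i\<in>{1..<n - 1}. D i * X (Suc i))"
    define J where "J i x = poly (D i) x * ((if cos (node n (Suc i)) < x then 1 else 0) - poly (X (Suc i)) x)" for i x
    have [measurable]: "J i \<in> borel_measurable borel" for i unfolding J_def by measurable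
    \<comment> \<open>The error of the discontinuous piecewise polynomial; \<open>J i\<close> is
      what changes when the jump between the cells \<open>i\<close> and \<open>Suc i\<close> is
      replaced by a polynomial step.\<close>
    define g0 where "g0 x = f x - (poly (P (n - 1)) x + (\<Sum>i\<in>{1..<n - 1}. poly (D i) x * (if cos (node n (Suc i)) < x then 1 else 0)))" for x
    have [measurable]: "g0 \<in> borel_measurable borel" unfolding g0_def by measurable
    have dD: "degree (D i) \<le> r - 1" if "i \<in> {1..<n - 1}" for i
      unfolding D_def using that by (intro degree_diff_le P(1)) auto
    have dT: "degree T \<le> K * m"
      unfolding T_def
    proof (intro degree_add_le degree_sum_le)
      have "r * 1 \<le> r * (13 * m)" using m by (intro mult_le_mono2) simp
      moreover have "K * m = r * (13 * m) + M * n + n" by (simp add: K_def n_def distrib_left distrib_right mult_ac)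
      ultimately have rK: "r - 1 + M * n \<le> K * m" by linarith
      show "degree (P (n - 1)) \<le> K * m" using P(1)[of "n - 1"] rK n by force
      fix i assume i: "i \<in> {1..<n - 1}"
      have "degree (D i * X (Suc i)) \<le> (r - 1) + M * n"
        using dD[OF i] X(1)[of "Suc i"] i by (intro order_trans[OF degree_mult_le] add_mono) auto
      also note rK
      finally show "degree (D i * X (Suc i)) \<le> K * m" .
    qed simp
    have part0: "wnorm p ?v g0 \<le> ennreal E * V"
    proof -
      have "wnorm p ?v g0 \<le> (\<integral>\<^sup>+x. (\<Sum>i\<in>{1..<n}. ennreal (E * v i) * (ennreal (\<bar>f x - poly (P i) x\<bar> powr p) * indicator {lo n i..hi n i} x)) \<partial>lborel)"
        unfolding wnorm_def
      proof (rule nn_integral_mono)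
        fix x :: real
        show "ennreal (\<bar>g0 x\<bar> powr p * ?v x) * indicator {-1..1} x \<le> (\<Sum>i\<in>{1..<n}. ennreal (E * v i) * (ennreal (\<bar>f x - poly (P i) x\<bar> powr p) * indicator {lo n i..hi n i} x))"
        proof (cases "x \<in> {-1..1}")
          case True
          define t where "t = arccos x"
          have t: "t \<in> {0..pi}" "cos t = x" using True by (auto simp: t_def arccos_lbound arccos_ubound)
          have iff: "(if cos (node n (Suc i)) < x then 1 else (0::real)) = (if t < node n (Suc i) then 1 else 0)" if "i \<in> {1..<n - 1}" for i
          proof -
            have "Suc i \<le> n" using that by auto
            from cos_less_iff[OF node_range[OF n(2) this] t(1)] show ?thesis by (simp only: t(2))
          qed
          obtain j where j: "j \<in> {1..<n}" "cos t \<in> {lo n j..hi n j}"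
             "poly (P (n - 1)) x + (\<Sum>i\<in>{1..<n - 1}. (poly (P i) x - poly (P (Suc i)) x) * (if t < node n (Suc i) then 1 else 0)) = poly (P j) x"
            using telescope_cell[OF n(1) t(1), of "\<lambda>i. poly (P i) x"] by blast
          have "g0 x = f x - poly (P j) x" unfolding g0_def j(3)[symmetric] using iff by (simp add: D_def)
          moreover have "?v x \<le> E * v j" unfolding E_def v_def
            using slow_cell(2)[OF C1(2)[OF n(2)] _ n(1) j(1) True] j(2) t(2) C1(1) by simp
          ultimately have "\<bar>g0 x\<bar> powr p * ?v x \<le> (E * v j) * \<bar>f x - poly (P j) x\<bar> powr p"
            by (simp add: mult.commute mult_right_mono)
          then have "ennreal (\<bar>g0 x\<bar> powr p * ?v x) \<le> ennreal (E * v j) * (ennreal (\<bar>f x - poly (P j) x\<bar> powr p) * indicator {lo n j..hi n j} x)"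
            using j(2) t(2) E0 v0[of j] by (simp add: ennreal_leI flip: ennreal_mult')
          also have "\<dots> \<le> (\<Sum>i\<in>{1..<n}. ennreal (E * v i) * (ennreal (\<bar>f x - poly (P i) x\<bar> powr p) * indicator {lo n i..hi n i} x))"
            using j(1) by (intro member_le_sum[of j "{1..<n}" "\<lambda>i. ennreal (E * v i) * (ennreal (\<bar>f x - poly (P i) x\<bar> powr p) * indicator {lo n i..hi n i} x)"]) auto
          finally show ?thesis using True by simp
        qed simp
      qed
      also have "\<dots> = (\<Sum>i\<in>{1..<n}. ennreal (E * v i) * e i)"
        unfolding e_def by (subst nn_integral_sum) (auto intro!: sum.cong nn_integral_cmult)
      also have "\<dots> = ennreal E * V" unfolding V_def sum_distrib_left using E0 by (intro sum.cong refl ennreal_mult_assoc[symmetric]) simp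
      finally show ?thesis .
    qed
    have partJ: "wnorm p ?v (J i) \<le> ennreal (C4 * E) * (ennreal (v i) * e i) + ennreal C4 * (ennreal (v (Suc i)) * e (Suc i))" if i: "i \<in> {1..<n - 1}" for i
    proof -
      have i1: "i \<in> {1..<n}" and i3: "Suc i \<in> {2..<n}" using i by auto
      have sub: "{cos (node n (Suc i))..cos (node n i)} \<subseteq> {lo n i..hi n i}" "{cos (node n (Suc i))..cos (node n i)} \<subseteq> {lo n (Suc i)..hi n (Suc i)}"
      proof -
        have r: "node n j \<in> {0..pi}" if "j \<le> n" for j using node_range[OF n(2) that] .
        have "cos (node n i) \<le> cos (node n (i - 1))" "cos (node n (Suc (Suc i))) \<le> cos (node n (Suc i))"
          using i by (subst cos_le_iff; auto intro!: r node_mono simp del: atLeastAtMost_iff)+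
        then show "{cos (node n (Suc i))..cos (node n i)} \<subseteq> {lo n i..hi n i}" "{cos (node n (Suc i))..cos (node n i)} \<subseteq> {lo n (Suc i)..hi n (Suc i)}"
          by (auto simp: lo_def hi_def)
      qed
      \<comment> \<open>The step bound carries the weight at node \<open>Suc i\<close>, which lies
        in cell \<open>i\<close>; for the local error on that cell the weight is moved to node
        \<open>i\<close>.\<close>
      have vE: "v (Suc i) \<le> E * v i"
      proof -
        have "cos (node n (Suc i)) \<in> {cos (node n (Suc i))..cos (node n i)}"
          using cos_le_iff[of "node n (Suc i)" "node n i"] node_range[OF n(2), of i] node_range[OF n(2), of "Suc i"] node_mono[of i "Suc i" n] i by auto
        then have "cos (node n (Suc i)) \<in> {lo n i..hi n i}" using sub(1) by blast
        then show ?thesis unfolding v_def E_def using slow_cell(2)[OF C1(2)[OF n(2)] _ n(1) i1, of "cos (node n (Suc i))"] C1(1) by simp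
      qed
      have "wnorm p ?v (J i) \<le> ennreal (C4 * v (Suc i)) * (\<integral>\<^sup>+y\<in>{cos (node n (Suc i))..cos (node n i)}. ennreal (\<bar>poly (D i) y\<bar> powr p) \<partial>lborel)"
        unfolding J_def using X(2)[OF i3 dD[OF i]] by simp
      also have "\<dots> \<le> ennreal (C4 * v (Suc i)) * (e i + e (Suc i))"
        unfolding e_def D_def by (intro mult_left_mono nn_integral_Lp_triangle p sub) auto
      also have "\<dots> = ennreal (C4 * v (Suc i)) * e i + ennreal C4 * (ennreal (v (Suc i)) * e (Suc i))"
        using C4(1) by (simp add: distrib_left ennreal_mult_assoc)
      also have "ennreal (C4 * v (Suc i)) * e i \<le> ennreal (C4 * E * v i) * e i"
        using vE C4(1) by (intro mult_right_mono ennreal_leI) (auto simp: mult.assoc)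
      also have "ennreal (C4 * E * v i) * e i = ennreal (C4 * E) * (ennreal (v i) * e i)"
        using C4(1) E0 by (intro ennreal_mult_assoc[symmetric]) simp
      finally show ?thesis by (simp add: add_right_mono)
    qed
    have sumJ: "(\<Sum>i\<in>{1..<n - 1}. wnorm p ?v (J i)) \<le> ennreal (C4 * E) * V + ennreal C4 * V"
    proof -
      have "(\<Sum>i\<in>{1..<n - 1}. wnorm p ?v (J i)) \<le> (\<Sum>i\<in>{1..<n - 1}. ennreal (C4 * E) * (ennreal (v i) * e i) + ennreal C4 * (ennreal (v (Suc i)) * e (Suc i)))"
        by (intro sum_mono partJ)
      also have "\<dots> = ennreal (C4 * E) * (\<Sum>i\<in>{1..<n - 1}. ennreal (v i) * e i) + ennreal C4 * (\<Sum>i\<in>{1..<n - 1}. ennreal (v (Suc i)) * e (Suc i))"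
        by (simp add: sum.distrib sum_distrib_left)
      also have "\<dots> \<le> ennreal (C4 * E) * V + ennreal C4 * V"
      proof (intro add_mono mult_left_mono)
        show "(\<Sum>i\<in>{1..<n - 1}. ennreal (v i) * e i) \<le> V" unfolding V_def by (intro sum_mono2) auto
        have "(\<Sum>i\<in>{1..<n - 1}. ennreal (v (Suc i)) * e (Suc i)) = (\<Sum>i\<in>Suc ` {1..<n - 1}. ennreal (v i) * e i)"
          by (subst sum.reindex) auto
        also have "\<dots> \<le> V" unfolding V_def by (intro sum_mono2) auto
        finally show "(\<Sum>i\<in>{1..<n - 1}. ennreal (v (Suc i)) * e (Suc i)) \<le> V" .
      qed auto
      finally show ?thesis .
    qed
    have "wnorm p ?v (\<lambda>x. f x - poly T x) \<le> wnorm p ?v g0 + wnorm p ?v (\<lambda>x. \<Sum>i\<in>{1..<n - 1}. J i x)"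
    proof (rule wnorm_add_le[OF p])
      fix x :: real
      show "f x - poly T x = g0 x + (\<Sum>i\<in>{1..<n - 1}. J i x)"
        by (simp add: T_def g0_def J_def poly_sum right_diff_distrib sum_subtractf)
    qed (auto simp: vnn)
    also have "\<dots> \<le> ennreal E * V + (\<Sum>i\<in>{1..<n - 1}. wnorm p ?v (J i))"
      by (intro add_mono part0 wnorm_sum_le[OF p]) (auto simp: vnn)
    also have "\<dots> \<le> ennreal E * V + (ennreal (C4 * E) * V + ennreal C4 * V)"
      by (intro add_left_mono sumJ)
    also have "\<dots> = ennreal C6 * V"
    proof -
      have "C6 = E + (C4 * E + C4)" by (simp add: C6_def distrib_left)
      then show ?thesis using E0 C4(1) by (simp add: distrib_right)
    qed
    also have "\<dots> \<le> ennreal C6 * ennreal (C5 * (\<Omega> + \<epsilon>))" by (intro mult_left_mono Vb) auto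
    also have "\<dots> = ennreal (C6 * C5 * (\<Omega> + \<epsilon>))" using C6 by (simp add: mult.assoc flip: ennreal_mult')
    finally show "\<exists>T. degree T \<le> K * m \<and> wnorm p (avg_weight w (13 * m)) (\<lambda>x. f x - poly T x) \<le> ennreal (C6 * C5 * (\<Omega> + \<epsilon>))"
      using dT by (auto simp: n_def)
  qed
qed

subsection \<open>The equivalence\<close>

text \<open>Monotonicity of the \<open>p\<close>-th root, together with the equality of the
  integrals over \<open>lebesgue\<close> and \<open>lborel\<close>. An infinite integral is treated
  apart, following the case distinction in \<open>Lp_norm\<close>.\<close>

lemma Lp_norm_le_iff:
  assumes p: "0 < p" and c: "0 \<le> c"
  shows "Lp_norm p v g \<le> ennreal c \<longleftrightarrow> wnorm p v g \<le> ennreal (c powr p)"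
proof (cases "wnorm p v g = \<infinity>")
  case True
  then show ?thesis by (simp add: Lp_norm_def Let_def nn_integral_completion wnorm_def top_unique)
next
  case False
  then obtain j where j: "0 \<le> j" "wnorm p v g = ennreal j" by (metis ennreal_cases infinity_ennreal_def)
  have "Lp_norm p v g = ennreal (j powr (1 / p))"
    using False j by (simp add: Lp_norm_def Let_def nn_integral_completion flip: wnorm_def)
  moreover have "j powr (1 / p) \<le> c \<longleftrightarrow> j \<le> c powr p"
  proof
    assume "j powr (1 / p) \<le> c"
    then have "(j powr (1 / p)) powr p \<le> c powr p" using p by (intro powr_mono2) auto
    then show "j \<le> c powr p" using p j by (simp add: powr_powr)
  next
    assume "j \<le> c powr p"
    then have "j powr (1 / p) \<le> (c powr p) powr (1 / p)" using p j by (intro powr_mono2) auto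
    then show "j powr (1 / p) \<le> c" using p c by (simp add: powr_powr)
  qed
  ultimately show ?thesis using j c by simp
qed

lemma wnorm_cong_AE:
  assumes "AE x in lborel. x \<in> {-1..1} \<longrightarrow> g x = g' x"
  shows "wnorm p v g = wnorm p v g'"
  unfolding wnorm_def
proof (rule nn_integral_cong_AE)
  from assms show "AE x in lborel. ennreal (\<bar>g x\<bar> powr p * v x) * indicator {-1..1} x = ennreal (\<bar>g' x\<bar> powr p * v x) * indicator {-1..1} x"
    by eventually_elim (auto simp: indicator_def)
qed

text \<open>Fubini and the substitutions above work with Borel functions, while \<open>in_Lp\<close>
  gives Lebesgue measurability. The exceptional set is named because differences evaluate
  \<open>f\<close> at shifted points, where an almost everywhere statement in \<open>x\<close> is of
  no direct use.\<close>

lemma borel_representative: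
  assumes f: "in_Lp p f"
  obtains f' N where "f' \<in> borel_measurable borel" "N \<in> null_sets lborel"
    "\<And>x. x \<in> {-1..1} \<Longrightarrow> x \<notin> N \<Longrightarrow> f x = f' x"
    "(\<integral>\<^sup>+x\<in>{-1..1}. ennreal (\<bar>f' x\<bar> powr p) \<partial>lborel) < \<infinity>"
proof -
  define F where "F x = (if x \<in> {-1..1} then f x else 0)" for x
  have "F \<in> borel_measurable lebesgue"
    using f borel_measurable_if[of "{-1..1}" f] unfolding in_Lp_def F_def[abs_def] by auto
  then obtain f' where f': "f' \<in> borel_measurable lborel" "AE x in lborel. F x = f' x"
    using completion_ex_borel_measurable_real by blast
  then obtain N where N: "N \<in> null_sets lborel" "{x \<in> space lborel. F x \<noteq> f' x} \<subseteq> N"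
    by (auto elim!: AE_E simp: null_sets_def)
  have eq: "f x = f' x" if "x \<in> {-1..1}" "x \<notin> N" for x
  proof -
    have "F x = f' x" using N(2) that(2) by auto
    then show ?thesis using that(1) by (simp add: F_def)
  qed
  have "(\<integral>\<^sup>+x. ennreal (\<bar>f x\<bar> powr p) \<partial>lebesgue_on {-1..1}) < \<infinity>"
    using f by (auto simp: in_Lp_def integrable_iff_bounded)
  then have fin: "(\<integral>\<^sup>+x\<in>{-1..1}. ennreal (\<bar>f x\<bar> powr p) \<partial>lborel) < \<infinity>"
    by (simp add: nn_integral_restrict_space nn_integral_completion)
  have "(\<integral>\<^sup>+x\<in>{-1..1}. ennreal (\<bar>f' x\<bar> powr p) \<partial>lborel) = (\<integral>\<^sup>+x\<in>{-1..1}. ennreal (\<bar>f x\<bar> powr p) \<partial>lborel)"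
    using AE_not_in[OF N(1)] by (intro nn_integral_cong_AE) (auto elim!: eventually_mono simp: indicator_def eq)
  with fin f'(1) N(1) eq show ?thesis by (intro that[of f' N]) auto
qed

text \<open>The admissible points whose \<open>i\<close>-th node falls into \<open>N\<close> form a
  null set, because \<open>nn_integral_phi_shift\<close> bounds its measure by twice that of
  \<open>N\<close>.\<close>

lemma sym_difference_AE_eq:
  assumes N: "N \<in> null_sets lborel" and eq: "\<And>x. x \<in> {-1..1} \<Longrightarrow> x \<notin> N \<Longrightarrow> f x = f' x"
    and r: "1 \<le> r" and h: "0 < h"
  shows "AE x in lborel. x \<in> {-1..1} \<longrightarrow> sym_difference r (h * phi x) f x = sym_difference r (h * phi x) f' x"
proof -
  define q where "q = real r * h / 2"
  define c where "c i = (real i - real r / 2) * h" for i :: nat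
  have q: "0 < q" using r h by (simp add: q_def)
  have [measurable]: "N \<in> sets borel" using N by auto
  have c: "\<bar>c i\<bar> \<le> q" if "i \<in> {..r}" for i
  proof -
    have "\<bar>real i - real r / 2\<bar> \<le> real r / 2" using that by (subst abs_le_iff) auto
    then have "\<bar>real i - real r / 2\<bar> * h \<le> real r / 2 * h" using h by (intro mult_right_mono) auto
    then show ?thesis using h by (simp add: c_def q_def abs_mult)
  qed
  have "AE x in lborel. \<forall>i\<in>{..r}. x \<in> {-1..1} \<and> q * phi x \<le> 1 - \<bar>x\<bar> \<longrightarrow> x + c i * phi x \<notin> N"
  proof (rule AE_finite_allI)
    fix i assume i: "i \<in> {..r}"
    have "(\<integral>\<^sup>+x\<in>{-1..1}. (if q * phi x \<le> 1 - \<bar>x\<bar> then indicator N (x + c i * phi x) else 0) \<partial>lborel)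
      \<le> 2 * (\<integral>\<^sup>+x\<in>{-1..1}. indicator N x \<partial>lborel)"
      by (rule nn_integral_phi_shift[OF _ q c[OF i]]) measurable
    also have "(\<integral>\<^sup>+x\<in>{-1..1}. indicator N x \<partial>lborel) = (0::ennreal)"
      using AE_not_in[OF N] by (subst nn_integral_0_iff_AE) (auto elim!: eventually_mono)
    finally have "(\<integral>\<^sup>+x\<in>{-1..1}. (if q * phi x \<le> 1 - \<bar>x\<bar> then indicator N (x + c i * phi x) else 0) \<partial>lborel) = (0::ennreal)"
      by simp
    then have "AE x in lborel. (if q * phi x \<le> 1 - \<bar>x\<bar> then indicator N (x + c i * phi x) else 0) * indicator {-1..1} x = (0::ennreal)"
      by (subst (asm) nn_integral_0_iff_AE) auto
    then show "AE x in lborel. x \<in> {-1..1} \<and> q * phi x \<le> 1 - \<bar>x\<bar> \<longrightarrow> x + c i * phi x \<notin> N"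
      by eventually_elim (auto simp: indicator_def split: if_splits)
  qed simp
  then show ?thesis
  proof eventually_elim
    case (elim x)
    show ?case
    proof
      assume x: "x \<in> {-1..1}"
      show "sym_difference r (h * phi x) f x = sym_difference r (h * phi x) f' x"
      proof (cases "q * phi x \<le> 1 - \<bar>x\<bar>")
        case True
        have "f (x + c i * phi x) = f' (x + c i * phi x)" if i: "i \<in> {..r}" for i
        proof (rule eq)
          have "\<bar>c i * phi x\<bar> \<le> q * phi x"
            using c[OF i] phi_nonneg[OF x] by (simp add: abs_mult mult_right_mono)
          then show "x + c i * phi x \<in> {-1..1}" using True by (auto simp: abs_le_iff)
          show "x + c i * phi x \<notin> N" using elim i x True by blast
        qed
        then show ?thesis
          unfolding sym_difference_phi[OF x h] by (intro if_cong sum.cong refl) (simp add: c_def)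
      next
        case False
        then show ?thesis unfolding sym_difference_phi[OF x h] by (simp add: q_def)
      qed
    qed
  qed
qed

section \<open>Transfer of rates between best approximation and modulus\<close>

lemma powr_rate: "0 \<le> C \<Longrightarrow> (C * real n powr (- \<alpha>)) powr p = C powr p * real n powr (- (\<alpha> * p))"
  by (simp add: powr_mult powr_powr)

text \<open>Given \<open>n\<close>, the direct bound is used at \<open>m = (n - 1) div K\<close>:
  its polynomial has degree at most \<open>n - 1\<close>, and since
  \<open>n \<le> 2 * K * m\<close>, passing from \<open>m\<close> to \<open>n\<close> changes
  weights and rates only by constants.\<close>

lemma omega_phi_rate_imp_best_approx_rate:
  assumes w: "doubling_weight w" and p: "0 < p" "p \<le> 1" and r: "1 \<le> r" and \<alpha>: "0 < \<alpha>" and f: "in_Lp p f"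
    and bound: "\<forall>\<^sub>F n in sequentially. omega_phi r f (1 / real n) p (avg_weight w n) \<le> ennreal (C * real n powr (- \<alpha>))"
  shows "\<exists>C. \<forall>\<^sub>F n in sequentially. best_approx n f p (avg_weight w n) \<le> ennreal (C * real n powr (- \<alpha>))"
proof -
  note [measurable] = avg_weight_measurable[OF w]
  obtain f' N where [measurable]: "f' \<in> borel_measurable borel" and N: "N \<in> null_sets lborel"
    and eq: "\<And>x. x \<in> {-1..1} \<Longrightarrow> x \<notin> N \<Longrightarrow> f x = f' x"
    and fin: "(\<integral>\<^sup>+x\<in>{-1..1}. ennreal (\<bar>f' x\<bar> powr p) \<partial>lborel) < \<infinity>"
    by (rule borel_representative[OF f]) blast
  have AEeq: "AE x in lborel. x \<in> {-1..1} \<longrightarrow> f x = f' x" using AE_not_in[OF N] by eventually_elim (auto simp: eq)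
  obtain K B where K: "13 \<le> K" and B: "0 < B" and direct: "\<And>m f \<epsilon> \<Omega>. 1 \<le> m \<Longrightarrow> f \<in> borel_measurable borel \<Longrightarrow>
     (\<integral>\<^sup>+x\<in>{-1..1}. ennreal (\<bar>f x\<bar> powr p) \<partial>lborel) < \<infinity> \<Longrightarrow> 0 < \<epsilon> \<Longrightarrow> 0 \<le> \<Omega> \<Longrightarrow>
     (\<And>h. 0 < h \<Longrightarrow> h \<le> 1 / real m \<Longrightarrow> wnorm p (avg_weight w m) (\<lambda>x. sym_difference r (h * phi x) f x) \<le> ennreal \<Omega>) \<Longrightarrow>
     \<exists>T. degree T \<le> K * m \<and> wnorm p (avg_weight w (13 * m)) (\<lambda>x. f x - poly T x) \<le> ennreal (B * (\<Omega> + \<epsilon>))"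
    by (rule direct_bound[OF w p r]) blast
  \<comment> \<open>The given constant may be negative, which is harmless in \<open>ennreal\<close>
    but not under real powers.\<close>
  define C' where "C' = max C 0"
  have C': "0 \<le> C'" "C \<le> C'" by (auto simp: C'_def)
  define \<beta> where "\<beta> = \<alpha> * p"
  have \<beta>: "0 < \<beta>" using \<alpha> p by (simp add: \<beta>_def)
  obtain n0 where n0: "\<And>n. n0 \<le> n \<Longrightarrow> omega_phi r f (1 / real n) p (avg_weight w n) \<le> ennreal (C * real n powr (- \<alpha>))"
    using bound unfolding eventually_sequentially by blast
  have diff: "wnorm p (avg_weight w m) (\<lambda>x. sym_difference r (h * phi x) f' x) \<le> ennreal (C' powr p * real m powr (- \<beta>))"
    if m: "n0 \<le> m" and h: "0 < h" "h \<le> 1 / real m" for m h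
  proof -
    have "Lp_norm p (avg_weight w m) (\<lambda>x. sym_difference r (h * phi x) f x) \<le> omega_phi r f (1 / real m) p (avg_weight w m)"
      unfolding omega_phi_def using h by (intro SUP_upper) auto
    also have "\<dots> \<le> ennreal (C * real m powr (- \<alpha>))" by (rule n0[OF m])
    also have "\<dots> \<le> ennreal (C' * real m powr (- \<alpha>))" using C' by (intro ennreal_leI mult_right_mono) auto
    finally have bd: "wnorm p (avg_weight w m) (\<lambda>x. sym_difference r (h * phi x) f x) \<le> ennreal (C' powr p * real m powr (- \<beta>))"
      using C' p by (subst (asm) Lp_norm_le_iff) (auto simp: powr_rate \<beta>_def)
    have "AE x in lborel. x \<in> {-1..1} \<longrightarrow> sym_difference r (h * phi x) f x = sym_difference r (h * phi x) f' x"
      by (intro sym_difference_AE_eq[OF N _ r h(1)] eq)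
    from wnorm_cong_AE[OF this] bd show ?thesis by simp
  qed
  define A where "A = (real K)\<^sup>2 * (B * (C' powr p + 1) * (2 * real K) powr \<beta>)"
  have A0: "0 \<le> A" using B by (simp add: A_def)
  define D where "D = A powr (1 / p)"
  have D: "0 \<le> D" "D powr p = A" using p A0 by (auto simp: D_def powr_powr)
  have "best_approx n f p (avg_weight w n) \<le> ennreal (D * real n powr (- \<alpha>))" if n: "K * (n0 + 1) + 1 \<le> n" for n
  proof -
    define m where "m = (n - 1) div K"
    have "K * (n0 + 1) div K \<le> (n - 1) div K" using n by (intro div_le_mono) simp
    then have m: "1 \<le> m" "n0 \<le> m" using K by (auto simp: m_def)
    have Km: "K * m \<le> n - 1" by (simp add: m_def)
    have "n - 1 < K * (m + 1)" unfolding m_def using K by (simp add: dividend_less_times_div algebra_simps)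
    moreover have "K * 1 \<le> K * m" using m by (intro mult_le_mono2) simp
    ultimately have "n \<le> K * m + K * m" using n by (simp only: distrib_left)
    then have n2: "n \<le> 2 * K * m" by simp
    have n1: "1 \<le> n" using n by simp
    have "13 * m \<le> K * m" using K by simp
    then have mn: "13 * m \<le> n" using Km by linarith
    have mp: "0 < real m" "0 < real n" using m n1 by auto
    have n2r: "real n \<le> 2 * real K * real m" using n2 by (metis of_nat_le_iff of_nat_mult of_nat_numeral)
    have rate: "real m powr (- \<beta>) \<le> (2 * real K) powr \<beta> * real n powr (- \<beta>)"
    proof -
      have "real n powr \<beta> \<le> (2 * real K * real m) powr \<beta>" using n2r \<beta> by (intro powr_mono2) auto
      also have "\<dots> = (2 * real K) powr \<beta> * real m powr \<beta>" by (simp add: powr_mult)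
      finally show ?thesis using mp by (simp add: powr_minus_divide field_simps)
    qed
    \<comment> \<open>The slack of the direct bound is chosen as \<open>m powr (- \<beta>)\<close>,
      so it has the rate of the main term.\<close>
    have "\<exists>T. degree T \<le> K * m \<and> wnorm p (avg_weight w (13 * m)) (\<lambda>x. f' x - poly T x)
        \<le> ennreal (B * (C' powr p * real m powr (- \<beta>) + real m powr (- \<beta>)))"
      using mp by (intro direct m fin diff) auto
    then obtain T where T: "degree T \<le> K * m" "wnorm p (avg_weight w (13 * m)) (\<lambda>x. f' x - poly T x)
        \<le> ennreal (B * (C' powr p * real m powr (- \<beta>) + real m powr (- \<beta>)))" by blast
    have "wnorm p (avg_weight w n) (\<lambda>x. f x - poly T x) = wnorm p (avg_weight w n) (\<lambda>x. f' x - poly T x)"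
      using AEeq by (intro wnorm_cong_AE) (auto elim!: eventually_mono)
    also have "\<dots> \<le> ennreal ((real K)\<^sup>2) * wnorm p (avg_weight w (13 * m)) (\<lambda>x. f' x - poly T x)"
    proof (rule wnorm_weight_mono)
      fix x :: real assume x: "x \<in> {-1..1}"
      have "2 * real K * real m \<le> real K * real (13 * m)" by simp
      then have "real n \<le> real K * real (13 * m)" using n2r by linarith
      then show "avg_weight w n x \<le> (real K)\<^sup>2 * avg_weight w (13 * m) x"
        using m mn by (intro avg_weight_le_coarser[OF w x]) auto
    qed auto
    also have "\<dots> \<le> ennreal ((real K)\<^sup>2) * ennreal (B * (C' powr p * real m powr (- \<beta>) + real m powr (- \<beta>)))"
      by (intro mult_left_mono T(2)) auto
    also have "\<dots> = ennreal ((real K)\<^sup>2 * (B * (C' powr p * real m powr (- \<beta>) + real m powr (- \<beta>))))"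
      by (subst ennreal_mult') auto
    also have "\<dots> \<le> ennreal (A * real n powr (- \<beta>))"
    proof (rule ennreal_leI)
      have "(real K)\<^sup>2 * (B * (C' powr p * real m powr (- \<beta>) + real m powr (- \<beta>))) = (real K)\<^sup>2 * (B * (C' powr p + 1) * real m powr (- \<beta>))"
        by (simp add: algebra_simps)
      also have "\<dots> \<le> (real K)\<^sup>2 * (B * (C' powr p + 1) * ((2 * real K) powr \<beta> * real n powr (- \<beta>)))"
        using B rate by (intro mult_left_mono) auto
      finally show "(real K)\<^sup>2 * (B * (C' powr p * real m powr (- \<beta>) + real m powr (- \<beta>))) \<le> A * real n powr (- \<beta>)"
        by (simp add: A_def mult_ac)
    qed
    also have "A * real n powr (- \<beta>) = (D * real n powr (- \<alpha>)) powr p" using D by (simp add: powr_rate \<beta>_def)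
    finally have "Lp_norm p (avg_weight w n) (\<lambda>x. f x - poly T x) \<le> ennreal (D * real n powr (- \<alpha>))"
      using D p by (subst Lp_norm_le_iff) auto
    moreover have "T \<in> Poly_space n" using T(1) Km by (simp add: Poly_space_def)
    ultimately show ?thesis unfolding best_approx_def by (rule INF_lower2[rotated])
  qed
  then show ?thesis unfolding eventually_sequentially by blast
qed

text \<open>\<open>inverse_rate\<close> is applied to \<open>p\<close>-th powers with
  \<open>\<beta> = \<alpha> * p\<close>; its bound is uniform in the step \<open>h\<close>, so the
  supremum is taken only at the end.\<close>

lemma best_approx_rate_imp_omega_phi_rate:
  assumes W: "w \<in> W_class \<delta> \<gamma>" and p: "0 < p" "p \<le> 1" and r: "1 \<le> r" and g: "0 \<le> \<gamma>" "\<gamma> \<le> real r * p"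
    and \<alpha>: "0 < \<alpha>" "\<alpha> < real r - \<delta> / p" and f: "in_Lp p f"
    and bound: "\<forall>\<^sub>F n in sequentially. best_approx n f p (avg_weight w n) \<le> ennreal (C * real n powr (- \<alpha>))"
  shows "\<exists>C. \<forall>\<^sub>F n in sequentially. omega_phi r f (1 / real n) p (avg_weight w n) \<le> ennreal (C * real n powr (- \<alpha>))"
proof -
  obtain f' N where [measurable]: "f' \<in> borel_measurable borel" and N: "N \<in> null_sets lborel"
    and eq: "\<And>x. x \<in> {-1..1} \<Longrightarrow> x \<notin> N \<Longrightarrow> f x = f' x"
    by (rule borel_representative[OF f]) blast
  have AEeq: "AE x in lborel. x \<in> {-1..1} \<longrightarrow> f x = f' x" using AE_not_in[OF N] by eventually_elim (auto simp: eq)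
  define \<beta> where "\<beta> = \<alpha> * p"
  have \<beta>: "0 < \<beta>" "\<beta> < real r * p - \<delta>" using \<alpha> p by (auto simp: \<beta>_def field_simps)
  \<comment> \<open>Strictly larger than \<open>C\<close>, so that some polynomial has an error
    below the enlarged bound even if the infimum is not attained.\<close>
  define C' where "C' = max C 0 + 1"
  have C': "0 < C'" "C < C'" by (auto simp: C'_def)
  obtain n0 where n0: "\<And>n. n0 \<le> n \<Longrightarrow> best_approx n f p (avg_weight w n) \<le> ennreal (C * real n powr (- \<alpha>))"
    using bound unfolding eventually_sequentially by blast
  have approx: "\<exists>P. degree P \<le> n \<and> wnorm p (avg_weight w n) (\<lambda>x. f' x - poly P x) \<le> ennreal (C' powr p * real n powr (- \<beta>))"
    if n: "max n0 1 \<le> n" for n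
  proof -
    have np: "0 < real n powr (- \<alpha>)" using n by simp
    have "best_approx n f p (avg_weight w n) \<le> ennreal (C * real n powr (- \<alpha>))" using n by (intro n0) simp
    also have "\<dots> < ennreal (C' * real n powr (- \<alpha>))" using C' np by (intro ennreal_lessI) auto
    finally obtain P where P: "P \<in> Poly_space n" "Lp_norm p (avg_weight w n) (\<lambda>x. f x - poly P x) < ennreal (C' * real n powr (- \<alpha>))"
      unfolding best_approx_def INF_less_iff by blast
    have "wnorm p (avg_weight w n) (\<lambda>x. f' x - poly P x) = wnorm p (avg_weight w n) (\<lambda>x. f x - poly P x)"
      using AEeq by (intro wnorm_cong_AE) (auto elim!: eventually_mono)
    also have "\<dots> \<le> ennreal ((C' * real n powr (- \<alpha>)) powr p)"
      using Lp_norm_le_iff[OF p(1), of "C' * real n powr (- \<alpha>)"] less_imp_le[OF P(2)] C' by simp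
    also have "(C' * real n powr (- \<alpha>)) powr p = C' powr p * real n powr (- \<beta>)" using C' by (simp add: powr_rate \<beta>_def)
    finally show ?thesis using P(1) by (intro exI[of _ P]) (simp add: Poly_space_def)
  qed
  obtain A n1 where A: "0 < A" and rate: "\<And>n h. n1 \<le> n \<Longrightarrow> 0 < h \<Longrightarrow> h \<le> 1 / real n \<Longrightarrow>
     wnorm p (avg_weight w n) (\<lambda>x. sym_difference r (h * phi x) f' x) \<le> ennreal (A * real n powr (- \<beta>))"
  proof (rule inverse_rate[OF W p r g \<beta>])
    show "\<exists>P. degree P \<le> n \<and> wnorm p (avg_weight w n) (\<lambda>x. f' x - poly P x) \<le> ennreal (C' powr p * real n powr (- \<beta>))"
      if "max n0 1 \<le> n" for n
      by (rule approx[OF that])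
  qed auto
  define D where "D = A powr (1 / p)"
  have D: "0 \<le> D" "D powr p = A" using p A by (auto simp: D_def powr_powr)
  have "omega_phi r f (1 / real n) p (avg_weight w n) \<le> ennreal (D * real n powr (- \<alpha>))" if n: "n1 \<le> n" for n
    unfolding omega_phi_def
  proof (rule SUP_least)
    fix h assume h: "h \<in> {0<..1 / real n}"
    have "wnorm p (avg_weight w n) (\<lambda>x. sym_difference r (h * phi x) f x) \<le> ennreal (A * real n powr (- \<beta>))"
    proof -
      have "0 < h" using h by simp
      then have "AE x in lborel. x \<in> {-1..1} \<longrightarrow> sym_difference r (h * phi x) f x = sym_difference r (h * phi x) f' x"
        by (intro sym_difference_AE_eq[OF N _ r] eq)
      from wnorm_cong_AE[OF this] show ?thesis using rate[OF n, of h] h by simp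
    qed
    also have "A * real n powr (- \<beta>) = (D * real n powr (- \<alpha>)) powr p" using D by (simp add: powr_rate \<beta>_def)
    finally show "Lp_norm p (avg_weight w n) (\<lambda>x. sym_difference r (h * phi x) f x) \<le> ennreal (D * real n powr (- \<alpha>))"
      using D p by (subst Lp_norm_le_iff) auto
  qed
  then show ?thesis unfolding eventually_sequentially by blast
qed

theorem corollary7p12:
  fixes r :: nat and p \<delta> \<gamma> \<alpha> :: real and f w :: "real \<Rightarrow> real"
  assumes "1 \<le> r" and "0 < p" and "p < 1"
    and "in_Lp p f"
    and "0 \<le> \<delta>" and "0 \<le> \<gamma>"
    and "w \<in> W_class \<delta> \<gamma>"
    and "\<gamma> \<le> real r * p"
    and "0 < \<alpha>" and "\<alpha> < real r - \<delta> / p"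
  shows "(\<exists>C::real. \<forall>\<^sub>F n in sequentially.
            best_approx n f p (avg_weight w n) \<le> ennreal (C * real n powr (- \<alpha>)))
     \<longleftrightarrow> (\<exists>C::real. \<forall>\<^sub>F n in sequentially.
            omega_phi r f (1 / real n) p (avg_weight w n) \<le> ennreal (C * real n powr (- \<alpha>)))"
proof -
  have w: "doubling_weight w" using assms by (simp add: W_class_def)
  have p: "0 < p" "p \<le> 1" using assms by auto
  show ?thesis
    using best_approx_rate_imp_omega_phi_rate[OF assms(7) p assms(1,6,8,9,10,4)]
      omega_phi_rate_imp_best_approx_rate[OF w p assms(1,9,4)] by blast
qed

end
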